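(* Let $L$ be a finite field containing $\mathbb{F}_q$ and fix an $\mathbb{F}_q$-homomorphism $c^*:A\to L$. On pure $A$-motives over $L$ of characteristic $c^*$, the relation "$\underline{M}'\sim\underline{M}$ if there exists a separable isogeny $\underline{M}'\to\underline{M}$" is an equivalence relation.
   Context: $\mathbb{F}_q$ finite field, $C$ smooth projective geometrically irreducible curve over $\mathbb{F}_q$, $\infty\in C(\mathbb{F}_q)$, $A=\Gamma(C\setminus\{\infty\},\mathcal{O}_C)$, $C_L=C\times_{\mathbb{F}_q}L$, $A_L=A\otimes_{\mathbb{F}_q}L$, $\sigma^*(a\otimes b)=a\otimes b^q$, $\sigma^*M=M\otimes_{A_L,\sigma^*}A_L$; $J\subset A_L$ is generated by $a\otimes1-1\otimes c^*(a)$. A pure $A$-motive $(M,\tau)$ of rank $r$, dimension $d$, characteristic $c^*$: $M$ locally free of rank $r$ over $A_L$, $\tau:\sigma^*M\to M$ injective $A_L$-linear, $\operatorname{coker}\tau$ of $L$-dimension $d$ annihilated by $J^d$, and $M$ extends to a locally free sheaf $\mathcal{M}$ on $C_L$ on which $\tau^l=\tau\circ\sigma^*\tau\circ\cdots\circ(\sigma^* )^{l-1}\tau$ induces an isomorphism $(\sigma^* )^l\mathcal{M}_\infty\to\mathcal{M}(k\cdot\infty)_\infty$ for some positive integers $k,l$. A morphism is an $A_L$-linear $f$ with $f\tau=\tau'\sigma^*f$; an isogeny is an injective morphism with torsion cokernel; an isogeny $f$ is separable if the map $\sigma^*\operatorname{coker}f\to\operatorname{coker}f$ induced by $\tau'$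 is an isomorphism. *)

theory Defs
  imports "HOL-Algebra.Algebra"
begin

section \<open>Linear algebra over commutative rings\<close>

definition linear_map :: "('r, 'x) ring_scheme \<Rightarrow> ('r, 'm) module \<Rightarrow> ('r, 'n) module \<Rightarrow> ('m \<Rightarrow> 'n) \<Rightarrow> bool"
  where "linear_map R M N f \<longleftrightarrow>
    f \<in> carrier M \<rightarrow> carrier N \<and>
    (\<forall>x\<in>carrier M. \<forall>y\<in>carrier M. f (x \<oplus>\<^bsub>M\<^esub> y) = f x \<oplus>\<^bsub>N\<^esub> f y) \<and>
    (\<forall>a\<in>carrier R. \<forall>x\<in>carrier M. f (a \<odot>\<^bsub>M\<^esub> x) = a \<odot>\<^bsub>N\<^esub> f x)"

definition lin_comb :: "('r, 'm) module \<Rightarrow> nat \<Rightarrow> (nat \<Rightarrow> 'r) \<Rightarrow> (nat \<Rightarrow> 'm) \<Rightarrow> 'm"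
  where "lin_comb M r a e = (\<Oplus>\<^bsub>M\<^esub> i\<in>{..<r}. a i \<odot>\<^bsub>M\<^esub> e i)"

definition is_basis :: "('r, 'x) ring_scheme \<Rightarrow> ('r, 'm) module \<Rightarrow> nat \<Rightarrow> (nat \<Rightarrow> 'm) \<Rightarrow> bool"
  where "is_basis R M r e \<longleftrightarrow>
    e \<in> {..<r} \<rightarrow> carrier M \<and>
    (\<forall>x\<in>carrier M. \<exists>!a. a \<in> {..<r} \<rightarrow>\<^sub>E carrier R \<and> x = lin_comb M r a e)"

text \<open>
  The localization \<open>M[1/f]\<close> is free of rank \<open>r\<close> over \<open>R[1/f]\<close>. A basis of \<open>M[1/f]\<close> can be
  multiplied by powers of the unit \<open>f\<close>, so that it comes from elements of \<open>M\<close>; clearing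
  denominators, the two clauses say that these elements generate \<open>M[1/f]\<close> and that they are
  linearly independent over \<open>R[1/f]\<close>.
\<close>
definition localization_free :: "('r, 'x) ring_scheme \<Rightarrow> ('r, 'm) module \<Rightarrow> nat \<Rightarrow> 'r \<Rightarrow> bool"
  where "localization_free R M r f \<longleftrightarrow>
    (\<exists>e \<in> {..<r} \<rightarrow> carrier M.
      (\<forall>x\<in>carrier M. \<exists>(n::nat). \<exists>a \<in> {..<r} \<rightarrow> carrier R.
         (f [^]\<^bsub>R\<^esub> n) \<odot>\<^bsub>M\<^esub> x = lin_comb M r a e) \<and>
      (\<forall>a \<in> {..<r} \<rightarrow> carrier R. lin_comb M r a e = \<zero>\<^bsub>M\<^esub> \<longrightarrow>
         (\<forall>i<r. \<exists>(n::nat). (f [^]\<^bsub>R\<^esub> n) \<otimes>\<^bsub>R\<^esub> a i = \<zero>\<^bsub>R\<^esub>)))"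

text \<open>Spec \<open>R\<close> is covered by finitely many principal open sets over which \<open>M\<close> is free of rank \<open>r\<close>.\<close>
definition locally_free_module :: "('r, 'x) ring_scheme \<Rightarrow> ('r, 'm) module \<Rightarrow> nat \<Rightarrow> bool"
  where "locally_free_module R M r \<longleftrightarrow>
    module R M \<and>
    (\<exists>S. finite S \<and> S \<subseteq> carrier R \<and> Idl\<^bsub>R\<^esub> S = carrier R \<and> (\<forall>f\<in>S. localization_free R M r f))"

definition quotient_module :: "('r, 'm) module \<Rightarrow> 'm set \<Rightarrow> ('r, 'm set) module"
  where "quotient_module M N =
    \<lparr> carrier = a_rcosets\<^bsub>M\<^esub> N, monoid.mult = undefined, monoid.one = undefined, ring.zero = N, ring.add = set_add M,
      module.smult = (\<lambda>a Z. \<Union>x\<in>Z. N +>\<^bsub>M\<^esub> (a \<odot>\<^bsub>M\<^esub> x)) \<rparr>"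

definition cokernel :: "('r, 'm) module \<Rightarrow> ('r, 'n) module \<Rightarrow> ('m \<Rightarrow> 'n) \<Rightarrow> ('r, 'n set) module"
  where "cokernel M N f = quotient_module N (f ` carrier M)"

text \<open>The ring \<open>B\<close> as a module over the source of a ring homomorphism \<open>h\<close> into \<open>B\<close>.\<close>
definition module_along :: "('b, 'x) ring_scheme \<Rightarrow> ('r \<Rightarrow> 'b) \<Rightarrow> ('r, 'b) module"
  where "module_along B h =
    \<lparr> carrier = carrier B, monoid.mult = monoid.mult B, monoid.one = monoid.one B, ring.zero = ring.zero B, ring.add = ring.add B,
      module.smult = (\<lambda>a b. h a \<otimes>\<^bsub>B\<^esub> b) \<rparr>"


section \<open>Tensor products\<close>

type_synonym ('m, 'n) tens = "(('m \<times> 'n) \<Rightarrow>\<^sub>0 int) set"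

abbreviation free_on_pairs :: "('r, 'm) module \<Rightarrow> ('r, 'n) module \<Rightarrow> (('m \<times> 'n) \<Rightarrow>\<^sub>0 int) monoid"
  where "free_on_pairs M N \<equiv> free_Abelian_group (carrier M \<times> carrier N)"

definition tensor_relations ::
    "('r, 'x) ring_scheme \<Rightarrow> ('r, 'm) module \<Rightarrow> ('r, 'n) module \<Rightarrow> (('m \<times> 'n) \<Rightarrow>\<^sub>0 int) set"
  where "tensor_relations R M N =
    {frag_of (x \<oplus>\<^bsub>M\<^esub> x', y) - frag_of (x, y) - frag_of (x', y) |x x' y.
       x \<in> carrier M \<and> x' \<in> carrier M \<and> y \<in> carrier N} \<union>
    {frag_of (x, y \<oplus>\<^bsub>N\<^esub> y') - frag_of (x, y) - frag_of (x, y') |x y y'.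
       x \<in> carrier M \<and> y \<in> carrier N \<and> y' \<in> carrier N} \<union>
    {frag_of (a \<odot>\<^bsub>M\<^esub> x, y) - frag_of (x, a \<odot>\<^bsub>N\<^esub> y) |a x y.
       a \<in> carrier R \<and> x \<in> carrier M \<and> y \<in> carrier N}"

definition tensor_kernel ::
    "('r, 'x) ring_scheme \<Rightarrow> ('r, 'm) module \<Rightarrow> ('r, 'n) module \<Rightarrow> (('m \<times> 'n) \<Rightarrow>\<^sub>0 int) set"
  where "tensor_kernel R M N = generate (free_on_pairs M N) (tensor_relations R M N)"

definition tensor_quotient ::
    "('r, 'x) ring_scheme \<Rightarrow> ('r, 'm) module \<Rightarrow> ('r, 'n) module \<Rightarrow> ('m, 'n) tens monoid"
  where "tensor_quotient R M N = free_on_pairs M N Mod tensor_kernel R M N"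

definition pure_tensor ::
    "('r, 'x) ring_scheme \<Rightarrow> ('r, 'm) module \<Rightarrow> ('r, 'n) module \<Rightarrow> 'm \<Rightarrow> 'n \<Rightarrow> ('m, 'n) tens"
  where "pure_tensor R M N x y = tensor_kernel R M N #>\<^bsub>free_on_pairs M N\<^esub> frag_of (x, y)"

text \<open>The tensor product as an additive group; the multiplicative fields are not used.\<close>
definition tensor_group ::
    "('r, 'x) ring_scheme \<Rightarrow> ('r, 'm) module \<Rightarrow> ('r, 'n) module \<Rightarrow> ('m, 'n) tens ring"
  where "tensor_group R M N =
    \<lparr> carrier = carrier (tensor_quotient R M N), monoid.mult = undefined, monoid.one = undefined,
      ring.zero = monoid.one (tensor_quotient R M N), ring.add = monoid.mult (tensor_quotient R M N) \<rparr>"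

text \<open>
  The additive map from a tensor product to \<open>G\<close> that sends \<open>x \<otimes> y\<close> to \<open>b x y\<close>, for balanced
  biadditive \<open>b\<close>; it is evaluated on an arbitrary representative of the class \<open>Z\<close>.
\<close>
definition tensor_lift :: "('g, 'x) ring_scheme \<Rightarrow> ('m \<Rightarrow> 'n \<Rightarrow> 'g) \<Rightarrow> ('m, 'n) tens \<Rightarrow> 'g"
  where "tensor_lift G b Z =
    (let p = (SOME p. p \<in> Z)
     in \<Oplus>\<^bsub>G\<^esub> z \<in> Poly_Mapping.keys p. [Poly_Mapping.lookup p z] \<cdot>\<^bsub>G\<^esub> b (fst z) (snd z))"

text \<open>\<open>M \<otimes>\<^sub>R S\<close> as an \<open>S\<close>-module, for a ring homomorphism \<open>h\<close> from \<open>R\<close> to \<open>S\<close>.\<close>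
definition base_change ::
    "('r, 'x) ring_scheme \<Rightarrow> ('r, 'm) module \<Rightarrow> ('r \<Rightarrow> 's) \<Rightarrow> ('s, 'y) ring_scheme \<Rightarrow> ('s, ('m, 's) tens) module"
  where "base_change R M h S =
    (let N = module_along S h; T = tensor_group R M N in
    \<lparr> carrier = carrier T, monoid.mult = undefined, monoid.one = undefined, ring.zero = ring.zero T, ring.add = ring.add T,
      module.smult = (\<lambda>a. tensor_lift T (\<lambda>x s. pure_tensor R M N x (a \<otimes>\<^bsub>S\<^esub> s))) \<rparr>)"

definition bc_tensor ::
    "('r, 'x) ring_scheme \<Rightarrow> ('r, 'm) module \<Rightarrow> ('r \<Rightarrow> 's) \<Rightarrow> ('s, 'y) ring_scheme \<Rightarrow> 'm \<Rightarrow> 's \<Rightarrow> ('m, 's) tens"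
  where "bc_tensor R M h S x s = pure_tensor R M (module_along S h) x s"

text \<open>The tensor product of two \<open>R\<close>-algebras with structure maps \<open>g\<close> and \<open>h\<close>.\<close>
definition alg_tensor ::
    "('r, 'x) ring_scheme \<Rightarrow> ('a, 'y) ring_scheme \<Rightarrow> ('r \<Rightarrow> 'a) \<Rightarrow> ('b, 'z) ring_scheme \<Rightarrow> ('r \<Rightarrow> 'b)
      \<Rightarrow> 'a \<Rightarrow> 'b \<Rightarrow> ('a, 'b) tens"
  where "alg_tensor R A g B h a b = pure_tensor R (module_along A g) (module_along B h) a b"

definition tensor_algebra ::
    "('r, 'x) ring_scheme \<Rightarrow> ('a, 'y) ring_scheme \<Rightarrow> ('r \<Rightarrow> 'a) \<Rightarrow> ('b, 'z) ring_scheme \<Rightarrow> ('r \<Rightarrow> 'b)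
      \<Rightarrow> ('a, 'b) tens ring"
  where "tensor_algebra R A g B h =
    (let T = tensor_group R (module_along A g) (module_along B h) in
    \<lparr> carrier = carrier T,
      monoid.mult = (\<lambda>Z Z'. tensor_lift T (\<lambda>a b. tensor_lift T
                (\<lambda>a' b'. alg_tensor R A g B h (a \<otimes>\<^bsub>A\<^esub> a') (b \<otimes>\<^bsub>B\<^esub> b')) Z') Z),
      monoid.one = alg_tensor R A g B h \<one>\<^bsub>A\<^esub> \<one>\<^bsub>B\<^esub>,
      ring.zero = ring.zero T, ring.add = ring.add T \<rparr>)"


section \<open>Curves\<close>

text \<open>
  A smooth projective irreducible curve over a perfect field \<open>k\<close> is described as the abstract
  nonsingular curve of its function field \<open>F\<close> (Hartshorne, Section I.6). Its closed points are
  the discrete valuation rings of \<open>F/k\<close>, each point being identified with its local ring inside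
  \<open>F\<close>. The nonempty open sets consist of the generic point, which is left implicit below, and of
  all but finitely many closed points. The ring of regular functions on such a set is the
  intersection of the local rings of its points. Here \<open>k\<close> is a subset of \<open>carrier F\<close>.
\<close>

definition closed_points :: "('f, 'x) ring_scheme \<Rightarrow> 'f set \<Rightarrow> 'f set set"
  where "closed_points F k =
    {P. subring P F \<and> k \<subseteq> P \<and> P \<noteq> carrier F \<and>
        (\<forall>x \<in> carrier F - {\<zero>\<^bsub>F\<^esub>}. x \<in> P \<or> inv\<^bsub>F\<^esub> x \<in> P) \<and>
        principal_domain (F\<lparr>carrier := P\<rparr>)}"

definition open_sets :: "('f, 'x) ring_scheme \<Rightarrow> 'f set \<Rightarrow> 'f set set set"
  where "open_sets F k = {U. U \<subseteq> closed_points F k \<and> finite (closed_points F k - U)}"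

definition regular_functions :: "('f, 'x) ring_scheme \<Rightarrow> 'f set set \<Rightarrow> 'f set"
  where "regular_functions F U = {x \<in> carrier F. \<forall>P\<in>U. x \<in> P}"

definition max_ideal :: "('f, 'x) ring_scheme \<Rightarrow> 'f set \<Rightarrow> 'f set"
  where "max_ideal F P = P - Units (F\<lparr>carrier := P\<rparr>)"

definition uniformizer :: "('f, 'x) ring_scheme \<Rightarrow> 'f set \<Rightarrow> 'f \<Rightarrow> bool"
  where "uniformizer F P t \<longleftrightarrow> t \<in> P \<and> max_ideal F P = {t \<otimes>\<^bsub>F\<^esub> x |x. x \<in> P}"

text \<open>\<open>F\<close> is finitely generated of transcendence degree one over \<open>k\<close>.\<close>
definition function_field_one_var :: "('f, 'x) ring_scheme \<Rightarrow> 'f set \<Rightarrow> bool"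
  where "function_field_one_var F k \<longleftrightarrow>
    field F \<and> subfield k F \<and>
    (\<exists>x\<in>carrier F. ring.transcendental F k x \<and>
       ring.finite_dimension F (generate_field F (insert x k)) (carrier F))"

text \<open>The spectrum of \<open>R\<close> is irreducible, that is, the nilradical of \<open>R\<close> is a prime ideal.\<close>
definition irreducible_spectrum :: "('r, 'x) ring_scheme \<Rightarrow> bool"
  where "irreducible_spectrum R \<longleftrightarrow>
    primeideal {x \<in> carrier R. \<exists>n::nat. x [^]\<^bsub>R\<^esub> n = \<zero>\<^bsub>R\<^esub>} R"

text \<open>
  \<open>Q\<close>, with structure map \<open>\<iota>Q\<close>, is the function field of a smooth projective geometrically
  irreducible curve over the finite field \<open>K\<close>. The curve is geometrically irreducible if and
  only if the base change of its generic point to an algebraic closure of \<open>K\<close> is irreducible.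
\<close>
definition smooth_projective_curve :: "'k ring \<Rightarrow> 'q ring \<Rightarrow> ('k \<Rightarrow> 'q) \<Rightarrow> bool"
  where "smooth_projective_curve K Q \<iota>Q \<longleftrightarrow>
    \<iota>Q \<in> ring_hom K Q \<and> function_field_one_var Q (\<iota>Q ` carrier K) \<and>
    irreducible_spectrum (tensor_algebra K Q \<iota>Q (field.alg_closure K) (ring.indexed_const K))"

text \<open>The closed point \<open>P\<close> has residue field \<open>k\<close>.\<close>
definition rational_point :: "('f, 'x) ring_scheme \<Rightarrow> 'f set \<Rightarrow> 'f set \<Rightarrow> bool"
  where "rational_point F k P \<longleftrightarrow>
    P \<in> closed_points F k \<and> (\<forall>x\<in>P. \<exists>a\<in>k. x \<ominus>\<^bsub>F\<^esub> a \<in> max_ideal F P)"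

text \<open>
  Locally free sheaves of rank \<open>r\<close> on the curve with function field \<open>F\<close>. A locally free sheaf on
  an integral scheme is a subsheaf of the constant sheaf given by its stalk \<open>V\<close> at the generic
  point, so \<open>E U\<close>, the module of sections over \<open>U\<close>, is taken to be a subset of \<open>V\<close>, with
  inclusions as restriction maps.
\<close>
definition locally_free_sheaf ::
    "('f, 'x) ring_scheme \<Rightarrow> 'f set \<Rightarrow> ('f, 'v) module \<Rightarrow> nat \<Rightarrow> ('f set set \<Rightarrow> 'v set) \<Rightarrow> bool"
  where "locally_free_sheaf F k V r E \<longleftrightarrow>
    (\<forall>U \<in> open_sets F k. submodule (E U) (F\<lparr>carrier := regular_functions F U\<rparr>) V) \<and>
    (\<forall>\<U>. \<U> \<noteq> {} \<longrightarrow> \<U> \<subseteq> open_sets F k \<longrightarrow> E (\<Union>\<U>) = (\<Inter>U\<in>\<U>. E U)) \<and>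
    (\<forall>P \<in> closed_points F k. \<exists>U \<in> open_sets F k. P \<in> U \<and>
       (\<exists>e. \<forall>U' \<in> open_sets F k. U' \<subseteq> U \<longrightarrow>
          is_basis (F\<lparr>carrier := regular_functions F U'\<rparr>) (V\<lparr>carrier := E U'\<rparr>) r e))"

definition stalk :: "('f, 'x) ring_scheme \<Rightarrow> 'f set \<Rightarrow> ('f set set \<Rightarrow> 'v set) \<Rightarrow> 'f set \<Rightarrow> 'v set"
  where "stalk F k E P = (\<Union>U \<in> {U \<in> open_sets F k. P \<in> U}. E U)"

text \<open>The stalk at \<open>P\<close> of the twist of \<open>E\<close> by the divisor \<open>n \<cdot> P\<close>, inside \<open>V\<close>.\<close>
definition twisted_stalk ::
    "('f, 'x) ring_scheme \<Rightarrow> 'f set \<Rightarrow> ('f, 'v) module \<Rightarrow> ('f set set \<Rightarrow> 'v set) \<Rightarrow> 'f set \<Rightarrow> nat \<Rightarrow> 'v set"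
  where "twisted_stalk F k V E P n =
    {v \<in> carrier V. \<exists>t. uniformizer F P t \<and> (t [^]\<^bsub>F\<^esub> n) \<odot>\<^bsub>V\<^esub> v \<in> stalk F k E P}"


section \<open>Pure A-motives\<close>

text \<open>
  \<open>K\<close> is the finite field \<open>\<bbbF>\<^sub>q\<close>, \<open>Q\<close> the function field of the curve \<open>C\<close>, \<open>pinf\<close> the
  local ring of the point \<open>\<infinity>\<close>, and \<open>c\<close> the characteristic homomorphism \<open>A \<rightarrow> L\<close>. The hypotheses
  on these data are part of the theorem; the locale only serves to state definitions.
\<close>
locale motive_data =
  fixes K :: "'k ring" and Q :: "'q ring" and \<iota>Q :: "'k \<Rightarrow> 'q" and pinf :: "'q set"
    and L :: "'l ring" and \<iota>L :: "'k \<Rightarrow> 'l" and c :: "'q \<Rightarrow> 'l"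
begin

definition A :: "'q ring"
  where "A = Q\<lparr>carrier := regular_functions Q (closed_points Q (\<iota>Q ` carrier K) - {pinf})\<rparr>"

definition AL :: "('q, 'l) tens ring"
  where "AL = tensor_algebra K A \<iota>Q L \<iota>L"

text \<open>The function field of \<open>C\<^sub>L\<close>, with constant field \<open>constL\<close>.\<close>
definition QL :: "('q, 'l) tens ring"
  where "QL = tensor_algebra K Q \<iota>Q L \<iota>L"

definition constL :: "('q, 'l) tens set"
  where "constL = (\<lambda>b. alg_tensor K Q \<iota>Q L \<iota>L \<one>\<^bsub>Q\<^esub> b) ` carrier L"

definition AL_to_QL :: "('q, 'l) tens \<Rightarrow> ('q, 'l) tens"
  where "AL_to_QL = tensor_lift QL (\<lambda>a b. alg_tensor K Q \<iota>Q L \<iota>L a b)"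

text \<open>\<open>\<sigma>\<^sup>*\<close> on \<open>A\<^sub>L\<close> and on the function field of \<open>C\<^sub>L\<close>\<close>
definition \<sigma>A :: "('q, 'l) tens \<Rightarrow> ('q, 'l) tens"
  where "\<sigma>A = tensor_lift AL (\<lambda>a b. alg_tensor K A \<iota>Q L \<iota>L a (b [^]\<^bsub>L\<^esub> card (carrier K)))"

definition \<sigma>Q :: "('q, 'l) tens \<Rightarrow> ('q, 'l) tens"
  where "\<sigma>Q = tensor_lift QL (\<lambda>a b. alg_tensor K Q \<iota>Q L \<iota>L a (b [^]\<^bsub>L\<^esub> card (carrier K)))"

text \<open>The point of \<open>C\<^sub>L\<close> above \<open>\<infinity>\<close>, which is unique because \<open>\<infinity>\<close> is rational.\<close>
definition pinfL :: "('q, 'l) tens set"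
  where "pinfL = (THE P. P \<in> closed_points QL constL \<and>
    {x \<in> carrier Q. alg_tensor K Q \<iota>Q L \<iota>L x \<one>\<^bsub>L\<^esub> \<in> P} = pinf)"

definition J :: "('q, 'l) tens set"
  where "J = Idl\<^bsub>AL\<^esub> {alg_tensor K A \<iota>Q L \<iota>L a \<one>\<^bsub>L\<^esub> \<ominus>\<^bsub>AL\<^esub> alg_tensor K A \<iota>Q L \<iota>L \<one>\<^bsub>A\<^esub> (c a) |a. a \<in> carrier A}"

definition pullback :: "(('q, 'l) tens, 'm) module \<Rightarrow> (('q, 'l) tens, ('m, ('q, 'l) tens) tens) module"
  where "pullback M = base_change AL M \<sigma>A AL"

definition pullback_map ::
    "(('q, 'l) tens, 'm) module \<Rightarrow> (('q, 'l) tens, 'n) module \<Rightarrow> ('m \<Rightarrow> 'n)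
      \<Rightarrow> ('m, ('q, 'l) tens) tens \<Rightarrow> ('n, ('q, 'l) tens) tens"
  where "pullback_map M N f = tensor_lift (pullback N) (\<lambda>x s. bc_tensor AL N \<sigma>A AL (f x) s)"

text \<open>A module over \<open>A\<^sub>L\<close> as an \<open>L\<close>-vector space\<close>
definition as_L_space :: "(('q, 'l) tens, 'm) module \<Rightarrow> ('l, 'm) module"
  where "as_L_space M =
    \<lparr> carrier = carrier M, monoid.mult = monoid.mult M, monoid.one = monoid.one M, ring.zero = ring.zero M, ring.add = ring.add M,
      module.smult = (\<lambda>b x. alg_tensor K A \<iota>Q L \<iota>L \<one>\<^bsub>A\<^esub> b \<odot>\<^bsub>M\<^esub> x) \<rparr>"

definition generic_stalk :: "(('q, 'l) tens, 'm) module \<Rightarrow> (('q, 'l) tens, ('m, ('q, 'l) tens) tens) module"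
  where "generic_stalk M = base_change AL M AL_to_QL QL"

text \<open>
  The \<open>\<sigma>Q\<close>-semilinear endomorphism \<open>v \<mapsto> \<tau>(v \<otimes> 1)\<close> of the generic stalk that corresponds to
  the linear extension of \<open>\<tau>\<close>.
\<close>
definition semilinear_\<tau> ::
    "(('q, 'l) tens, 'm) module \<Rightarrow> (('m, ('q, 'l) tens) tens \<Rightarrow> 'm)
      \<Rightarrow> ('m, ('q, 'l) tens) tens \<Rightarrow> ('m, ('q, 'l) tens) tens"
  where "semilinear_\<tau> M \<tau> = tensor_lift (generic_stalk M)
    (\<lambda>x s. bc_tensor AL M AL_to_QL QL (\<tau> (bc_tensor AL M \<sigma>A AL x \<one>\<^bsub>AL\<^esub>)) (\<sigma>Q s))"

text \<open>
  The restriction of \<open>\<tau>\<^sup>l = \<tau> \<circ> \<sigma>\<^sup>*\<tau> \<circ> \<dots> \<circ> (\<sigma>\<^sup>*)\<^sup>l\<^sup>-\<^sup>1\<tau>\<close> to the pullback under the \<open>l\<close>-th power of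
  \<open>\<sigma>\<close> of the stalk of \<open>E\<close> at the point of \<open>C\<^sub>L\<close> above \<open>\<infinity>\<close>. The \<open>l\<close>-fold iterated pullback is
  identified, as usual, with the base change along the \<open>l\<close>-th power of \<open>\<sigma>\<^sup>*\<close>; \<open>\<tau>\<^sup>l\<close> then sends
  \<open>v \<otimes> s\<close> to \<open>s\<close> times the \<open>l\<close>-th iterate of \<open>semilinear_\<tau>\<close> at \<open>v\<close>.
\<close>
definition stalk_infty ::
    "(('q, 'l) tens, 'm) module \<Rightarrow> (('q, 'l) tens set set \<Rightarrow> ('m, ('q, 'l) tens) tens set)
      \<Rightarrow> (('q, 'l) tens, ('m, ('q, 'l) tens) tens) module"
  where "stalk_infty M E = (generic_stalk M)\<lparr>carrier := stalk QL constL E pinfL\<rparr>"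

definition pullback_stalk_infty ::
    "(('q, 'l) tens, 'm) module \<Rightarrow> (('q, 'l) tens set set \<Rightarrow> ('m, ('q, 'l) tens) tens set) \<Rightarrow> nat
      \<Rightarrow> (('q, 'l) tens, (('m, ('q, 'l) tens) tens, ('q, 'l) tens) tens) module"
  where "pullback_stalk_infty M E l =
    base_change (QL\<lparr>carrier := pinfL\<rparr>) (stalk_infty M E) (\<sigma>Q ^^ l) (QL\<lparr>carrier := pinfL\<rparr>)"

definition \<tau>_power_at_infty ::
    "(('q, 'l) tens, 'm) module \<Rightarrow> (('m, ('q, 'l) tens) tens \<Rightarrow> 'm) \<Rightarrow> nat
      \<Rightarrow> (('m, ('q, 'l) tens) tens, ('q, 'l) tens) tens \<Rightarrow> ('m, ('q, 'l) tens) tens"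
  where "\<tau>_power_at_infty M \<tau> l =
    tensor_lift (generic_stalk M) (\<lambda>v s. s \<odot>\<^bsub>generic_stalk M\<^esub> (semilinear_\<tau> M \<tau> ^^ l) v)"

text \<open>
  The map to the twisted stalk is linear over the local ring at \<open>\<infinity>\<close> by construction, hence it
  is an isomorphism if and only if it is bijective.
\<close>
definition pure_at_infty ::
    "nat \<Rightarrow> (('q, 'l) tens, 'm) module \<Rightarrow> (('m, ('q, 'l) tens) tens \<Rightarrow> 'm) \<Rightarrow> bool"
  where "pure_at_infty r M \<tau> \<longleftrightarrow>
    (\<exists>E. locally_free_sheaf QL constL (generic_stalk M) r E \<and>
       E (closed_points QL constL - {pinfL}) = (\<lambda>x. bc_tensor AL M AL_to_QL QL x \<one>\<^bsub>QL\<^esub>) ` carrier M \<and>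
       (\<exists>k>0. \<exists>l>0. bij_betw (\<tau>_power_at_infty M \<tau> l)
          (carrier (pullback_stalk_infty M E l))
          (twisted_stalk QL constL (generic_stalk M) E pinfL k)))"

definition pure_motive ::
    "nat \<Rightarrow> nat \<Rightarrow> (('q, 'l) tens, 'm) module \<times> (('m, ('q, 'l) tens) tens \<Rightarrow> 'm) \<Rightarrow> bool"
  where "pure_motive r d MM \<longleftrightarrow>
    (case MM of (M, \<tau>) \<Rightarrow>
      locally_free_module AL M r \<and>
      linear_map AL (pullback M) M \<tau> \<and> inj_on \<tau> (carrier (pullback M)) \<and>
      (\<exists>e. is_basis L (as_L_space (cokernel (pullback M) M \<tau>)) d e) \<and>
      (\<forall>s \<in> J [^]\<^bsub>ideals_set AL\<^esub> d. \<forall>Z \<in> carrier (cokernel (pullback M) M \<tau>).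
         s \<odot>\<^bsub>cokernel (pullback M) M \<tau>\<^esub> Z = \<zero>\<^bsub>cokernel (pullback M) M \<tau>\<^esub>) \<and>
      pure_at_infty r M \<tau>)"

definition pure_motives :: "((('q, 'l) tens, 'm) module \<times> (('m, ('q, 'l) tens) tens \<Rightarrow> 'm)) set"
  where "pure_motives = {MM. \<exists>r d. pure_motive r d MM}"

definition morphism ::
    "(('q, 'l) tens, 'm) module \<times> (('m, ('q, 'l) tens) tens \<Rightarrow> 'm)
      \<Rightarrow> (('q, 'l) tens, 'n) module \<times> (('n, ('q, 'l) tens) tens \<Rightarrow> 'n) \<Rightarrow> ('m \<Rightarrow> 'n) \<Rightarrow> bool"
  where "morphism MM NN f \<longleftrightarrow>
    (case (MM, NN) of ((M, \<tau>), (M', \<tau>')) \<Rightarrow>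
      linear_map AL M M' f \<and>
      (\<forall>x \<in> carrier (pullback M). f (\<tau> x) = \<tau>' (pullback_map M M' f x)))"

definition torsion_module :: "(('q, 'l) tens, 'm) module \<Rightarrow> bool"
  where "torsion_module M \<longleftrightarrow>
    (\<forall>x \<in> carrier M. \<exists>s \<in> carrier AL - {\<zero>\<^bsub>AL\<^esub>}. s \<odot>\<^bsub>M\<^esub> x = \<zero>\<^bsub>M\<^esub>)"

definition isogeny ::
    "(('q, 'l) tens, 'm) module \<times> (('m, ('q, 'l) tens) tens \<Rightarrow> 'm)
      \<Rightarrow> (('q, 'l) tens, 'n) module \<times> (('n, ('q, 'l) tens) tens \<Rightarrow> 'n) \<Rightarrow> ('m \<Rightarrow> 'n) \<Rightarrow> bool"
  where "isogeny MM NN f \<longleftrightarrow>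
    morphism MM NN f \<and> inj_on f (carrier (fst MM)) \<and> torsion_module (cokernel (fst MM) (fst NN) f)"

text \<open>
  The map from the pullback of \<open>coker f\<close> to \<open>coker f\<close> induced by \<open>\<tau>'\<close>; it sends the tensor
  product of the class of \<open>y\<close> with \<open>s\<close> to the class of \<open>\<tau>'(y \<otimes> s)\<close>.
\<close>
definition coker_\<tau> ::
    "(('q, 'l) tens, 'm) module \<Rightarrow> (('q, 'l) tens, 'n) module \<times> (('n, ('q, 'l) tens) tens \<Rightarrow> 'n)
      \<Rightarrow> ('m \<Rightarrow> 'n) \<Rightarrow> ('n set, ('q, 'l) tens) tens \<Rightarrow> 'n set"
  where "coker_\<tau> M NN f =
    (case NN of (M', \<tau>') \<Rightarrow>
      tensor_lift (cokernel M M' f)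
        (\<lambda>Z s. \<Union>y\<in>Z. (f ` carrier M) +>\<^bsub>M'\<^esub> \<tau>' (bc_tensor AL M' \<sigma>A AL y s)))"

definition separable_isogeny ::
    "(('q, 'l) tens, 'm) module \<times> (('m, ('q, 'l) tens) tens \<Rightarrow> 'm)
      \<Rightarrow> (('q, 'l) tens, 'n) module \<times> (('n, ('q, 'l) tens) tens \<Rightarrow> 'n) \<Rightarrow> ('m \<Rightarrow> 'n) \<Rightarrow> bool"
  where "separable_isogeny MM NN f \<longleftrightarrow>
    isogeny MM NN f \<and>
    bij_betw (coker_\<tau> (fst MM) NN f)
      (carrier (pullback (cokernel (fst MM) (fst NN) f)))
      (carrier (cokernel (fst MM) (fst NN) f))"

end

end

theory Submission
  imports Defs
begin

text \<open>
  As \<open>L\<close> is finite, \<open>\<sigma>\<^sup>*\<close> is an automorphism of finite order \<open>e\<close> of \<open>A\<^sub>L\<close>. So \<open>\<tau>\<close> amounts to the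
  \<open>\<sigma>\<close>-semilinear map \<open>T x = \<tau>(x \<otimes> 1)\<close>, and an isogeny \<open>f: M' \<rightarrow> M\<close> is separable if and only if \<open>T\<close> is
  bijective on \<open>M/N\<close> for \<open>N = f(M')\<close>. The point is symmetry. A power \<open>\<pi>\<close> of \<open>T\<close> is \<open>A\<^sub>L\<close>-linear and
  bijective on \<open>M/N\<close>, and \<open>M\<close> is finitely generated over the \<open>\<sigma>\<close>-invariants of \<open>A\<^sub>L\<close>, so Nakayama's lemma
  gives \<open>\<phi>\<close> in the ring generated by these invariants and \<open>\<pi>\<close> with \<open>(1 - \<pi>\<phi>)M \<subseteq> N\<close>. Let \<open>s \<noteq> 0\<close> be an
  invariant that annihilates \<open>M/N\<close>. Then \<open>h = 1 - \<pi>\<phi> + s\<pi>\<^sup>m\<close> commutes with \<open>T\<close>, maps \<open>M\<close> into \<open>N\<close>, and is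
  congruent to \<open>1\<close> modulo \<open>\<pi>\<close>, whence \<open>T\<close> is bijective on \<open>N/h(M)\<close>. Purity says that a power of \<open>T\<close>
  shifts the filtration of \<open>M\<close> by the order of poles at infinity, so for large \<open>m\<close> the term \<open>s\<pi>\<^sup>m\<close> dominates
  and \<open>h\<close> is injective. The map \<open>f\<inverse> \<circ> h: M \<rightarrow> M'\<close> is the required isogeny.
\<close>

section \<open>Linear algebra over commutative rings\<close>

text \<open>The third summand of \<open>h\<close> answers an obstacle: Nakayama's lemma controls
  \<open>1 - \<pi>\<phi>\<close> only modulo \<open>N\<close>, so this map may have a kernel. A
  correction has to map \<open>M\<close> into \<open>N\<close>, be divisible by \<open>\<pi>\<close>
  and commute with \<open>T\<close>; an invariant annihilator times a power of \<open>\<pi>\<close>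
  does all three and leaves the exponent free. Nakayama's lemma is proved by removing generators one
  at a time, so that commuting functions on \<open>M\<close> suffice and no determinants occur. To
  measure poles, the stalk at infinity must be a lattice in the generic fibre of \<open>M\<close>.
  The function field of the curve over \<open>L\<close> is built as \<open>Q \<otimes> L\<close>; a
  Gauss lemma relative to the rational point shows that it is a field, that exactly one point lies
  above infinity, and that a uniformizer of the original curve is still one there. Coming from the
  original curve, it is fixed by \<open>\<sigma>\<close>, so \<open>T\<close> commutes with its
  powers. Sections are compared by shrinking open sets, which presupposes that functions have
  finitely many poles; this is proved by counting over the finite constant field.\<close>

lemma (in cring) unimodular_powers:
  assumes "finite S" "S \<subseteq> carrier R" "ideal I R" "\<And>f. f \<in> S ==> \<exists>n::nat. f [^] n \<in> I"
    and "\<one> \<in> Idl (I \<union> S)"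
  shows "\<one> \<in> I"
  using assms
proof (induction S arbitrary: I rule: finite_induct)
  case empty
  then show ?case using genideal_minimal[of I I] by auto
next
  case (insert f S)
  have f: "f \<in> carrier R" and S: "S \<subseteq> carrier R" and I: "I \<subseteq> carrier R"
    using insert.prems ideal.Icarr by auto
  \<comment> \<open>The element \<open>f\<close> is moved from \<open>S\<close> into the ideal, so
    the induction hypothesis yields \<open>1 = i + a f\<close> with \<open>i\<close> in
    \<open>I\<close>. Inserting this identity into itself raises the power of \<open>f\<close> until
    it reaches one that lies in \<open>I\<close>.\<close>
  let ?I = "Idl (I \<union> {f})"
  have I': "ideal ?I R" using f I by (intro genideal_ideal) auto
  have sub: "I \<union> {f} \<subseteq> ?I" using f I by (intro genideal_self) auto
  have "Idl (I \<union> insert f S) \<subseteq> Idl (?I \<union> S)"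
  proof (rule genideal_minimal)
    show "ideal (Idl (?I \<union> S)) R" using ideal.Icarr[OF I'] S by (intro genideal_ideal) auto
    have "?I \<union> S \<subseteq> Idl (?I \<union> S)" using ideal.Icarr[OF I'] S by (intro genideal_self) auto
    then show "I \<union> insert f S \<subseteq> Idl (?I \<union> S)" using sub by auto
  qed
  then have one: "\<one> \<in> ?I"
    using insert.prems sub by (intro insert.IH[OF S I']) blast+
  have J: "ideal (I <+> PIdl f) R"
    using insert.prems(2) cgenideal_ideal[OF f] by (rule add_ideals)
  have "I \<union> {f} \<subseteq> Idl (I \<union> PIdl f)"
    using genideal_self[of "I \<union> PIdl f"] I cgenideal_self[OF f] ideal.Icarr[OF cgenideal_ideal[OF f]] by auto
  then have "I \<union> {f} \<subseteq> I <+> PIdl f"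
    using union_genideal[OF insert.prems(2) cgenideal_ideal[OF f]] by simp
  then have "?I \<subseteq> I <+> PIdl f" by (rule genideal_minimal[OF J])
  then have "\<one> \<in> I <+> PIdl f" using one by blast
  then obtain i a where ia: "i \<in> I" "a \<in> carrier R" "\<one> = i \<oplus> a \<otimes> f"
    by (auto simp: set_add_def' cgenideal_def)
  have iR: "i \<in> carrier R" using ia(1) I by auto
  interpret I: ideal I R by fact
  have "\<exists>j\<in>I. \<exists>b\<in>carrier R. \<one> = j \<oplus> b \<otimes> f [^] n" for n :: nat
  proof (induction n)
    case 0
    show ?case by (intro bexI[of _ \<zero>] bexI[of _ \<one>]) auto
  next
    case (Suc n)
    then obtain j b where jb: "j \<in> I" "b \<in> carrier R" "\<one> = j \<oplus> b \<otimes> f [^] n" by auto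
    have jR: "j \<in> carrier R" using jb(1) I by auto
    let ?F = "f [^] n"
    have F: "?F \<in> carrier R" using f by simp
    have bF: "b \<otimes> ?F \<in> carrier R" using jb(2) F by simp
    have "\<one> = j \<oplus> b \<otimes> ?F \<otimes> \<one>" unfolding r_one[OF bF] by (rule jb(3))
    also have "\<dots> = j \<oplus> b \<otimes> ?F \<otimes> (i \<oplus> a \<otimes> f)" by (simp only: ia(3)[symmetric])
    also have "\<dots> = (j \<oplus> b \<otimes> ?F \<otimes> i) \<oplus> (b \<otimes> a) \<otimes> (?F \<otimes> f)"
      using jR jb(2) ia(2) iR f F by (simp add: r_distr a_ac m_ac)
    finally have "\<one> = (j \<oplus> b \<otimes> ?F \<otimes> i) \<oplus> (b \<otimes> a) \<otimes> f [^] Suc n" by (simp only: nat_pow_Suc)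
    moreover have "b \<otimes> ?F \<otimes> i \<in> I" by (rule I.I_l_closed) (use ia jb F in auto)
    then have "j \<oplus> b \<otimes> ?F \<otimes> i \<in> I" using jb(1) I.a_closed by blast
    moreover have "b \<otimes> a \<in> carrier R" using jb ia by blast
    ultimately show ?case by blast
  qed
  moreover have "\<exists>n::nat. f [^] n \<in> I" using insert.prems by auto
  then obtain n :: nat where n: "f [^] n \<in> I" by blast
  ultimately obtain j b where "j \<in> I" "b \<in> carrier R" "\<one> = j \<oplus> b \<otimes> f [^] n" by blast
  moreover from this have "j \<oplus> b \<otimes> f [^] n \<in> I" using I.I_l_closed[OF n] I.a_closed by blast
  ultimately show ?case by (simp only:)
qed

text \<open>Gaussian elimination without division: with a pivot \<open>p = v i0 j0\<close> the
  coordinate \<open>j0\<close> is cleared by passing to \<open>p v i j - v i j0 v i0 j\<close>,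
  which costs one vector and one coordinate. A coordinate that vanishes on all vectors is
  dropped.\<close>

lemma (in domain) linear_dependence:
  assumes "finite J" "finite I" "card J < card I" "\<And>i j. i \<in> I ==> j \<in> J ==> v i j \<in> carrier R"
  shows "\<exists>c \<in> I \<rightarrow> carrier R. (\<exists>i\<in>I. c i \<noteq> \<zero>) \<and> (\<forall>j\<in>J. (\<Oplus>i\<in>I. c i \<otimes> v i j) = \<zero>)"
  using assms
proof (induction J arbitrary: I v rule: finite_induct)
  case empty
  then have "I \<noteq> {}" by auto
  then show ?case by (intro bexI[of _ "\<lambda>_. \<one>"]) auto
next
  case (insert j0 J)
  have vc: "v i j \<in> carrier R" if "i \<in> I" "j \<in> insert j0 J" for i j using insert.prems that by auto
  have vJ: "v i j \<in> carrier R" if "i \<in> I" "j \<in> J" for i j using vc that by blast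
  note fin = \<open>finite J\<close> \<open>finite I\<close> \<open>j0 \<notin> J\<close>
  have cardJ: "card J < card I - 1" using insert.hyps insert.prems(2) by simp
  show ?case
  proof (cases "\<forall>i\<in>I. v i j0 = \<zero>")
    case True
    have "card J < card I" using cardJ by simp
    have "\<exists>c \<in> I \<rightarrow> carrier R. (\<exists>i\<in>I. c i \<noteq> \<zero>) \<and> (\<forall>j\<in>J. (\<Oplus>i\<in>I. c i \<otimes> v i j) = \<zero>)"
      by (rule insert.IH) (fact fin(2), fact, rule vJ)
    then obtain c where
      c: "c \<in> I \<rightarrow> carrier R" "\<exists>i\<in>I. c i \<noteq> \<zero>" "\<forall>j\<in>J. (\<Oplus>i\<in>I. c i \<otimes> v i j) = \<zero>" by blast
    have "(\<Oplus>i\<in>I. c i \<otimes> v i j0) = (\<Oplus>i\<in>I. \<zero>)"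
    proof (rule finsum_cong'[OF refl])
      fix i assume i: "i \<in> I"
      then have "c i \<in> carrier R" using c(1) by auto
      then show "c i \<otimes> v i j0 = \<zero>" using bspec[OF True i] by simp
    qed simp
    also have "\<dots> = \<zero>" by simp
    finally show ?thesis using c by (intro bexI[of _ c] conjI) blast+
  next
    case False
    then obtain i0 where i0: "i0 \<in> I" "v i0 j0 \<noteq> \<zero>" by auto
    let ?p = "v i0 j0"
    let ?I = "I - {i0}"
    define w where "w i j = ?p \<otimes> v i j \<ominus> v i j0 \<otimes> v i0 j" for i j
    have wc: "w i j \<in> carrier R" if "i \<in> ?I" "j \<in> J" for i j
      using that vc[of i j] vc[of i j0] vc[of i0 j] vc[of i0 j0] i0(1) by (auto simp: w_def)
    have "card J < card ?I" using cardJ i0 fin by simp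
    have "\<exists>c \<in> ?I \<rightarrow> carrier R. (\<exists>i\<in>?I. c i \<noteq> \<zero>) \<and> (\<forall>j\<in>J. (\<Oplus>i\<in>?I. c i \<otimes> w i j) = \<zero>)"
      by (rule insert.IH) (use fin in simp, fact, rule wc)
    then obtain c where c: "c \<in> ?I \<rightarrow> carrier R" "\<exists>i\<in>?I. c i \<noteq> \<zero>" "\<forall>j\<in>J. (\<Oplus>i\<in>?I. c i \<otimes> w i j) = \<zero>"
      by blast
    have cc: "c i \<in> carrier R" if "i \<in> ?I" for i using c(1) that by auto
    \<comment> \<open>Coordinate \<open>j0\<close> forces the coefficient of the pivot vector; the
      other coefficients are scaled by the pivot, and in a domain this keeps a nonzero one
      nonzero.\<close>
    define s where "s = (\<Oplus>i\<in>?I. c i \<otimes> v i j0)"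
    define c' where "c' i = (if i = i0 then \<ominus> s else ?p \<otimes> c i)" for i
    have pc: "?p \<in> carrier R" using vc i0 by auto
    have sc: "s \<in> carrier R" unfolding s_def using c(1) vc by (intro finsum_closed) auto
    have c'c: "c' \<in> I \<rightarrow> carrier R" using cc sc pc by (auto simp: c'_def)
    have split: "(\<Oplus>i\<in>I. c' i \<otimes> v i j) = \<ominus> (s \<otimes> v i0 j) \<oplus> ?p \<otimes> (\<Oplus>i\<in>?I. c i \<otimes> v i j)" if "j \<in> insert j0 J" for j
    proof -
      have "(\<Oplus>i\<in>insert i0 ?I. c' i \<otimes> v i j) = c' i0 \<otimes> v i0 j \<oplus> (\<Oplus>i\<in>?I. c' i \<otimes> v i j)"
        using fin c'c vc that i0 by (intro finsum_insert) auto
      also have "(\<Oplus>i\<in>?I. c' i \<otimes> v i j) = (\<Oplus>i\<in>?I. ?p \<otimes> (c i \<otimes> v i j))"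
        using cc pc vc that by (intro finsum_cong') (auto simp: c'_def m_assoc)
      also have "\<dots> = ?p \<otimes> (\<Oplus>i\<in>?I. c i \<otimes> v i j)"
        using cc pc vc that fin by (intro finsum_rdistr[symmetric]) auto
      finally show ?thesis using i0(1) sc vc that by (simp add: c'_def insert_absorb l_minus)
    qed
    have "(\<Oplus>i\<in>I. c' i \<otimes> v i j0) = \<zero>"
      unfolding split[of j0, simplified] using sc pc by (simp add: s_def[symmetric] m_comm l_neg)
    moreover have "(\<Oplus>i\<in>I. c' i \<otimes> v i j) = \<zero>" if j: "j \<in> J" for j
    proof -
      have "(\<Oplus>i\<in>?I. c i \<otimes> w i j) = (\<Oplus>i\<in>?I. ?p \<otimes> (c i \<otimes> v i j) \<oplus> (c i \<otimes> v i j0) \<otimes> (\<ominus> v i0 j))"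
        using cc pc vc j i0(1)
        by (intro finsum_cong') (auto simp: w_def r_distr minus_eq m_ac r_minus l_minus)
      also have "\<dots> = (\<Oplus>i\<in>?I. ?p \<otimes> (c i \<otimes> v i j)) \<oplus> (\<Oplus>i\<in>?I. (c i \<otimes> v i j0) \<otimes> (\<ominus> v i0 j))"
        using cc pc vc j i0(1) by (intro finsum_addf) auto
      also have "(\<Oplus>i\<in>?I. ?p \<otimes> (c i \<otimes> v i j)) = ?p \<otimes> (\<Oplus>i\<in>?I. c i \<otimes> v i j)"
        using cc pc vc j fin by (intro finsum_rdistr[symmetric]) auto
      also have "(\<Oplus>i\<in>?I. (c i \<otimes> v i j0) \<otimes> (\<ominus> v i0 j)) = s \<otimes> (\<ominus> v i0 j)"
        unfolding s_def using cc vc j i0(1) fin by (intro finsum_ldistr[symmetric]) auto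
      finally have "?p \<otimes> (\<Oplus>i\<in>?I. c i \<otimes> v i j) \<oplus> s \<otimes> (\<ominus> v i0 j) = \<zero>" using bspec[OF c(3) j] by (simp only:)
      moreover have "(\<Oplus>i\<in>?I. c i \<otimes> v i j) \<in> carrier R" using cc vJ[OF _ j] by (intro finsum_closed) auto
      ultimately show ?thesis
        using split[of j] sc vJ[OF i0(1) j] j pc by (simp add: r_minus a_comm)
    qed
    moreover have "\<exists>i\<in>I. c' i \<noteq> \<zero>"
    proof -
      obtain i where "i \<in> ?I" "c i \<noteq> \<zero>" using c(2) by auto
      then show ?thesis using i0 pc cc[of i] by (intro bexI[of _ i]) (auto simp: c'_def integral_iff)
    qed
    ultimately show ?thesis using c'c by (intro bexI[of _ c']) auto
  qed
qed

text \<open>Finite generation is stated as an induction principle: a subset closed under sums and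
  scalars that contains \<open>U\<close> is everything. This is the form in which it is applied, so
  that linear combinations of generators need not be written down.\<close>

definition fg_module :: "('r, 'x) ring_scheme \<Rightarrow> ('r, 'm) module \<Rightarrow> bool"
  where "fg_module R M \<longleftrightarrow> (\<exists>U. finite U \<and> U \<subseteq> carrier M \<and> (\<forall>H. U \<subseteq> H \<longrightarrow> H \<subseteq> carrier M \<longrightarrow> \<zero>\<^bsub>M\<^esub> \<in> H \<longrightarrow>
    (\<forall>x\<in>H. \<forall>y\<in>H. x \<oplus>\<^bsub>M\<^esub> y \<in> H) \<longrightarrow> (\<forall>a\<in>carrier R. \<forall>x\<in>H. a \<odot>\<^bsub>M\<^esub> x \<in> H) \<longrightarrow> H = carrier M))"

lemma finsum_in:
  assumes "abelian_group M" "H \<subseteq> carrier M" "\<zero>\<^bsub>M\<^esub> \<in> H" "\<And>x y. x \<in> H ==> y \<in> H ==> x \<oplus>\<^bsub>M\<^esub> y \<in> H"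
    and "finite I" "\<And>i. i \<in> I ==> g i \<in> H"
  shows "(\<Oplus>\<^bsub>M\<^esub>i\<in>I. g i) \<in> H"
  using assms(5,6)
proof (induction I rule: finite_induct)
  interpret M: abelian_group M by fact
  case empty then show ?case using assms(3) by (simp add: M.finsum_empty)
next
  interpret M: abelian_group M by fact
  case (insert i I)
  then have "(\<Oplus>\<^bsub>M\<^esub>i\<in>insert i I. g i) = g i \<oplus>\<^bsub>M\<^esub> (\<Oplus>\<^bsub>M\<^esub>i\<in>I. g i)"
    using assms(2) by (intro M.finsum_insert) auto
  then show ?case using insert assms(4) by auto
qed

text \<open>Local-to-global principle: the elements over which \<open>M\<close> becomes free
  generate the unit ideal, hence so do arbitrary powers of them. A claim of the form
  \<open>1 \<in> I\<close> may thus be checked up to a power of each of these elements.\<close>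

lemma locally_free_unimodular:
  assumes "locally_free_module R M r"
  obtains S where "finite S" "S \<subseteq> carrier R" "\<And>f. f \<in> S ==> localization_free R M r f"
    "\<And>I. ideal I R ==> (\<And>f. f \<in> S ==> \<exists>n::nat. f [^]\<^bsub>R\<^esub> n \<in> I) ==> I = carrier R"
proof -
  obtain S where S: "finite S" "S \<subseteq> carrier R" "Idl\<^bsub>R\<^esub> S = carrier R" "\<forall>f\<in>S. localization_free R M r f"
    and "module R M"
    using assms unfolding locally_free_module_def by blast
  interpret module R M by fact
  have "I = carrier R" if I: "ideal I R" "\<And>f. f \<in> S ==> \<exists>n::nat. f [^]\<^bsub>R\<^esub> n \<in> I" for I
  proof -
    have "I \<subseteq> carrier R" using ideal.Icarr[OF I(1)] by auto
    then have IS: "I \<union> S \<subseteq> carrier R" using S(2) by blast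
    have "S \<subseteq> Idl\<^bsub>R\<^esub> (I \<union> S)" using R.genideal_self[OF IS] by blast
    then have "Idl\<^bsub>R\<^esub> S \<subseteq> Idl\<^bsub>R\<^esub> (I \<union> S)"
      by (rule R.genideal_minimal[OF R.genideal_ideal[OF IS]])
    then have one: "\<one>\<^bsub>R\<^esub> \<in> Idl\<^bsub>R\<^esub> (I \<union> S)" unfolding S(3) by (rule subsetD) (rule R.one_closed)
    have "\<one>\<^bsub>R\<^esub> \<in> I" by (rule R.unimodular_powers[OF S(1,2) I(1) _ one]) (rule I(2))
    then show ?thesis by (rule ideal.one_imp_carrier[OF I(1)])
  qed
  then show thesis by (intro that[OF S(1,2)]) (use S(4) in blast)+
qed

text \<open>Turns \<open>y \<in> H\<close> into the claim that an ideal contains 1, to which the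
  local-to-global principle applies.\<close>

lemma (in module) transporter_ideal:
  assumes H: "H \<subseteq> carrier M" "\<zero>\<^bsub>M\<^esub> \<in> H" "\<And>x y. x \<in> H ==> y \<in> H ==> x \<oplus>\<^bsub>M\<^esub> y \<in> H"
    "\<And>a x. a \<in> carrier R ==> x \<in> H ==> a \<odot>\<^bsub>M\<^esub> x \<in> H" and y: "y \<in> carrier M"
  shows "ideal {a \<in> carrier R. a \<odot>\<^bsub>M\<^esub> y \<in> H} R"
proof (rule idealI)
  have "inv\<^bsub>add_monoid R\<^esub> a = (\<ominus> \<one>) \<otimes> a" if "a \<in> carrier R" for a
    unfolding a_inv_def[symmetric] using that by (simp add: R.l_minus)
  then show "subgroup {a \<in> carrier R. a \<odot>\<^bsub>M\<^esub> y \<in> H} (add_monoid R)"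
    using H y by (intro subgroup.intro) (auto simp: smult_l_distr smult_assoc1)
next
  fix a x assume ax: "a \<in> {a \<in> carrier R. a \<odot>\<^bsub>M\<^esub> y \<in> H}" "x \<in> carrier R"
  then have "x \<odot>\<^bsub>M\<^esub> (a \<odot>\<^bsub>M\<^esub> y) \<in> H" using H(4) by blast
  then show "x \<otimes> a \<in> {a \<in> carrier R. a \<odot>\<^bsub>M\<^esub> y \<in> H}" using ax y by (simp add: smult_assoc1)
  then show "a \<otimes> x \<in> {a \<in> carrier R. a \<odot>\<^bsub>M\<^esub> y \<in> H}" using ax by (simp add: R.m_comm)
qed (rule R.ring_axioms)

lemma locally_free_fg:
  assumes "locally_free_module R M r"
  shows "fg_module R M"
proof -
  obtain S where S: "finite S" "S \<subseteq> carrier R" "\<And>f. f \<in> S ==> localization_free R M r f"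
    "\<And>I. ideal I R ==> (\<And>f. f \<in> S ==> \<exists>n::nat. f [^]\<^bsub>R\<^esub> n \<in> I) ==> I = carrier R"
    using locally_free_unimodular[OF assms] by blast
  interpret module R M using assms by (simp add: locally_free_module_def)
  obtain e where e: "\<And>f. f \<in> S ==> e f \<in> {..<r} \<rightarrow> carrier M"
    "\<And>f x. f \<in> S ==> x \<in> carrier M ==> \<exists>(n::nat). \<exists>a \<in> {..<r} \<rightarrow> carrier R. (f [^]\<^bsub>R\<^esub> n) \<odot>\<^bsub>M\<^esub> x = lin_comb M r a (e f)"
    using S(3) unfolding localization_free_def by metis
  \<comment> \<open>The bases of the finitely many localizations generate together: for each
    \<open>f\<close> some power of it moves a given element into the span of the corresponding
    basis.\<close>
  let ?U = "\<Union>f\<in>S. e f ` {..<r}"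
  show ?thesis unfolding fg_module_def
  proof (intro exI[of _ ?U] conjI allI impI)
    show "finite ?U" using S by auto
    show "?U \<subseteq> carrier M" using e(1) by auto
    fix H assume H: "?U \<subseteq> H" "H \<subseteq> carrier M" "\<zero>\<^bsub>M\<^esub> \<in> H" "\<forall>x\<in>H. \<forall>y\<in>H. x \<oplus>\<^bsub>M\<^esub> y \<in> H" "\<forall>a\<in>carrier R. \<forall>x\<in>H. a \<odot>\<^bsub>M\<^esub> x \<in> H"
    have "y \<in> H" if y: "y \<in> carrier M" for y
    proof -
      have "{a \<in> carrier R. a \<odot>\<^bsub>M\<^esub> y \<in> H} = carrier R"
      proof (rule S(4)[OF transporter_ideal])
        fix f assume f: "f \<in> S"
        obtain n :: nat and a where a: "a \<in> {..<r} \<rightarrow> carrier R" "(f [^]\<^bsub>R\<^esub> n) \<odot>\<^bsub>M\<^esub> y = lin_comb M r a (e f)"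
          using e(2)[OF f y] by auto
        have "lin_comb M r a (e f) \<in> H" unfolding lin_comb_def
        proof (rule finsum_in[OF M.abelian_group_axioms H(2,3)])
          fix i assume "i \<in> {..<r}"
          then have "a i \<in> carrier R" "e f i \<in> H" using a(1) f H(1) by auto
          then show "a i \<odot>\<^bsub>M\<^esub> e f i \<in> H" using H(5) by blast
        qed (use H(4) in auto)
        then show "\<exists>n::nat. f [^]\<^bsub>R\<^esub> n \<in> {a \<in> carrier R. a \<odot>\<^bsub>M\<^esub> y \<in> H}"
          using a(2) f S(2) by (intro exI[of _ n]) auto
      qed (use H y in auto)
      then have "\<one>\<^bsub>R\<^esub> \<odot>\<^bsub>M\<^esub> y \<in> H" by blast
      then show ?thesis using y by simp
    qed
    then show "H = carrier M" using H(2) by auto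
  qed
qed

section \<open>Tensor products and base change\<close>

text \<open>Only additivity is recorded, so that linear and semilinear maps are treated alike. Two
  additive maps out of a tensor product agree as soon as they agree on pure tensors.\<close>

definition additive_map :: "('a, 'x) ring_scheme \<Rightarrow> ('b, 'y) ring_scheme \<Rightarrow> ('a \<Rightarrow> 'b) \<Rightarrow> bool"
  where "additive_map G H f \<longleftrightarrow> f \<in> carrier G \<rightarrow> carrier H \<and>
    (\<forall>x\<in>carrier G. \<forall>y\<in>carrier G. f (x \<oplus>\<^bsub>G\<^esub> y) = f x \<oplus>\<^bsub>H\<^esub> f y)"

lemma additive_mapI:
  assumes "\<And>x. x \<in> carrier G ==> f x \<in> carrier H"
    and "\<And>x y. x \<in> carrier G ==> y \<in> carrier G ==> f (x \<oplus>\<^bsub>G\<^esub> y) = f x \<oplus>\<^bsub>H\<^esub> f y"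
  shows "additive_map G H f"
  using assms by (auto simp: additive_map_def)

lemma additive_map_closed: "additive_map G H f ==> x \<in> carrier G ==> f x \<in> carrier H"
  by (auto simp: additive_map_def)

lemma additive_map_add:
  "additive_map G H f ==> x \<in> carrier G ==> y \<in> carrier G ==> f (x \<oplus>\<^bsub>G\<^esub> y) = f x \<oplus>\<^bsub>H\<^esub> f y"
  by (auto simp: additive_map_def)

lemma additive_map_hom:
  assumes "abelian_group G" "abelian_group H" "additive_map G H f"
  shows "group_hom (add_monoid G) (add_monoid H) f"
  using assms abelian_group.a_group[of G] abelian_group.a_group[of H]
  by (auto intro!: group_hom.intro group_hom_axioms.intro simp: hom_def additive_map_def)

lemma additive_map_zero:
  assumes "abelian_group G" "abelian_group H" "additive_map G H f"
  shows "f \<zero>\<^bsub>G\<^esub> = \<zero>\<^bsub>H\<^esub>"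
  using group_hom.hom_one[OF additive_map_hom[OF assms]] by simp

lemma additive_map_uminus:
  assumes "abelian_group G" "abelian_group H" "additive_map G H f" "x \<in> carrier G"
  shows "f (\<ominus>\<^bsub>G\<^esub> x) = \<ominus>\<^bsub>H\<^esub> f x"
  using group_hom.hom_inv[OF additive_map_hom[OF assms(1-3)], of x] assms(4) by (simp add: a_inv_def)

lemma additive_map_minus:
  assumes "abelian_group G" "abelian_group H" "additive_map G H f" "x \<in> carrier G" "y \<in> carrier G"
  shows "f (x \<ominus>\<^bsub>G\<^esub> y) = f x \<ominus>\<^bsub>H\<^esub> f y"
  using assms by (simp add: a_minus_def additive_map_add additive_map_uminus abelian_group.a_inv_closed)

lemma additive_map_finsum:
  assumes G: "abelian_group G" and H: "abelian_group H" and f: "additive_map G H f"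
    and "finite I" and "g \<in> I \<rightarrow> carrier G"
  shows "f (\<Oplus>\<^bsub>G\<^esub>i\<in>I. g i) = (\<Oplus>\<^bsub>H\<^esub>i\<in>I. f (g i))"
  using assms(4,5)
proof (induction I rule: finite_induct)
  case empty
  then show ?case using additive_map_zero[OF G H f]
    by (simp add: abelian_monoid.finsum_empty abelian_group.axioms(1) G H)
next
  case (insert i I)
  interpret G: abelian_group G by fact
  interpret H: abelian_group H by fact
  have "(\<lambda>i. f (g i)) \<in> insert i I \<rightarrow> carrier H" using insert.prems f by (auto simp: additive_map_def)
  then show ?case using insert f
    by (simp add: G.finsum_insert H.finsum_insert additive_map_add Pi_def)
qed

lemma additive_map_compose:
  "additive_map G H f ==> additive_map H I g ==> additive_map G I (\<lambda>x. g (f x))"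
  by (auto simp: additive_map_def Pi_iff)

lemma additive_map_plus:
  assumes "abelian_group H" "additive_map G H f" "additive_map G H g"
  shows "additive_map G H (\<lambda>x. f x \<oplus>\<^bsub>H\<^esub> g x)"
proof -
  interpret H: abelian_group H by fact
  show ?thesis using assms by (auto simp: additive_map_def H.a_ac Pi_iff)
qed

lemma additive_map_finsum_fun:
  assumes "abelian_group H" "finite I" "\<And>i. i \<in> I ==> additive_map G H (f i)"
  shows "additive_map G H (\<lambda>x. \<Oplus>\<^bsub>H\<^esub>i\<in>I. f i x)"
proof -
  interpret H: abelian_group H by fact
  have "(\<Oplus>\<^bsub>H\<^esub>i\<in>I. f i (x \<oplus>\<^bsub>G\<^esub> y)) = (\<Oplus>\<^bsub>H\<^esub>i\<in>I. f i x \<oplus>\<^bsub>H\<^esub> f i y)"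
    if "x \<in> carrier G" "y \<in> carrier G" for x y
    using assms(3) that by (intro H.finsum_cong') (auto simp: additive_map_def)
  then show ?thesis using assms(3)
    by (auto simp: additive_map_def H.finsum_addf Pi_iff intro!: H.finsum_closed)
qed

definition balanced ::
    "('r, 'x) ring_scheme \<Rightarrow> ('r, 'm) module \<Rightarrow> ('r, 'n) module \<Rightarrow> ('g, 'y) ring_scheme \<Rightarrow> ('m \<Rightarrow> 'n \<Rightarrow> 'g) \<Rightarrow> bool"
  where "balanced R M N G b \<longleftrightarrow>
    (\<forall>x\<in>carrier M. \<forall>y\<in>carrier N. b x y \<in> carrier G) \<and>
    (\<forall>x\<in>carrier M. \<forall>x'\<in>carrier M. \<forall>y\<in>carrier N. b (x \<oplus>\<^bsub>M\<^esub> x') y = b x y \<oplus>\<^bsub>G\<^esub> b x' y) \<and>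
    (\<forall>x\<in>carrier M. \<forall>y\<in>carrier N. \<forall>y'\<in>carrier N. b x (y \<oplus>\<^bsub>N\<^esub> y') = b x y \<oplus>\<^bsub>G\<^esub> b x y') \<and>
    (\<forall>a\<in>carrier R. \<forall>x\<in>carrier M. \<forall>y\<in>carrier N. b (a \<odot>\<^bsub>M\<^esub> x) y = b x (a \<odot>\<^bsub>N\<^esub> y))"

lemma balancedI:
  assumes "\<And>x y. x \<in> carrier M ==> y \<in> carrier N ==> b x y \<in> carrier G"
    and "\<And>x x' y. x \<in> carrier M ==> x' \<in> carrier M ==> y \<in> carrier N ==> b (x \<oplus>\<^bsub>M\<^esub> x') y = b x y \<oplus>\<^bsub>G\<^esub> b x' y"
    and "\<And>x y y'. x \<in> carrier M ==> y \<in> carrier N ==> y' \<in> carrier N ==> b x (y \<oplus>\<^bsub>N\<^esub> y') = b x y \<oplus>\<^bsub>G\<^esub> b x y'"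
    and "\<And>a x y. a \<in> carrier R ==> x \<in> carrier M ==> y \<in> carrier N ==> b (a \<odot>\<^bsub>M\<^esub> x) y = b x (a \<odot>\<^bsub>N\<^esub> y)"
  shows "balanced R M N G b"
  using assms by (auto simp: balanced_def)

section \<open>The tensor product as an abelian group\<close>

locale two_modules = M: module R M + N: module R N
  for R :: "('r, 'x) ring_scheme" and M :: "('r, 'm) module" and N :: "('r, 'n) module"
begin

abbreviation "FP \<equiv> free_on_pairs M N"
abbreviation "TK \<equiv> tensor_kernel R M N"
abbreviation "TG \<equiv> tensor_group R M N"
abbreviation "ptens \<equiv> pure_tensor R M N"

lemma FP_comm_group: "comm_group FP"
  by (rule abelian_free_Abelian_group)

lemma frag_diff_carrier: "x \<in> carrier FP ==> y \<in> carrier FP ==> x - y \<in> carrier FP"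
  by (simp add: keys_diff[THEN order_trans])

lemma relations_carrier: "tensor_relations R M N \<subseteq> carrier FP"
  unfolding tensor_relations_def
  by (auto intro!: frag_diff_carrier simp del: carrier_free_Abelian_group_iff)

lemma TK_subgroup: "subgroup TK FP"
  unfolding tensor_kernel_def
  by (rule group.generate_is_subgroup[OF group_free_Abelian_group relations_carrier])

lemma TK_normal: "TK \<lhd> FP"
  by (rule comm_group.subgroup_imp_normal[OF FP_comm_group TK_subgroup])

lemma add_monoid_TG: "add_monoid TG = FP Mod TK"
  by (simp add: tensor_group_def tensor_quotient_def FactGroup_def)

lemma TG_abelian_group: "abelian_group TG"
proof -
  have "comm_group (add_monoid TG)"
    unfolding add_monoid_TG
    by (rule comm_group.abelian_FactGroup[OF FP_comm_group TK_subgroup])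
  then show ?thesis
    by (simp add: abelian_group_def abelian_group_axioms_def abelian_monoid_def comm_group_def)
qed

sublocale TG: abelian_group TG by (rule TG_abelian_group)

lemma TG_carrier: "carrier TG = {TK #>\<^bsub>FP\<^esub> p |p. p \<in> carrier FP}"
  by (auto simp: tensor_group_def tensor_quotient_def FactGroup_def RCOSETS_def)

lemma TG_add:
  "p \<in> carrier FP ==> p' \<in> carrier FP ==> (TK #>\<^bsub>FP\<^esub> p) \<oplus>\<^bsub>TG\<^esub> (TK #>\<^bsub>FP\<^esub> p') = TK #>\<^bsub>FP\<^esub> (p + p')"
  using normal.rcos_sum[OF TK_normal, of p p']
  by (simp add: tensor_group_def tensor_quotient_def FactGroup_def)

lemma rcos_closed: "p \<in> carrier FP ==> TK #>\<^bsub>FP\<^esub> p \<in> carrier TG"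
  by (auto simp: TG_carrier)

lemma TG_zero: "\<zero>\<^bsub>TG\<^esub> = TK"
  by (simp add: tensor_group_def tensor_quotient_def FactGroup_def)

lemma ptens_closed [simp, intro]: "x \<in> carrier M ==> y \<in> carrier N ==> ptens x y \<in> carrier TG"
  by (auto simp: pure_tensor_def TG_carrier)

lemma rcos_eqI: "p - p' \<in> TK ==> p \<in> carrier FP ==> p' \<in> carrier FP ==> TK #>\<^bsub>FP\<^esub> p = TK #>\<^bsub>FP\<^esub> p'"
proof -
  assume a: "p - p' \<in> TK" "p \<in> carrier FP" "p' \<in> carrier FP"
  have "(p - p') \<otimes>\<^bsub>FP\<^esub> p' \<in> TK #>\<^bsub>FP\<^esub> p'" unfolding r_coset_def using a(1) by blast
  then have "p \<in> TK #>\<^bsub>FP\<^esub> p'" by simp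
  from group.repr_independence[OF group_free_Abelian_group this a(3) TK_subgroup]
  show ?thesis by simp
qed

lemma relation_in_TK: "p \<in> tensor_relations R M N ==> p \<in> TK"
  unfolding tensor_kernel_def by (rule generate.incl)

lemma ptens_add_left:
  assumes "x \<in> carrier M" "x' \<in> carrier M" "y \<in> carrier N"
  shows "ptens (x \<oplus>\<^bsub>M\<^esub> x') y = ptens x y \<oplus>\<^bsub>TG\<^esub> ptens x' y"
proof -
  have "frag_of (x \<oplus>\<^bsub>M\<^esub> x', y) - frag_of (x, y) - frag_of (x', y) \<in> TK"
    by (rule relation_in_TK) (use assms in \<open>auto simp: tensor_relations_def\<close>)
  then have "frag_of (x \<oplus>\<^bsub>M\<^esub> x', y) - (frag_of (x, y) + frag_of (x', y)) \<in> TK"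
    by (simp add: algebra_simps)
  moreover have "frag_of (x, y) + frag_of (x', y) \<in> carrier FP"
    using assms by (metis comm_group.axioms(2) frag_of_in_free_Abelian_group group.subgroup_self mem_Sigma_iff mult_free_Abelian_group FP_comm_group subgroup.m_closed)
  ultimately show ?thesis
    using assms unfolding pure_tensor_def
    by (subst TG_add, simp, simp, intro rcos_eqI) (simp_all del: carrier_free_Abelian_group_iff add: frag_of_in_free_Abelian_group)
qed

lemma ptens_add_right:
  assumes "x \<in> carrier M" "y \<in> carrier N" "y' \<in> carrier N"
  shows "ptens x (y \<oplus>\<^bsub>N\<^esub> y') = ptens x y \<oplus>\<^bsub>TG\<^esub> ptens x y'"
proof -
  have "frag_of (x, y \<oplus>\<^bsub>N\<^esub> y') - frag_of (x, y) - frag_of (x, y') \<in> TK"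
    by (rule relation_in_TK) (use assms in \<open>auto simp: tensor_relations_def\<close>)
  then have "frag_of (x, y \<oplus>\<^bsub>N\<^esub> y') - (frag_of (x, y) + frag_of (x, y')) \<in> TK"
    by (simp add: algebra_simps)
  moreover have "frag_of (x, y) + frag_of (x, y') \<in> carrier FP"
    using assms by (metis comm_group.axioms(2) frag_of_in_free_Abelian_group group.subgroup_self mem_Sigma_iff mult_free_Abelian_group FP_comm_group subgroup.m_closed)
  ultimately show ?thesis
    using assms unfolding pure_tensor_def
    by (subst TG_add, simp, simp, intro rcos_eqI) (simp_all del: carrier_free_Abelian_group_iff add: frag_of_in_free_Abelian_group)
qed

lemma ptens_smult:
  assumes "a \<in> carrier R" "x \<in> carrier M" "y \<in> carrier N"
  shows "ptens (a \<odot>\<^bsub>M\<^esub> x) y = ptens x (a \<odot>\<^bsub>N\<^esub> y)"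
  unfolding pure_tensor_def
proof (rule rcos_eqI)
  show "frag_of (a \<odot>\<^bsub>M\<^esub> x, y) - frag_of (x, a \<odot>\<^bsub>N\<^esub> y) \<in> TK"
    by (rule relation_in_TK) (use assms in \<open>auto simp: tensor_relations_def\<close>)
qed (use assms in \<open>auto simp del: carrier_free_Abelian_group_iff\<close>)

lemma additive_ptens_left: "y \<in> carrier N ==> additive_map M TG (\<lambda>x. ptens x y)"
  by (auto simp: additive_map_def ptens_add_left)

lemma ptens_zero_left [simp]: "y \<in> carrier N ==> ptens \<zero>\<^bsub>M\<^esub> y = \<zero>\<^bsub>TG\<^esub>"
  using additive_map_zero[OF M.abelian_group_axioms TG_abelian_group additive_ptens_left] by simp

lemma ptens_uminus_left: "x \<in> carrier M ==> y \<in> carrier N ==> ptens (\<ominus>\<^bsub>M\<^esub> x) y = \<ominus>\<^bsub>TG\<^esub> ptens x y"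
  using additive_map_uminus[OF M.abelian_group_axioms TG_abelian_group additive_ptens_left] by simp

text \<open>Induction over the free abelian group passes to differences. As
  \<open>- (x \<otimes> y) = (- x) \<otimes> y\<close> is again pure, carrying the property together
  with its negative reduces differences to sums.\<close>

lemma tensor_induct [consumes 1, case_names pure add]:
  assumes Z: "Z \<in> carrier TG"
    and pure: "\<And>x y. x \<in> carrier M ==> y \<in> carrier N ==> P (ptens x y)"
    and add: "\<And>Y0 Y. Y0 \<in> carrier TG ==> Y \<in> carrier TG ==> P Y0 ==> P Y ==> P (Y0 \<oplus>\<^bsub>TG\<^esub> Y)"
  shows "P Z"
proof -
  obtain p where p: "Z = TK #>\<^bsub>FP\<^esub> p" "Poly_Mapping.keys p \<subseteq> carrier M \<times> carrier N"
    using Z by (auto simp: TG_carrier)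
  define P' where "P' Y \<longleftrightarrow> Y \<in> carrier TG \<and> P Y \<and> P (\<ominus>\<^bsub>TG\<^esub> Y)" for Y
  have zero: "P' \<zero>\<^bsub>TG\<^esub>"
    using pure[of "\<zero>\<^bsub>M\<^esub>" "\<zero>\<^bsub>N\<^esub>"] TG.add.inv_one by (simp add: P'_def a_inv_def)
  have P'_pure: "P' (ptens x y)" if "x \<in> carrier M" "y \<in> carrier N" for x y
    using that pure[of x y] pure[of "\<ominus>\<^bsub>M\<^esub> x" y] by (simp add: P'_def ptens_uminus_left)
  have P'_add: "P' (Y0 \<oplus>\<^bsub>TG\<^esub> Y)" if "P' Y0" "P' Y" for Y0 Y
    using that add[of Y0 Y] add[of "\<ominus>\<^bsub>TG\<^esub> Y0" "\<ominus>\<^bsub>TG\<^esub> Y"] by (simp add: P'_def TG.minus_add)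
  have P'_uminus: "P' (\<ominus>\<^bsub>TG\<^esub> Y0)" if "P' Y0" for Y0
    using that by (simp add: P'_def)
  have in_FP: "q \<in> carrier FP" if "Poly_Mapping.keys q \<subseteq> carrier M \<times> carrier N" for q
    using that by simp
  have "Poly_Mapping.keys p \<subseteq> carrier M \<times> carrier N \<and> P' (TK #>\<^bsub>FP\<^esub> p)"
  proof (rule frag_induction[OF p(2), where P = "\<lambda>q. Poly_Mapping.keys q \<subseteq> carrier M \<times> carrier N \<and> P' (TK #>\<^bsub>FP\<^esub> q)"], goal_cases)
    case 1
    then show ?case using zero group.coset_mult_one[OF group_free_Abelian_group, of TK "carrier M \<times> carrier N"] subgroup.subset[OF TK_subgroup] TG_zero
      by simp
  next
    case (2 z)
    obtain x y where [simp]: "z = (x, y)" by (cases z)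
    show ?case using P'_pure[of x y] 2 by (simp add: pure_tensor_def)
  next
    case (3 a b)
    have ca: "a \<in> carrier FP" and cb: "b \<in> carrier FP" using 3 by auto
    have cmb: "- b \<in> carrier FP" using cb by simp
    have cab: "a - b \<in> carrier FP" using frag_diff_carrier[OF ca cb] .
    have "(TK #>\<^bsub>FP\<^esub> b) \<oplus>\<^bsub>TG\<^esub> (TK #>\<^bsub>FP\<^esub> (- b)) = \<zero>\<^bsub>TG\<^esub>"
      using TG_add[OF cb cmb] group.coset_mult_one[OF group_free_Abelian_group, of TK "carrier M \<times> carrier N"] subgroup.subset[OF TK_subgroup] TG_zero
      by simp
    then have "TK #>\<^bsub>FP\<^esub> (- b) = \<ominus>\<^bsub>TG\<^esub> (TK #>\<^bsub>FP\<^esub> b)"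
      using rcos_closed[OF cb] rcos_closed[OF cmb] by (metis TG.a_comm TG.minus_equality)
    then have "TK #>\<^bsub>FP\<^esub> (a - b) = (TK #>\<^bsub>FP\<^esub> a) \<oplus>\<^bsub>TG\<^esub> (\<ominus>\<^bsub>TG\<^esub> (TK #>\<^bsub>FP\<^esub> b))"
      using TG_add[OF ca cmb] by simp
    then have "P' (TK #>\<^bsub>FP\<^esub> (a - b))" using 3 P'_add P'_uminus by simp
    then show ?case using cab by simp
  qed
  then show ?thesis using p by (simp add: P'_def)
qed

end

lemma (in abelian_group) add_pow_int_zero: "add_pow G (0::int) x = \<zero>"
  by (simp add: add_pow_def int_pow_def)

lemma (in abelian_group) add_pow_int_closed: "x \<in> carrier G ==> add_pow G (k::int) x \<in> carrier G"
  using group.int_pow_closed[OF a_group, of x k] by (simp add: add_pow_def)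

lemma (in abelian_group) add_pow_int_add:
  "x \<in> carrier G ==> add_pow G (k + l::int) x = add_pow G k x \<oplus> add_pow G l x"
  using group.int_pow_mult[OF a_group, of x k l] by (simp add: add_pow_def)

text \<open>The supports of \<open>p\<close>, \<open>p'\<close> and \<open>p + p'\<close> may
  differ, so all three sums are extended to the union of the first two supports, where the
  additional coefficients are 0.\<close>

lemma (in abelian_group) finsum_keys_add:
  fixes p p' :: "'z \<Rightarrow>\<^sub>0 int"
  assumes b: "\<And>z. z \<in> Poly_Mapping.keys p \<union> Poly_Mapping.keys p' ==> b z \<in> carrier G"
  shows "(\<Oplus>z\<in>Poly_Mapping.keys (p + p'). [Poly_Mapping.lookup (p + p') z] \<cdot> b z) =
     (\<Oplus>z\<in>Poly_Mapping.keys p. [Poly_Mapping.lookup p z] \<cdot> b z) \<oplus> (\<Oplus>z\<in>Poly_Mapping.keys p'. [Poly_Mapping.lookup p' z] \<cdot> (b z))"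
proof -
  let ?K = "Poly_Mapping.keys p \<union> Poly_Mapping.keys p'"
  have b': "\<And>z. z \<in> Poly_Mapping.keys p ==> b z \<in> carrier G" "\<And>z. z \<in> Poly_Mapping.keys p' ==> b z \<in> carrier G"
    using b by auto
  have *: "(\<Oplus>z\<in>Poly_Mapping.keys q. [Poly_Mapping.lookup q z] \<cdot> b z) = (\<Oplus>z\<in>?K. [Poly_Mapping.lookup q z] \<cdot> b z)"
    if "Poly_Mapping.keys q \<subseteq> ?K" for q :: "_ \<Rightarrow>\<^sub>0 int"
    using that b
    by (intro add.finprod_mono_neutral_cong_left) (auto simp: in_keys_iff add_pow_int_zero intro!: add_pow_int_closed)
  have "(\<Oplus>z\<in>?K. [Poly_Mapping.lookup (p + p') z] \<cdot> b z) =
      (\<Oplus>z\<in>?K. [Poly_Mapping.lookup p z] \<cdot> b z \<oplus> [Poly_Mapping.lookup p' z] \<cdot> b z)"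
  proof (rule finsum_cong'[OF refl])
    fix z assume "z \<in> ?K"
    then have "b z \<in> carrier G" using b by blast
    then show "[Poly_Mapping.lookup (p + p') z] \<cdot> b z = [Poly_Mapping.lookup p z] \<cdot> b z \<oplus> [Poly_Mapping.lookup p' z] \<cdot> b z"
      by (simp add: lookup_add add_pow_int_add)
  next
    show "(\<lambda>z. [Poly_Mapping.lookup p z] \<cdot> b z \<oplus> [Poly_Mapping.lookup p' z] \<cdot> b z) \<in> ?K \<rightarrow> carrier G"
      using b by (intro Pi_I a_closed add_pow_int_closed) blast+
  qed
  also have "\<dots> = (\<Oplus>z\<in>?K. [Poly_Mapping.lookup p z] \<cdot> b z) \<oplus> (\<Oplus>z\<in>?K. [Poly_Mapping.lookup p' z] \<cdot> b z)"
    using b' by (intro finsum_addf) (auto intro!: add_pow_int_closed)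
  finally show ?thesis using *[of "p + p'"] *[of p] *[of p'] keys_add[of p p'] by (simp add: subset_iff)
qed

section \<open>The universal property of the tensor product\<close>

context two_modules
begin

context
  fixes G :: "('g, 'y) ring_scheme" and b
  assumes G: "abelian_group G" and b: "balanced R M N G b"
begin

interpretation G: abelian_group G by (rule G)

definition free_lift where
  "free_lift p = (\<Oplus>\<^bsub>G\<^esub> z \<in> Poly_Mapping.keys p. [Poly_Mapping.lookup p z] \<cdot>\<^bsub>G\<^esub> b (fst z) (snd z))"

lemma b_closed: "x \<in> carrier M ==> y \<in> carrier N ==> b x y \<in> carrier G"
  using b by (simp add: balanced_def)

lemma free_lift_closed: "p \<in> carrier FP ==> free_lift p \<in> carrier G"
  unfolding free_lift_def by (intro G.finsum_closed) (auto intro!: b_closed G.add_pow_int_closed)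

lemma free_lift_add: "p \<in> carrier FP ==> p' \<in> carrier FP ==> free_lift (p + p') = free_lift p \<oplus>\<^bsub>G\<^esub> free_lift p'"
  unfolding free_lift_def by (intro G.finsum_keys_add) (auto intro!: b_closed)

lemma free_lift_frag: "x \<in> carrier M ==> y \<in> carrier N ==> free_lift (frag_of (x, y)) = b x y"
  by (simp add: free_lift_def G.finsum_insert b_closed G.finsum_empty)

lemma free_lift_hom: "group_hom FP (add_monoid G) free_lift"
  using free_lift_closed free_lift_add G.a_group
  by (auto intro!: group_hom.intro group_hom_axioms.intro simp: hom_def)

lemma free_lift_diff:
  assumes "p \<in> carrier FP" "p' \<in> carrier FP" shows "free_lift (p - p') = free_lift p \<ominus>\<^bsub>G\<^esub> free_lift p'"
proof -
  have "free_lift (- p') = \<ominus>\<^bsub>G\<^esub> free_lift p'"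
    using group_hom.hom_inv[OF free_lift_hom, of p'] assms(2) by (simp add: a_inv_def)
  then show ?thesis using free_lift_add[of p "- p'"] assms by (simp add: a_minus_def)
qed

lemma free_lift_relation: "p \<in> tensor_relations R M N ==> free_lift p = \<zero>\<^bsub>G\<^esub>"
proof -
  have [simp]: "frag_of (x, y) \<in> carrier FP" if "x \<in> carrier M" "y \<in> carrier N" for x y
    using that by simp
  have D: "u = v ==> v \<in> carrier G ==> u \<ominus>\<^bsub>G\<^esub> v = \<zero>\<^bsub>G\<^esub>" for u v by (simp add: G.r_neg a_minus_def)
  have D3: "u = v \<oplus>\<^bsub>G\<^esub> w ==> v \<in> carrier G ==> w \<in> carrier G ==> (u \<ominus>\<^bsub>G\<^esub> v) \<ominus>\<^bsub>G\<^esub> w = \<zero>\<^bsub>G\<^esub>" for u v w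
    by (metis G.a_comm G.add.m_closed G.minus_eq G.add.inv_closed G.add.m_assoc G.r_neg G.r_zero G.r_neg2)
  assume "p \<in> tensor_relations R M N"
  then show ?thesis unfolding tensor_relations_def
  proof (elim UnE CollectE exE conjE, goal_cases)
    case (1 x x' y)
    then show ?thesis using b
      by (simp add: free_lift_diff free_lift_frag b_closed frag_diff_carrier D3 balanced_def del: carrier_free_Abelian_group_iff)
  next
    case (2 x y y')
    then show ?thesis using b
      by (simp add: free_lift_diff free_lift_frag b_closed frag_diff_carrier D3 balanced_def del: carrier_free_Abelian_group_iff)
  next
    case (3 a x y)
    then show ?thesis using b
      by (simp add: free_lift_diff free_lift_frag b_closed frag_diff_carrier D balanced_def del: carrier_free_Abelian_group_iff)
  qed
qed

lemma free_lift_TK: "p \<in> TK ==> free_lift p = \<zero>\<^bsub>G\<^esub>"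
proof -
  have "subgroup {p \<in> carrier FP. free_lift p = \<zero>\<^bsub>G\<^esub>} FP"
    using group_hom.subgroup_kernel[OF free_lift_hom] by (simp add: kernel_def)
  moreover have "tensor_relations R M N \<subseteq> {p \<in> carrier FP. free_lift p = \<zero>\<^bsub>G\<^esub>}"
    using relations_carrier free_lift_relation by (auto simp del: carrier_free_Abelian_group_iff)
  ultimately show "p \<in> TK ==> free_lift p = \<zero>\<^bsub>G\<^esub>"
    unfolding tensor_kernel_def
    using group.generate_subgroup_incl[OF group_free_Abelian_group, of "tensor_relations R M N"] by blast
qed

text \<open>\<open>tensor_lift\<close> evaluates at a representative obtained by choice. Two
  representatives differ by an element of \<open>TK\<close>, on which \<open>free_lift\<close>
  vanishes, so the choice does not matter.\<close>

lemma tensor_lift_coset: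
  assumes p: "p \<in> carrier FP"
  shows "tensor_lift G b (TK #>\<^bsub>FP\<^esub> p) = free_lift p"
proof -
  let ?p = "SOME q. q \<in> TK #>\<^bsub>FP\<^esub> p"
  have "p \<in> TK #>\<^bsub>FP\<^esub> p"
    by (rule group.rcos_self[OF group_free_Abelian_group p TK_subgroup])
  then have "?p \<in> TK #>\<^bsub>FP\<^esub> p" by (rule someI)
  then obtain k where k: "k \<in> TK" "?p = k + p" by (auto simp: r_coset_def)
  have "k \<in> carrier FP" using k(1) subgroup.subset[OF TK_subgroup] by blast
  then have "free_lift ?p = free_lift p"
    unfolding k(2) using p free_lift_add free_lift_TK[OF k(1)] free_lift_closed[OF p] by simp
  then show ?thesis by (simp add: tensor_lift_def Let_def free_lift_def)
qed

lemma tensor_lift_pure [simp]: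
  "x \<in> carrier M ==> y \<in> carrier N ==> tensor_lift G b (ptens x y) = b x y"
  by (simp add: pure_tensor_def tensor_lift_coset free_lift_frag)

lemma tensor_lift_additive: "additive_map TG G (tensor_lift G b)"
proof (rule additive_mapI)
  fix Y0 assume "Y0 \<in> carrier TG"
  then show "tensor_lift G b Y0 \<in> carrier G"
    using tensor_lift_coset free_lift_closed by (auto simp: TG_carrier simp del: carrier_free_Abelian_group_iff)
next
  fix Y0 Y assume "Y0 \<in> carrier TG" "Y \<in> carrier TG"
  then obtain p p' where p: "Y0 = TK #>\<^bsub>FP\<^esub> p" "p \<in> carrier FP" "Y = TK #>\<^bsub>FP\<^esub> p'" "p' \<in> carrier FP"
    unfolding TG_carrier by auto
  have "p + p' \<in> carrier FP" using p group.is_monoid[OF group_free_Abelian_group] monoid.m_closed mult_free_Abelian_group by metis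
  then show "tensor_lift G b (Y0 \<oplus>\<^bsub>TG\<^esub> Y) = tensor_lift G b Y0 \<oplus>\<^bsub>G\<^esub> tensor_lift G b Y"
    using p by (simp add: TG_add tensor_lift_coset free_lift_add del: carrier_free_Abelian_group_iff)
qed

end

end

section \<open>Extension of scalars along a ring homomorphism\<close>

lemma module_along_simps [simp]:
  "carrier (module_along B h) = carrier B" "ring.add (module_along B h) = ring.add B" "ring.zero (module_along B h) = ring.zero B"
  "module.smult (module_along B h) a b = h a \<otimes>\<^bsub>B\<^esub> b"
  by (auto simp: module_along_def)

lemma abelian_group_cong:
  assumes "abelian_group G" "carrier H = carrier G" "ring.add H = ring.add G" "ring.zero H = ring.zero G"
  shows "abelian_group H"
proof -
  interpret G: abelian_group G by fact
  show ?thesis by (rule abelian_groupI) (use assms(2-4) in \<open>auto simp: G.a_ac intro: G.add.l_inv_ex\<close>)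
qed

lemma module_along_module:
  assumes "cring R" "cring B" "h \<in> ring_hom R B"
  shows "module R (module_along B h)"
proof -
  interpret R: cring R by fact
  interpret B: cring B by fact
  have "abelian_group (module_along B h)"
    by (rule abelian_group_cong[OF B.abelian_group_axioms]) auto
  then show ?thesis using assms(3)
    by (intro moduleI assms) (auto simp: ring_hom_closed ring_hom_add ring_hom_mult ring_hom_one B.l_distr B.r_distr B.m_assoc)
qed

locale base_change_data = M: module R M + S: cring S
  for R :: "('r, 'x) ring_scheme" and M :: "('r, 'm) module" and S :: "('s, 'y) ring_scheme" +
  fixes h :: "'r \<Rightarrow> 's"
  assumes h: "h \<in> ring_hom R S"

sublocale base_change_data \<subseteq> two_modules R M "module_along S h"
proof -
  interpret N: module R "module_along S h"
    by (rule module_along_module) (auto simp: M.R.cring_axioms S.cring_axioms h)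
  show "two_modules R M (module_along S h)" ..
qed

context base_change_data
begin

abbreviation "BC \<equiv> base_change R M h S"
abbreviation "bc \<equiv> bc_tensor R M h S"

lemma BC_simps: "carrier BC = carrier TG" "ring.add BC = ring.add TG" "ring.zero BC = ring.zero TG"
  by (simp_all add: base_change_def Let_def)

lemma BC_abelian_group: "abelian_group BC"
  by (rule abelian_group_cong[OF TG_abelian_group]) (auto simp: BC_simps)

lemma additive_BC_source: "additive_map BC G f \<longleftrightarrow> additive_map TG G f"
  by (simp add: additive_map_def BC_simps)

lemma additive_BC_target: "additive_map G BC f \<longleftrightarrow> additive_map G TG f"
  by (simp add: additive_map_def BC_simps)

lemma bc_ptens: "bc x s = ptens x s"
  by (simp add: bc_tensor_def)

lemma bc_closed [simp, intro]: "x \<in> carrier M ==> s \<in> carrier S ==> bc x s \<in> carrier BC"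
  using ptens_closed by (simp add: bc_ptens BC_simps)

lemma bc_add_left:
  "x \<in> carrier M ==> x' \<in> carrier M ==> s \<in> carrier S ==> bc (x \<oplus>\<^bsub>M\<^esub> x') s = bc x s \<oplus>\<^bsub>BC\<^esub> bc x' s"
  using ptens_add_left by (simp add: bc_ptens BC_simps)

lemma bc_add_right:
  "x \<in> carrier M ==> s \<in> carrier S ==> s' \<in> carrier S ==> bc x (s \<oplus>\<^bsub>S\<^esub> s') = bc x s \<oplus>\<^bsub>BC\<^esub> bc x s'"
  using ptens_add_right[of x s s'] by (simp add: bc_ptens BC_simps)

lemma bc_smult_left:
  "a \<in> carrier R ==> x \<in> carrier M ==> s \<in> carrier S ==> bc (a \<odot>\<^bsub>M\<^esub> x) s = bc x (h a \<otimes>\<^bsub>S\<^esub> s)"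
  using ptens_smult[of a x s] by (simp add: bc_ptens)

lemma bc_induct [consumes 1, case_names pure add]:
  assumes "Z \<in> carrier BC"
    and "\<And>x s. x \<in> carrier M ==> s \<in> carrier S ==> P (bc x s)"
    and "\<And>Y Z. Y \<in> carrier BC ==> Z \<in> carrier BC ==> P Y ==> P Z ==> P (Y \<oplus>\<^bsub>BC\<^esub> Z)"
  shows "P Z"
  using assms unfolding BC_simps bc_ptens by (induction rule: tensor_induct) auto

lemma bc_map_eq:
  assumes "additive_map BC G f" "additive_map BC G g"
    and "\<And>x s. x \<in> carrier M ==> s \<in> carrier S ==> f (bc x s) = g (bc x s)" and "Z \<in> carrier BC"
  shows "f Z = g Z"
  using assms(4) by (induction rule: bc_induct) (use assms(1-3) in \<open>auto simp: additive_map_add\<close>)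

lemma bc_lift:
  assumes "abelian_group G" "balanced R M (module_along S h) G b"
  shows "additive_map BC G (tensor_lift G b)"
    and "x \<in> carrier M ==> s \<in> carrier S ==> tensor_lift G b (bc x s) = b x s"
  using tensor_lift_additive[OF assms] tensor_lift_pure[OF assms] by (auto simp: additive_BC_source bc_ptens)

lemma smult_balanced:
  assumes a: "a \<in> carrier S"
  shows "balanced R M (module_along S h) TG (\<lambda>x s. bc x (a \<otimes>\<^bsub>S\<^esub> s))"
proof (rule balancedI)
  fix x s assume "x \<in> carrier M" "s \<in> carrier (module_along S h)"
  then show "bc x (a \<otimes>\<^bsub>S\<^esub> s) \<in> carrier TG"
    using bc_closed[of x "a \<otimes>\<^bsub>S\<^esub> s"] a by (simp add: BC_simps)
next
  fix x x' s assume "x \<in> carrier M" "x' \<in> carrier M" "s \<in> carrier (module_along S h)"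
  then show "bc (x \<oplus>\<^bsub>M\<^esub> x') (a \<otimes>\<^bsub>S\<^esub> s) = bc x (a \<otimes>\<^bsub>S\<^esub> s) \<oplus>\<^bsub>TG\<^esub> bc x' (a \<otimes>\<^bsub>S\<^esub> s)"
    using bc_add_left[of x x' "a \<otimes>\<^bsub>S\<^esub> s"] a by (simp add: BC_simps)
next
  fix x s t assume "x \<in> carrier M" "s \<in> carrier (module_along S h)" "t \<in> carrier (module_along S h)"
  then show "bc x (a \<otimes>\<^bsub>S\<^esub> (s \<oplus>\<^bsub>module_along S h\<^esub> t)) = bc x (a \<otimes>\<^bsub>S\<^esub> s) \<oplus>\<^bsub>TG\<^esub> bc x (a \<otimes>\<^bsub>S\<^esub> t)"
    using bc_add_right[of x "a \<otimes>\<^bsub>S\<^esub> s" "a \<otimes>\<^bsub>S\<^esub> t"] a by (simp add: BC_simps S.r_distr)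
next
  fix b x s assume "b \<in> carrier R" "x \<in> carrier M" "s \<in> carrier (module_along S h)"
  then show "bc (b \<odot>\<^bsub>M\<^esub> x) (a \<otimes>\<^bsub>S\<^esub> s) = bc x (a \<otimes>\<^bsub>S\<^esub> (b \<odot>\<^bsub>module_along S h\<^esub> s))"
    using a ring_hom_closed[OF h, of b] by (simp add: bc_smult_left S.m_lcomm)
qed

lemma smult_additive: "a \<in> carrier S ==> additive_map BC BC (module.smult BC a)"
  using tensor_lift_additive[OF TG_abelian_group smult_balanced, of a]
  by (simp add: additive_BC_source additive_BC_target) (simp add: base_change_def Let_def bc_tensor_def)

lemma smult_bc: "a \<in> carrier S ==> x \<in> carrier M ==> s \<in> carrier S ==> a \<odot>\<^bsub>BC\<^esub> bc x s = bc x (a \<otimes>\<^bsub>S\<^esub> s)"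
  using tensor_lift_pure[OF TG_abelian_group smult_balanced, of a x s]
  by (simp add: bc_ptens) (simp add: base_change_def Let_def bc_tensor_def)

lemma BC_module: "module S BC"
proof -
  interpret BC: abelian_group BC by (rule BC_abelian_group)
  have comp: "additive_map BC BC (\<lambda>Z. a \<odot>\<^bsub>BC\<^esub> (b \<odot>\<^bsub>BC\<^esub> Z))" if "a \<in> carrier S" "b \<in> carrier S" for a b
    using additive_map_compose[OF smult_additive smult_additive] that by simp
  have plus: "additive_map BC BC (\<lambda>Z. a \<odot>\<^bsub>BC\<^esub> Z \<oplus>\<^bsub>BC\<^esub> b \<odot>\<^bsub>BC\<^esub> Z)" if "a \<in> carrier S" "b \<in> carrier S" for a b
    using additive_map_plus[OF BC_abelian_group smult_additive smult_additive] that by simp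
  show ?thesis
  proof (rule moduleI)
    show "a \<odot>\<^bsub>BC\<^esub> Z \<in> carrier BC" if "a \<in> carrier S" "Z \<in> carrier BC" for a Z
      by (rule additive_map_closed[OF smult_additive[OF that(1)] that(2)])
    show "(a \<oplus>\<^bsub>S\<^esub> b) \<odot>\<^bsub>BC\<^esub> Z = a \<odot>\<^bsub>BC\<^esub> Z \<oplus>\<^bsub>BC\<^esub> b \<odot>\<^bsub>BC\<^esub> Z"
      if "a \<in> carrier S" "b \<in> carrier S" "Z \<in> carrier BC" for a b Z
      by (rule bc_map_eq[OF smult_additive[OF S.a_closed[OF that(1,2)]] plus[OF that(1,2)] _ that(3)])
        (use that in \<open>simp add: smult_bc bc_add_right S.l_distr\<close>)
    show "a \<odot>\<^bsub>BC\<^esub> (Y \<oplus>\<^bsub>BC\<^esub> Z) = a \<odot>\<^bsub>BC\<^esub> Y \<oplus>\<^bsub>BC\<^esub> a \<odot>\<^bsub>BC\<^esub> Z"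
      if "a \<in> carrier S" "Y \<in> carrier BC" "Z \<in> carrier BC" for a Y Z
      by (rule additive_map_add[OF smult_additive[OF that(1)] that(2,3)])
    show "(a \<otimes>\<^bsub>S\<^esub> b) \<odot>\<^bsub>BC\<^esub> Z = a \<odot>\<^bsub>BC\<^esub> (b \<odot>\<^bsub>BC\<^esub> Z)"
      if "a \<in> carrier S" "b \<in> carrier S" "Z \<in> carrier BC" for a b Z
      by (rule bc_map_eq[OF smult_additive[OF S.m_closed[OF that(1,2)]] comp[OF that(1,2)] _ that(3)])
        (use that in \<open>simp add: smult_bc S.m_assoc\<close>)
    have "additive_map BC BC (\<lambda>Z. Z)" by (simp add: additive_map_def)
    then show "\<one>\<^bsub>S\<^esub> \<odot>\<^bsub>BC\<^esub> Z = Z" if "Z \<in> carrier BC" for Z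
      by (rule bc_map_eq[OF smult_additive[OF S.one_closed] _ _ that]) (simp add: smult_bc)
  qed (use S.cring_axioms BC_abelian_group in auto)
qed

sublocale BC: module S BC by (rule BC_module)

lemma bc_one: "x \<in> carrier M ==> s \<in> carrier S ==> bc x s = s \<odot>\<^bsub>BC\<^esub> bc x \<one>\<^bsub>S\<^esub>"
  by (simp add: smult_bc)

lemma additive_bc_one: "additive_map M BC (\<lambda>x. bc x \<one>\<^bsub>S\<^esub>)"
  by (auto simp: additive_map_def bc_add_left)

lemma bc_one_smult: "a \<in> carrier R ==> x \<in> carrier M ==> bc (a \<odot>\<^bsub>M\<^esub> x) \<one>\<^bsub>S\<^esub> = h a \<odot>\<^bsub>BC\<^esub> bc x \<one>\<^bsub>S\<^esub>"
  by (simp add: bc_smult_left smult_bc ring_hom_closed[OF h])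

text \<open>The inverse sends \<open>x \<otimes> s\<close> to \<open>k s\<close> times
  \<open>x\<close>, where \<open>k\<close> inverts \<open>h\<close>. For \<open>h = \<sigma>\<close>
  every element of a pullback is therefore uniquely of the form \<open>x \<otimes> 1\<close>; this
  is what turns linear maps on pullbacks into semilinear maps.\<close>

lemma bc_one_bij:
  assumes bij: "bij_betw h (carrier R) (carrier S)"
  shows "bij_betw (\<lambda>x. bc x \<one>\<^bsub>S\<^esub>) (carrier M) (carrier BC)"
proof -
  define k where "k = inv_into (carrier R) h"
  have k: "k s \<in> carrier R" "h (k s) = s" if "s \<in> carrier S" for s
    using that bij unfolding k_def by (auto simp: bij_betw_def f_inv_into_f inv_into_into)
  have kh: "k (h a) = a" if "a \<in> carrier R" for a
    using that bij unfolding k_def by (auto simp: bij_betw_def)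
  have k_add: "k (s \<oplus>\<^bsub>S\<^esub> t) = k s \<oplus>\<^bsub>R\<^esub> k t" if "s \<in> carrier S" "t \<in> carrier S" for s t
    using that k kh[of "k s \<oplus>\<^bsub>R\<^esub> k t"] ring_hom_add[OF h, of "k s" "k t"] by simp
  have k_mult: "k (s \<otimes>\<^bsub>S\<^esub> t) = k s \<otimes>\<^bsub>R\<^esub> k t" if "s \<in> carrier S" "t \<in> carrier S" for s t
    using that k kh[of "k s \<otimes>\<^bsub>R\<^esub> k t"] ring_hom_mult[OF h, of "k s" "k t"] by simp
  have k_one: "k \<one>\<^bsub>S\<^esub> = \<one>\<^bsub>R\<^esub>"
    using kh[of "\<one>\<^bsub>R\<^esub>"] ring_hom_one[OF h] by simp
  have hc: "h a \<in> carrier S" if "a \<in> carrier R" for a using that ring_hom_closed[OF h] by blast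
  have bal: "balanced R M (module_along S h) M (\<lambda>x s. k s \<odot>\<^bsub>M\<^esub> x)"
    by (rule balancedI) (auto simp: k k_add k_mult kh hc M.smult_r_distr M.smult_l_distr M.smult_assoc1[symmetric] M.m_comm)
  let ?g = "tensor_lift M (\<lambda>x s. k s \<odot>\<^bsub>M\<^esub> x)"
  have "?g (bc x \<one>\<^bsub>S\<^esub>) = x" if "x \<in> carrier M" for x
    using that bc_lift(2)[OF M.abelian_group_axioms bal, of x "\<one>\<^bsub>S\<^esub>"] by (simp add: k_one)
  then have "inj_on (\<lambda>x. bc x \<one>\<^bsub>S\<^esub>) (carrier M)" by (rule inj_on_inverseI)
  moreover have "Z \<in> (\<lambda>x. bc x \<one>\<^bsub>S\<^esub>) ` carrier M" if "Z \<in> carrier BC" for Z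
    using that
  proof (induction rule: bc_induct)
    case (pure x s)
    then have "bc x s = bc (k s \<odot>\<^bsub>M\<^esub> x) \<one>\<^bsub>S\<^esub>" by (simp add: bc_smult_left k)
    then show ?case using pure k by blast
  next
    case (add Y Z)
    then obtain x y where "x \<in> carrier M" "y \<in> carrier M" "Y = bc x \<one>\<^bsub>S\<^esub>" "Z = bc y \<one>\<^bsub>S\<^esub>" by auto
    then show ?case by (intro image_eqI[of _ _ "x \<oplus>\<^bsub>M\<^esub> y"]) (auto simp: bc_add_left)
  qed
  ultimately show ?thesis by (auto simp: bij_betw_def)
qed

end

section \<open>The tensor product of two commutative algebras\<close>

locale two_algebras = K: cring K + A: cring A + B: cring B
  for K :: "('k, 'x) ring_scheme" and A :: "('a, 'y) ring_scheme" and B :: "('b, 'z) ring_scheme" +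
  fixes g :: "'k \<Rightarrow> 'a" and h :: "'k \<Rightarrow> 'b"
  assumes g: "g \<in> ring_hom K A" and h: "h \<in> ring_hom K B"

sublocale two_algebras \<subseteq> two_modules K "module_along A g" "module_along B h"
proof -
  interpret M: module K "module_along A g"
    by (rule module_along_module) (auto simp: K.cring_axioms A.cring_axioms g)
  interpret N: module K "module_along B h"
    by (rule module_along_module) (auto simp: K.cring_axioms B.cring_axioms h)
  show "two_modules K (module_along A g) (module_along B h)" ..
qed

context two_algebras
begin

abbreviation "TA \<equiv> tensor_algebra K A g B h"
abbreviation "atens \<equiv> alg_tensor K A g B h"

lemma TA_simps: "carrier TA = carrier TG" "ring.add TA = ring.add TG" "ring.zero TA = ring.zero TG" "monoid.one TA = atens \<one>\<^bsub>A\<^esub> \<one>\<^bsub>B\<^esub>"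
  by (simp_all add: tensor_algebra_def Let_def)

lemma TA_mult: "monoid.mult TA Y Z = tensor_lift TG (\<lambda>a b. tensor_lift TG (\<lambda>a' b'. atens (a \<otimes>\<^bsub>A\<^esub> a') (b \<otimes>\<^bsub>B\<^esub> b')) Z) Y"
  by (simp add: tensor_algebra_def Let_def)

lemma TA_abelian_group: "abelian_group TA"
  by (rule abelian_group_cong[OF TG_abelian_group]) (auto simp: TA_simps)

lemma additive_TA_source: "additive_map TA G f \<longleftrightarrow> additive_map TG G f"
  by (simp add: additive_map_def TA_simps)

lemma additive_TA_target: "additive_map G TA f \<longleftrightarrow> additive_map G TG f"
  by (simp add: additive_map_def TA_simps)

lemma at_ptens: "atens a b = ptens a b"
  by (simp add: alg_tensor_def)

lemma at_closed [simp, intro]: "a \<in> carrier A ==> b \<in> carrier B ==> atens a b \<in> carrier TA"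
  using ptens_closed[of a b] by (simp add: at_ptens TA_simps)

lemma at_add_left:
  "a \<in> carrier A ==> a' \<in> carrier A ==> b \<in> carrier B ==> atens (a \<oplus>\<^bsub>A\<^esub> a') b = atens a b \<oplus>\<^bsub>TA\<^esub> atens a' b"
  using ptens_add_left[of a a' b] by (simp add: at_ptens TA_simps)

lemma at_add_right:
  "a \<in> carrier A ==> b \<in> carrier B ==> b' \<in> carrier B ==> atens a (b \<oplus>\<^bsub>B\<^esub> b') = atens a b \<oplus>\<^bsub>TA\<^esub> atens a b'"
  using ptens_add_right[of a b b'] by (simp add: at_ptens TA_simps)

lemma at_scalar:
  "k \<in> carrier K ==> a \<in> carrier A ==> b \<in> carrier B ==> atens (g k \<otimes>\<^bsub>A\<^esub> a) b = atens a (h k \<otimes>\<^bsub>B\<^esub> b)"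
  using ptens_smult[of k a b] by (simp add: at_ptens)

lemma at_zero_left: "b \<in> carrier B ==> atens \<zero>\<^bsub>A\<^esub> b = \<zero>\<^bsub>TA\<^esub>"
  using ptens_zero_left[of b] by (simp add: at_ptens TA_simps)

lemma at_induct [consumes 1, case_names pure add]:
  assumes "Z \<in> carrier TA"
    and "\<And>a b. a \<in> carrier A ==> b \<in> carrier B ==> P (atens a b)"
    and "\<And>Y Z. Y \<in> carrier TA ==> Z \<in> carrier TA ==> P Y ==> P Z ==> P (Y \<oplus>\<^bsub>TA\<^esub> Z)"
  shows "P Z"
  using assms unfolding TA_simps at_ptens by (induction rule: tensor_induct) auto

lemma at_map_eq:
  assumes "additive_map TA G f" "additive_map TA G f'"
    and "\<And>a b. a \<in> carrier A ==> b \<in> carrier B ==> f (atens a b) = f' (atens a b)" and "Z \<in> carrier TA"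
  shows "f Z = f' Z"
  using assms(4) by (induction rule: at_induct) (use assms(1-3) in \<open>auto simp: additive_map_add\<close>)

lemma at_lift:
  assumes "abelian_group G"
    and "\<And>x y. x \<in> carrier A ==> y \<in> carrier B ==> b x y \<in> carrier G"
    and "\<And>x x' y. x \<in> carrier A ==> x' \<in> carrier A ==> y \<in> carrier B ==> b (x \<oplus>\<^bsub>A\<^esub> x') y = b x y \<oplus>\<^bsub>G\<^esub> b x' y"
    and "\<And>x y y'. x \<in> carrier A ==> y \<in> carrier B ==> y' \<in> carrier B ==> b x (y \<oplus>\<^bsub>B\<^esub> y') = b x y \<oplus>\<^bsub>G\<^esub> b x y'"
    and "\<And>k x y. k \<in> carrier K ==> x \<in> carrier A ==> y \<in> carrier B ==> b (g k \<otimes>\<^bsub>A\<^esub> x) y = b x (h k \<otimes>\<^bsub>B\<^esub> y)"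
  shows "additive_map TA G (tensor_lift G b)"
    and "x \<in> carrier A ==> y \<in> carrier B ==> tensor_lift G b (atens x y) = b x y"
proof -
  have "balanced K (module_along A g) (module_along B h) G b"
    by (rule balancedI) (use assms in auto)
  note * = tensor_lift_additive[OF assms(1) this] tensor_lift_pure[OF assms(1) this]
  show "additive_map TA G (tensor_lift G b)"
    and "x \<in> carrier A ==> y \<in> carrier B ==> tensor_lift G b (atens x y) = b x y"
    using * by (auto simp: additive_TA_source at_ptens)
qed

lemma at_lift_algebra:
  assumes G: "ring G"
    and u: "additive_map A G u" and v: "additive_map B G v"
    and uv: "\<And>k x y. k \<in> carrier K ==> x \<in> carrier A ==> y \<in> carrier B ==> u (g k \<otimes>\<^bsub>A\<^esub> x) \<otimes>\<^bsub>G\<^esub> v y = u x \<otimes>\<^bsub>G\<^esub> v (h k \<otimes>\<^bsub>B\<^esub> y)"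
  shows "additive_map TA G (tensor_lift G (\<lambda>x y. u x \<otimes>\<^bsub>G\<^esub> v y))"
    and "x \<in> carrier A ==> y \<in> carrier B ==> tensor_lift G (\<lambda>x y. u x \<otimes>\<^bsub>G\<^esub> v y) (atens x y) = u x \<otimes>\<^bsub>G\<^esub> v y"
proof -
  interpret G: ring G by fact
  have 1: "u x \<otimes>\<^bsub>G\<^esub> v y \<in> carrier G" if "x \<in> carrier A" "y \<in> carrier B" for x y
    using that u v by (simp add: additive_map_closed)
  have 2: "u (x \<oplus>\<^bsub>A\<^esub> x') \<otimes>\<^bsub>G\<^esub> v y = u x \<otimes>\<^bsub>G\<^esub> v y \<oplus>\<^bsub>G\<^esub> u x' \<otimes>\<^bsub>G\<^esub> v y" if "x \<in> carrier A" "x' \<in> carrier A" "y \<in> carrier B" for x x' y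
    using that u v by (simp add: additive_map_closed additive_map_add G.l_distr)
  have 3: "u x \<otimes>\<^bsub>G\<^esub> v (y \<oplus>\<^bsub>B\<^esub> y') = u x \<otimes>\<^bsub>G\<^esub> v y \<oplus>\<^bsub>G\<^esub> u x \<otimes>\<^bsub>G\<^esub> v y'" if "x \<in> carrier A" "y \<in> carrier B" "y' \<in> carrier B" for x y y'
    using that u v by (simp add: additive_map_closed additive_map_add G.r_distr)
  note * = at_lift[OF G.abelian_group_axioms, of "\<lambda>x y. u x \<otimes>\<^bsub>G\<^esub> v y", OF 1 2 3 uv]
  show "additive_map TA G (tensor_lift G (\<lambda>x y. u x \<otimes>\<^bsub>G\<^esub> v y))"
    using * by simp
  show "x \<in> carrier A ==> y \<in> carrier B ==> tensor_lift G (\<lambda>x y. u x \<otimes>\<^bsub>G\<^esub> v y) (atens x y) = u x \<otimes>\<^bsub>G\<^esub> v y"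
    using * by simp
qed

text \<open>The product is a lift in its left factor of a lift in its right factor. This is the
  inner stage, for a pure left factor; its additivity is required before the outer map can be shown
  to be balanced.\<close>

lemma mult_inner:
  assumes a: "a \<in> carrier A" and b: "b \<in> carrier B"
  shows "additive_map TA TA (tensor_lift TG (\<lambda>a' b'. atens (a \<otimes>\<^bsub>A\<^esub> a') (b \<otimes>\<^bsub>B\<^esub> b')))"
    and "a' \<in> carrier A ==> b' \<in> carrier B ==>
      tensor_lift TG (\<lambda>a' b'. atens (a \<otimes>\<^bsub>A\<^esub> a') (b \<otimes>\<^bsub>B\<^esub> b')) (atens a' b') = atens (a \<otimes>\<^bsub>A\<^esub> a') (b \<otimes>\<^bsub>B\<^esub> b')"
proof -
  have 1: "atens (a \<otimes>\<^bsub>A\<^esub> x) (b \<otimes>\<^bsub>B\<^esub> y) \<in> carrier TG" if "x \<in> carrier A" "y \<in> carrier B" for x y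
    using at_closed that a b TA_simps by auto
  have 2: "atens (a \<otimes>\<^bsub>A\<^esub> (x \<oplus>\<^bsub>A\<^esub> x')) (b \<otimes>\<^bsub>B\<^esub> y) = atens (a \<otimes>\<^bsub>A\<^esub> x) (b \<otimes>\<^bsub>B\<^esub> y) \<oplus>\<^bsub>TG\<^esub> atens (a \<otimes>\<^bsub>A\<^esub> x') (b \<otimes>\<^bsub>B\<^esub> y)"
    if "x \<in> carrier A" "x' \<in> carrier A" "y \<in> carrier B" for x x' y
    using at_add_left that a b by (simp add: A.r_distr TA_simps)
  have 3: "atens (a \<otimes>\<^bsub>A\<^esub> x) (b \<otimes>\<^bsub>B\<^esub> (y \<oplus>\<^bsub>B\<^esub> y')) = atens (a \<otimes>\<^bsub>A\<^esub> x) (b \<otimes>\<^bsub>B\<^esub> y) \<oplus>\<^bsub>TG\<^esub> atens (a \<otimes>\<^bsub>A\<^esub> x) (b \<otimes>\<^bsub>B\<^esub> y')"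
    if "x \<in> carrier A" "y \<in> carrier B" "y' \<in> carrier B" for x y y'
    using at_add_right that a b by (simp add: B.r_distr TA_simps)
  have 4: "atens (a \<otimes>\<^bsub>A\<^esub> (g k \<otimes>\<^bsub>A\<^esub> x)) (b \<otimes>\<^bsub>B\<^esub> y) = atens (a \<otimes>\<^bsub>A\<^esub> x) (b \<otimes>\<^bsub>B\<^esub> (h k \<otimes>\<^bsub>B\<^esub> y))"
    if "k \<in> carrier K" "x \<in> carrier A" "y \<in> carrier B" for k x y
    using at_scalar[of k "a \<otimes>\<^bsub>A\<^esub> x" "b \<otimes>\<^bsub>B\<^esub> y"] that a b
    by (simp add: A.m_lcomm B.m_lcomm ring_hom_closed[OF g] ring_hom_closed[OF h])
  note * = at_lift[OF TG_abelian_group, of "\<lambda>a' b'. atens (a \<otimes>\<^bsub>A\<^esub> a') (b \<otimes>\<^bsub>B\<^esub> b')", OF 1 2 3 4]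
  show "additive_map TA TA (tensor_lift TG (\<lambda>a' b'. atens (a \<otimes>\<^bsub>A\<^esub> a') (b \<otimes>\<^bsub>B\<^esub> b')))"
    using * by (simp add: additive_TA_target)
  show "a' \<in> carrier A ==> b' \<in> carrier B ==>
      tensor_lift TG (\<lambda>a' b'. atens (a \<otimes>\<^bsub>A\<^esub> a') (b \<otimes>\<^bsub>B\<^esub> b')) (atens a' b') = atens (a \<otimes>\<^bsub>A\<^esub> a') (b \<otimes>\<^bsub>B\<^esub> b')"
    using * by simp
qed

lemma mult_outer:
  assumes Z: "Z \<in> carrier TA"
  defines "b \<equiv> \<lambda>x y. tensor_lift TG (\<lambda>a' b'. atens (x \<otimes>\<^bsub>A\<^esub> a') (y \<otimes>\<^bsub>B\<^esub> b')) Z"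
  shows "additive_map TA TA (\<lambda>Y. Y \<otimes>\<^bsub>TA\<^esub> Z)"
    and "x \<in> carrier A ==> y \<in> carrier B ==> atens x y \<otimes>\<^bsub>TA\<^esub> Z = b x y"
proof -
  let ?l = "\<lambda>x y. tensor_lift TG (\<lambda>a' b'. atens (x \<otimes>\<^bsub>A\<^esub> a') (y \<otimes>\<^bsub>B\<^esub> b'))"
  have 1: "b x y \<in> carrier TG" if "x \<in> carrier A" "y \<in> carrier B" for x y
    using mult_inner(1)[OF that] Z unfolding b_def by (simp add: additive_map_closed TA_simps(1)[symmetric])
  have 2: "b (x \<oplus>\<^bsub>A\<^esub> x') y = b x y \<oplus>\<^bsub>TG\<^esub> b x' y"
    if "x \<in> carrier A" "x' \<in> carrier A" "y \<in> carrier B" for x x' y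
    unfolding b_def TA_simps(2)[symmetric]
    by (rule at_map_eq[OF mult_inner(1) additive_map_plus[OF TA_abelian_group mult_inner(1) mult_inner(1)]])
       (use that Z in \<open>auto simp: mult_inner(2) A.l_distr at_add_left\<close>)
  have 3: "b x (y \<oplus>\<^bsub>B\<^esub> y') = b x y \<oplus>\<^bsub>TG\<^esub> b x y'"
    if "x \<in> carrier A" "y \<in> carrier B" "y' \<in> carrier B" for x y y'
    unfolding b_def TA_simps(2)[symmetric]
    by (rule at_map_eq[OF mult_inner(1) additive_map_plus[OF TA_abelian_group mult_inner(1) mult_inner(1)]])
       (use that Z in \<open>auto simp: mult_inner(2) B.l_distr at_add_right\<close>)
  have 4: "b (g k \<otimes>\<^bsub>A\<^esub> x) y = b x (h k \<otimes>\<^bsub>B\<^esub> y)"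
    if "k \<in> carrier K" "x \<in> carrier A" "y \<in> carrier B" for k x y
    unfolding b_def
    by (rule at_map_eq[OF mult_inner(1) mult_inner(1)])
       (use that Z in \<open>auto simp: mult_inner(2) A.m_assoc B.m_assoc at_scalar ring_hom_closed[OF g] ring_hom_closed[OF h]\<close>)
  note * = at_lift[OF TG_abelian_group, of b, OF 1 2 3 4]
  have eq: "(\<lambda>Y. Y \<otimes>\<^bsub>TA\<^esub> Z) = tensor_lift TG b"
    by (auto simp: TA_mult b_def fun_eq_iff)
  show "additive_map TA TA (\<lambda>Y. Y \<otimes>\<^bsub>TA\<^esub> Z)"
    unfolding eq additive_TA_target using * by simp
  show "x \<in> carrier A ==> y \<in> carrier B ==> atens x y \<otimes>\<^bsub>TA\<^esub> Z = b x y"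
    using * fun_cong[OF eq, of "atens x y"] by simp
qed

lemma at_mult:
  "a \<in> carrier A ==> b \<in> carrier B ==> a' \<in> carrier A ==> b' \<in> carrier B ==>
    atens a b \<otimes>\<^bsub>TA\<^esub> atens a' b' = atens (a \<otimes>\<^bsub>A\<^esub> a') (b \<otimes>\<^bsub>B\<^esub> b')"
  by (simp add: mult_outer(2) mult_inner(2))

lemma mult_additive_left: "Z \<in> carrier TA ==> additive_map TA TA (\<lambda>Y. Y \<otimes>\<^bsub>TA\<^esub> Z)"
  by (rule mult_outer(1))

lemma TA_mult_closed: "Y \<in> carrier TA ==> Z \<in> carrier TA ==> Y \<otimes>\<^bsub>TA\<^esub> Z \<in> carrier TA"
  using mult_additive_left additive_map_closed by fastforce

lemma mult_additive_right: "Y \<in> carrier TA ==> additive_map TA TA (\<lambda>Z. Y \<otimes>\<^bsub>TA\<^esub> Z)"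
proof (rule additive_mapI)
  fix U V assume Y: "Y \<in> carrier TA" and U: "U \<in> carrier TA" and V: "V \<in> carrier TA"
  interpret TA: abelian_group TA by (rule TA_abelian_group)
  have UV: "U \<oplus>\<^bsub>TA\<^esub> V \<in> carrier TA" using U V by simp
  show "Y \<otimes>\<^bsub>TA\<^esub> (U \<oplus>\<^bsub>TA\<^esub> V) = Y \<otimes>\<^bsub>TA\<^esub> U \<oplus>\<^bsub>TA\<^esub> Y \<otimes>\<^bsub>TA\<^esub> V"
  proof (rule at_map_eq[OF mult_additive_left[OF UV] additive_map_plus[OF TA_abelian_group mult_additive_left[OF U] mult_additive_left[OF V]] _ Y])
    fix a b assume ab: "a \<in> carrier A" "b \<in> carrier B"
    then show "atens a b \<otimes>\<^bsub>TA\<^esub> (U \<oplus>\<^bsub>TA\<^esub> V) = atens a b \<otimes>\<^bsub>TA\<^esub> U \<oplus>\<^bsub>TA\<^esub> atens a b \<otimes>\<^bsub>TA\<^esub> V"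
      using additive_map_add[OF mult_inner(1)[OF ab] U V] U V UV by (simp add: mult_outer(2))
  qed
qed (use TA_mult_closed in auto)

lemma TA_m_comm: "Y \<in> carrier TA ==> Z \<in> carrier TA ==> Y \<otimes>\<^bsub>TA\<^esub> Z = Z \<otimes>\<^bsub>TA\<^esub> Y"
proof -
  assume Y: "Y \<in> carrier TA" and Z: "Z \<in> carrier TA"
  show ?thesis
  proof (rule at_map_eq[OF mult_additive_left[OF Z] mult_additive_right[OF Z] _ Y])
    fix a b assume ab: "a \<in> carrier A" "b \<in> carrier B"
    show "atens a b \<otimes>\<^bsub>TA\<^esub> Z = Z \<otimes>\<^bsub>TA\<^esub> atens a b"
      by (rule at_map_eq[OF mult_additive_right mult_additive_left _ Z]) (use ab in \<open>auto simp: at_mult A.m_comm B.m_comm\<close>)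
  qed
qed

lemma TA_m_assoc:
  assumes Y: "Y \<in> carrier TA" and Z: "Z \<in> carrier TA" and W: "W \<in> carrier TA"
  shows "Y \<otimes>\<^bsub>TA\<^esub> Z \<otimes>\<^bsub>TA\<^esub> W = Y \<otimes>\<^bsub>TA\<^esub> (Z \<otimes>\<^bsub>TA\<^esub> W)"
proof (rule at_map_eq[OF additive_map_compose[OF mult_additive_left[OF Z] mult_additive_left[OF W]]
      mult_additive_left[OF TA_mult_closed[OF Z W]] _ Y])
  fix a b assume ab: "a \<in> carrier A" "b \<in> carrier B"
  show "atens a b \<otimes>\<^bsub>TA\<^esub> Z \<otimes>\<^bsub>TA\<^esub> W = atens a b \<otimes>\<^bsub>TA\<^esub> (Z \<otimes>\<^bsub>TA\<^esub> W)"
  proof (rule at_map_eq[OF additive_map_compose[OF mult_additive_right mult_additive_left[OF W]]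
        additive_map_compose[OF mult_additive_left[OF W] mult_additive_right] _ Z])
    fix a' b' assume ab': "a' \<in> carrier A" "b' \<in> carrier B"
    show "atens a b \<otimes>\<^bsub>TA\<^esub> atens a' b' \<otimes>\<^bsub>TA\<^esub> W = atens a b \<otimes>\<^bsub>TA\<^esub> (atens a' b' \<otimes>\<^bsub>TA\<^esub> W)"
      by (rule at_map_eq[OF mult_additive_right additive_map_compose[OF mult_additive_right mult_additive_right] _ W])
         (use ab ab' in \<open>auto simp: at_mult TA_mult_closed A.m_assoc B.m_assoc\<close>)
  qed (use ab in auto)
qed

lemma TA_l_one: "Z \<in> carrier TA ==> \<one>\<^bsub>TA\<^esub> \<otimes>\<^bsub>TA\<^esub> Z = Z"
proof -
  assume Z: "Z \<in> carrier TA"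
  have one: "\<one>\<^bsub>TA\<^esub> \<in> carrier TA" unfolding TA_simps(4) by (rule at_closed) auto
  have id: "additive_map TA TA (\<lambda>Z. Z)" by (simp add: additive_map_def)
  show ?thesis
    by (rule at_map_eq[OF mult_additive_right[OF one] id _ Z]) (simp add: TA_simps(4) at_mult)
qed

lemma TA_cring: "cring TA"
proof (rule cringI)
  show "abelian_group TA" by (rule TA_abelian_group)
  have "\<one>\<^bsub>TA\<^esub> \<in> carrier TA" unfolding TA_simps(4) by (rule at_closed) auto
  then show "Group.comm_monoid TA"
    by (intro comm_monoidI) ((erule (2) TA_m_assoc | erule (1) TA_mult_closed | erule TA_l_one | erule (1) TA_m_comm | assumption)+)
  show "(x \<oplus>\<^bsub>TA\<^esub> y) \<otimes>\<^bsub>TA\<^esub> z = x \<otimes>\<^bsub>TA\<^esub> z \<oplus>\<^bsub>TA\<^esub> y \<otimes>\<^bsub>TA\<^esub> z"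
    if "x \<in> carrier TA" "y \<in> carrier TA" "z \<in> carrier TA" for x y z
    using additive_map_add[OF mult_additive_left] that by blast
qed

sublocale TA: cring TA by (rule TA_cring)

lemma at_one_one: "atens \<one>\<^bsub>A\<^esub> \<one>\<^bsub>B\<^esub> = \<one>\<^bsub>TA\<^esub>"
  by (simp add: TA_simps)

lemma left_hom: "(\<lambda>a. atens a \<one>\<^bsub>B\<^esub>) \<in> ring_hom A TA"
  by (rule ring_hom_memI) (auto simp: at_mult at_add_left at_one_one)

lemma right_hom: "(\<lambda>b. atens \<one>\<^bsub>A\<^esub> b) \<in> ring_hom B TA"
  by (rule ring_hom_memI) (auto simp: at_mult at_add_right at_one_one)

text \<open>Both sides of the multiplicativity law are additive in each argument, so it is enough to
  compare them on pure tensors, where it reduces to the laws for \<open>u\<close> and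
  \<open>v\<close>.\<close>

lemma TA_hom_criterion:
  assumes "cring C" and f: "additive_map TA C f" and u: "u \<in> ring_hom A C" and v: "v \<in> ring_hom B C"
    and fp: "\<And>a b. a \<in> carrier A ==> b \<in> carrier B ==> f (atens a b) = u a \<otimes>\<^bsub>C\<^esub> v b"
  shows "f \<in> ring_hom TA C"
proof (rule ring_hom_memI)
  interpret C: cring C by fact
  have uc: "u a \<in> carrier C" if "a \<in> carrier A" for a using that ring_hom_closed[OF u] by blast
  have vc: "v a \<in> carrier C" if "a \<in> carrier B" for a using that ring_hom_closed[OF v] by blast
  show fc: "f x \<in> carrier C" if "x \<in> carrier TA" for x using f that by (rule additive_map_closed)
  have ml: "additive_map C C (\<lambda>x. x \<otimes>\<^bsub>C\<^esub> y)" if "y \<in> carrier C" for y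
    using that by (auto simp: additive_map_def C.l_distr)
  have mr: "additive_map C C (\<lambda>x. y \<otimes>\<^bsub>C\<^esub> x)" if "y \<in> carrier C" for y
    using that by (auto simp: additive_map_def C.r_distr)
  show "f (Y \<otimes>\<^bsub>TA\<^esub> Z) = f Y \<otimes>\<^bsub>C\<^esub> f Z" if Y: "Y \<in> carrier TA" and Z: "Z \<in> carrier TA" for Y Z
  proof (rule at_map_eq[OF additive_map_compose[OF mult_additive_left[OF Z] f] additive_map_compose[OF f ml[OF fc[OF Z]]] _ Y])
    fix a b assume ab: "a \<in> carrier A" "b \<in> carrier B"
    show "f (atens a b \<otimes>\<^bsub>TA\<^esub> Z) = f (atens a b) \<otimes>\<^bsub>C\<^esub> f Z"
      by (rule at_map_eq[OF additive_map_compose[OF mult_additive_right f] additive_map_compose[OF f mr] _ Z])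
         (use ab in \<open>auto simp: at_mult fp uc vc fc ring_hom_mult[OF u] ring_hom_mult[OF v] C.m_ac\<close>)
  qed
  show "f (x \<oplus>\<^bsub>TA\<^esub> y) = f x \<oplus>\<^bsub>C\<^esub> f y" if "x \<in> carrier TA" "y \<in> carrier TA" for x y
    using additive_map_add[OF f that] .
  show "f \<one>\<^bsub>TA\<^esub> = \<one>\<^bsub>C\<^esub>"
    using fp[of "\<one>\<^bsub>A\<^esub>" "\<one>\<^bsub>B\<^esub>"] by (simp add: at_one_one ring_hom_one[OF u] ring_hom_one[OF v])
qed

end

text \<open>Applied to the inclusion of a subring of the function field, this gives the comparison
  with \<open>Q \<otimes> L\<close>; applied to the Frobenius of \<open>L\<close>, it gives
  \<open>\<sigma>\<close>.\<close>

lemma tensor_algebra_map: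
  assumes T: "two_algebras K A B g h" and T': "two_algebras K A' B' g' h'"
    and u: "u \<in> ring_hom A A'" and v: "v \<in> ring_hom B B'"
    and ug: "\<And>k. k \<in> carrier K ==> u (g k) = g' k" and vh: "\<And>k. k \<in> carrier K ==> v (h k) = h' k"
  defines "f \<equiv> tensor_lift (tensor_algebra K A' g' B' h') (\<lambda>a b. alg_tensor K A' g' B' h' (u a) (v b))"
  shows "f \<in> ring_hom (tensor_algebra K A g B h) (tensor_algebra K A' g' B' h')"
    and "a \<in> carrier A ==> b \<in> carrier B ==> f (alg_tensor K A g B h a b) = alg_tensor K A' g' B' h' (u a) (v b)"
proof -
  interpret two_algebras K A B g h by fact
  interpret T': two_algebras K A' B' g' h' by fact
  have gc: "g k \<in> carrier A" if "k \<in> carrier K" for k using that ring_hom_closed[OF g] by blast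
  have hc: "h k \<in> carrier B" if "k \<in> carrier K" for k using that ring_hom_closed[OF h] by blast
  have uc: "u a \<in> carrier A'" if "a \<in> carrier A" for a using that ring_hom_closed[OF u] by blast
  have vc: "v a \<in> carrier B'" if "a \<in> carrier B" for a using that ring_hom_closed[OF v] by blast
  have *: "additive_map TA T'.TA f" "\<And>a b. a \<in> carrier A ==> b \<in> carrier B ==> f (atens a b) = T'.atens (u a) (v b)"
    unfolding f_def
    by (intro at_lift; simp add: T'.TA_abelian_group uc vc gc hc ring_hom_add[OF u] ring_hom_add[OF v]
        ring_hom_mult[OF u] ring_hom_mult[OF v] T'.at_add_left T'.at_add_right ug vh T'.at_scalar)+
  show "f \<in> ring_hom TA T'.TA"
    by (rule TA_hom_criterion[OF T'.TA_cring *(1) ring_hom_trans[OF u T'.left_hom] ring_hom_trans[OF v T'.right_hom]])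
       (auto simp: *(2) T'.at_mult uc vc)
  show "a \<in> carrier A ==> b \<in> carrier B ==> f (atens a b) = T'.atens (u a) (v b)"
    by (rule *(2))
qed

section \<open>Semilinear endomorphisms\<close>

lemma (in abelian_group) minus_split:
  assumes "a \<in> carrier G" "b \<in> carrier G" "c \<in> carrier G"
  shows "a \<ominus> c = (a \<ominus> (b \<oplus> c)) \<oplus> b"
proof -
  have "(\<ominus> b \<oplus> \<ominus> c) \<oplus> b = \<ominus> c"
    using assms a_comm[of "\<ominus> b \<oplus> \<ominus> c" b] r_neg2[of b "\<ominus> c"] by simp
  then show ?thesis using assms by (simp add: minus_eq minus_add a_assoc)
qed

lemma (in abelian_group) minus_eq_zeroD:
  assumes "x \<in> carrier G" "y \<in> carrier G" "x \<ominus> y = \<zero>"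
  shows "x = y"
proof -
  have "x = (x \<ominus> y) \<oplus> y" using assms(1,2) by (simp add: minus_eq a_assoc l_neg)
  also have "\<dots> = y" using assms by simp
  finally show ?thesis .
qed

lemma fg_moduleE:
  assumes "fg_module R M"
  obtains U where "finite U" "U \<subseteq> carrier M"
    "\<And>H. U \<subseteq> H ==> H \<subseteq> carrier M ==> \<zero>\<^bsub>M\<^esub> \<in> H ==>
      (\<And>x y. x \<in> H ==> y \<in> H ==> x \<oplus>\<^bsub>M\<^esub> y \<in> H) ==> (\<And>a x. a \<in> carrier R ==> x \<in> H ==> a \<odot>\<^bsub>M\<^esub> x \<in> H) ==> H = carrier M"
proof -
  from assms obtain U where U: "finite U" "U \<subseteq> carrier M"
    and gen: "\<forall>H. U \<subseteq> H \<longrightarrow> H \<subseteq> carrier M \<longrightarrow> \<zero>\<^bsub>M\<^esub> \<in> H \<longrightarrow>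
      (\<forall>x\<in>H. \<forall>y\<in>H. x \<oplus>\<^bsub>M\<^esub> y \<in> H) \<longrightarrow> (\<forall>a\<in>carrier R. \<forall>x\<in>H. a \<odot>\<^bsub>M\<^esub> x \<in> H) \<longrightarrow> H = carrier M"
    unfolding fg_module_def by (elim exE conjE)
  show thesis
  proof (rule that[OF U])
    fix H assume a: "U \<subseteq> H" "H \<subseteq> carrier M" "\<zero>\<^bsub>M\<^esub> \<in> H"
      and b: "\<And>x y. x \<in> H ==> y \<in> H ==> x \<oplus>\<^bsub>M\<^esub> y \<in> H" "\<And>a x. a \<in> carrier R ==> x \<in> H ==> a \<odot>\<^bsub>M\<^esub> x \<in> H"
    have "\<forall>x\<in>H. \<forall>y\<in>H. x \<oplus>\<^bsub>M\<^esub> y \<in> H" "\<forall>a\<in>carrier R. \<forall>x\<in>H. a \<odot>\<^bsub>M\<^esub> x \<in> H" using b by blast+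
    with gen[THEN spec, THEN mp, OF a(1), THEN mp, OF a(2), THEN mp, OF a(3)]
    show "H = carrier M" by blast
  qed
qed

text \<open>For linear \<open>p\<close> this is the image of the polynomial ring in \<open>p\<close>
  over \<open>F\<close> inside the endomorphisms of \<open>M\<close>. HOL functions are total, and
  the rule \<open>cong\<close> makes membership depend on the values on \<open>carrier M\<close>
  alone.\<close>

inductive_set ops :: "('r, 'm) module \<Rightarrow> 'r set \<Rightarrow> ('m \<Rightarrow> 'm) \<Rightarrow> ('m \<Rightarrow> 'm) set" for M F p where
  scal: "a \<in> F ==> (\<lambda>x. a \<odot>\<^bsub>M\<^esub> x) \<in> ops M F p"
| frob: "p \<in> ops M F p"
| add: "\<phi> \<in> ops M F p ==> \<psi> \<in> ops M F p ==> (\<lambda>x. \<phi> x \<oplus>\<^bsub>M\<^esub> \<psi> x) \<in> ops M F p"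
| comp: "\<phi> \<in> ops M F p ==> \<psi> \<in> ops M F p ==> (\<lambda>x. \<phi> (\<psi> x)) \<in> ops M F p"
| cong: "\<phi> \<in> ops M F p ==> (\<And>x. x \<in> carrier M ==> \<psi> x = \<phi> x) ==> \<psi> \<in> ops M F p"

definition fixed_ring :: "('r, 'x) ring_scheme \<Rightarrow> ('r \<Rightarrow> 'r) \<Rightarrow> 'r set"
  where "fixed_ring R \<sigma> = {a \<in> carrier R. \<sigma> a = a}"

text \<open>The exponent \<open>e\<close> may be any positive period of \<open>\<sigma>\<close>; it
  need not be the exact order.\<close>

locale frob_module = module R M + dom: domain R
  for R :: "('r, 'x) ring_scheme" and M :: "('r, 'm) module" (structure) +
  fixes \<sigma> :: "'r \<Rightarrow> 'r" and T :: "'m \<Rightarrow> 'm" and e :: nat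
  assumes \<sigma>_hom: "\<sigma> \<in> ring_hom R R" and \<sigma>_pow: "a \<in> carrier R ==> (\<sigma> ^^ e) a = a" and e_pos: "e > 0"
    and T_additive: "additive_map M M T"
    and T_smult: "a \<in> carrier R ==> x \<in> carrier M ==> T (a \<odot> x) = \<sigma> a \<odot> T x"
begin

abbreviation "F \<equiv> fixed_ring R \<sigma>"

lemma F_carrier: "a \<in> F ==> a \<in> carrier R" and F_fixed: "a \<in> F ==> \<sigma> a = a"
  by (auto simp: fixed_ring_def)

lemma \<sigma>_closed: "a \<in> carrier R ==> \<sigma> a \<in> carrier R"
  using ring_hom_closed[OF \<sigma>_hom] .

lemma \<sigma>_iter_closed: "a \<in> carrier R ==> (\<sigma> ^^ n) a \<in> carrier R"
  by (induction n) (auto simp: \<sigma>_closed)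

lemma \<sigma>_pow_mult: "a \<in> carrier R ==> (\<sigma> ^^ (l * e)) a = a"
  by (induction l) (simp_all add: funpow_add \<sigma>_pow)

lemma \<sigma>_zero: "\<sigma> \<zero>\<^bsub>R\<^esub> = \<zero>\<^bsub>R\<^esub>"
  using ring_hom_zero[OF \<sigma>_hom R.ring_axioms R.ring_axioms] .

lemma \<sigma>_uminus: "a \<in> carrier R ==> \<sigma> (\<ominus>\<^bsub>R\<^esub> a) = \<ominus>\<^bsub>R\<^esub> \<sigma> a"
  using additive_map_uminus[OF R.abelian_group_axioms R.abelian_group_axioms, of \<sigma> a]
  by (simp add: additive_map_def \<sigma>_closed ring_hom_add[OF \<sigma>_hom])

lemma \<sigma>_nonzero:
  assumes a: "a \<in> carrier R" "a \<noteq> \<zero>\<^bsub>R\<^esub>" shows "\<sigma> a \<noteq> \<zero>\<^bsub>R\<^esub>"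
proof
  assume 0: "\<sigma> a = \<zero>\<^bsub>R\<^esub>"
  have "(\<sigma> ^^ Suc n) a = \<zero>\<^bsub>R\<^esub>" for n by (induction n) (simp_all add: 0 \<sigma>_zero)
  from this[of "e - 1"] show False using \<sigma>_pow[OF a(1)] e_pos a(2) by simp
qed

lemma one_F: "\<one>\<^bsub>R\<^esub> \<in> F" and minus_one_F: "\<ominus>\<^bsub>R\<^esub> \<one>\<^bsub>R\<^esub> \<in> F" and zero_F: "\<zero>\<^bsub>R\<^esub> \<in> F"
  by (simp_all add: fixed_ring_def \<sigma>_uminus \<sigma>_zero ring_hom_one[OF \<sigma>_hom])

lemma T_closed: "x \<in> carrier M ==> T x \<in> carrier M"
  by (rule additive_map_closed[OF T_additive])

lemma T_add: "x \<in> carrier M ==> y \<in> carrier M ==> T (x \<oplus> y) = T x \<oplus> T y"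
  by (rule additive_map_add[OF T_additive])

lemma T_iter_closed: "x \<in> carrier M ==> (T ^^ n) x \<in> carrier M"
  by (induction n) (auto simp: T_closed)

lemma T_iter_add: "x \<in> carrier M ==> y \<in> carrier M ==> (T ^^ n) (x \<oplus> y) = (T ^^ n) x \<oplus> (T ^^ n) y"
  by (induction n) (auto simp: T_add T_iter_closed)

lemma T_iter_smult:
  "a \<in> carrier R ==> x \<in> carrier M ==> (T ^^ n) (a \<odot> x) = (\<sigma> ^^ n) a \<odot> (T ^^ n) x"
  by (induction n) (auto simp: T_smult T_iter_closed \<sigma>_iter_closed)

definition frobenius_stable :: "'m set \<Rightarrow> bool"
  where "frobenius_stable N \<longleftrightarrow> N \<subseteq> carrier M \<and> \<zero> \<in> N \<and> (\<forall>x\<in>N. \<forall>y\<in>N. x \<oplus> y \<in> N) \<and>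
    (\<forall>a\<in>carrier R. \<forall>x\<in>N. a \<odot> x \<in> N) \<and> (\<forall>x\<in>N. T x \<in> N)"

lemma frobenius_stable_iter: "frobenius_stable N ==> x \<in> N ==> (T ^^ n) x \<in> N"
  by (induction n) (auto simp: frobenius_stable_def)

text \<open>The product is the norm of \<open>a\<close>, taken over \<open>\<sigma> ^^ i\<close> for
  \<open>i < e\<close>, and \<open>b\<close> collects the conjugates other than \<open>a\<close>
  itself. So each nonzero element divides a nonzero invariant one.\<close>

lemma norm_element:
  assumes a: "a \<in> carrier R" "a \<noteq> \<zero>\<^bsub>R\<^esub>"
  shows "\<exists>b\<in>carrier R. a \<otimes>\<^bsub>R\<^esub> b \<in> F \<and> a \<otimes>\<^bsub>R\<^esub> b \<noteq> \<zero>\<^bsub>R\<^esub>"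
proof -
  interpret h: ring_hom_cring R R \<sigma>
    by (rule RingHom.ring_hom_cringI[OF ring_hom_ringI2[OF R.ring_axioms R.ring_axioms \<sigma>_hom] R.cring_axioms R.cring_axioms])
  obtain n where n: "e = Suc n" using e_pos by (cases e) auto
  define g where "g i = (\<sigma> ^^ i) a" for i
  have gc: "g i \<in> carrier R" for i using a \<sigma>_iter_closed by (simp add: g_def)
  have gn: "g i \<noteq> \<zero>\<^bsub>R\<^esub>" for i unfolding g_def using a by (induction i) (auto simp: \<sigma>_nonzero \<sigma>_iter_closed)
  have prodn: "(\<Otimes>\<^bsub>R\<^esub>i\<in>I. g i) \<noteq> \<zero>\<^bsub>R\<^esub>" if "finite I" for I
    using that by (induction I rule: finite_induct) (auto simp: gc gn dom.integral_iff)
  define s where "s = (\<Otimes>\<^bsub>R\<^esub>i\<in>{..n}. g i)"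
  define b where "b = (\<Otimes>\<^bsub>R\<^esub>i\<in>{1..n}. g i)"
  have "{..n} = insert 0 {1..n}" by auto
  then have "s = g 0 \<otimes>\<^bsub>R\<^esub> b"
    unfolding s_def b_def using gc by (simp add: R.finprod_insert Pi_def)
  then have sb: "s = a \<otimes>\<^bsub>R\<^esub> b" by (simp add: g_def)
  have sig: "\<sigma> (g i) = g (Suc i)" for i by (simp add: g_def)
  \<comment> \<open>Applying \<open>\<sigma>\<close> shifts the index by one, which replaces the
    factor \<open>g 0\<close> by \<open>g (Suc n)\<close>. As \<open>Suc n = e\<close>, the two
    factors are equal, and \<open>g 0\<close> can be cancelled.\<close>
  have "\<sigma> s = (\<Otimes>\<^bsub>R\<^esub>i\<in>{..n}. g (Suc i))"
    unfolding s_def using gc by (subst h.hom_finprod) (auto simp: sig comp_def)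
  also have "\<dots> \<otimes>\<^bsub>R\<^esub> g 0 = (\<Otimes>\<^bsub>R\<^esub>i\<in>{..Suc n}. g i)"
    using gc by (subst R.finprod_Suc2) auto
  also have "\<dots> = g (Suc n) \<otimes>\<^bsub>R\<^esub> s" unfolding s_def using gc by (subst R.finprod_Suc) auto
  also have "g (Suc n) = g 0" using \<sigma>_pow[OF a(1)] n by (simp add: g_def)
  finally have "\<sigma> s \<otimes>\<^bsub>R\<^esub> g 0 = g 0 \<otimes>\<^bsub>R\<^esub> s" .
  moreover have sc: "s \<in> carrier R" unfolding s_def using gc by auto
  ultimately have "\<sigma> s = s"
    using gc[of 0] gn[of 0] \<sigma>_closed[OF sc] dom.m_lcancel[of "g 0" "\<sigma> s" s] by (simp add: R.m_comm)
  then show ?thesis using sb sc prodn[of "{..n}"] gc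
    by (intro bexI[of _ b]) (auto simp: fixed_ring_def s_def[symmetric] b_def)
qed

text \<open>Annihilators of the finitely many generators modulo \<open>N\<close> are multiplied, and
  the product is replaced by its norm: only an invariant scalar commutes with \<open>T\<close> and
  can occur in an operator.\<close>

lemma uniform_annihilator:
  assumes fg: "fg_module R M" and N: "frobenius_stable N"
    and tors: "\<And>y. y \<in> carrier M ==> \<exists>s\<in>carrier R - {\<zero>\<^bsub>R\<^esub>}. s \<odot> y \<in> N"
  shows "\<exists>s\<in>F. s \<noteq> \<zero>\<^bsub>R\<^esub> \<and> (\<forall>y\<in>carrier M. s \<odot> y \<in> N)"
proof -
  obtain U where U: "finite U" "U \<subseteq> carrier M"
    and gen: "\<And>H. U \<subseteq> H ==> H \<subseteq> carrier M ==> \<zero> \<in> H ==>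
      (\<And>x y. x \<in> H ==> y \<in> H ==> x \<oplus> y \<in> H) ==> (\<And>a x. a \<in> carrier R ==> x \<in> H ==> a \<odot> x \<in> H) ==> H = carrier M"
    using fg_moduleE[OF fg] by blast
  have Nc: "x \<in> carrier M" if "x \<in> N" for x using N that by (auto simp: frobenius_stable_def)
  have Ns: "a \<odot> x \<in> N" if "x \<in> N" "a \<in> carrier R" for a x using N that by (auto simp: frobenius_stable_def)
  have "\<exists>s\<in>carrier R - {\<zero>\<^bsub>R\<^esub>}. \<forall>y\<in>U. s \<odot> y \<in> N"
    using U
  proof (induction U rule: finite_induct)
    case empty then show ?case by (intro bexI[of _ "\<one>\<^bsub>R\<^esub>"]) auto
  next
    case (insert u U)
    obtain s where s: "s \<in> carrier R" "s \<noteq> \<zero>\<^bsub>R\<^esub>" "\<forall>y\<in>U. s \<odot> y \<in> N" using insert by auto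
    obtain t where t: "t \<in> carrier R" "t \<noteq> \<zero>\<^bsub>R\<^esub>" "t \<odot> u \<in> N" using tors[of u] insert by auto
    have "(s \<otimes>\<^bsub>R\<^esub> t) \<odot> y \<in> N" if "y \<in> insert u U" for y
    proof (cases "y = u")
      case True then show ?thesis using s t insert.prems by (simp add: smult_assoc1 Ns)
    next
      case False
      then have "t \<odot> (s \<odot> y) \<in> N" using that s t Ns by auto
      then show ?thesis using s t insert.prems that by (auto simp: R.m_comm[of s t] smult_assoc1)
    qed
    then show ?case using s t by (intro bexI[of _ "s \<otimes>\<^bsub>R\<^esub> t"]) (auto simp: dom.integral_iff)
  qed
  then obtain s0 where s0: "s0 \<in> carrier R" "s0 \<noteq> \<zero>\<^bsub>R\<^esub>" "\<forall>y\<in>U. s0 \<odot> y \<in> N" by auto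
  obtain b where b: "b \<in> carrier R" "s0 \<otimes>\<^bsub>R\<^esub> b \<in> F" "s0 \<otimes>\<^bsub>R\<^esub> b \<noteq> \<zero>\<^bsub>R\<^esub>" using norm_element[OF s0(1,2)] by auto
  have "{y \<in> carrier M. s0 \<odot> y \<in> N} = carrier M"
  proof (rule gen)
    show "a \<odot> x \<in> {y \<in> carrier M. s0 \<odot> y \<in> N}" if "a \<in> carrier R" "x \<in> {y \<in> carrier M. s0 \<odot> y \<in> N}" for a x
    proof -
      have "a \<odot> (s0 \<odot> x) \<in> N" using that Ns by blast
      then show ?thesis using that s0 by (simp add: smult_assoc1[symmetric] R.m_comm[of a s0])
    qed
    show "x \<oplus> y \<in> {y \<in> carrier M. s0 \<odot> y \<in> N}"
      if "x \<in> {y \<in> carrier M. s0 \<odot> y \<in> N}" "y \<in> {y \<in> carrier M. s0 \<odot> y \<in> N}" for x y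
      using that N s0(1) unfolding frobenius_stable_def by (simp add: smult_r_distr)
    show "\<zero> \<in> {y \<in> carrier M. s0 \<odot> y \<in> N}" using N s0(1) unfolding frobenius_stable_def by simp
  qed (use U s0 in auto)
  then have "b \<odot> (s0 \<odot> y) \<in> N" if "y \<in> carrier M" for y using that b Ns by blast
  then show ?thesis using b s0 by (intro bexI[of _ "s0 \<otimes>\<^bsub>R\<^esub> b"]) (auto simp: R.m_comm[of s0 b] smult_assoc1)
qed

section \<open>The commutative ring of operators on the module\<close>

context
  fixes l :: nat
begin

text \<open>This is \<open>\<pi>\<close> of the overview. The factor \<open>e\<close> makes it
  linear, and the factor \<open>l\<close> makes it a power of \<open>T ^^ l\<close>, whose effect on
  the filtration is known from purity.\<close>

abbreviation "P \<equiv> T ^^ (l * e)"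
abbreviation "Ops \<equiv> ops M F P"

lemma op_linear: "\<phi> \<in> Ops ==> linear_map R M M \<phi>"
proof (induction rule: ops.induct)
  case (scal a)
  then have a: "a \<in> carrier R" by (rule F_carrier)
  show ?case using a by (auto simp: linear_map_def smult_r_distr smult_assoc1[symmetric] R.m_comm)
next
  case frob
  show ?case by (auto simp: linear_map_def T_iter_closed T_iter_add T_iter_smult \<sigma>_pow_mult)
next
  case (add \<phi> \<psi>)
  then show ?case by (auto simp: linear_map_def Pi_iff M.a_ac smult_r_distr)
next
  case (comp \<phi> \<psi>)
  then show ?case by (auto simp: linear_map_def Pi_iff)
next
  case (cong \<phi> \<psi>)
  then show ?case by (auto simp: linear_map_def Pi_iff)
qed

lemma op_closed: "\<phi> \<in> Ops ==> x \<in> carrier M ==> \<phi> x \<in> carrier M"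
  and op_add: "\<phi> \<in> Ops ==> x \<in> carrier M ==> y \<in> carrier M ==> \<phi> (x \<oplus> y) = \<phi> x \<oplus> \<phi> y"
  and op_smult: "\<phi> \<in> Ops ==> a \<in> carrier R ==> x \<in> carrier M ==> \<phi> (a \<odot> x) = a \<odot> \<phi> x"
  using op_linear unfolding linear_map_def by blast+

lemma op_additive: "\<phi> \<in> Ops ==> additive_map M M \<phi>"
  by (auto simp: additive_map_def op_closed op_add)

lemma op_minus: "\<phi> \<in> Ops ==> x \<in> carrier M ==> y \<in> carrier M ==> \<phi> (x \<ominus> y) = \<phi> x \<ominus> \<phi> y"
  using additive_map_minus[OF M.abelian_group_axioms M.abelian_group_axioms op_additive] by blast

text \<open>Scalars pass through \<open>T\<close> because \<open>\<sigma>\<close> fixes them. This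
  is the reason why operators have coefficients in \<open>F\<close> and not in
  \<open>R\<close>.\<close>

lemma op_T: "\<phi> \<in> Ops ==> x \<in> carrier M ==> \<phi> (T x) = T (\<phi> x)"
proof (induction arbitrary: x rule: ops.induct)
  case (scal a)
  then show ?case by (simp add: T_smult F_carrier F_fixed)
next
  case frob
  show ?case by (simp add: funpow_swap1)
qed (auto simp: T_add T_closed op_closed)

lemma op_T_iter: "\<phi> \<in> Ops ==> x \<in> carrier M ==> \<phi> ((T ^^ n) x) = (T ^^ n) (\<phi> x)"
  by (induction n) (auto simp: op_T T_iter_closed)

lemma op_comm: "\<psi> \<in> Ops ==> \<phi> \<in> Ops ==> x \<in> carrier M ==> \<phi> (\<psi> x) = \<psi> (\<phi> x)"
proof (induction arbitrary: x rule: ops.induct)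
  case (scal a) then show ?case by (simp add: op_smult F_carrier)
next
  case frob then show ?case by (simp add: op_T_iter)
qed (auto simp: op_add op_closed)

lemma op_id: "(\<lambda>x. x) \<in> Ops"
  by (rule ops.cong[OF ops.scal[OF one_F]]) simp

lemma op_diff:
  assumes "\<phi> \<in> Ops" "\<psi> \<in> Ops" shows "(\<lambda>x. \<phi> x \<ominus> \<psi> x) \<in> Ops"
proof (rule ops.cong)
  have "(\<lambda>x. (\<ominus>\<^bsub>R\<^esub> \<one>\<^bsub>R\<^esub>) \<odot> \<psi> x) \<in> Ops" by (rule ops.comp[OF ops.scal[OF minus_one_F] assms(2)])
  from ops.add[OF assms(1) this] show "(\<lambda>x. \<phi> x \<oplus> (\<ominus>\<^bsub>R\<^esub> \<one>\<^bsub>R\<^esub>) \<odot> \<psi> x) \<in> Ops" .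
qed (use assms in \<open>simp add: M.minus_eq smult_l_minus op_closed\<close>)

lemma op_zero: "(\<lambda>x. \<zero>) \<in> Ops"
  by (rule ops.cong[OF ops.scal[OF zero_F]]) simp

lemma op_stable: "\<phi> \<in> Ops ==> frobenius_stable N ==> x \<in> N ==> \<phi> x \<in> N"
proof (induction arbitrary: x rule: ops.induct)
  case (scal a) then show ?case by (auto simp: frobenius_stable_def F_carrier)
next
  case frob then show ?case by (simp add: frobenius_stable_iter)
next
  case (cong \<phi> \<psi>)
  moreover have "x \<in> carrier M" using cong.prems by (auto simp: frobenius_stable_def)
  ultimately show ?case by simp
qed (auto simp: frobenius_stable_def)

section \<open>Nakayama's lemma for the ring of operators\<close>

definition ops_stable :: "'m set \<Rightarrow> bool"
  where "ops_stable H \<longleftrightarrow> H \<subseteq> carrier M \<and> \<zero> \<in> H \<and> (\<forall>x\<in>H. \<forall>y\<in>H. x \<oplus> y \<in> H) \<and> (\<forall>\<phi>\<in>Ops. \<forall>x\<in>H. \<phi> x \<in> H)"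

lemma frobenius_stable_ops: "frobenius_stable N ==> ops_stable N"
  using op_stable by (auto simp: ops_stable_def frobenius_stable_def)

text \<open>The operator submodule generated by \<open>H\<close> and \<open>x\<close>; a single
  \<open>\<theta>\<close> is enough, as operators are closed under addition.\<close>

definition adjoin :: "'m set \<Rightarrow> 'm \<Rightarrow> 'm set"
  where "adjoin H x = {h \<oplus> \<theta> x |h \<theta>. h \<in> H \<and> \<theta> \<in> Ops}"

lemma adjoinI: "h \<in> H ==> \<theta> \<in> Ops ==> z = h \<oplus> \<theta> x ==> z \<in> adjoin H x"
  unfolding adjoin_def by blast

lemma ops_stable_adjoin:
  assumes H: "ops_stable H" and x: "x \<in> carrier M"
  shows "ops_stable (adjoin H x)" "H \<subseteq> adjoin H x" "\<And>\<theta>. \<theta> \<in> Ops ==> \<theta> x \<in> adjoin H x"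
proof -
  have Hc: "h \<in> carrier M" if "h \<in> H" for h using H that by (auto simp: ops_stable_def)
  have H0: "\<zero> \<in> H" and Ha: "\<And>h h'. h \<in> H ==> h' \<in> H ==> h \<oplus> h' \<in> H" and Ho: "\<And>\<phi> h. \<phi> \<in> Ops ==> h \<in> H ==> \<phi> h \<in> H"
    using H by (auto simp: ops_stable_def)
  show sub: "H \<subseteq> adjoin H x"
  proof
    fix h assume "h \<in> H"
    then have "\<exists>h' \<theta>. h = h' \<oplus> \<theta> x \<and> h' \<in> H \<and> \<theta> \<in> Ops"
      using op_zero Hc[of h] by (intro exI[of _ h] exI[of _ "\<lambda>x. \<zero>"]) simp
    then show "h \<in> adjoin H x" unfolding adjoin_def by blast
  qed
  show "\<theta> x \<in> adjoin H x" if "\<theta> \<in> Ops" for \<theta>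
  proof -
    have "\<theta> x = \<zero> \<oplus> \<theta> x" using op_closed[OF that x] by simp
    then show ?thesis unfolding adjoin_def using that H0 by blast
  qed
  show "ops_stable (adjoin H x)" unfolding ops_stable_def
  proof (intro conjI ballI)
    show "adjoin H x \<subseteq> carrier M" using Hc x op_closed by (auto simp: adjoin_def)
    show "\<zero> \<in> adjoin H x" using sub H0 by blast
    fix u v assume "u \<in> adjoin H x" "v \<in> adjoin H x"
    then obtain h \<theta> h' \<theta>' where h: "u = h \<oplus> \<theta> x" "v = h' \<oplus> \<theta>' x" "h \<in> H" "h' \<in> H" "\<theta> \<in> Ops" "\<theta>' \<in> Ops"
      by (auto simp: adjoin_def)
    have "u \<oplus> v = (h \<oplus> h') \<oplus> (\<lambda>x. \<theta> x \<oplus> \<theta>' x) x"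
      using h Hc op_closed x by (simp add: M.a_ac)
    then show "u \<oplus> v \<in> adjoin H x" by (rule adjoinI[OF Ha[OF h(3,4)] ops.add[OF h(5,6)]])
  next
    fix \<phi> u assume \<phi>: "\<phi> \<in> Ops" and "u \<in> adjoin H x"
    then obtain h \<theta> where h: "u = h \<oplus> \<theta> x" "h \<in> H" "\<theta> \<in> Ops" by (auto simp: adjoin_def)
    have "\<phi> u = \<phi> h \<oplus> (\<lambda>x. \<phi> (\<theta> x)) x" using h Hc op_closed x \<phi> by (simp add: op_add)
    then show "\<phi> u \<in> adjoin H x" by (rule adjoinI[OF Ho[OF \<phi> h(2)] ops.comp[OF \<phi> h(3)]])
  qed
qed

text \<open>Removes the generator \<open>x\<close>. Put \<open>q = 1 - P \<phi>\<close>, write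
  \<open>x = P y'\<close> modulo \<open>N\<close>, and \<open>q y' = n + \<psi> x\<close> with
  \<open>n\<close> in \<open>H\<close>. Since operators commute,
  \<open>q x = P (q y') = P n + P (\<psi> x)\<close> modulo \<open>N\<close>, so
  \<open>q2 = q - P \<psi>\<close> maps \<open>x\<close> into \<open>H\<close>. Now \<open>q\<close>
  maps \<open>M\<close> into the module generated by \<open>H\<close> and \<open>x\<close>, and
  \<open>q2\<close> maps that module into \<open>H\<close>; the product \<open>q2 q\<close> is again
  of the form \<open>1 - P \<phi>'\<close>.\<close>

lemma nakayama_step:
  assumes N: "ops_stable N" and H: "ops_stable H" and NH: "N \<subseteq> H" and x: "x \<in> carrier M"
    and surj: "\<exists>y'\<in>carrier M. x \<ominus> P y' \<in> N"
    and \<phi>: "\<phi> \<in> Ops" "\<And>y. y \<in> carrier M ==> y \<ominus> P (\<phi> y) \<in> adjoin H x"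
  shows "\<exists>\<phi>'\<in>Ops. \<forall>y\<in>carrier M. y \<ominus> P (\<phi>' y) \<in> H"
proof -
  have Hc: "h \<in> carrier M" if "h \<in> H" for h using H that by (auto simp: ops_stable_def)
  have Ha: "\<And>h h'. h \<in> H ==> h' \<in> H ==> h \<oplus> h' \<in> H" and Ho: "\<And>\<phi> h. \<phi> \<in> Ops ==> h \<in> H ==> \<phi> h \<in> H"
    using H by (auto simp: ops_stable_def)
  define q where "q = (\<lambda>z. z \<ominus> P (\<phi> z))"
  have q: "q \<in> Ops" unfolding q_def by (rule op_diff[OF op_id ops.comp[OF ops.frob \<phi>(1)]])
  obtain y' where y': "y' \<in> carrier M" "x \<ominus> P y' \<in> N" using surj by auto
  have Py: "P y' \<in> carrier M" using op_closed[OF ops.frob y'(1)] .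
  obtain n \<psi> where n: "q y' = n \<oplus> \<psi> x" "n \<in> H" "\<psi> \<in> Ops"
    using \<phi>(2)[OF y'(1)] by (auto simp: adjoin_def q_def)
  have nc: "n \<in> carrier M" and \<psi>x: "\<psi> x \<in> carrier M" using n Hc op_closed x by auto
  define q2 where "q2 = (\<lambda>z. q z \<ominus> P (\<psi> z))"
  have q2: "q2 \<in> Ops" unfolding q2_def by (rule op_diff[OF q ops.comp[OF ops.frob n(3)]])
  have "q x \<ominus> q (P y') \<in> N"
    using N y'(2) q unfolding op_minus[OF q x Py, symmetric] ops_stable_def by blast
  moreover have "q (P y') = P n \<oplus> P (\<psi> x)"
    using op_comm[OF ops.frob q y'(1)] n op_add[OF ops.frob nc \<psi>x] by simp
  ultimately have A: "q x \<ominus> (P n \<oplus> P (\<psi> x)) \<in> H" using NH by auto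
  have c: "q x \<in> carrier M" "P n \<in> carrier M" "P (\<psi> x) \<in> carrier M"
    using op_closed[OF q x] T_iter_closed[OF nc] T_iter_closed[OF \<psi>x] by simp_all
  have "q2 x = (q x \<ominus> (P n \<oplus> P (\<psi> x))) \<oplus> P n"
    unfolding q2_def by (rule M.minus_split[OF c])
  then have q2x: "q2 x \<in> H" using Ha[OF A Ho[OF ops.frob n(2)]] by (simp only:)
  \<comment> \<open>Obtained by expanding \<open>q2 q = q - P ((\<phi> + \<psi>) q)\<close> with
    \<open>q = 1 - P \<phi>\<close>.\<close>
  define \<phi>' where "\<phi>' = (\<lambda>z. \<phi> z \<oplus> (\<phi> (q z) \<oplus> \<psi> (q z)))"
  have \<phi>': "\<phi>' \<in> Ops" unfolding \<phi>'_def
    by (rule ops.add[OF \<phi>(1) ops.add[OF ops.comp[OF \<phi>(1) q] ops.comp[OF n(3) q]]])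
  have "y \<ominus> P (\<phi>' y) \<in> H" if y: "y \<in> carrier M" for y
  proof -
    obtain h \<theta> where h: "q y = h \<oplus> \<theta> x" "h \<in> H" "\<theta> \<in> Ops"
      using \<phi>(2)[OF y] by (auto simp: adjoin_def q_def)
    have \<theta>x: "\<theta> x \<in> carrier M" using op_closed[OF h(3) x] .
    have "q2 (q y) = q2 h \<oplus> \<theta> (q2 x)"
      unfolding h(1) using op_add[OF q2 Hc[OF h(2)] \<theta>x] op_comm[OF h(3) q2 x] by simp
    then have in_H: "q2 (q y) \<in> H" using Ha[OF Ho[OF q2 h(2)] Ho[OF h(3) q2x]] by (simp only:)
    let ?z = "q y"
    have z: "?z \<in> carrier M" using op_closed[OF q y] .
    have cc: "\<phi> y \<in> carrier M" "\<phi> ?z \<in> carrier M" "\<psi> ?z \<in> carrier M"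
      "P (\<phi> y) \<in> carrier M" "P (\<phi> ?z) \<in> carrier M" "P (\<psi> ?z) \<in> carrier M"
      using op_closed[OF \<phi>(1) y] op_closed[OF \<phi>(1) z] op_closed[OF n(3) z] T_iter_closed by simp_all
    have "P (\<phi>' y) = P (\<phi> y) \<oplus> (P (\<phi> ?z) \<oplus> P (\<psi> ?z))"
      unfolding \<phi>'_def using cc(1-3) by (simp add: T_iter_add)
    then have "y \<ominus> P (\<phi>' y) = (y \<ominus> P (\<phi> y)) \<ominus> P (\<phi> ?z) \<ominus> P (\<psi> ?z)"
      using cc y by (simp add: M.minus_eq M.minus_add M.a_ac)
    also have "\<dots> = q2 ?z" by (simp add: q2_def q_def)
    finally show ?thesis using in_H by (simp only:)
  qed
  then show ?thesis using \<phi>' by blast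
qed

fun adjoin_list :: "'m set \<Rightarrow> 'm list \<Rightarrow> 'm set" where
  "adjoin_list N [] = N"
| "adjoin_list N (x # xs) = adjoin (adjoin_list N xs) x"

lemma adjoin_list_stable:
  "ops_stable N ==> set xs \<subseteq> carrier M ==> ops_stable (adjoin_list N xs) \<and> N \<subseteq> adjoin_list N xs"
proof (induction xs)
  case (Cons x xs)
  then have "ops_stable (adjoin_list N xs)" "N \<subseteq> adjoin_list N xs" "x \<in> carrier M" by auto
  with ops_stable_adjoin[of "adjoin_list N xs" x] show ?case by auto
qed auto

lemma adjoin_list_mem:
  "ops_stable N ==> set xs \<subseteq> carrier M ==> z \<in> set xs ==> \<theta> \<in> Ops ==> \<theta> z \<in> adjoin_list N xs"
proof (induction xs)
  case (Cons x xs)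
  have "ops_stable (adjoin_list N xs)" using adjoin_list_stable[of N xs] Cons.prems by auto
  with ops_stable_adjoin[of "adjoin_list N xs" x] Cons show ?case by auto
qed auto

lemma nakayama:
  assumes N: "ops_stable N" and surj: "\<And>x. x \<in> carrier M ==> \<exists>y'\<in>carrier M. x \<ominus> P y' \<in> N"
    and xs: "set xs \<subseteq> carrier M" "carrier M \<subseteq> adjoin_list N xs"
  shows "\<exists>\<phi>\<in>Ops. \<forall>y\<in>carrier M. y \<ominus> P (\<phi> y) \<in> N"
proof -
  have "\<exists>\<phi>\<in>Ops. \<forall>y\<in>carrier M. y \<ominus> P (\<phi> y) \<in> N"
    if "set xs \<subseteq> carrier M" "\<phi> \<in> Ops" "\<forall>y\<in>carrier M. y \<ominus> P (\<phi> y) \<in> adjoin_list N xs" for \<phi> xs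
    using that
  proof (induction xs arbitrary: \<phi>)
    case Nil then show ?case by auto
  next
    case (Cons x xs)
    have x: "x \<in> carrier M" using Cons.prems by auto
    have st: "ops_stable (adjoin_list N xs)" "N \<subseteq> adjoin_list N xs"
      using adjoin_list_stable[OF N, of xs] Cons.prems by auto
    obtain \<phi>' where "\<phi>' \<in> Ops" "\<forall>y\<in>carrier M. y \<ominus> P (\<phi>' y) \<in> adjoin_list N xs"
      using nakayama_step[OF N st x surj[OF x] Cons.prems(2)] Cons.prems(3) by auto
    then show ?case using Cons.IH Cons.prems by auto
  qed
  \<comment> \<open>The descent starts with \<open>\<phi> = 0\<close>, for which
    \<open>1 - P \<phi>\<close> is the identity and the required containment says that the list
    generates \<open>M\<close> modulo \<open>N\<close>.\<close>
  moreover have "y \<ominus> P \<zero> \<in> carrier M" if "y \<in> carrier M" for y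
    using that op_closed[OF ops.frob M.zero_closed] by simp
  ultimately show ?thesis using xs op_zero by blast
qed

text \<open>\<open>M\<close> is finitely generated over \<open>R\<close>, but operators have
  coefficients in \<open>F\<close> only. As \<open>\<Lambda>\<close> generates \<open>R\<close> over
  \<open>F\<close>, the products of elements of \<open>\<Lambda>\<close> with generators of
  \<open>M\<close> generate \<open>M\<close> over \<open>F\<close>.\<close>

lemma fg_adjoin_list:
  assumes fg: "fg_module R M" and N: "ops_stable N" and L: "finite \<Lambda>" "\<Lambda> \<subseteq> carrier R"
    and gen: "\<And>H. \<Lambda> \<subseteq> H ==> H \<subseteq> carrier R ==> \<zero>\<^bsub>R\<^esub> \<in> H ==> (\<And>a b. a \<in> H ==> b \<in> H ==> a \<oplus>\<^bsub>R\<^esub> b \<in> H) ==>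
       (\<And>a b. a \<in> F ==> b \<in> H ==> a \<otimes>\<^bsub>R\<^esub> b \<in> H) ==> H = carrier R"
  obtains xs where "set xs \<subseteq> carrier M" "carrier M \<subseteq> adjoin_list N xs"
proof -
  obtain U where U: "finite U" "U \<subseteq> carrier M"
    and genU: "\<And>H. U \<subseteq> H ==> H \<subseteq> carrier M ==> \<zero> \<in> H ==>
      (\<And>x y. x \<in> H ==> y \<in> H ==> x \<oplus> y \<in> H) ==> (\<And>a x. a \<in> carrier R ==> x \<in> H ==> a \<odot> x \<in> H) ==> H = carrier M"
    using fg_moduleE[OF fg] by blast
  let ?Z = "(\<lambda>(a, u). a \<odot> u) ` (\<Lambda> \<times> U)"
  obtain xs where xs: "set xs = ?Z" using finite_list[of ?Z] U L by auto
  have xsc: "set xs \<subseteq> carrier M" using xs U L by auto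
  let ?A = "adjoin_list N xs"
  have A: "?A \<subseteq> carrier M" "\<zero> \<in> ?A" "\<And>x y. x \<in> ?A ==> y \<in> ?A ==> x \<oplus> y \<in> ?A" "\<And>\<phi> x. \<phi> \<in> Ops ==> x \<in> ?A ==> \<phi> x \<in> ?A"
    using adjoin_list_stable[OF N xsc] by (auto simp: ops_stable_def)
  have AF: "a \<odot> x \<in> ?A" if "a \<in> F" "x \<in> ?A" for a x using A(4)[OF ops.scal[OF that(1)] that(2)] .
  have au: "a \<odot> u \<in> ?A" if u: "u \<in> U" and a: "a \<in> carrier R" for a u
  proof -
    have uc: "u \<in> carrier M" using u U by auto
    have "{a \<in> carrier R. a \<odot> u \<in> ?A} = carrier R"
    proof (rule gen)
      show "\<Lambda> \<subseteq> {a \<in> carrier R. a \<odot> u \<in> ?A}"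
      proof
        fix a assume a: "a \<in> \<Lambda>"
        have "(\<lambda>x. x) (a \<odot> u) \<in> ?A"
          by (rule adjoin_list_mem[OF N xsc _ op_id]) (use xs a u in auto)
        then show "a \<in> {a \<in> carrier R. a \<odot> u \<in> ?A}" using a L by auto
      qed
      show "a \<otimes>\<^bsub>R\<^esub> b \<in> {a \<in> carrier R. a \<odot> u \<in> ?A}" if "a \<in> F" "b \<in> {a \<in> carrier R. a \<odot> u \<in> ?A}" for a b
        using that AF uc F_carrier[OF that(1)] by (auto simp: smult_assoc1)
    qed (use uc A(1-3) in \<open>auto simp: smult_l_distr\<close>)
    then show ?thesis using a by blast
  qed
  have "{x \<in> carrier M. \<forall>a\<in>carrier R. a \<odot> x \<in> ?A} = carrier M"
  proof (rule genU)
    show "a \<odot> x \<in> {x \<in> carrier M. \<forall>a\<in>carrier R. a \<odot> x \<in> ?A}"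
      if "a \<in> carrier R" "x \<in> {x \<in> carrier M. \<forall>a\<in>carrier R. a \<odot> x \<in> ?A}" for a x
      using that by (auto simp: smult_assoc1[symmetric])
  qed (use au U A(1-3) in \<open>auto simp: smult_r_distr\<close>)
  then have "\<one>\<^bsub>R\<^esub> \<odot> x \<in> ?A" if "x \<in> carrier M" for x using that by blast
  then have "carrier M \<subseteq> ?A" by (metis smult_one subsetI)
  with xsc show thesis by (rule that)
qed

text \<open>\<open>Fil j\<close> models the elements that vanish to order at least \<open>j\<close>
  at infinity, so it shrinks as \<open>j\<close> grows. In the last clause \<open>v\<close> is the
  order of the scalar \<open>a\<close>; the equivalence says that orders add up exactly under scalar
  multiplication.\<close>

definition filtration :: "(int \<Rightarrow> 'm set) \<Rightarrow> bool"
  where "filtration Fil \<longleftrightarrow>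
    (\<forall>j. Fil j \<subseteq> carrier M \<and> \<zero> \<in> Fil j \<and> (\<forall>x\<in>Fil j. \<forall>y\<in>Fil j. x \<oplus> y \<in> Fil j) \<and>
       (\<forall>x\<in>Fil j. \<ominus> x \<in> Fil j) \<and> Fil (j + 1) \<subseteq> Fil j) \<and>
    (\<forall>y\<in>carrier M. \<exists>j. y \<in> Fil j) \<and> (\<forall>y\<in>carrier M. y \<noteq> \<zero> \<longrightarrow> (\<exists>j. y \<notin> Fil j)) \<and>
    (\<forall>a\<in>carrier R - {\<zero>\<^bsub>R\<^esub>}. \<exists>v. \<forall>y\<in>carrier M. \<forall>j. a \<odot> y \<in> Fil (j + v) \<longleftrightarrow> y \<in> Fil j)"

section \<open>Orders at infinity and the construction of the reverse map\<close>

context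
  fixes Fil :: "int \<Rightarrow> 'm set" and k :: int
  assumes Fil: "filtration Fil" and k: "k > 0"
    and T_Fil: "\<And>y j. y \<in> carrier M ==> (T ^^ l) y \<in> Fil (j - k) \<longleftrightarrow> y \<in> Fil j"
begin

lemma Fil_carrier: "y \<in> Fil j ==> y \<in> carrier M"
  and Fil_zero: "\<zero> \<in> Fil j"
  and Fil_add: "x \<in> Fil j ==> y \<in> Fil j ==> x \<oplus> y \<in> Fil j"
  and Fil_uminus: "x \<in> Fil j ==> \<ominus> x \<in> Fil j"
  and Fil_Suc: "x \<in> Fil (j + 1) ==> x \<in> Fil j"
  and Fil_exhaustive: "y \<in> carrier M ==> \<exists>j. y \<in> Fil j"
  and Fil_separated: "y \<in> carrier M ==> y \<noteq> \<zero> ==> \<exists>j. y \<notin> Fil j"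
  and Fil_smult: "a \<in> carrier R ==> a \<noteq> \<zero>\<^bsub>R\<^esub> ==> \<exists>v. \<forall>y\<in>carrier M. \<forall>j. a \<odot> y \<in> Fil (j + v) \<longleftrightarrow> y \<in> Fil j"
  using Fil unfolding filtration_def by blast+

lemma Fil_mono: "i \<le> j ==> x \<in> Fil j ==> x \<in> Fil i"
proof -
  have "x \<in> Fil (i + int n) ==> x \<in> Fil i" for n
  proof (induction n)
    case (Suc n)
    then show ?case using Fil_Suc[of x "i + int n"] by (simp add: algebra_simps)
  qed simp
  from this[of "nat (j - i)"] show "i \<le> j ==> x \<in> Fil j ==> x \<in> Fil i" by simp
qed

lemma T_iter_Fil: "y \<in> carrier M ==> (T ^^ (l * n)) y \<in> Fil (j - int n * k) \<longleftrightarrow> y \<in> Fil j"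
proof (induction n)
  case (Suc n)
  have "(T ^^ (l * Suc n)) y = (T ^^ l) ((T ^^ (l * n)) y)" by (simp add: funpow_add)
  moreover have "j - int (Suc n) * k = (j - int n * k) - k" by (simp add: algebra_simps)
  ultimately show ?case
    using T_Fil[OF T_iter_closed[OF Suc.prems], of "l * n" "j - int n * k"] Suc.IH[OF Suc.prems] by (simp only:)
qed simp

lemma P_iter: "(P ^^ m) = T ^^ (l * (e * m))"
  by (simp add: funpow_mult mult.assoc mult.commute mult.left_commute)

lemma P_Fil: "y \<in> carrier M ==> P y \<in> Fil (j - int e * k) \<longleftrightarrow> y \<in> Fil j"
  by (rule T_iter_Fil)

lemma P_iter_Fil: "y \<in> carrier M ==> (P ^^ m) y \<in> Fil (j - int (e * m) * k) \<longleftrightarrow> y \<in> Fil j"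
  unfolding P_iter by (rule T_iter_Fil)

text \<open>An operator lowers the order by at most a constant that depends neither on the element
  nor on its order. The constant is kept nonnegative so that the bounds of two summands can be
  added.\<close>

lemma op_bounded: "\<phi> \<in> Ops ==> \<exists>c\<ge>0. \<forall>j. \<forall>x\<in>Fil j. \<phi> x \<in> Fil (j - c)"
proof (induction rule: ops.induct)
  case (scal a)
  then have a: "a \<in> carrier R" by (rule F_carrier)
  show ?case
  proof (cases "a = \<zero>\<^bsub>R\<^esub>")
    case True
    have "a \<odot> x \<in> Fil (j - 0)" if "x \<in> Fil j" for x j
      using Fil_carrier[OF that] Fil_zero by (simp add: True)
    then show ?thesis by (intro exI[of _ 0]) simp
  next
    case False
    then obtain v where v: "\<forall>y\<in>carrier M. \<forall>j. a \<odot> y \<in> Fil (j + v) \<longleftrightarrow> y \<in> Fil j" using Fil_smult[OF a] by blast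
    have "a \<odot> x \<in> Fil (j - \<bar>v\<bar>)" if "x \<in> Fil j" for x j
    proof (rule Fil_mono)
      show "a \<odot> x \<in> Fil (j + v)" using v that Fil_carrier[OF that] by blast
    qed simp
    then show ?thesis by (intro exI[of _ "\<bar>v\<bar>"]) simp
  qed
next
  case frob
  have "P x \<in> Fil (j - int e * k)" if "x \<in> Fil j" for x j using P_Fil[OF Fil_carrier[OF that]] that by blast
  then show ?case using k by (intro exI[of _ "int e * k"]) simp
next
  case (add \<phi> \<psi>)
  then obtain c c' where c: "c \<ge> 0" "c' \<ge> 0" "\<And>j x. x \<in> Fil j ==> \<phi> x \<in> Fil (j - c)" "\<And>j x. x \<in> Fil j ==> \<psi> x \<in> Fil (j - c')" by blast
  have "\<phi> x \<oplus> \<psi> x \<in> Fil (j - (c + c'))" if "x \<in> Fil j" for x j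
    using Fil_add[OF Fil_mono[OF _ c(3)[OF that]] Fil_mono[OF _ c(4)[OF that]], of "j - (c + c')"] c(1,2) by simp
  then show ?case using c(1,2) by (intro exI[of _ "c + c'"]) simp
next
  case (comp \<phi> \<psi>)
  then obtain c c' where c: "c \<ge> 0" "c' \<ge> 0" "\<And>j x. x \<in> Fil j ==> \<phi> x \<in> Fil (j - c)" "\<And>j x. x \<in> Fil j ==> \<psi> x \<in> Fil (j - c')" by blast
  have "\<phi> (\<psi> x) \<in> Fil (j - (c + c'))" if "x \<in> Fil j" for x j
    using c(3)[OF c(4)[OF that]] by (simp add: algebra_simps)
  then show ?case using c(1,2) by (intro exI[of _ "c + c'"]) simp
next
  case (cong \<phi> \<psi>)
  then obtain c where c: "c \<ge> 0" "\<And>j x. x \<in> Fil j ==> \<phi> x \<in> Fil (j - c)" by blast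
  have "\<psi> x \<in> Fil (j - c)" if "x \<in> Fil j" for x j
    using c(2)[OF that] cong.hyps(2)[OF Fil_carrier[OF that]] by simp
  then show ?case using c(1) by (intro exI[of _ c]) simp
qed

lemma exists_last_Fil:
  assumes y: "y \<in> carrier M" "y \<noteq> \<zero>"
  obtains j where "y \<in> Fil j" "y \<notin> Fil (j + 1)"
proof -
  obtain i where i: "y \<in> Fil i" using Fil_exhaustive[OF y(1)] by blast
  obtain j where j: "y \<notin> Fil j" using Fil_separated[OF y] by blast
  have "\<exists>n. y \<notin> Fil (i + int n)"
  proof (rule exI[of _ "nat (j - i)"])
    show "y \<notin> Fil (i + int (nat (j - i)))" using Fil_mono[of j "i + int (nat (j - i))" y] j by auto
  qed
  define n where "n = (LEAST n. y \<notin> Fil (i + int n))"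
  have n: "y \<notin> Fil (i + int n)" "\<And>m. m < n ==> y \<in> Fil (i + int m)"
    unfolding n_def using LeastI_ex[OF \<open>\<exists>n. y \<notin> Fil (i + int n)\<close>] not_less_Least by blast+
  have "n \<noteq> 0" using n(1) i by (cases n) auto
  then obtain m where m: "n = Suc m" by (cases n) auto
  show thesis
    by (rule that[of "i + int m"]) (use n(2)[of m] n(1) m in \<open>auto simp: algebra_simps\<close>)
qed

text \<open>The assumption \<open>gen\<close> makes \<open>\<Lambda>\<close> a generating set of
  \<open>R\<close> over the invariants, and \<open>rank\<close> is the comparison of ranks that
  holds for locally free modules. The last two conclusions amount to injectivity and surjectivity of
  \<open>T\<close> on the quotient of \<open>N\<close> by the image of \<open>h\<close>, which is
  separability of \<open>h\<close> as a map into \<open>N\<close>.\<close>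

theorem separable_endomorphism:
  assumes l: "l > 0" and fg: "fg_module R M" and L: "finite \<Lambda>" "\<Lambda> \<subseteq> carrier R"
    and gen: "\<And>H. \<Lambda> \<subseteq> H ==> H \<subseteq> carrier R ==> \<zero>\<^bsub>R\<^esub> \<in> H ==> (\<And>a b. a \<in> H ==> b \<in> H ==> a \<oplus>\<^bsub>R\<^esub> b \<in> H) ==>
       (\<And>a b. a \<in> F ==> b \<in> H ==> a \<otimes>\<^bsub>R\<^esub> b \<in> H) ==> H = carrier R"
    and rank: "\<And>h y. linear_map R M M h ==> inj_on h (carrier M) ==> y \<in> carrier M ==>
       \<exists>s\<in>carrier R - {\<zero>\<^bsub>R\<^esub>}. s \<odot> y \<in> h ` carrier M"
    and N: "frobenius_stable N"
    and tors: "\<And>y. y \<in> carrier M ==> \<exists>s\<in>carrier R - {\<zero>\<^bsub>R\<^esub>}. s \<odot> y \<in> N"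
    and surj: "\<And>y. y \<in> carrier M ==> \<exists>y'\<in>carrier M. y \<ominus> T y' \<in> N"
  obtains h where "linear_map R M M h" "h ` carrier M \<subseteq> N" "inj_on h (carrier M)"
    "\<And>x. x \<in> carrier M ==> h (T x) = T (h x)"
    "\<And>y. y \<in> carrier M ==> \<exists>s\<in>carrier R - {\<zero>\<^bsub>R\<^esub>}. s \<odot> y \<in> h ` carrier M"
    "\<And>y. y \<in> N ==> T y \<in> h ` carrier M ==> y \<in> h ` carrier M"
    "\<And>y. y \<in> N ==> \<exists>y'\<in>N. y \<ominus> T y' \<in> h ` carrier M"
proof -
  have Nc: "x \<in> carrier M" if "x \<in> N" for x using N that unfolding frobenius_stable_def by blast
  have N0: "\<zero> \<in> N" using N unfolding frobenius_stable_def by blast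
  have Na: "x \<oplus> y \<in> N" if "x \<in> N" "y \<in> N" for x y using N that unfolding frobenius_stable_def by blast
  have NT: "T x \<in> N" if "x \<in> N" for x using N that unfolding frobenius_stable_def by blast
  \<comment> \<open>Surjectivity modulo \<open>N\<close> is given for \<open>T\<close>, but
    Nakayama's lemma is applied to \<open>P\<close>; it passes to iterates because \<open>T\<close>
    preserves \<open>N\<close>.\<close>
  have surj_iter: "\<exists>y'\<in>carrier M. y \<ominus> (T ^^ n) y' \<in> N" if "y \<in> carrier M" for n y
    using that
  proof (induction n arbitrary: y)
    case 0 then show ?case using N0 by (intro bexI[of _ y]) (simp_all add: M.minus_eq M.r_neg)
  next
    case (Suc n)
    obtain y1 where y1: "y1 \<in> carrier M" "y \<ominus> T y1 \<in> N" using surj[OF Suc.prems] by blast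
    obtain y2 where y2: "y2 \<in> carrier M" "y1 \<ominus> (T ^^ n) y2 \<in> N" using Suc.IH[OF y1(1)] by blast
    have c: "T y1 \<in> carrier M" "T ((T ^^ n) y2) \<in> carrier M" "(T ^^ n) y2 \<in> carrier M"
      using y1 y2 T_closed T_iter_closed by auto
    have "T (y1 \<ominus> (T ^^ n) y2) = T y1 \<ominus> T ((T ^^ n) y2)"
      using additive_map_minus[OF M.abelian_group_axioms M.abelian_group_axioms T_additive y1(1) c(3)] .
    then have "(y \<ominus> T y1) \<oplus> (T y1 \<ominus> T ((T ^^ n) y2)) \<in> N" using Na[OF y1(2) NT[OF y2(2)]] by simp
    also have "(y \<ominus> T y1) \<oplus> (T y1 \<ominus> T ((T ^^ n) y2)) = y \<ominus> T ((T ^^ n) y2)"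
      using c Suc.prems by (simp add: M.minus_eq M.a_assoc M.r_neg1)
    finally show ?case using y2(1) by auto
  qed
  obtain xs where xs: "set xs \<subseteq> carrier M" "carrier M \<subseteq> adjoin_list N xs"
    using fg_adjoin_list[OF fg frobenius_stable_ops[OF N] L gen] by blast
  obtain \<phi> where \<phi>: "\<phi> \<in> Ops" "\<And>y. y \<in> carrier M ==> y \<ominus> P (\<phi> y) \<in> N"
    using nakayama[OF frobenius_stable_ops[OF N] surj_iter xs] by blast
  obtain s where s: "s \<in> F" "s \<noteq> \<zero>\<^bsub>R\<^esub>" "\<And>y. y \<in> carrier M ==> s \<odot> y \<in> N"
    using uniform_annihilator[OF fg N tors] by blast
  have sR: "s \<in> carrier R" by (rule F_carrier[OF s(1)])
  obtain c where c: "c \<ge> 0" "\<And>j x. x \<in> Fil j ==> P (\<phi> x) \<in> Fil (j - c)"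
    using op_bounded[OF ops.comp[OF ops.frob \<phi>(1)]] by blast
  obtain v where v: "\<And>y j. y \<in> carrier M ==> s \<odot> y \<in> Fil (j + v) \<longleftrightarrow> y \<in> Fil j"
    using Fil_smult[OF sR s(2)] by blast
  \<comment> \<open>Here \<open>c\<close> bounds the loss of order under \<open>P \<phi>\<close>,
    and \<open>v\<close> is the order of \<open>s\<close>. Each \<open>P\<close> lowers orders by
    \<open>e k\<close>, which is at least 1; so with this \<open>m\<close> the order of
    \<open>s (P ^^ m) y\<close> is less than \<open>j - c\<close> if \<open>y\<close> has order
    \<open>j\<close>.\<close>
  define m where "m = nat (c + \<bar>v\<bar>) + 1"
  have "c + 1 + v \<le> int m" unfolding m_def using c(1) by simp
  also have "int m * 1 \<le> int m * (int e * k)"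
    using k e_pos by (intro mult_left_mono) (auto simp: int_one_le_iff_zero_less intro: order.trans[OF _ mult_mono[of 1 "int e" 1 k]])
  finally have m: "c + 1 + v \<le> int (e * m) * k" by (simp add: mult_ac)
  have P_smult: "P (a \<odot> x) = a \<odot> P x" if "a \<in> carrier R" "x \<in> carrier M" for a x
    using op_smult[OF ops.frob that] .
  have P_iter_op: "(P ^^ n) \<in> Ops" for n
  proof (induction n)
    case 0 show ?case by (rule ops.cong[OF op_id]) simp
  next
    case (Suc n) show ?case by (rule ops.cong[OF ops.comp[OF ops.frob Suc]]) simp
  qed
  have Pc: "(P ^^ n) x \<in> carrier M" if "x \<in> carrier M" for x n using op_closed[OF P_iter_op that] .
  \<comment> \<open>With the exponent \<open>m - 1\<close> the correction \<open>s P ^^ m\<close> is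
    absorbed into \<open>P \<psi>\<close>, so that \<open>h\<close> keeps the form
    \<open>1 - P \<psi>\<close> on which bijectivity modulo the image of \<open>h\<close>
    rests.\<close>
  define \<psi> where "\<psi> = (\<lambda>z. \<phi> z \<ominus> s \<odot> (P ^^ (m - 1)) z)"
  have \<psi>: "\<psi> \<in> Ops" unfolding \<psi>_def by (rule op_diff[OF \<phi>(1) ops.comp[OF ops.scal[OF s(1)] P_iter_op]])
  define h where "h = (\<lambda>z. z \<ominus> P (\<psi> z))"
  have h: "h \<in> Ops" unfolding h_def by (rule op_diff[OF op_id ops.comp[OF ops.frob \<psi>]])
  have h_eq: "h z = (z \<ominus> P (\<phi> z)) \<oplus> s \<odot> (P ^^ m) z" if z: "z \<in> carrier M" for z
  proof -
    let ?u = "(P ^^ (m - 1)) z"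
    have u: "?u \<in> carrier M" by (rule Pc[OF z])
    have "P ?u = (P ^^ Suc (m - 1)) z" by simp
    then have Pu: "P ?u = (P ^^ m) z" by (simp add: m_def)
    have su: "s \<odot> ?u \<in> carrier M" using u sR by simp
    have "P (\<psi> z) = P (\<phi> z) \<ominus> P (s \<odot> ?u)"
      unfolding \<psi>_def by (rule op_minus[OF ops.frob op_closed[OF \<phi>(1) z] su])
    also have "\<dots> = P (\<phi> z) \<ominus> s \<odot> (P ^^ m) z" using P_smult[OF sR u] Pu by simp
    finally show ?thesis
      unfolding h_def using z T_iter_closed[OF op_closed[OF \<phi>(1) z]] Pc[OF z, of m] sR
      by (simp add: M.minus_eq M.minus_add M.a_assoc)
  qed
  have h_in_N: "h z \<in> N" if "z \<in> carrier M" for z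
    using Na[OF \<phi>(2)[OF that] s(3)[OF Pc[OF that]]] h_eq[OF that] by simp
  \<comment> \<open>For \<open>y\<close> of exact order \<open>j\<close> the summand
    \<open>y - P (\<phi> y)\<close> lies in \<open>Fil (j - c)\<close>, whereas by the choice of
    \<open>m\<close> the summand \<open>s (P ^^ m) y\<close> does not. Hence the two cannot
    cancel.\<close>
  have h_ker: "y = \<zero>" if y: "y \<in> carrier M" "h y = \<zero>" for y
  proof (rule ccontr)
    assume "y \<noteq> \<zero>"
    then obtain j where j: "y \<in> Fil j" "y \<notin> Fil (j + 1)" using exists_last_Fil[OF y(1)] by blast
    let ?u = "y \<ominus> P (\<phi> y)" and ?w = "s \<odot> (P ^^ m) y"
    have u: "?u \<in> Fil (j - c)"
      unfolding M.minus_eq using c j by (intro Fil_add Fil_uminus) (auto intro: Fil_mono[of "j - c" j])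
    have w: "?w \<in> carrier M" using sR Pc[OF y(1)] by simp
    have "?u \<oplus> ?w = \<zero>" using h_eq[OF y(1)] y(2) by simp
    then have "?w \<oplus> ?u = \<zero>" using w Fil_carrier[OF u] by (simp add: M.a_comm)
    then have "?w = \<ominus> ?u" using w Fil_carrier[OF u] by (metis M.minus_equality)
    then have "?w \<in> Fil (j - c)" using Fil_uminus[OF u] by simp
    moreover have "j + 1 - int (e * m) * k + v \<le> j - c" using m by simp
    ultimately have "?w \<in> Fil (j + 1 - int (e * m) * k + v)" by (rule Fil_mono[rotated])
    then have "(P ^^ m) y \<in> Fil (j + 1 - int (e * m) * k)" using v[OF Pc[OF y(1)]] by blast
    then show False using P_iter_Fil[OF y(1)] j(2) by blast
  qed
  have inj: "inj_on h (carrier M)"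
  proof (rule inj_onI)
    fix x y assume xy: "x \<in> carrier M" "y \<in> carrier M" "h x = h y"
    have "h (x \<ominus> y) = \<zero>"
      unfolding op_minus[OF h xy(1,2)] xy(3) using op_closed[OF h xy(2)] by (simp add: M.r_neg M.minus_eq)
    then have "x \<ominus> y = \<zero>" by (rule h_ker[OF M.minus_closed[OF xy(1,2)]])
    then show "x = y" by (rule M.minus_eq_zeroD[OF xy(1,2)])
  qed
  \<comment> \<open>One factor is split off, \<open>P = T o T ^^ n\<close>, because the claims to be
    shown concern \<open>T\<close> and not \<open>P\<close>.\<close>
  obtain n where n: "l * e = Suc n" using l e_pos by (metis mult_is_0 not0_implies_Suc not_gr_zero)
  have decomp: "y = h y \<oplus> P (\<psi> y)" if "y \<in> carrier M" for y
    unfolding h_def using that T_iter_closed[OF op_closed[OF \<psi> that]] by (simp add: M.minus_eq M.a_assoc M.l_neg)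
  show thesis
  proof (rule that[OF op_linear[OF h]])
    show "h ` carrier M \<subseteq> N" using h_in_N by blast
    show "inj_on h (carrier M)" by (rule inj)
    show "h (T x) = T (h x)" if "x \<in> carrier M" for x by (rule op_T[OF h that])
    show "\<exists>s\<in>carrier R - {\<zero>\<^bsub>R\<^esub>}. s \<odot> y \<in> h ` carrier M" if "y \<in> carrier M" for y
      by (rule rank[OF op_linear[OF h] inj that])
    \<comment> \<open>From \<open>T y = h x\<close> follows
      \<open>P (\<psi> y) = h (\<psi> ((T ^^ n) x))\<close>, since operators commute with each other
      and with \<open>T\<close>. So both summands of \<open>y = h y + P (\<psi> y)\<close> lie in
      the image of \<open>h\<close>.\<close>
    show "y \<in> h ` carrier M" if y: "y \<in> N" "T y \<in> h ` carrier M" for y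
    proof -
      obtain x where x: "x \<in> carrier M" "T y = h x" using y(2) by blast
      let ?x = "\<psi> ((T ^^ n) x)"
      have xc: "?x \<in> carrier M" by (rule op_closed[OF \<psi> T_iter_closed[OF x(1)]])
      have "P (\<psi> y) = \<psi> (P y)" by (rule op_comm[OF \<psi> ops.frob Nc[OF y(1)]])
      also have "P y = (T ^^ n) (T y)" by (simp only: n funpow_Suc_right comp_apply)
      also have "\<dots> = h ((T ^^ n) x)" unfolding x(2) by (rule op_T_iter[OF h x(1), symmetric])
      also have "\<psi> (h ((T ^^ n) x)) = h ?x" by (rule op_comm[OF h \<psi> T_iter_closed[OF x(1)]])
      finally have "y = h (y \<oplus> ?x)" using decomp[OF Nc[OF y(1)]] op_add[OF h Nc[OF y(1)] xc] by simp
      then show ?thesis using Nc[OF y(1)] xc by (metis M.a_closed image_eqI)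
    qed
    show "\<exists>y'\<in>N. y \<ominus> T y' \<in> h ` carrier M" if y: "y \<in> N" for y
    proof (rule bexI)
      show "(T ^^ n) (\<psi> y) \<in> N" by (rule frobenius_stable_iter[OF N op_stable[OF \<psi> N y]])
      have "T ((T ^^ n) (\<psi> y)) = P (\<psi> y)" by (simp only: n funpow.simps comp_apply)
      then have "y \<ominus> T ((T ^^ n) (\<psi> y)) = h y" by (simp add: h_def)
      then show "y \<ominus> T ((T ^^ n) (\<psi> y)) \<in> h ` carrier M" using Nc[OF y] by simp
    qed
  qed
qed

end

end

end

section \<open>Frobenius of a finite field\<close>

lemma (in cring) binomial_expansion:
  assumes "x \<in> carrier R" "y \<in> carrier R"
  shows "(x \<oplus> y) [^] n = (\<Oplus>i\<in>{..n}. add_pow R (n choose i) (x [^] i \<otimes> y [^] (n - i)))"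
proof (induction n)
  case 0
  show ?case using assms by (simp add: add_pow_def)
next
  case (Suc n)
  define g where "g i = add_pow R (n choose i) (x [^] Suc i \<otimes> y [^] (n - i))" for i
  define h where "h i = add_pow R (n choose i) (x [^] i \<otimes> y [^] (Suc n - i))" for i
  define f where "f i = add_pow R (n choose i) (x [^] i \<otimes> y [^] (n - i))" for i
  define t where "t i = add_pow R (Suc n choose i) (x [^] i \<otimes> y [^] (Suc n - i))" for i
  have c: "g i \<in> carrier R" "h i \<in> carrier R" "f i \<in> carrier R" "t i \<in> carrier R" for i
    using assms by (auto simp: g_def h_def f_def t_def)
  have fx: "f i \<otimes> x = g i" for i
  proof -
    have "f i \<otimes> x = add_pow R (n choose i) ((x [^] i \<otimes> y [^] (n - i)) \<otimes> x)"
      unfolding f_def using assms by (intro add_pow_ldistr) auto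
    also have "(x [^] i \<otimes> y [^] (n - i)) \<otimes> x = x [^] Suc i \<otimes> y [^] (n - i)"
      using assms by (simp add: m_ac)
    finally show ?thesis by (simp add: g_def)
  qed
  have fy: "f i \<otimes> y = h i" if "i \<le> n" for i
  proof -
    have "f i \<otimes> y = add_pow R (n choose i) ((x [^] i \<otimes> y [^] (n - i)) \<otimes> y)"
      unfolding f_def using assms by (intro add_pow_ldistr) auto
    also have "(x [^] i \<otimes> y [^] (n - i)) \<otimes> y = x [^] i \<otimes> y [^] (Suc n - i)"
      using assms that by (simp add: m_assoc Suc_diff_le)
    finally show ?thesis by (simp add: h_def)
  qed
  have tS: "t (Suc i) = g i \<oplus> h (Suc i)" for i
    unfolding t_def g_def h_def using assms
    by (simp add: add.nat_pow_mult)
  have "(x \<oplus> y) [^] Suc n = (\<Oplus>i\<in>{..n}. f i) \<otimes> (x \<oplus> y)"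
    using Suc by (simp add: f_def)
  also have "\<dots> = (\<Oplus>i\<in>{..n}. f i) \<otimes> x \<oplus> (\<Oplus>i\<in>{..n}. f i) \<otimes> y"
    using assms c by (intro r_distr finsum_closed) auto
  also have "(\<Oplus>i\<in>{..n}. f i) \<otimes> x = (\<Oplus>i\<in>{..n}. f i \<otimes> x)" using assms c by (intro finsum_ldistr) auto
  also have "\<dots> = (\<Oplus>i\<in>{..n}. g i)" using c by (intro finsum_cong') (auto simp: fx)
  also have "(\<Oplus>i\<in>{..n}. f i) \<otimes> y = (\<Oplus>i\<in>{..n}. f i \<otimes> y)" using assms c by (intro finsum_ldistr) auto
  also have "\<dots> = (\<Oplus>i\<in>{..n}. h i)" using c by (intro finsum_cong') (auto simp: fy)
  \<comment> \<open>For Pascal's rule the second sum is shifted by one. It is first extended to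
    \<open>Suc n\<close>, where its term vanishes because the binomial coefficient
    \<open>n choose Suc n\<close> is 0.\<close>
  also have "(\<Oplus>i\<in>{..n}. h i) = (\<Oplus>i\<in>{..Suc n}. h i)"
  proof -
    have "n choose Suc n = 0" by simp
    then have "h (Suc n) = \<zero>" unfolding h_def by (simp only: add_pow_def nat_pow_0) simp
    then show ?thesis using c by (subst finsum_Suc) (auto intro!: finsum_closed)
  qed
  also have "\<dots> = (\<Oplus>i\<in>{..n}. h (Suc i)) \<oplus> h 0" using c by (intro finsum_Suc2) auto
  also have "h 0 = t 0" by (simp add: h_def t_def)
  also have "(\<Oplus>i\<in>{..n}. g i) \<oplus> ((\<Oplus>i\<in>{..n}. h (Suc i)) \<oplus> t 0) = ((\<Oplus>i\<in>{..n}. g i) \<oplus> (\<Oplus>i\<in>{..n}. h (Suc i))) \<oplus> t 0"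
    using c by (intro a_assoc[symmetric] finsum_closed) auto
  also have "(\<Oplus>i\<in>{..n}. g i) \<oplus> (\<Oplus>i\<in>{..n}. h (Suc i)) = (\<Oplus>i\<in>{..n}. g i \<oplus> h (Suc i))"
    using c by (intro finsum_addf[symmetric]) auto
  also have "\<dots> = (\<Oplus>i\<in>{..n}. t (Suc i))" using c by (intro finsum_cong') (auto simp: tS)
  also have "\<dots> \<oplus> t 0 = (\<Oplus>i\<in>{..Suc n}. t i)" using c by (intro finsum_Suc2[symmetric]) auto
  finally show ?case by (simp add: t_def)
qed

text \<open>All binomial coefficients other than the two outer ones are divisible by
  \<open>p\<close>, so only the outer terms survive.\<close>

lemma (in cring) frobenius_add_prime:
  assumes p: "Factorial_Ring.prime (p::nat)" "\<And>z. z \<in> carrier R ==> add_pow R p z = \<zero>" and "x \<in> carrier R" "y \<in> carrier R"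
  shows "(x \<oplus> y) [^] p = x [^] p \<oplus> y [^] p"
proof -
  define f where "f i = add_pow R (p choose i) (x [^] i \<otimes> y [^] (p - i))" for i
  have fc: "f i \<in> carrier R" for i using assms by (simp add: f_def)
  have "(x \<oplus> y) [^] p = (\<Oplus>i\<in>{..p}. f i)" unfolding f_def by (rule binomial_expansion[OF assms(3,4)])
  also have "\<dots> = (\<Oplus>i\<in>{0, p}. f i)"
  proof (rule add.finprod_mono_neutral_cong_left[symmetric])
    show "f i = \<zero>" if i: "i \<in> {..p} - {0, p}" for i
    proof -
      have "p dvd (p choose i)" using i p(1) by (intro dvd_choose_prime) auto
      then obtain m where m: "p choose i = p * m" by (elim dvdE)
      have z: "x [^] i \<otimes> y [^] (p - i) \<in> carrier R" using assms by simp
      have "f i = add_pow R m (add_pow R p (x [^] i \<otimes> y [^] (p - i)))"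
        unfolding f_def m using add.nat_pow_pow[OF z, of m p] by (simp add: mult.commute)
      then show ?thesis using p(2)[OF z] by (simp add: add.nat_pow_one)
    qed
  qed (use fc in auto)
  also have "\<dots> = f 0 \<oplus> f p" using fc prime_gt_0_nat[OF p(1)] by (subst finsum_insert) (auto simp: finsum_insert)
  also have "f 0 = y [^] p" using assms by (simp add: f_def add_pow_def)
  also have "f p = x [^] p" using assms by (simp add: f_def add_pow_def)
  finally show ?thesis using assms by (simp add: a_comm)
qed

section \<open>The order of a finite field and its Frobenius map\<close>

lemma prime_power_if_unique_prime:
  fixes q p :: nat
  assumes "q > 0" "\<And>r. Factorial_Ring.prime r ==> r dvd q ==> r = p"
  shows "\<exists>n. q = p ^ n"
  using assms
proof (induction q rule: less_induct)
  case (less q)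
  show ?case
  proof (cases "q = 1")
    case True then show ?thesis by (intro exI[of _ 0]) simp
  next
    case False
    then obtain r where r: "Factorial_Ring.prime r" "r dvd q" using prime_factor_nat by blast
    then have rp: "r = p" using less.prems by blast
    then obtain m where m: "q = p * m" using r by (elim dvdE) simp
    have "p > 1" using r rp prime_gt_1_nat by blast
    then have "m < q" "m > 0" using m less.prems(1) by auto
    moreover have "\<And>r. Factorial_Ring.prime r ==> r dvd m ==> r = p" using less.prems(2) m by (meson dvd_mult)
    ultimately obtain n where "m = p ^ n" using less.IH by blast
    then show ?thesis using m by (intro exI[of _ "Suc n"]) simp
  qed
qed

text \<open>\<open>p\<close> is the additive order of 1, which is prime as there are no zero
  divisors. Another prime divisor \<open>r\<close> of the cardinality would give, by Sylow's
  theorem, a nonzero element annihilated by \<open>r\<close> and by \<open>p\<close>, contrary to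
  Bezout's identity.\<close>

lemma finite_field_prime_power:
  assumes "field K" "finite (carrier K)"
  obtains p n where "Factorial_Ring.prime (p::nat)" "card (carrier K) = p ^ n" "add_pow K p \<one>\<^bsub>K\<^esub> = \<zero>\<^bsub>K\<^esub>"
proof -
  interpret field K by fact
  let ?G = "add_monoid K"
  have G: "group ?G" by (rule a_group)
  have pw: "z [^]\<^bsub>?G\<^esub> m = add_pow K m z" for z and m :: nat by (simp add: add_pow_def)
  have ord: "order ?G = card (carrier K)" by (simp add: order_def)
  have q: "add_pow K (card (carrier K)) \<one>\<^bsub>K\<^esub> = \<zero>\<^bsub>K\<^esub>"
    using group.pow_order_eq_1[OF G, of "\<one>\<^bsub>K\<^esub>"] unfolding ord pw by simp
  have qpos: "card (carrier K) > 0" using assms(2) zero_closed card_gt_0_iff by blast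
  define p where "p = (LEAST p. p > 0 \<and> add_pow K (p::nat) \<one>\<^bsub>K\<^esub> = \<zero>\<^bsub>K\<^esub>)"
  have p: "p > 0" "add_pow K p \<one>\<^bsub>K\<^esub> = \<zero>\<^bsub>K\<^esub>"
    unfolding p_def using LeastI[of "\<lambda>p. p > 0 \<and> add_pow K (p::nat) \<one>\<^bsub>K\<^esub> = \<zero>\<^bsub>K\<^esub>" "card (carrier K)"] q qpos by blast+
  have pmin: "\<not> (m > 0 \<and> add_pow K m \<one>\<^bsub>K\<^esub> = \<zero>\<^bsub>K\<^esub>)" if "m < p" for m
    using not_less_Least that unfolding p_def by blast
  have p1: "p \<noteq> 1" using p(2) by (auto simp: add_pow_def)
  have pprime: "Factorial_Ring.prime p"
  proof (rule ccontr)
    assume "\<not> Factorial_Ring.prime p"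
    obtain a where a: "Factorial_Ring.prime a" "a dvd p" using prime_factor_nat[OF p1] by blast
    obtain b where ab1: "p = a * b" using a(2) by (elim dvdE)
    have "a \<noteq> p" using a(1) \<open>\<not> Factorial_Ring.prime p\<close> by blast
    then have ab: "p = a * b" "1 < a" "a < p"
      using ab1 prime_gt_1_nat[OF a(1)] dvd_imp_le[OF a(2) p(1)] by auto
    then have b: "0 < b" "b < p" using p(1) by (auto intro: Nat.gr0I)
    have "add_pow K a \<one>\<^bsub>K\<^esub> \<otimes>\<^bsub>K\<^esub> add_pow K b \<one>\<^bsub>K\<^esub> = add_pow K a (add_pow K b \<one>\<^bsub>K\<^esub>)"
      using add_pow_ldistr[of "\<one>\<^bsub>K\<^esub>" "add_pow K b \<one>\<^bsub>K\<^esub>" a] by simp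
    also have "\<dots> = add_pow K p \<one>\<^bsub>K\<^esub>" unfolding ab(1) using add.nat_pow_pow[of "\<one>\<^bsub>K\<^esub>" a b] by (simp add: mult.commute)
    finally have "add_pow K a \<one>\<^bsub>K\<^esub> \<otimes>\<^bsub>K\<^esub> add_pow K b \<one>\<^bsub>K\<^esub> = \<zero>\<^bsub>K\<^esub>" using p(2) by simp
    then have "add_pow K a \<one>\<^bsub>K\<^esub> = \<zero>\<^bsub>K\<^esub> \<or> add_pow K b \<one>\<^bsub>K\<^esub> = \<zero>\<^bsub>K\<^esub>" by (rule integral) auto
    then show False using pmin[of a] pmin[of b] ab b by auto
  qed
  have pz: "add_pow K p z = \<zero>\<^bsub>K\<^esub>" if "z \<in> carrier K" for z
    using add_pow_ldistr[of "\<one>\<^bsub>K\<^esub>" z p] that p(2) by simp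
  have "\<exists>n. card (carrier K) = p ^ n"
  proof (rule prime_power_if_unique_prime[OF qpos])
    fix r :: nat assume r: "Factorial_Ring.prime r" "r dvd card (carrier K)"
    then obtain m where m: "card (carrier K) = r ^ 1 * m" by (elim dvdE) simp
    obtain H where H: "subgroup H ?G" "card H = r ^ 1"
      using sylow_thm[OF r(1) G, of 1 m] m ord assms(2) by auto
    have finH: "finite H" using H(2) r(1) by (metis card.infinite power_one_right not_prime_0)
    have "H \<noteq> {\<zero>\<^bsub>K\<^esub>}" using H(2) r(1) by (auto dest: prime_gt_1_nat)
    moreover have "\<zero>\<^bsub>K\<^esub> \<in> H" using subgroup.one_closed[OF H(1)] by simp
    ultimately obtain z where z: "z \<in> H" "z \<noteq> \<zero>\<^bsub>K\<^esub>" by blast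
    have zK: "z \<in> carrier K" using subgroup.mem_carrier[OF H(1) z(1)] by simp
    interpret H: group "?G\<lparr>carrier := H\<rparr>" by (rule subgroup.subgroup_is_group[OF H(1) G])
    have "z [^]\<^bsub>?G\<lparr>carrier := H\<rparr>\<^esub> (card H) = \<one>\<^bsub>?G\<lparr>carrier := H\<rparr>\<^esub>"
      using H.pow_order_eq_1[of z] z by (simp add: order_def)
    then have rz: "add_pow K r z = \<zero>\<^bsub>K\<^esub>" using H(2) by (simp add: add_pow_def nat_pow_def)
    show "r = p"
    proof (rule ccontr)
      assume "r \<noteq> p"
      then have "coprime r p" using r(1) pprime primes_coprime by blast
      then obtain u v where uv: "r * u = p * v + 1"
        using coprime_bezout_strong[of r p] p1 by auto
      have "add_pow K (r * u) z = \<zero>\<^bsub>K\<^esub>"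
        using add.nat_pow_pow[OF zK, of u r] rz by (simp add: mult.commute add.nat_pow_one)
      moreover have "add_pow K (p * v + 1) z = add_pow K (p * v) z \<oplus>\<^bsub>K\<^esub> add_pow K (1::nat) z"
        by (rule add.nat_pow_mult[OF zK, symmetric])
      moreover have "add_pow K (p * v) z = \<zero>\<^bsub>K\<^esub>"
        using add.nat_pow_pow[OF zK, of v p] pz[OF zK] by (simp add: mult.commute add.nat_pow_one)
      moreover have "add_pow K (1::nat) z = z" using zK by (simp add: add_pow_def)
      ultimately show False using uv z(2) zK by simp
    qed
  qed
  then show thesis using that pprime p(2) by blast
qed

lemma frobenius_finite:
  assumes K: "field K" "finite (carrier K)" and L: "field L" "finite (carrier L)" and \<iota>: "\<iota> \<in> ring_hom K L"
  defines "\<phi> \<equiv> \<lambda>b. b [^]\<^bsub>L\<^esub> card (carrier K)"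
  shows "\<phi> \<in> ring_hom L L" and "k \<in> carrier K ==> \<phi> (\<iota> k) = \<iota> k"
    and "\<exists>e>0. \<forall>b\<in>carrier L. (\<phi> ^^ e) b = b"
proof -
  interpret K: field K by fact
  interpret L: field L by fact
  obtain p n where p: "Factorial_Ring.prime (p::nat)" "card (carrier K) = p ^ n" "add_pow K p \<one>\<^bsub>K\<^esub> = \<zero>\<^bsub>K\<^esub>"
    using finite_field_prime_power[OF K] .
  have \<iota>_add: "additive_map K L \<iota>" using \<iota> by (auto simp: additive_map_def ring_hom_closed ring_hom_add)
  have \<iota>0: "\<iota> \<zero>\<^bsub>K\<^esub> = \<zero>\<^bsub>L\<^esub>" using additive_map_zero[OF K.abelian_group_axioms L.abelian_group_axioms \<iota>_add] .
  have "\<iota> (add_pow K m \<one>\<^bsub>K\<^esub>) = add_pow L m \<one>\<^bsub>L\<^esub>" for m :: nat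
    by (induction m) (simp_all add: add_pow_def \<iota>0 ring_hom_add[OF \<iota>] ring_hom_one[OF \<iota>] K.add.nat_pow_closed[unfolded add_pow_def])
  then have "add_pow L p \<one>\<^bsub>L\<^esub> = \<zero>\<^bsub>L\<^esub>" using p(3) \<iota>0 by metis
  then have pz: "add_pow L p z = \<zero>\<^bsub>L\<^esub>" if "z \<in> carrier L" for z
    using L.add_pow_ldistr[of "\<one>\<^bsub>L\<^esub>" z p] that by simp
  have add: "(x \<oplus>\<^bsub>L\<^esub> y) [^]\<^bsub>L\<^esub> (p ^ m) = x [^]\<^bsub>L\<^esub> (p ^ m) \<oplus>\<^bsub>L\<^esub> y [^]\<^bsub>L\<^esub> (p ^ m)"
    if "x \<in> carrier L" "y \<in> carrier L" for x y m
  proof (induction m)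
    case 0 then show ?case using that by simp
  next
    case (Suc m)
    have "(x \<oplus>\<^bsub>L\<^esub> y) [^]\<^bsub>L\<^esub> (p ^ Suc m) = ((x \<oplus>\<^bsub>L\<^esub> y) [^]\<^bsub>L\<^esub> (p ^ m)) [^]\<^bsub>L\<^esub> p"
      using that L.nat_pow_pow[of "x \<oplus>\<^bsub>L\<^esub> y" "p ^ m" p] by (simp add: mult.commute)
    also have "\<dots> = (x [^]\<^bsub>L\<^esub> (p ^ m)) [^]\<^bsub>L\<^esub> p \<oplus>\<^bsub>L\<^esub> (y [^]\<^bsub>L\<^esub> (p ^ m)) [^]\<^bsub>L\<^esub> p"
      unfolding Suc using that by (intro L.frobenius_add_prime p(1) pz) auto
    finally show ?case using that L.nat_pow_pow[of x "p ^ m" p] L.nat_pow_pow[of y "p ^ m" p] by (simp add: mult.commute)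
  qed
  show hom: "\<phi> \<in> ring_hom L L"
    by (rule ring_hom_memI) (auto simp: \<phi>_def p(2) add L.nat_pow_distrib)
  \<comment> \<open>Lagrange's theorem in the multiplicative group. It shows that the Frobenius of
    \<open>L\<close> fixes the image of \<open>K\<close>, as required for it to induce a map on
    tensor products over \<open>K\<close>.\<close>
  have kq: "k [^]\<^bsub>K\<^esub> card (carrier K) = k" if "k \<in> carrier K" for k
  proof (cases "k = \<zero>\<^bsub>K\<^esub>")
    case True
    have "card (carrier K) \<noteq> 0" using K(2) K.zero_closed by auto
    then show ?thesis using True by (metis K.nat_pow_zero)
  next
    case False
    have ord: "order (Multiplicative_Group.mult_of K) = card (carrier K) - 1" using K(2) by (simp add: order_def)
    have "k [^]\<^bsub>K\<^esub> (card (carrier K) - 1) = \<one>\<^bsub>K\<^esub>"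
      using group.pow_order_eq_1[OF K.field_mult_group, of k] that False unfolding ord by (simp add: Multiplicative_Group.nat_pow_mult_of)
    moreover have "card (carrier K) > 0" using K(2) K.zero_closed by (auto simp: card_gt_0_iff)
    then have "card (carrier K) = Suc (card (carrier K) - 1)" by simp
    ultimately show ?thesis using that K.nat_pow_Suc[of k "card (carrier K) - 1"] by simp
  qed
  have "\<iota> (k [^]\<^bsub>K\<^esub> m) = \<iota> k [^]\<^bsub>L\<^esub> m" if "k \<in> carrier K" for m :: nat and k
    using that by (induction m) (simp_all add: ring_hom_one[OF \<iota>] ring_hom_mult[OF \<iota>])
  then show "\<phi> (\<iota> k) = \<iota> k" if "k \<in> carrier K" using kq[OF that] that unfolding \<phi>_def by metis
  have inj: "inj_on \<phi> (carrier L)"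
  proof (rule inj_onI)
    fix x y assume xy: "x \<in> carrier L" "y \<in> carrier L" "\<phi> x = \<phi> y"
    have "additive_map L L \<phi>" using hom by (auto simp: additive_map_def ring_hom_closed ring_hom_add)
    then have "\<phi> (x \<ominus>\<^bsub>L\<^esub> y) = \<phi> x \<ominus>\<^bsub>L\<^esub> \<phi> y"
      using additive_map_minus[OF L.abelian_group_axioms L.abelian_group_axioms] xy by blast
    also have "\<dots> = \<zero>\<^bsub>L\<^esub>" unfolding xy(3) using ring_hom_closed[OF hom xy(2)] by (simp add: L.minus_eq L.r_neg)
    finally have 0: "(x \<ominus>\<^bsub>L\<^esub> y) [^]\<^bsub>L\<^esub> card (carrier K) = \<zero>\<^bsub>L\<^esub>" by (simp add: \<phi>_def)
    have "z = \<zero>\<^bsub>L\<^esub>" if "z \<in> carrier L" "z [^]\<^bsub>L\<^esub> m = \<zero>\<^bsub>L\<^esub>" for z and m :: nat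
      using that by (induction m) (auto dest: L.integral)
    then have "x \<ominus>\<^bsub>L\<^esub> y = \<zero>\<^bsub>L\<^esub>" using 0 xy by blast
    then show "x = y" by (rule L.minus_eq_zeroD[OF xy(1,2)])
  qed
  have self: "\<phi> ` carrier L \<subseteq> carrier L" using ring_hom_closed[OF hom] by blast
  have iter: "(\<phi> ^^ m) b \<in> carrier L" if "b \<in> carrier L" for m b
    using that self by (induction m) auto
  have inj_iter: "inj_on (\<phi> ^^ m) (carrier L)" for m
  proof (induction m)
    case (Suc m)
    have "inj_on (\<phi> \<circ> (\<phi> ^^ m)) (carrier L)"
      by (rule comp_inj_on[OF Suc inj_on_subset[OF inj]]) (use iter in blast)
    then show ?case by (simp only: funpow.simps)
  qed simp
  \<comment> \<open>Restricted to the finite carrier, the iterates lie in a finite set of functions,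
    so two of them coincide; injectivity then cancels the smaller exponent and leaves a
    period.\<close>
  define r where "r m = restrict (\<phi> ^^ m) (carrier L)" for m
  have "range r \<subseteq> carrier L \<rightarrow>\<^sub>E carrier L" using iter by (auto simp: r_def)
  moreover have "finite (carrier L \<rightarrow>\<^sub>E carrier L)" using L(2) by (intro finite_PiE) auto
  ultimately have "finite (range r)" by (rule finite_subset)
  then have "\<not> inj r" using finite_imageD infinite_UNIV_nat by blast
  then obtain i j where ij: "i < j" "r i = r j" by (metis injI linorder_neqE_nat)
  have "(\<phi> ^^ (j - i)) b = b" if b: "b \<in> carrier L" for b
  proof -
    have "(\<phi> ^^ i) b = (\<phi> ^^ (i + (j - i))) b" using fun_cong[OF ij(2), of b] b ij(1) by (simp add: r_def)
    also have "\<dots> = (\<phi> ^^ i) ((\<phi> ^^ (j - i)) b)" by (simp only: funpow_add comp_apply)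
    finally show ?thesis using inj_onD[OF inj_iter _ b iter[OF b]] by metis
  qed
  then show "\<exists>e>0. \<forall>b\<in>carrier L. (\<phi> ^^ e) b = b" using ij(1) by (intro exI[of _ "j - i"]) auto
qed

section \<open>Points of a curve as discrete valuation rings\<close>

lemma cring_restrict: "subring P F ==> cring F ==> cring (F\<lparr>carrier := P\<rparr>)"
  by (metis cring.axioms(1) cring.subcringI' ring.subcring_iff subringE(1))

text \<open>Units of the local ring are expressed by inverses in \<open>F\<close>, which keeps all
  computations inside one field; \<open>Units_restrict\<close> identifies the two notions.\<close>

definition dvr_units :: "('f, 'x) ring_scheme \<Rightarrow> 'f set \<Rightarrow> 'f set"
  where "dvr_units F P = {x \<in> P. x \<noteq> \<zero>\<^bsub>F\<^esub> \<and> inv\<^bsub>F\<^esub> x \<in> P}"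

lemma (in field) inv_closed_field: "x \<in> carrier R ==> x \<noteq> \<zero> ==> inv x \<in> carrier R"
  by (simp add: field_Units)

lemma (in field) inv_field:
  assumes "x \<in> carrier R" "x \<noteq> \<zero>"
  shows "inv x \<noteq> \<zero>" "inv x \<otimes> x = \<one>" "x \<otimes> inv x = \<one>" "inv (inv x) = x"
proof -
  have U: "x \<in> Units R" using assms by (simp add: field_Units)
  show "inv x \<otimes> x = \<one>" "x \<otimes> inv x = \<one>" "inv (inv x) = x"
    using U by auto
  then show "inv x \<noteq> \<zero>" using assms(1) one_not_zero by (metis r_null)
qed

lemma (in field) inv_mult:
  assumes "x \<in> carrier R" "x \<noteq> \<zero>" "y \<in> carrier R" "y \<noteq> \<zero>"
  shows "inv (x \<otimes> y) = inv x \<otimes> inv y"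
proof (rule comm_inv_char)
  have c: "inv x \<in> carrier R" "inv y \<in> carrier R" using assms inv_closed_field by auto
  have "(x \<otimes> y) \<otimes> (inv x \<otimes> inv y) = (x \<otimes> inv x) \<otimes> (y \<otimes> inv y)"
    using assms c by (simp add: m_ac)
  then show "(x \<otimes> y) \<otimes> (inv x \<otimes> inv y) = \<one>" using assms by (simp add: inv_field)
qed (use assms inv_closed_field in auto)

locale valuation_point = field F for F :: "('f, 'x) ring_scheme" (structure) +
  fixes k P
  assumes P: "P \<in> closed_points F k"
begin

lemma P_subring: "subring P F" and k_P: "k \<subseteq> P" and P_proper: "P \<noteq> carrier F"
  and P_val: "x \<in> carrier F ==> x \<noteq> \<zero> ==> x \<in> P \<or> inv x \<in> P" and P_pid: "principal_domain (F\<lparr>carrier := P\<rparr>)"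
  using P by (auto simp: closed_points_def)

lemma P_carrier: "x \<in> P ==> x \<in> carrier F"
  using subringE(1)[OF P_subring] by blast

lemmas P_zero = subringE(2)[OF P_subring] and P_one = subringE(3)[OF P_subring]
  and P_uminus = subringE(5)[OF P_subring] and P_mult = subringE(6)[OF P_subring] and P_add = subringE(7)[OF P_subring]

abbreviation "U \<equiv> dvr_units F P"

lemma U_iff: "x \<in> U \<longleftrightarrow> x \<in> P \<and> x \<noteq> \<zero> \<and> inv x \<in> P"
  by (simp add: dvr_units_def)

lemma Units_restrict: "Units (F\<lparr>carrier := P\<rparr>) = U"
proof (intro equalityI subsetI)
  fix x assume "x \<in> Units (F\<lparr>carrier := P\<rparr>)"
  then obtain y where xy: "x \<in> P" "y \<in> P" "x \<otimes> y = \<one>" "y \<otimes> x = \<one>" by (auto simp: Units_def)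
  have "x \<noteq> \<zero>" using xy P_carrier one_not_zero by (metis l_null)
  moreover have "inv x = y" using xy P_carrier by (intro comm_inv_char) auto
  ultimately show "x \<in> U" using xy by (simp add: U_iff)
next
  fix x assume x: "x \<in> U"
  then show "x \<in> Units (F\<lparr>carrier := P\<rparr>)"
    using inv_field(2,3)[of x] P_carrier[of x] unfolding U_iff Units_def by auto
qed

lemma max_ideal_eq: "max_ideal F P = P - U"
  by (simp add: max_ideal_def Units_restrict)

lemma U_mult: "x \<in> U ==> y \<in> U ==> x \<otimes> y \<in> U"
  using P_carrier[of x] P_carrier[of y] by (auto simp: U_iff P_mult inv_mult integral_iff)

lemma U_inv: "x \<in> U ==> inv x \<in> U"
  using P_carrier[of x] by (auto simp: U_iff inv_field)

lemma nonunit_mult: "x \<in> P - U ==> y \<in> P ==> x \<otimes> y \<in> P - U"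
proof -
  assume x: "x \<in> P - U" and y: "y \<in> P"
  have "x \<in> U" if u: "x \<otimes> y \<in> U"
  proof -
    have c: "x \<in> carrier F" "y \<in> carrier F" "x \<noteq> \<zero>" "y \<noteq> \<zero>" using x y u P_carrier by (auto simp: U_iff)
    have "inv x = inv (x \<otimes> y) \<otimes> y"
      using c inv_closed_field[of x] inv_closed_field[of y] by (simp add: inv_mult m_assoc inv_field)
    then show ?thesis using x y u c P_mult by (auto simp: U_iff)
  qed
  then show ?thesis using x y P_mult by auto
qed

text \<open>If \<open>x / y\<close> lies in \<open>P\<close>, then
  \<open>x + y = y (x / y + 1)\<close> is a multiple of the nonunit \<open>y\<close>. The valuation
  property ensures this up to exchanging \<open>x\<close> and \<open>y\<close>.\<close>

lemma nonunit_add: "x \<in> P - U ==> y \<in> P - U ==> x \<oplus> y \<in> P - U"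
proof -
  have *: "x \<oplus> y \<in> P - U" if x: "x \<in> P - U" and y: "y \<in> P - U" and nz: "y \<noteq> \<zero>" and q: "x \<otimes> inv y \<in> P" for x y
  proof -
    have c: "x \<in> carrier F" "y \<in> carrier F" "inv y \<in> carrier F" using x y nz P_carrier inv_closed_field by auto
    have "x \<oplus> y = y \<otimes> (x \<otimes> inv y \<oplus> \<one>)"
    proof -
      have "y \<otimes> (x \<otimes> inv y \<oplus> \<one>) = x \<otimes> (y \<otimes> inv y) \<oplus> y" using c by (simp add: r_distr m_lcomm)
      then show ?thesis using c nz by (simp add: inv_field)
    qed
    then show ?thesis using nonunit_mult[OF y P_add[OF q P_one]] by simp
  qed
  assume x: "x \<in> P - U" and y: "y \<in> P - U"
  have c: "x \<in> carrier F" "y \<in> carrier F" using x y P_carrier by auto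
  show "x \<oplus> y \<in> P - U"
  proof (cases "x = \<zero> \<or> y = \<zero>")
    case True then show ?thesis using x y c by auto
  next
    case False
    have ci: "inv x \<in> carrier F" "inv y \<in> carrier F" using c False inv_closed_field by auto
    have "x \<otimes> inv y \<noteq> \<zero>" using False c ci inv_field(1) by (auto simp: integral_iff)
    then have "x \<otimes> inv y \<in> P \<or> inv (x \<otimes> inv y) \<in> P" using c ci by (intro P_val) auto
    moreover have "inv (x \<otimes> inv y) = y \<otimes> inv x"
      using c ci False by (simp add: inv_mult inv_field m_comm)
    ultimately show ?thesis using *[OF x y] *[OF y x] False c by (auto simp: a_comm)
  qed
qed

lemma nonunit_zero: "\<zero> \<in> P - U"
  using P_zero by (simp add: U_iff)

lemma nonunit_uminus: "x \<in> P - U ==> \<ominus> x \<in> P - U"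
proof -
  assume x: "x \<in> P - U"
  then have "x \<otimes> (\<ominus> \<one>) \<in> P - U" by (intro nonunit_mult P_uminus P_one)
  then show "\<ominus> x \<in> P - U" using x P_carrier by (simp add: r_minus)
qed

lemma one_U: "\<one> \<in> U"
  using P_one by (simp add: U_iff)

lemma ideal_restrictI:
  assumes "I \<subseteq> P" "\<zero> \<in> I" "\<And>x y. x \<in> I ==> y \<in> I ==> x \<oplus> y \<in> I" "\<And>x a. x \<in> I ==> a \<in> P ==> a \<otimes> x \<in> I"
  shows "ideal I (F\<lparr>carrier := P\<rparr>)"
proof -
  interpret PR: principal_domain "F\<lparr>carrier := P\<rparr>" by (rule P_pid)
  have um: "\<ominus> x \<in> I" if "x \<in> I" for x
    using assms(4)[OF that P_uminus[OF P_one]] assms(1) that P_carrier by (auto simp: l_minus)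
  have "inv\<^bsub>add_monoid (F\<lparr>carrier := P\<rparr>)\<^esub> x \<in> I" if x: "x \<in> I" for x
  proof -
    have "\<ominus>\<^bsub>F\<lparr>carrier := P\<rparr>\<^esub> x = \<ominus> x"
      by (rule PR.minus_equality) (use assms(1) x um[OF x] P_carrier in \<open>auto simp: l_neg\<close>)
    then show ?thesis using um[OF x] by (simp add: a_inv_def)
  qed
  then show ?thesis
  proof (intro idealI PR.ring_axioms subgroup.intro)
    fix a x assume a: "a \<in> I" "x \<in> carrier (F\<lparr>carrier := P\<rparr>)"
    then show "x \<otimes>\<^bsub>F\<lparr>carrier := P\<rparr>\<^esub> a \<in> I" using assms(4) by simp
    then show "a \<otimes>\<^bsub>F\<lparr>carrier := P\<rparr>\<^esub> x \<in> I" using a assms(1) P_carrier by (auto simp: m_comm[of a x])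
  qed (use assms in auto)
qed

lemma ideal_generator:
  assumes "I \<subseteq> P" "\<zero> \<in> I" "\<And>x y. x \<in> I ==> y \<in> I ==> x \<oplus> y \<in> I" "\<And>x a. x \<in> I ==> a \<in> P ==> a \<otimes> x \<in> I"
  obtains g where "g \<in> I" "\<And>x. x \<in> I ==> \<exists>a\<in>P. x = a \<otimes> g"
proof -
  interpret PR: principal_domain "F\<lparr>carrier := P\<rparr>" by (rule P_pid)
  obtain g where g: "g \<in> P" "I = PIdl\<^bsub>F\<lparr>carrier := P\<rparr>\<^esub> g"
    using PR.exists_gen[OF ideal_restrictI[OF assms]] by auto
  have I: "I = {a \<otimes> g |a. a \<in> P}" using g(2) by (auto simp: cgenideal_def)
  have "\<one> \<otimes> g \<in> I" unfolding I using P_one by blast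
  then show thesis using that[of g] I g P_carrier by auto
qed

section \<open>Uniformizers and orders of functions\<close>

definition unif :: "'f \<Rightarrow> bool"
  where "unif t \<longleftrightarrow> t \<in> P - U \<and> t \<noteq> \<zero> \<and> (\<forall>x\<in>P - U. \<exists>y\<in>P. x = t \<otimes> y)"

text \<open>The maximal ideal is principal, and its generator is nonzero because \<open>P\<close> is
  not the whole field: an element outside \<open>P\<close> has a nonzero inverse in the maximal
  ideal.\<close>

lemma exists_unif: "\<exists>t. unif t"
proof -
  obtain g where g: "g \<in> P - U" "\<And>x. x \<in> P - U ==> \<exists>a\<in>P. x = a \<otimes> g"
    by (rule ideal_generator[of "P - U"]) (use nonunit_zero nonunit_add nonunit_mult P_carrier m_comm in auto)
  obtain x where x: "x \<in> carrier F" "x \<notin> P" using P_proper subringE(1)[OF P_subring] by blast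
  then have nz: "x \<noteq> \<zero>" using P_zero by auto
  then have i: "inv x \<in> P - U" using P_val[OF x(1)] x by (auto simp: U_iff inv_field)
  obtain a where "a \<in> P" "inv x = a \<otimes> g" using g(2)[OF i] by blast
  then have "g \<noteq> \<zero>" using inv_field(1)[OF x(1) nz] P_carrier by auto
  moreover have "\<exists>y\<in>P. x = g \<otimes> y" if "x \<in> P - U" for x
    using g(2)[OF that] g(1) P_carrier by (auto simp: m_comm)
  ultimately show ?thesis using g(1) by (auto simp: unif_def)
qed

lemma unif_iff: "uniformizer F P t \<longleftrightarrow> unif t"
proof
  assume u: "uniformizer F P t"
  then have t: "t \<in> P" "P - U = {t \<otimes> x |x. x \<in> P}" by (auto simp: uniformizer_def max_ideal_eq)
  have "t \<otimes> \<one> \<in> P - U" unfolding t(2) using P_one by blast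
  then have tm: "t \<in> P - U" using t(1) P_carrier by simp
  obtain s where s: "unif s" using exists_unif by blast
  then have "s \<in> P - U" "s \<noteq> \<zero>" by (auto simp: unif_def)
  then obtain y where "y \<in> P" "s = t \<otimes> y" using t(2) by blast
  then have "t \<noteq> \<zero>" using \<open>s \<noteq> \<zero>\<close> P_carrier by auto
  then show "unif t" using tm t(2) by (auto simp: unif_def)
next
  assume t: "unif t"
  then have "P - U = {t \<otimes> x |x. x \<in> P}" using nonunit_mult[of t] by (auto simp: unif_def)
  then show "uniformizer F P t" using t by (auto simp: uniformizer_def max_ideal_eq unif_def)
qed

text \<open>Powers are taken in the multiplicative group of the field, which makes negative
  exponents available.\<close>

definition tp :: "'f \<Rightarrow> int \<Rightarrow> 'f"
  where "tp t n = t [^]\<^bsub>Multiplicative_Group.mult_of F\<^esub> n"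

context
  fixes t assumes t: "unif t"
begin

lemma t_P: "t \<in> P" and t_nz: "t \<noteq> \<zero>" and t_nU: "t \<notin> U" and t_carrier: "t \<in> carrier F"
  and t_gen: "x \<in> P - U ==> \<exists>y\<in>P. x = t \<otimes> y"
  using t P_carrier by (auto simp: unif_def)

lemma tp_closed: "tp t n \<in> carrier F" and tp_nz: "tp t n \<noteq> \<zero>"
  using group.int_pow_closed[OF field_mult_group, of t n] t_carrier t_nz by (auto simp: tp_def)

lemma tp_add: "tp t (m + n) = tp t m \<otimes> tp t n"
  using group.int_pow_mult[OF field_mult_group, of t m n] t_carrier t_nz by (simp add: tp_def)

lemma tp_0: "tp t 0 = \<one>"
  by (simp add: tp_def)

lemma tp_nat: "tp t (int n) = t [^] n"
  by (simp add: tp_def int_pow_int Multiplicative_Group.nat_pow_mult_of)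

lemma tp_1: "tp t 1 = t"
  using tp_nat[of 1] t_carrier by simp

lemma tp_inverse: "tp t n \<otimes> tp t (- n) = \<one>"
  using tp_add[of n "- n"] tp_0 by simp

lemma tp_inv: "inv (tp t n) = tp t (- n)"
  using tp_inverse tp_closed by (intro comm_inv_char) auto

lemma tp_nonneg: "n \<ge> 0 ==> tp t n \<in> P"
proof -
  have "t [^] m \<in> P" for m :: nat by (induction m) (auto simp: P_one P_mult t_P)
  then show "n \<ge> 0 ==> tp t n \<in> P" using tp_nat by (metis zero_le_imp_eq_int)
qed

lemma tp_pos: "n > 0 ==> tp t n \<in> P - U"
  using nonunit_mult[of t "tp t (n - 1)"] tp_nonneg[of "n - 1"] tp_add[of 1 "n - 1"] tp_1 t_P t_nU by simp

text \<open>The elements divisible by all powers of \<open>t\<close> form an ideal, which has a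
  generator \<open>g\<close>. The quotient of \<open>g\<close> by \<open>t\<close> belongs to it as
  well and is a multiple \<open>a g\<close>. Thus \<open>g = t a g\<close>, and a nonzero
  \<open>g\<close> would make \<open>t\<close> a unit.\<close>

lemma t_separated:
  assumes x: "x \<in> P" "\<And>n. \<exists>y\<in>P. x = t [^] (n::nat) \<otimes> y"
  shows "x = \<zero>"
proof -
  define I where "I = {x \<in> P. \<forall>n::nat. \<exists>y\<in>P. x = t [^] n \<otimes> y}"
  obtain g where g: "g \<in> I" "\<And>x. x \<in> I ==> \<exists>a\<in>P. x = a \<otimes> g"
  proof (rule ideal_generator[of I])
    show "I \<subseteq> P" by (auto simp: I_def)
    show "\<zero> \<in> I" using P_zero t_carrier by (auto simp: I_def intro!: bexI[of _ \<zero>])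
    show "x \<oplus> y \<in> I" if "x \<in> I" "y \<in> I" for x y
    proof -
      have "\<exists>z\<in>P. x \<oplus> y = t [^] n \<otimes> z" for n :: nat
      proof -
        obtain u v where "u \<in> P" "v \<in> P" "x = t [^] n \<otimes> u" "y = t [^] n \<otimes> v" using \<open>x \<in> I\<close> \<open>y \<in> I\<close> unfolding I_def by blast
        then show ?thesis using P_carrier t_carrier by (intro bexI[of _ "u \<oplus> v"] P_add) (simp_all add: r_distr)
      qed
      then show ?thesis using that P_add by (auto simp: I_def)
    qed
    show "a \<otimes> x \<in> I" if "x \<in> I" "a \<in> P" for x a
    proof -
      have "\<exists>z\<in>P. a \<otimes> x = t [^] n \<otimes> z" for n :: nat
      proof -
        obtain u where "u \<in> P" "x = t [^] n \<otimes> u" using \<open>x \<in> I\<close> unfolding I_def by blast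
        then show ?thesis using P_carrier t_carrier \<open>a \<in> P\<close> by (intro bexI[of _ "a \<otimes> u"] P_mult) (simp_all add: m_lcomm)
      qed
      then show ?thesis using that P_mult by (auto simp: I_def)
    qed
  qed blast
  have gP: "g \<in> P" using g(1) by (simp add: I_def)
  have "\<exists>y\<in>P. g = t [^] (1::nat) \<otimes> y" using g(1) unfolding I_def by blast
  then obtain y where y: "y \<in> P" "g = t \<otimes> y" using t_carrier by auto
  have yc: "y \<in> carrier F" using y P_carrier by blast
  have "y \<in> I"
  proof -
    have "\<exists>z\<in>P. y = t [^] n \<otimes> z" for n :: nat
    proof -
      obtain z where z: "z \<in> P" "g = t [^] Suc n \<otimes> z" using g(1) unfolding I_def by blast
      then have "t \<otimes> y = t \<otimes> (t [^] n \<otimes> z)" using y P_carrier t_carrier by (simp add: m_ac)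
      then have "y = t [^] n \<otimes> z" using m_lcancel[OF t_nz t_carrier, of y "t [^] n \<otimes> z"] yc z P_carrier t_carrier by simp
      then show ?thesis using z by blast
    qed
    then show ?thesis using y by (simp add: I_def)
  qed
  then obtain a where a: "a \<in> P" "y = a \<otimes> g" using g(2) by blast
  have "g = \<zero>"
  proof (rule ccontr)
    assume nz: "g \<noteq> \<zero>"
    have "g \<otimes> (t \<otimes> a) = g \<otimes> \<one>" using y(2) a P_carrier gP t_carrier by (simp add: m_ac)
    then have "t \<otimes> a = \<one>" using m_lcancel[OF nz, of "t \<otimes> a" \<one>] a P_carrier gP t_carrier by simp
    then have "\<one> \<in> P - U" using nonunit_mult[of t a] t_P t_nU a by simp
    then show False using one_U by blast
  qed
  moreover have "x \<in> I" using x by (simp add: I_def)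
  ultimately show "x = \<zero>" using g(2)[of x] P_carrier by auto
qed

lemma tp_decompose:
  assumes x: "x \<in> carrier F" "x \<noteq> \<zero>"
  obtains n u where "u \<in> U" "x = tp t n \<otimes> u"
proof -
  have *: "\<exists>n. \<exists>u\<in>U. x = tp t n \<otimes> u" if x: "x \<in> P" "x \<noteq> \<zero>" for x
  proof -
    have "\<not> (\<forall>n::nat. \<exists>y\<in>P. x = t [^] n \<otimes> y)" using t_separated[OF x(1)] x(2) by blast
    then have ex: "\<exists>n::nat. \<not> (\<exists>y\<in>P. x = t [^] n \<otimes> y)" by blast
    \<comment> \<open>The least power of \<open>t\<close> that does not divide \<open>x\<close>. It
      is positive, since \<open>t [^] 0\<close> divides everything, and the cofactor of the
      preceding power is a unit.\<close>
    define n where "n = (LEAST n::nat. \<not> (\<exists>y\<in>P. x = t [^] n \<otimes> y))"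
    have n: "\<not> (\<exists>y\<in>P. x = t [^] n \<otimes> y)" "\<And>m. m < n ==> \<exists>y\<in>P. x = t [^] m \<otimes> y"
      unfolding n_def using LeastI_ex[OF ex] not_less_Least by blast+
    have "n \<noteq> 0"
    proof
      assume "n = 0"
      then have "x = t [^] n \<otimes> x" using x(1) P_carrier by simp
      then show False using n(1) x(1) by blast
    qed
    then obtain m where m: "n = Suc m" by (cases n) auto
    obtain y where y: "y \<in> P" "x = t [^] m \<otimes> y" using n(2)[of m] m by auto
    have "y \<in> U"
    proof (rule ccontr)
      assume "y \<notin> U"
      then obtain z where z: "z \<in> P" "y = t \<otimes> z" using t_gen[of y] y(1) by blast
      then have "x = t [^] n \<otimes> z" unfolding m y(2) using t_carrier P_carrier by (simp add: m_assoc)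
      then show False using n(1) z by blast
    qed
    then show ?thesis using y(2) tp_nat[of m] by metis
  qed
  show thesis
  proof (cases "x \<in> P")
    case True then show ?thesis using *[of x] x that by blast
  next
    case False
    then have "inv x \<in> P" "inv x \<noteq> \<zero>" using P_val[OF x] inv_field(1)[OF x] by auto
    then obtain n u where u: "u \<in> U" "inv x = tp t n \<otimes> u" using * by blast
    have "x = inv (tp t n \<otimes> u)" using inv_field(4)[OF x] u(2) by simp
    also have "\<dots> = tp t (- n) \<otimes> inv u" using u(1) P_carrier tp_closed tp_nz by (simp add: inv_mult tp_inv U_iff)
    finally show ?thesis using that[OF U_inv[OF u(1)]] by blast
  qed
qed

end

end

text \<open>An element of \<open>P'\<close> outside \<open>P\<close> is a unit of \<open>P\<close>
  times a negative power \<open>tp t n\<close>. Multiplying by \<open>tp t (- n - 1)\<close>, which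
  lies in \<open>P\<close>, puts the inverse of \<open>t\<close> into \<open>P'\<close>; then all
  powers of \<open>t\<close>, and with them the whole field, lie in \<open>P'\<close>.\<close>

lemma closed_points_maximal:
  assumes "field F" "P \<in> closed_points F k" "P' \<in> closed_points F k" "P \<subseteq> P'"
  shows "P = P'"
proof (rule ccontr)
  assume "P \<noteq> P'"
  interpret V: valuation_point F k P using assms by (simp add: valuation_point_def valuation_point_axioms_def)
  interpret V': valuation_point F k P' using assms by (simp add: valuation_point_def valuation_point_axioms_def)
  obtain y where y: "y \<in> P'" "y \<notin> P" using assms(4) \<open>P \<noteq> P'\<close> by blast
  obtain t where t: "V.unif t" using V.exists_unif by blast
  have yc: "y \<in> carrier F" "y \<noteq> \<zero>\<^bsub>F\<^esub>" using y V'.P_carrier V.P_zero by auto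
  obtain n u where n: "u \<in> V.U" "y = V.tp t n \<otimes>\<^bsub>F\<^esub> u" using V.tp_decompose[OF t yc] by blast
  have uc: "u \<in> carrier F" "u \<in> P" "inv\<^bsub>F\<^esub> u \<in> P" "u \<noteq> \<zero>\<^bsub>F\<^esub>" using n(1) V.P_carrier by (auto simp: V.U_iff)
  have neg: "n < 0"
  proof (rule ccontr)
    assume "\<not> n < 0"
    then have "V.tp t n \<in> P" using V.tp_nonneg[OF t] by simp
    then show False using n uc V.P_mult y by simp
  qed
  have "y \<otimes>\<^bsub>F\<^esub> inv\<^bsub>F\<^esub> u = V.tp t n"
    unfolding n(2) using uc V.inv_closed_field[of u] V.tp_closed[OF t] by (simp add: V.m_assoc V.inv_field)
  then have "V.tp t n \<in> P'" using V'.P_mult[OF y(1), of "inv\<^bsub>F\<^esub> u"] uc assms(4) by auto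
  moreover have "V.tp t (- n - 1) \<in> P'" using V.tp_nonneg[OF t, of "- n - 1"] neg assms(4) by auto
  ultimately have "V.tp t n \<otimes>\<^bsub>F\<^esub> V.tp t (- n - 1) \<in> P'" by (rule V'.P_mult)
  then have m1: "V.tp t (-1) \<in> P'" using V.tp_add[OF t, of n "- n - 1"] by simp
  have mneg: "V.tp t (- int m) \<in> P'" for m
  proof (induction m)
    case 0 then show ?case using V.tp_0[OF t] V'.P_one by simp
  next
    case (Suc m)
    have eq: "- int (Suc m) = - int m + (-1)" by simp
    show ?case unfolding eq V.tp_add[OF t] by (rule V'.P_mult[OF Suc m1])
  qed
  have tpP': "V.tp t m \<in> P'" for m
    using mneg[of "nat (- m)"] V.tp_nonneg[OF t, of m] assms(4) by (cases "m \<ge> 0") auto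
  have "x \<in> P'" if x: "x \<in> carrier F" for x
  proof (cases "x = \<zero>\<^bsub>F\<^esub>")
    case True then show ?thesis using V'.P_zero by simp
  next
    case False
    obtain m w where "w \<in> V.U" "x = V.tp t m \<otimes>\<^bsub>F\<^esub> w" using V.tp_decompose[OF t x False] by blast
    then show ?thesis using V'.P_mult[OF tpP'] assms(4) by (auto simp: V.U_iff)
  qed
  then show False using V'.P_proper V'.P_carrier by blast
qed

section \<open>The function field of the curve over the larger constant field\<close>

lemma (in module) finsum_smult_add:
  assumes "a \<in> I \<rightarrow> carrier R" "a' \<in> I \<rightarrow> carrier R" "e \<in> I \<rightarrow> carrier M"
  shows "(\<Oplus>\<^bsub>M\<^esub>i\<in>I. (a i \<oplus> a' i) \<odot>\<^bsub>M\<^esub> e i) = (\<Oplus>\<^bsub>M\<^esub>i\<in>I. a i \<odot>\<^bsub>M\<^esub> e i) \<oplus>\<^bsub>M\<^esub> (\<Oplus>\<^bsub>M\<^esub>i\<in>I. a' i \<odot>\<^bsub>M\<^esub> e i)"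
proof -
  have "(\<Oplus>\<^bsub>M\<^esub>i\<in>I. (a i \<oplus> a' i) \<odot>\<^bsub>M\<^esub> e i) = (\<Oplus>\<^bsub>M\<^esub>i\<in>I. a i \<odot>\<^bsub>M\<^esub> e i \<oplus>\<^bsub>M\<^esub> a' i \<odot>\<^bsub>M\<^esub> e i)"
    using assms by (intro M.finsum_cong') (auto simp: Pi_iff smult_l_distr)
  then show ?thesis using assms by (simp add: Pi_iff)
qed

lemma (in module) finsum_smult_smult:
  assumes "finite I" "a \<in> I \<rightarrow> carrier R" "s \<in> carrier R" "e \<in> I \<rightarrow> carrier M"
  shows "(\<Oplus>\<^bsub>M\<^esub>i\<in>I. (s \<otimes> a i) \<odot>\<^bsub>M\<^esub> e i) = s \<odot>\<^bsub>M\<^esub> (\<Oplus>\<^bsub>M\<^esub>i\<in>I. a i \<odot>\<^bsub>M\<^esub> e i)"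
  using assms by (subst finsum_smult_ldistr) (auto intro!: M.finsum_cong' simp: Pi_iff smult_assoc1)

text \<open>\<open>lam x b\<close> is the coordinate of \<open>b\<close> at the basis element
  \<open>x\<close>. Coordinates are carried along as functions, because maps on tensor products are
  defined by lifting them.\<close>

locale l_basis = K: field K + L: field L for K :: "('k, 'x) ring_scheme" and L :: "('l, 'y) ring_scheme" +
  fixes \<iota> :: "'k \<Rightarrow> 'l" and B :: "'l set" and lam :: "'l \<Rightarrow> 'l \<Rightarrow> 'k"
  assumes \<iota>: "\<iota> \<in> ring_hom K L" and B_finite: "finite B" and B_carrier: "B \<subseteq> carrier L"
    and lam_closed: "x \<in> B ==> b \<in> carrier L ==> lam x b \<in> carrier K"
    and lam_add: "x \<in> B ==> b \<in> carrier L ==> b' \<in> carrier L ==> lam x (b \<oplus>\<^bsub>L\<^esub> b') = lam x b \<oplus>\<^bsub>K\<^esub> lam x b'"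
    and lam_smult: "x \<in> B ==> k \<in> carrier K ==> b \<in> carrier L ==> lam x (\<iota> k \<otimes>\<^bsub>L\<^esub> b) = k \<otimes>\<^bsub>K\<^esub> lam x b"
    and lam_expand: "b \<in> carrier L ==> b = (\<Oplus>\<^bsub>L\<^esub>x\<in>B. \<iota> (lam x b) \<otimes>\<^bsub>L\<^esub> x)"
    and B_indep: "c \<in> B \<rightarrow> carrier K ==> (\<Oplus>\<^bsub>L\<^esub>x\<in>B. \<iota> (c x) \<otimes>\<^bsub>L\<^esub> x) = \<zero>\<^bsub>L\<^esub> ==> x \<in> B ==> c x = \<zero>\<^bsub>K\<^esub>"

lemma exists_l_basis:
  assumes K: "field K" and L: "field L" "finite (carrier L)" and \<iota>: "\<iota> \<in> ring_hom K L"
  shows "\<exists>B lam. l_basis K L \<iota> B lam"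
proof -
  interpret K: field K by fact
  interpret L: field L by fact
  define S where "S c B = (\<Oplus>\<^bsub>L\<^esub>x\<in>B. \<iota> (c x) \<otimes>\<^bsub>L\<^esub> x)" for c and B
  define spanning where "spanning B \<longleftrightarrow> B \<subseteq> carrier L \<and> (\<forall>b\<in>carrier L. \<exists>c\<in>B \<rightarrow> carrier K. b = S c B)" for B
  have ic: "\<iota> k \<in> carrier L" if "k \<in> carrier K" for k using that ring_hom_closed[OF \<iota>] by blast
  have \<iota>_additive: "additive_map K L \<iota>" using \<iota> by (auto simp: additive_map_def ring_hom_closed ring_hom_add)
  have \<iota>0: "\<iota> \<zero>\<^bsub>K\<^esub> = \<zero>\<^bsub>L\<^esub>" by (rule additive_map_zero[OF K.abelian_group_axioms L.abelian_group_axioms \<iota>_additive])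
  interpret LK: module K "module_along L \<iota>"
    by (rule module_along_module[OF K.cring_axioms L.cring_axioms \<iota>])
  have S_eq: "S c B = (\<Oplus>\<^bsub>module_along L \<iota>\<^esub>x\<in>B. c x \<odot>\<^bsub>module_along L \<iota>\<^esub> x)" for c B
    by (simp add: S_def finsum_def finprod_def foldD_def)
  have S_add: "S (\<lambda>x. c x \<oplus>\<^bsub>K\<^esub> c' x) B = S c B \<oplus>\<^bsub>L\<^esub> S c' B" if "c \<in> B \<rightarrow> carrier K" "c' \<in> B \<rightarrow> carrier K" "B \<subseteq> carrier L" for c c' B
    unfolding S_eq using LK.finsum_smult_add[OF that(1,2), of "\<lambda>x. x"] that(3) by auto
  have S_smult: "S (\<lambda>x. k \<otimes>\<^bsub>K\<^esub> c x) B = \<iota> k \<otimes>\<^bsub>L\<^esub> S c B" if "k \<in> carrier K" "c \<in> B \<rightarrow> carrier K" "B \<subseteq> carrier L" for c k B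
    unfolding S_eq using LK.finsum_smult_smult[OF finite_subset[OF that(3) L(2)] that(2,1), of "\<lambda>x. x"] that(3) by auto
  have "spanning (carrier L)"
    unfolding spanning_def
  proof (intro conjI ballI)
    fix b assume b: "b \<in> carrier L"
    define c where "c = (\<lambda>x. if x = b then \<one>\<^bsub>K\<^esub> else \<zero>\<^bsub>K\<^esub>)"
    have "S c (carrier L) = (\<Oplus>\<^bsub>L\<^esub>x\<in>carrier L. if b = x then x else \<zero>\<^bsub>L\<^esub>)"
      unfolding S_def by (rule L.finsum_cong') (auto simp: c_def \<iota>0 ring_hom_one[OF \<iota>])
    also have "\<dots> = b" by (rule L.add.finprod_singleton[OF b L(2)]) auto
    finally show "\<exists>c\<in>carrier L \<rightarrow> carrier K. b = S c (carrier L)" by (intro bexI[of _ c]) (auto simp: c_def)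
  qed simp
  \<comment> \<open>A spanning set of least cardinality is independent: a relation with a nonzero
    coefficient at \<open>x\<close> would allow \<open>x\<close> to be dropped.\<close>
  then obtain B where B: "spanning B" "\<And>B'. spanning B' ==> card B \<le> card B'"
    using ex_has_least_nat[of spanning "carrier L" card] by blast
  have BL: "B \<subseteq> carrier L" using B(1) by (simp add: spanning_def)
  have finB: "finite B" using finite_subset[OF BL L(2)] .
  have Sc: "S c B' \<in> carrier L" if "c \<in> B' \<rightarrow> carrier K" "B' \<subseteq> B" for c B'
    unfolding S_def using that ic BL by (intro L.finsum_closed) (auto simp: Pi_iff subset_iff)
  have indep: "c x = \<zero>\<^bsub>K\<^esub>" if c: "c \<in> B \<rightarrow> carrier K" "S c B = \<zero>\<^bsub>L\<^esub>" and x: "x \<in> B" for c x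
  proof (rule ccontr)
    assume nz: "c x \<noteq> \<zero>\<^bsub>K\<^esub>"
    have cx: "c x \<in> carrier K" using c x by auto
    let ?B = "B - {x}"
    have xL: "x \<in> carrier L" using x BL by blast
    have SB: "S d B = \<iota> (d x) \<otimes>\<^bsub>L\<^esub> x \<oplus>\<^bsub>L\<^esub> S d ?B" if "d \<in> B \<rightarrow> carrier K" for d
    proof -
      have "S d (insert x ?B) = \<iota> (d x) \<otimes>\<^bsub>L\<^esub> x \<oplus>\<^bsub>L\<^esub> S d ?B"
        unfolding S_def using that ic BL finB x by (intro L.finsum_insert) (auto simp: Pi_iff subset_iff)
      then show ?thesis using x by (simp add: insert_absorb)
    qed
    have "spanning ?B" unfolding spanning_def
    proof (intro conjI ballI)
      show "?B \<subseteq> carrier L" using BL by blast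
      fix b assume "b \<in> carrier L"
      then obtain d where d: "d \<in> B \<rightarrow> carrier K" "b = S d B" using B(1) unfolding spanning_def by blast
      have dx: "d x \<in> carrier K" using d x by auto
      \<comment> \<open>Adding \<open>k\<close> times the relation to the expansion of
        \<open>b\<close> leaves \<open>b\<close> unchanged and makes its coefficient at
        \<open>x\<close> vanish.\<close>
      define k where "k = \<ominus>\<^bsub>K\<^esub> (d x \<otimes>\<^bsub>K\<^esub> inv\<^bsub>K\<^esub> c x)"
      have ci: "inv\<^bsub>K\<^esub> c x \<in> carrier K" "inv\<^bsub>K\<^esub> c x \<otimes>\<^bsub>K\<^esub> c x = \<one>\<^bsub>K\<^esub>" using cx nz K.inv_closed_field K.inv_field by auto
      have k: "k \<in> carrier K" using dx ci by (simp add: k_def)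
      define d' where "d' y = d y \<oplus>\<^bsub>K\<^esub> k \<otimes>\<^bsub>K\<^esub> c y" for y
      have d': "d' \<in> B \<rightarrow> carrier K" using d c k by (auto simp: d'_def Pi_iff)
      have "k \<otimes>\<^bsub>K\<^esub> c x = \<ominus>\<^bsub>K\<^esub> d x" using dx cx ci by (simp add: k_def K.l_minus K.m_assoc)
      then have d'x: "d' x = \<zero>\<^bsub>K\<^esub>" using dx by (simp add: d'_def K.r_neg)
      have "S d' B = S d B \<oplus>\<^bsub>L\<^esub> S (\<lambda>y. k \<otimes>\<^bsub>K\<^esub> c y) B" unfolding d'_def using d c k BL by (intro S_add) auto
      also have "S (\<lambda>y. k \<otimes>\<^bsub>K\<^esub> c y) B = \<zero>\<^bsub>L\<^esub>" using S_smult[OF k c(1) BL] c(2) ic[OF k] by simp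
      finally have "S d' B = b" using d(2) Sc[OF d(1)] by simp
      then have "b = S d' ?B" using SB[OF d'] d'x \<iota>0 xL Sc[of d' ?B] d' by (auto simp: Pi_iff)
      then show "\<exists>c\<in>?B \<rightarrow> carrier K. b = S c ?B" using d' by blast
    qed
    then have "card B \<le> card ?B" by (rule B(2))
    moreover have "card ?B < card B" by (rule card_Diff1_less[OF finB x])
    ultimately show False by simp
  qed
  define cf where "cf b = (SOME c. c \<in> B \<rightarrow> carrier K \<and> b = S c B)" for b
  have cf: "cf b \<in> B \<rightarrow> carrier K" "b = S (cf b) B" if "b \<in> carrier L" for b
  proof -
    have "\<exists>c. c \<in> B \<rightarrow> carrier K \<and> b = S c B" using B(1) that unfolding spanning_def by blast
    from someI_ex[OF this] show "cf b \<in> B \<rightarrow> carrier K" "b = S (cf b) B" unfolding cf_def by blast+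
  qed
  have uniq: "c x = c' x" if c: "c \<in> B \<rightarrow> carrier K" "c' \<in> B \<rightarrow> carrier K" "S c B = S c' B" "x \<in> B" for c c' x
  proof -
    have m1: "\<ominus>\<^bsub>K\<^esub> \<one>\<^bsub>K\<^esub> \<in> carrier K" by simp
    define d where "d y = c y \<oplus>\<^bsub>K\<^esub> (\<ominus>\<^bsub>K\<^esub> \<one>\<^bsub>K\<^esub>) \<otimes>\<^bsub>K\<^esub> c' y" for y
    have d: "d \<in> B \<rightarrow> carrier K" using c by (auto simp: d_def Pi_iff)
    have mc: "(\<lambda>y. (\<ominus>\<^bsub>K\<^esub> \<one>\<^bsub>K\<^esub>) \<otimes>\<^bsub>K\<^esub> c' y) \<in> B \<rightarrow> carrier K" using c by (auto simp: Pi_iff)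
    have i1: "\<iota> (\<ominus>\<^bsub>K\<^esub> \<one>\<^bsub>K\<^esub>) = \<ominus>\<^bsub>L\<^esub> \<one>\<^bsub>L\<^esub>"
      using additive_map_uminus[OF K.abelian_group_axioms L.abelian_group_axioms \<iota>_additive, of "\<one>\<^bsub>K\<^esub>"] by (simp add: ring_hom_one[OF \<iota>])
    have "S d B = S c B \<oplus>\<^bsub>L\<^esub> S (\<lambda>y. (\<ominus>\<^bsub>K\<^esub> \<one>\<^bsub>K\<^esub>) \<otimes>\<^bsub>K\<^esub> c' y) B"
      unfolding d_def by (rule S_add[OF c(1) mc BL])
    also have "\<dots> = S c B \<oplus>\<^bsub>L\<^esub> (\<ominus>\<^bsub>L\<^esub> \<one>\<^bsub>L\<^esub>) \<otimes>\<^bsub>L\<^esub> S c' B" using S_smult[OF m1 c(2) BL] i1 by simp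
    also have "\<dots> = \<zero>\<^bsub>L\<^esub>" using c(3) Sc[OF c(2)] by (simp add: L.l_minus L.r_neg)
    finally have "d x = \<zero>\<^bsub>K\<^esub>" by (rule indep[OF d _ c(4)])
    moreover have "c x \<in> carrier K" "c' x \<in> carrier K" using c by auto
    ultimately show ?thesis using K.minus_eq_zeroD[of "c x" "c' x"] by (simp add: d_def K.minus_eq K.l_minus)
  qed
  have "l_basis K L \<iota> B (\<lambda>x b. cf b x)"
  proof (unfold_locales)
    show "\<iota> \<in> ring_hom K L" "finite B" "B \<subseteq> carrier L" by fact+
    show "cf b x \<in> carrier K" if "x \<in> B" "b \<in> carrier L" for x b using cf(1)[OF that(2)] that(1) by auto
    show "cf (b \<oplus>\<^bsub>L\<^esub> b') x = cf b x \<oplus>\<^bsub>K\<^esub> cf b' x" if "x \<in> B" "b \<in> carrier L" "b' \<in> carrier L" for x b b'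
    proof -
      have a: "(\<lambda>x. cf b x \<oplus>\<^bsub>K\<^esub> cf b' x) \<in> B \<rightarrow> carrier K" using cf(1)[OF that(2)] cf(1)[OF that(3)] by auto
      have "S (cf (b \<oplus>\<^bsub>L\<^esub> b')) B = b \<oplus>\<^bsub>L\<^esub> b'" using cf(2)[of "b \<oplus>\<^bsub>L\<^esub> b'"] that by simp
      also have "\<dots> = S (\<lambda>x. cf b x \<oplus>\<^bsub>K\<^esub> cf b' x) B"
        using S_add[OF cf(1)[OF that(2)] cf(1)[OF that(3)] BL] cf(2)[OF that(2)] cf(2)[OF that(3)] by simp
      finally show ?thesis using uniq[OF cf(1) a _ that(1)] that by simp
    qed
    show "cf (\<iota> k \<otimes>\<^bsub>L\<^esub> b) x = k \<otimes>\<^bsub>K\<^esub> cf b x" if "x \<in> B" "k \<in> carrier K" "b \<in> carrier L" for x k b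
    proof -
      have a: "(\<lambda>x. k \<otimes>\<^bsub>K\<^esub> cf b x) \<in> B \<rightarrow> carrier K" using cf(1)[OF that(3)] that by auto
      have kb: "\<iota> k \<otimes>\<^bsub>L\<^esub> b \<in> carrier L" using ic that by simp
      have "S (cf (\<iota> k \<otimes>\<^bsub>L\<^esub> b)) B = \<iota> k \<otimes>\<^bsub>L\<^esub> b" using cf(2)[OF kb] by simp
      also have "\<dots> = S (\<lambda>x. k \<otimes>\<^bsub>K\<^esub> cf b x) B"
        using S_smult[OF that(2) cf(1)[OF that(3)] BL] cf(2)[OF that(3)] by simp
      finally show ?thesis using uniq[OF cf(1)[OF kb] a _ that(1)] by simp
    qed
    show "b = (\<Oplus>\<^bsub>L\<^esub>x\<in>B. \<iota> (cf b x) \<otimes>\<^bsub>L\<^esub> x)" if "b \<in> carrier L" for b using cf(2)[OF that] by (simp add: S_def)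
    show "c x = \<zero>\<^bsub>K\<^esub>" if "c \<in> B \<rightarrow> carrier K" "(\<Oplus>\<^bsub>L\<^esub>x\<in>B. \<iota> (c x) \<otimes>\<^bsub>L\<^esub> x) = \<zero>\<^bsub>L\<^esub>" "x \<in> B" for c x
      using indep[of c x] that by (simp add: S_def)
  qed
  then show ?thesis by blast
qed

locale basis_algebra = two_algebras K A L g \<iota> + basis: l_basis K L \<iota> B lam
  for K :: "('k, 'x) ring_scheme" and A :: "('a, 'y) ring_scheme" and L :: "('l, 'z) ring_scheme" and g \<iota> B lam
begin

text \<open>The coordinate at \<open>1 \<otimes> x\<close> when \<open>A \<otimes> L\<close> is
  regarded as a free \<open>A\<close>-module on the basis of \<open>L\<close>.\<close>

definition coord :: "'l \<Rightarrow> ('a, 'l) tens \<Rightarrow> 'a"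
  where "coord x = tensor_lift A (\<lambda>a b. a \<otimes>\<^bsub>A\<^esub> g (lam x b))"

lemma g_closed: "k \<in> carrier K ==> g k \<in> carrier A"
  using ring_hom_closed[OF g] .

lemma B_mem: "x \<in> B ==> x \<in> carrier L"
  using basis.B_carrier by blast

lemma coord_lift:
  assumes x: "x \<in> B"
  shows "additive_map TA A (coord x)"
    and "a \<in> carrier A ==> b \<in> carrier L ==> coord x (atens a b) = a \<otimes>\<^bsub>A\<^esub> g (lam x b)"
proof -
  have 1: "additive_map A A (\<lambda>a. a)" by (simp add: additive_map_def)
  have 2: "additive_map L A (\<lambda>b. g (lam x b))"
    using x by (auto simp: additive_map_def g_closed basis.lam_closed basis.lam_add ring_hom_add[OF g])
  have 3: "(g k \<otimes>\<^bsub>A\<^esub> a) \<otimes>\<^bsub>A\<^esub> g (lam x b) = a \<otimes>\<^bsub>A\<^esub> g (lam x (\<iota> k \<otimes>\<^bsub>L\<^esub> b))"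
    if "k \<in> carrier K" "a \<in> carrier A" "b \<in> carrier L" for k a b
    using that x by (simp add: basis.lam_smult ring_hom_mult[OF g] basis.lam_closed g_closed A.m_lcomm A.m_assoc)
  note * = at_lift_algebra[OF A.ring_axioms 1 2 3]
  show "additive_map TA A (coord x)" unfolding coord_def by (rule *(1))
  show "a \<in> carrier A ==> b \<in> carrier L ==> coord x (atens a b) = a \<otimes>\<^bsub>A\<^esub> g (lam x b)"
    unfolding coord_def by (rule *(2))
qed

lemma coord_closed: "x \<in> B ==> Z \<in> carrier TA ==> coord x Z \<in> carrier A"
  by (rule additive_map_closed[OF coord_lift(1)])

lemma expand_additive: "additive_map TA TA (\<lambda>Z. \<Oplus>\<^bsub>TA\<^esub>x\<in>B. atens (coord x Z) x)"
proof (rule additive_map_finsum_fun[OF TA_abelian_group basis.B_finite])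
  fix x assume x: "x \<in> B"
  have "additive_map A TA (\<lambda>a. atens a x)" using B_mem[OF x] by (auto simp: additive_map_def at_add_left)
  then show "additive_map TA TA (\<lambda>Z. atens (coord x Z) x)" by (rule additive_map_compose[OF coord_lift(1)[OF x]])
qed

text \<open>On a pure tensor the second factor is expanded in the basis, and its coefficients in
  \<open>K\<close> are moved to the left factor.\<close>

lemma expand:
  assumes Z: "Z \<in> carrier TA"
  shows "Z = (\<Oplus>\<^bsub>TA\<^esub>x\<in>B. atens (coord x Z) x)"
proof -
  have id: "additive_map TA TA (\<lambda>Z. Z)" by (simp add: additive_map_def)
  show ?thesis
  proof (rule at_map_eq[OF id expand_additive _ Z])
    fix a b assume a: "a \<in> carrier A" and b: "b \<in> carrier L"
    have ad: "additive_map L TA (atens a)" using a by (auto simp: additive_map_def at_add_right)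
    have ic: "\<iota> (lam x b) \<otimes>\<^bsub>L\<^esub> x \<in> carrier L" if "x \<in> B" for x
      using that b B_mem basis.lam_closed ring_hom_closed[OF h] by auto
    have "atens a b = atens a (\<Oplus>\<^bsub>L\<^esub>x\<in>B. \<iota> (lam x b) \<otimes>\<^bsub>L\<^esub> x)" using basis.lam_expand[OF b] by simp
    also have "\<dots> = (\<Oplus>\<^bsub>TA\<^esub>x\<in>B. atens a (\<iota> (lam x b) \<otimes>\<^bsub>L\<^esub> x))"
      by (rule additive_map_finsum[OF B.abelian_group_axioms TA_abelian_group ad basis.B_finite]) (use ic in auto)
    also have "\<dots> = (\<Oplus>\<^bsub>TA\<^esub>x\<in>B. atens (coord x (atens a b)) x)"
    proof (rule TA.finsum_cong'[OF refl])
      fix x assume x: "x \<in> B"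
      have l: "lam x b \<in> carrier K" using basis.lam_closed[OF x b] .
      show "atens a (\<iota> (lam x b) \<otimes>\<^bsub>L\<^esub> x) = atens (coord x (atens a b)) x"
        using at_scalar[OF l a B_mem[OF x]] coord_lift(2)[OF x a b] a g_closed[OF l] by (simp add: A.m_comm)
    next
      show "(\<lambda>x. atens (coord x (atens a b)) x) \<in> B \<rightarrow> carrier TA"
        using a b B_mem coord_closed by auto
    qed
    finally show "atens a b = (\<Oplus>\<^bsub>TA\<^esub>x\<in>B. atens (coord x (atens a b)) x)" .
  qed
qed

lemma coords_zero: "Z \<in> carrier TA ==> (\<And>x. x \<in> B ==> coord x Z = \<zero>\<^bsub>A\<^esub>) ==> Z = \<zero>\<^bsub>TA\<^esub>"
proof -
  assume Z: "Z \<in> carrier TA" and 0: "\<And>x. x \<in> B ==> coord x Z = \<zero>\<^bsub>A\<^esub>"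
  have "Z = (\<Oplus>\<^bsub>TA\<^esub>x\<in>B. atens (coord x Z) x)" by (rule expand[OF Z])
  also have "\<dots> = (\<Oplus>\<^bsub>TA\<^esub>x\<in>B. \<zero>\<^bsub>TA\<^esub>)"
    by (rule TA.finsum_cong'[OF refl]) (use 0 B_mem at_zero_left in auto)
  finally show ?thesis by simp
qed

lemma coord_smult:
  assumes x: "x \<in> B" and a: "a \<in> carrier A" and Z: "Z \<in> carrier TA"
  shows "coord x (atens a \<one>\<^bsub>L\<^esub> \<otimes>\<^bsub>TA\<^esub> Z) = a \<otimes>\<^bsub>A\<^esub> coord x Z"
proof -
  have ml: "additive_map A A (\<lambda>y. a \<otimes>\<^bsub>A\<^esub> y)" using a by (auto simp: additive_map_def A.r_distr)
  have a1: "atens a \<one>\<^bsub>L\<^esub> \<in> carrier TA" using a by auto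
  show ?thesis
    by (rule at_map_eq[OF additive_map_compose[OF mult_additive_right[OF a1] coord_lift(1)[OF x]] additive_map_compose[OF coord_lift(1)[OF x] ml] _ Z])
       (use a x in \<open>simp add: at_mult coord_lift(2) basis.lam_closed g_closed A.m_assoc\<close>)
qed

end

lemma (in domain) zero_not_Unit: "\<zero> \<notin> Units R"
proof
  assume u: "\<zero> \<in> Units R"
  have "\<zero> \<otimes> inv \<zero> = \<one>" by (rule Units_r_inv[OF u])
  then show False using Units_inv_closed[OF u] by simp
qed

text \<open>The relation can be divided by \<open>Z\<close> until its constant term is nonzero,
  hence a unit; solving for that term then exhibits an inverse of \<open>Z\<close>.\<close>

lemma (in domain) algebraic_unit:
  fixes n :: nat
  assumes Z: "Z \<in> carrier R" "Z \<noteq> \<zero>"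
    and c: "\<And>i. c i \<in> carrier R" "\<And>i. c i = \<zero> \<or> c i \<in> Units R" "\<exists>i\<le>n. c i \<noteq> \<zero>"
    and rel: "(\<Oplus>i\<in>{..n}. c i \<otimes> Z [^] i) = \<zero>"
  shows "Z \<in> Units R"
  using c rel
proof (induction n arbitrary: c)
  case 0
  then have "c 0 = \<zero>" by simp
  then show ?case using "0.prems"(3) by simp
next
  case (Suc n)
  define S where "S = (\<Oplus>i\<in>{..n}. c (Suc i) \<otimes> Z [^] i)"
  have Sc: "S \<in> carrier R" unfolding S_def using Suc.prems(1) Z by (intro finsum_closed) auto
  have "(\<Oplus>i\<in>{..Suc n}. c i \<otimes> Z [^] i) = (\<Oplus>i\<in>{..n}. c (Suc i) \<otimes> Z [^] Suc i) \<oplus> c 0 \<otimes> Z [^] (0::nat)"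
    using Suc.prems(1) Z by (intro finsum_Suc2) auto
  also have "(\<Oplus>i\<in>{..n}. c (Suc i) \<otimes> Z [^] Suc i) = (\<Oplus>i\<in>{..n}. (c (Suc i) \<otimes> Z [^] i) \<otimes> Z)"
    using Suc.prems(1) Z by (intro finsum_cong') (auto simp: m_assoc)
  also have "\<dots> = S \<otimes> Z" unfolding S_def using Suc.prems(1) Z by (intro finsum_ldistr[symmetric]) auto
  finally have rel: "S \<otimes> Z \<oplus> c 0 = \<zero>" using Suc.prems(1,4) by simp
  show ?case
  proof (cases "c 0 = \<zero>")
    case True
    then have "S \<otimes> Z = \<zero>" using rel Sc Z by simp
    then have "S = \<zero>" using Sc Z by (auto simp: integral_iff)
    moreover have "\<exists>i\<le>n. c (Suc i) \<noteq> \<zero>"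
      using Suc.prems(3) True by (metis Suc_le_mono not0_implies_Suc)
    ultimately show ?thesis using Suc.IH[of "\<lambda>i. c (Suc i)"] Suc.prems(1,2) S_def by simp
  next
    case False
    then have u: "c 0 \<in> Units R" using Suc.prems(2) by blast
    have c0: "c 0 \<in> carrier R" by (rule Suc.prems(1))
    have "c 0 = \<ominus> (S \<otimes> Z)" using rel Sc Z c0 by (metis minus_equality minus_minus m_closed a_comm)
    let ?i = "inv (c 0)"
    have ic: "?i \<in> carrier R" using u by simp
    have w: "\<ominus> S \<otimes> ?i \<in> carrier R" using Sc ic by simp
    have "Z \<otimes> (\<ominus> S \<otimes> ?i) = \<ominus> (S \<otimes> Z) \<otimes> ?i" using Sc ic Z by (simp add: l_minus r_minus m_ac)
    also have "\<dots> = \<one>" using \<open>c 0 = \<ominus> (S \<otimes> Z)\<close>[symmetric] Units_r_inv[OF u] by simp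
    finally have "Z \<otimes> (\<ominus> S \<otimes> ?i) = \<one>" .
    moreover from this have "(\<ominus> S \<otimes> ?i) \<otimes> Z = \<one>" using m_comm[OF w Z(1)] by (simp only:)
    ultimately show ?thesis using Z(1) w unfolding Units_def by blast
  qed
qed

text \<open>With \<open>pre x y\<close> saying that the quotient of two coordinates is regular at
  infinity, the element found is a coordinate of least valuation.\<close>

lemma finite_valuation_max:
  assumes "finite S" "S \<noteq> {}" and tot: "\<And>x y. x \<in> S ==> y \<in> S ==> pre x y \<or> pre y x"
    and tr: "\<And>x y z. x \<in> S ==> y \<in> S ==> z \<in> S ==> pre x y ==> pre y z ==> pre x z"
  shows "\<exists>m\<in>S. \<forall>x\<in>S. pre x m"
  using assms
proof (induction S rule: finite_ne_induct)
  case (singleton x) then show ?case by blast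
next
  case (insert x S)
  then obtain m where m: "m \<in> S" "\<forall>x\<in>S. pre x m" by blast
  have mm: "m \<in> insert x S" "x \<in> insert x S" using m by auto
  show ?case
  proof (cases "pre x m")
    case True then show ?thesis using m by blast
  next
    case False
    then have "pre m x" "pre x x" using insert.prems(1) mm by blast+
    then have "\<forall>y\<in>insert x S. pre y x" using insert.prems(2)[of _ m x] m mm by blast
    then show ?thesis by blast
  qed
qed

section \<open>The function field over the larger constants, by a Gauss lemma at infinity\<close>

locale curve_data = K: field K + Q: field Q + V: valuation_point Q "\<iota>Q ` carrier K" pinf + l_basis K L \<iota>L B lam
  for K :: "'k ring" and Q :: "'q ring" (structure) and \<iota>Q :: "'k \<Rightarrow> 'q" and pinf :: "'q set" and L :: "'l ring" and \<iota>L B lam +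
  assumes K_finite: "finite (carrier K)" and L_finite: "finite (carrier L)"
    and \<iota>Q: "\<iota>Q \<in> ring_hom K Q"
    and rational: "\<And>x. x \<in> pinf ==> \<exists>k\<in>carrier K. x \<ominus> \<iota>Q k \<in> max_ideal Q pinf"
begin

sublocale QT: basis_algebra K Q L \<iota>Q \<iota>L B lam
  by unfold_locales (rule \<iota>Q, rule \<iota>)

abbreviation "Pr \<equiv> Q\<lparr>carrier := pinf\<rparr>"
abbreviation "QL \<equiv> tensor_algebra K Q \<iota>Q L \<iota>L"
abbreviation "atQ \<equiv> alg_tensor K Q \<iota>Q L \<iota>L"
abbreviation "incl \<equiv> tensor_lift QL (\<lambda>a b. atQ a b)"

lemma sub_two_algebras:
  assumes S: "subring S Q" "\<iota>Q ` carrier K \<subseteq> S"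
  shows "two_algebras K (Q\<lparr>carrier := S\<rparr>) L \<iota>Q \<iota>L"
proof -
  interpret S: cring "Q\<lparr>carrier := S\<rparr>" by (rule cring_restrict[OF S(1) Q.cring_axioms])
  have "\<iota>Q \<in> ring_hom K (Q\<lparr>carrier := S\<rparr>)"
    using S(2) by (intro ring_hom_memI) (auto simp: ring_hom_mult[OF \<iota>Q] ring_hom_add[OF \<iota>Q] ring_hom_one[OF \<iota>Q])
  then show ?thesis using \<iota> by unfold_locales
qed

lemma sub_basis_algebra:
  assumes S: "subring S Q" "\<iota>Q ` carrier K \<subseteq> S"
  shows "basis_algebra K (Q\<lparr>carrier := S\<rparr>) L \<iota>Q \<iota>L B lam"
proof -
  interpret two_algebras K "Q\<lparr>carrier := S\<rparr>" L \<iota>Q \<iota>L by (rule sub_two_algebras[OF S])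
  show ?thesis by unfold_locales
qed

text \<open>Injectivity holds because the coordinates with respect to the basis of \<open>L\<close>
  are the same before and after the inclusion of \<open>S\<close> into the function field. This is
  flatness of \<open>L\<close> over \<open>K\<close> in concrete form.\<close>

lemma incl_sub:
  assumes S: "subring S Q" "\<iota>Q ` carrier K \<subseteq> S"
  defines "SL \<equiv> tensor_algebra K (Q\<lparr>carrier := S\<rparr>) \<iota>Q L \<iota>L"
  shows "incl \<in> ring_hom SL QL"
    and "a \<in> S ==> b \<in> carrier L ==> incl (alg_tensor K (Q\<lparr>carrier := S\<rparr>) \<iota>Q L \<iota>L a b) = atQ a b"
    and "inj_on incl (carrier SL)"
proof -
  interpret S: basis_algebra K "Q\<lparr>carrier := S\<rparr>" L \<iota>Q \<iota>L B lam by (rule sub_basis_algebra[OF S])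
  have Sc: "S \<subseteq> carrier Q" by (rule subringE(1)[OF S(1)])
  have u: "(\<lambda>a. a) \<in> ring_hom (Q\<lparr>carrier := S\<rparr>) Q" using Sc by (intro ring_hom_memI) auto
  have v: "(\<lambda>b. b) \<in> ring_hom L L" by (intro ring_hom_memI) auto
  note * = tensor_algebra_map[OF S.two_algebras_axioms QT.two_algebras_axioms u v refl refl]
  show hom: "incl \<in> ring_hom SL QL" unfolding SL_def by (rule *(1))
  show pure: "incl (alg_tensor K (Q\<lparr>carrier := S\<rparr>) \<iota>Q L \<iota>L a b) = atQ a b" if "a \<in> S" "b \<in> carrier L" for a b
    by (rule *(2)) (use that in auto)
  have add: "additive_map SL QL incl" using hom by (auto simp: additive_map_def ring_hom_closed ring_hom_add)
  have co: "QT.coord x (incl Z) = S.coord x Z" if x: "x \<in> B" and Z: "Z \<in> carrier SL" for x Z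
  proof (rule S.at_map_eq[OF _ _ _ Z[unfolded SL_def]])
    show "additive_map S.TA Q (\<lambda>Z. QT.coord x (incl Z))"
      using additive_map_compose[OF add QT.coord_lift(1)[OF x]] by (simp add: SL_def)
    show "additive_map S.TA Q (S.coord x)"
      using S.coord_lift(1)[OF x] Sc by (auto simp: additive_map_def)
    fix a b assume "a \<in> carrier (Q\<lparr>carrier := S\<rparr>)" "b \<in> carrier L"
    then show "QT.coord x (incl (S.atens a b)) = S.coord x (S.atens a b)"
      using Sc x by (simp add: pure QT.coord_lift(2) S.coord_lift(2) subset_iff)
  qed
  have ker: "Z = \<zero>\<^bsub>SL\<^esub>" if Z: "Z \<in> carrier SL" "incl Z = \<zero>\<^bsub>QL\<^esub>" for Z
    unfolding SL_def
  proof (rule S.coords_zero)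
    show "Z \<in> carrier S.TA" using Z by (simp add: SL_def)
    fix x assume x: "x \<in> B"
    have "S.coord x Z = QT.coord x \<zero>\<^bsub>QL\<^esub>" using co[OF x Z(1)] Z(2) by simp
    also have "\<dots> = \<zero>" by (rule additive_map_zero[OF QT.TA_abelian_group Q.abelian_group_axioms QT.coord_lift(1)[OF x]])
    finally show "S.coord x Z = \<zero>\<^bsub>Q\<lparr>carrier := S\<rparr>\<^esub>" by simp
  qed
  show "inj_on incl (carrier SL)"
  proof (rule inj_onI)
    fix Y Z assume YZ: "Y \<in> carrier SL" "Z \<in> carrier SL" "incl Y = incl Z"
    have SLg: "abelian_group SL" unfolding SL_def by (rule S.TA_abelian_group)
    have c: "incl Z \<in> carrier QL" using additive_map_closed[OF add YZ(2)] .
    have "incl (Y \<ominus>\<^bsub>SL\<^esub> Z) = incl Y \<ominus>\<^bsub>QL\<^esub> incl Z"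
      by (rule additive_map_minus[OF SLg QT.TA_abelian_group add YZ(1,2)])
    also have "\<dots> = \<zero>\<^bsub>QL\<^esub>" unfolding YZ(3) using c by (simp add: QT.TA.minus_eq QT.TA.r_neg)
    finally have "Y \<ominus>\<^bsub>SL\<^esub> Z = \<zero>\<^bsub>SL\<^esub>" using abelian_group.minus_closed[OF SLg YZ(1,2)] by (intro ker)
    then show "Y = Z" by (rule abelian_group.minus_eq_zeroD[OF SLg YZ(1,2)])
  qed
qed

sublocale PT: basis_algebra K Pr L \<iota>Q \<iota>L B lam
  by (rule sub_basis_algebra[OF V.P_subring V.k_P])

abbreviation "PT \<equiv> tensor_algebra K Pr \<iota>Q L \<iota>L"
abbreviation "atP \<equiv> alg_tensor K Pr \<iota>Q L \<iota>L"

lemmas inclP_hom = incl_sub(1)[OF V.P_subring V.k_P] and inclP_pure = incl_sub(2)[OF V.P_subring V.k_P]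
  and inclP_inj = incl_sub(3)[OF V.P_subring V.k_P]

text \<open>The residue of \<open>x\<close> at infinity. Rationality of the point places it in
  \<open>K\<close>; uniqueness follows in \<open>res_eqI\<close>.\<close>

definition res :: "'q \<Rightarrow> 'k" where "res x = (SOME k. k \<in> carrier K \<and> x \<ominus> \<iota>Q k \<in> pinf - V.U)"

lemma \<iota>Q_closed: "k \<in> carrier K ==> \<iota>Q k \<in> carrier Q" and \<iota>Q_pinf: "k \<in> carrier K ==> \<iota>Q k \<in> pinf"
  using V.k_P V.P_carrier by auto

lemma \<iota>Q_nonunit: "k \<in> carrier K ==> \<iota>Q k \<in> pinf - V.U ==> k = \<zero>\<^bsub>K\<^esub>"
proof (rule ccontr)
  assume k: "k \<in> carrier K" "\<iota>Q k \<in> pinf - V.U" "k \<noteq> \<zero>\<^bsub>K\<^esub>"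
  have "\<iota>Q k \<otimes> \<iota>Q (inv\<^bsub>K\<^esub> k) = \<one>"
    using k K.inv_closed_field[of k] K.inv_field[of k] by (metis ring_hom_mult[OF \<iota>Q] ring_hom_one[OF \<iota>Q])
  then have "\<one> \<in> pinf - V.U" using V.nonunit_mult[OF k(2) \<iota>Q_pinf[OF K.inv_closed_field[OF k(1,3)]]] by simp
  then show False using V.one_U by blast
qed

lemma res: "x \<in> pinf ==> res x \<in> carrier K" "x \<in> pinf ==> x \<ominus> \<iota>Q (res x) \<in> pinf - V.U"
proof -
  assume "x \<in> pinf"
  then have "\<exists>k. k \<in> carrier K \<and> x \<ominus> \<iota>Q k \<in> pinf - V.U" using rational by (auto simp: V.max_ideal_eq)
  from someI_ex[OF this] show "res x \<in> carrier K" "x \<ominus> \<iota>Q (res x) \<in> pinf - V.U" unfolding res_def by blast+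
qed

lemma \<iota>Q_minus: "k \<in> carrier K ==> k' \<in> carrier K ==> \<iota>Q (k \<ominus>\<^bsub>K\<^esub> k') = \<iota>Q k \<ominus> \<iota>Q k'"
  by (rule additive_map_minus[OF K.abelian_group_axioms Q.abelian_group_axioms])
     (auto simp: additive_map_def \<iota>Q_closed ring_hom_add[OF \<iota>Q])

text \<open>The difference of two candidates is a constant and a nonunit at infinity, hence
  0.\<close>

lemma res_eqI:
  assumes x: "x \<in> pinf" and k: "k \<in> carrier K" "x \<ominus> \<iota>Q k \<in> pinf - V.U"
  shows "res x = k"
proof -
  have c: "x \<in> carrier Q" "\<iota>Q k \<in> carrier Q" "\<iota>Q (res x) \<in> carrier Q"
    using V.P_carrier[OF x] \<iota>Q_closed k res(1)[OF x] by auto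
  have "\<iota>Q (res x \<ominus>\<^bsub>K\<^esub> k) = (x \<ominus> \<iota>Q k) \<oplus> (\<ominus> (x \<ominus> \<iota>Q (res x)))"
  proof -
    have "(x \<ominus> \<iota>Q k) \<oplus> (\<ominus> (x \<ominus> \<iota>Q (res x))) = \<iota>Q (res x) \<ominus> \<iota>Q k"
      using c by algebra
    then show ?thesis using \<iota>Q_minus[OF res(1)[OF x] k(1)] by simp
  qed
  also have "\<dots> \<in> pinf - V.U" by (rule V.nonunit_add[OF k(2) V.nonunit_uminus[OF res(2)[OF x]]])
  finally have "res x \<ominus>\<^bsub>K\<^esub> k = \<zero>\<^bsub>K\<^esub>" using res(1)[OF x] k(1) by (intro \<iota>Q_nonunit) auto
  then show ?thesis by (rule K.minus_eq_zeroD[OF res(1)[OF x] k(1)])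
qed

lemma res_\<iota>Q: "k \<in> carrier K ==> res (\<iota>Q k) = k"
  using V.nonunit_zero \<iota>Q_closed by (intro res_eqI \<iota>Q_pinf) (auto simp: Q.minus_eq Q.r_neg)

lemma res_nonunit: "x \<in> pinf - V.U ==> res x = \<zero>\<^bsub>K\<^esub>"
proof (rule res_eqI)
  assume x: "x \<in> pinf - V.U"
  have "\<iota>Q \<zero>\<^bsub>K\<^esub> = \<zero>" by (rule ring_hom_zero[OF \<iota>Q K.ring_axioms Q.ring_axioms])
  then show "x \<ominus> \<iota>Q \<zero>\<^bsub>K\<^esub> \<in> pinf - V.U" using x V.P_carrier by (simp add: Q.minus_eq)
qed auto

lemma res_add: "x \<in> pinf ==> y \<in> pinf ==> res (x \<oplus> y) = res x \<oplus>\<^bsub>K\<^esub> res y"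
proof (rule res_eqI)
  assume x: "x \<in> pinf" and y: "y \<in> pinf"
  have c: "x \<in> carrier Q" "y \<in> carrier Q" "\<iota>Q (res y) \<in> carrier Q" "\<iota>Q (res x) \<in> carrier Q"
    using V.P_carrier x y \<iota>Q_closed res(1) by auto
  have "x \<oplus> y \<ominus> \<iota>Q (res x \<oplus>\<^bsub>K\<^esub> res y) = (x \<ominus> \<iota>Q (res x)) \<oplus> (y \<ominus> \<iota>Q (res y))"
    unfolding ring_hom_add[OF \<iota>Q res(1)[OF x] res(1)[OF y]] using c by algebra
  then show "x \<oplus> y \<ominus> \<iota>Q (res x \<oplus>\<^bsub>K\<^esub> res y) \<in> pinf - V.U" using V.nonunit_add[OF res(2)[OF x] res(2)[OF y]] by simp
qed (use V.P_add res(1) in auto)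

lemma res_mult: "x \<in> pinf ==> y \<in> pinf ==> res (x \<otimes> y) = res x \<otimes>\<^bsub>K\<^esub> res y"
proof (rule res_eqI)
  assume x: "x \<in> pinf" and y: "y \<in> pinf"
  have c: "x \<in> carrier Q" "y \<in> carrier Q" "\<iota>Q (res y) \<in> carrier Q" "\<iota>Q (res x) \<in> carrier Q"
    using V.P_carrier x y \<iota>Q_closed res(1) by auto
  have "x \<otimes> y \<ominus> \<iota>Q (res x \<otimes>\<^bsub>K\<^esub> res y) = (x \<ominus> \<iota>Q (res x)) \<otimes> y \<oplus> (y \<ominus> \<iota>Q (res y)) \<otimes> \<iota>Q (res x)"
    unfolding ring_hom_mult[OF \<iota>Q res(1)[OF x] res(1)[OF y]] using c by algebra
  then show "x \<otimes> y \<ominus> \<iota>Q (res x \<otimes>\<^bsub>K\<^esub> res y) \<in> pinf - V.U"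
    using V.nonunit_add[OF V.nonunit_mult[OF res(2)[OF x] y] V.nonunit_mult[OF res(2)[OF y] \<iota>Q_pinf[OF res(1)[OF x]]]] by simp
qed (use V.P_mult res(1) in auto)

lemma res_hom: "res \<in> ring_hom Pr K"
  using res_\<iota>Q[OF K.one_closed] ring_hom_one[OF \<iota>Q] by (intro ring_hom_memI) (auto simp: res res_add res_mult)

text \<open>Reduction of \<open>pinf \<otimes> L\<close> modulo the maximal ideal of
  \<open>pinf\<close>: as the residue field is \<open>K\<close>, the target is
  \<open>K \<otimes> L = L\<close>. The elements with nonzero reduction, called primitive from here
  on, take the place of primitive polynomials in Gauss's lemma.\<close>

definition \<rho> :: "('q, 'l) tens \<Rightarrow> 'l"
  where "\<rho> = tensor_lift L (\<lambda>a b. \<iota>L (res a) \<otimes>\<^bsub>L\<^esub> b)"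

lemma \<rho>: "\<rho> \<in> ring_hom PT L" "a \<in> pinf ==> b \<in> carrier L ==> \<rho> (atP a b) = \<iota>L (res a) \<otimes>\<^bsub>L\<^esub> b"
proof -
  have u: "(\<lambda>a. \<iota>L (res a)) \<in> ring_hom Pr L" using ring_hom_trans[OF res_hom \<iota>] by (simp add: comp_def)
  have v: "(\<lambda>b. b) \<in> ring_hom L L" by (intro ring_hom_memI) auto
  have ua: "additive_map Pr L (\<lambda>a. \<iota>L (res a))" and va: "additive_map L L (\<lambda>b. b)"
    using u by (auto simp: additive_map_def ring_hom_closed[OF u] ring_hom_add[OF u, simplified])
  have bal: "\<iota>L (res (\<iota>Q k \<otimes>\<^bsub>Pr\<^esub> a)) \<otimes>\<^bsub>L\<^esub> b = \<iota>L (res a) \<otimes>\<^bsub>L\<^esub> (\<iota>L k \<otimes>\<^bsub>L\<^esub> b)"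
    if "k \<in> carrier K" "a \<in> carrier Pr" "b \<in> carrier L" for k a b
    using that \<iota>Q_pinf ring_hom_closed[OF \<iota>] res by (simp add: res_mult res_\<iota>Q ring_hom_mult[OF \<iota>] L.m_lcomm L.m_assoc)
  note * = PT.at_lift_algebra[OF L.ring_axioms ua va bal]
  show "a \<in> pinf ==> b \<in> carrier L ==> \<rho> (atP a b) = \<iota>L (res a) \<otimes>\<^bsub>L\<^esub> b"
    unfolding \<rho>_def by (rule *(2)) auto
  have add: "additive_map PT L \<rho>" unfolding \<rho>_def by (rule *(1)) auto
  show "\<rho> \<in> ring_hom PT L"
    by (rule PT.TA_hom_criterion[OF L.cring_axioms add u v]) (unfold \<rho>_def, rule *(2), auto)
qed

lemma inclP_closed: "Y \<in> carrier PT ==> incl Y \<in> carrier QL"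
  by (rule ring_hom_closed[OF inclP_hom])

lemma incl_zero: "incl \<zero>\<^bsub>PT\<^esub> = \<zero>\<^bsub>QL\<^esub>"
  by (rule ring_hom_zero[OF inclP_hom PT.TA.ring_axioms QT.TA.ring_axioms])

lemma \<rho>_zero: "\<rho> \<zero>\<^bsub>PT\<^esub> = \<zero>\<^bsub>L\<^esub>"
  by (rule ring_hom_zero[OF \<rho>(1) PT.TA.ring_axioms L.ring_axioms])

lemma \<rho>_closed: "Y \<in> carrier PT ==> \<rho> Y \<in> carrier L"
  by (rule ring_hom_closed[OF \<rho>(1)])

lemma incl_primitive_nonzero: "Y \<in> carrier PT ==> \<rho> Y \<noteq> \<zero>\<^bsub>L\<^esub> ==> incl Y \<noteq> \<zero>\<^bsub>QL\<^esub>"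
  using inj_onD[OF inclP_inj, of Y "\<zero>\<^bsub>PT\<^esub>"] incl_zero \<rho>_zero PT.TA.zero_closed by metis

abbreviation "q1 q \<equiv> atQ q \<one>\<^bsub>L\<^esub>"

lemma q1_closed: "q \<in> carrier Q ==> q1 q \<in> carrier QL"
  by auto

lemma q1_mult: "q \<in> carrier Q ==> q' \<in> carrier Q ==> q1 (q \<otimes> q') = q1 q \<otimes>\<^bsub>QL\<^esub> q1 q'"
  by (simp add: QT.at_mult)

lemma q1_one: "q1 \<one> = \<one>\<^bsub>QL\<^esub>"
  by (rule QT.at_one_one)

lemma q1_Units: "q \<in> carrier Q ==> q \<noteq> \<zero> ==> q1 q \<in> Units QL"
proof -
  assume q: "q \<in> carrier Q" "q \<noteq> \<zero>"
  have "q1 q \<otimes>\<^bsub>QL\<^esub> q1 (inv q) = \<one>\<^bsub>QL\<^esub>" "q1 (inv q) \<otimes>\<^bsub>QL\<^esub> q1 q = \<one>\<^bsub>QL\<^esub>"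
    using q Q.inv_closed_field[OF q] Q.inv_field[OF q] by (simp_all add: q1_mult[symmetric] q1_one)
  then show ?thesis using q1_closed[OF q(1)] q1_closed[OF Q.inv_closed_field[OF q]] unfolding Units_def by blast
qed

text \<open>\<open>q\<close> is the content of \<open>Z\<close>, a coordinate of least valuation.
  After division by it all coordinates are regular at infinity and one of them is 1; its residue is
  1, so independence of the basis of \<open>L\<close> prevents the reduction from vanishing.\<close>

lemma primitive_decomposition:
  assumes Z: "Z \<in> carrier QL" "Z \<noteq> \<zero>\<^bsub>QL\<^esub>"
  obtains q Y where "q \<in> carrier Q" "q \<noteq> \<zero>" "Y \<in> carrier PT" "\<rho> Y \<noteq> \<zero>\<^bsub>L\<^esub>" "Z = q1 q \<otimes>\<^bsub>QL\<^esub> incl Y"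
proof -
  let ?c = "\<lambda>x. QT.coord x Z"
  have cc: "?c x \<in> carrier Q" if "x \<in> B" for x using QT.coord_closed[OF that Z(1)] .
  define S where "S = {x \<in> B. ?c x \<noteq> \<zero>}"
  have S: "S \<noteq> {}" using QT.coords_zero[OF Z(1)] Z(2) by (auto simp: S_def)
  have finS: "finite S" using B_finite by (simp add: S_def)
  have "\<exists>m\<in>S. \<forall>x\<in>S. ?c x \<otimes> inv ?c m \<in> pinf"
  proof (rule finite_valuation_max[OF finS S])
    fix x y assume xy: "x \<in> S" "y \<in> S"
    have n: "?c x \<in> carrier Q" "?c x \<noteq> \<zero>" "?c y \<in> carrier Q" "?c y \<noteq> \<zero>" using xy cc by (auto simp: S_def)
    note i = Q.inv_closed_field[OF n(1,2)] Q.inv_closed_field[OF n(3,4)] Q.inv_field[OF n(1,2)] Q.inv_field[OF n(3,4)]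
    have "?c x \<otimes> inv ?c y \<in> pinf \<or> inv (?c x \<otimes> inv ?c y) \<in> pinf"
      using n i by (intro V.P_val) (auto simp: Q.integral_iff)
    moreover have "inv (?c x \<otimes> inv ?c y) = ?c y \<otimes> inv ?c x"
      using n i by (simp add: Q.inv_mult Q.m_comm)
    ultimately show "?c x \<otimes> inv ?c y \<in> pinf \<or> ?c y \<otimes> inv ?c x \<in> pinf" by simp
  next
    fix x y z assume xyz: "x \<in> S" "y \<in> S" "z \<in> S" and a: "?c x \<otimes> inv ?c y \<in> pinf" "?c y \<otimes> inv ?c z \<in> pinf"
    have n: "?c x \<in> carrier Q" "?c y \<in> carrier Q" "?c y \<noteq> \<zero>" "?c z \<in> carrier Q" "?c z \<noteq> \<zero>" using xyz cc by (auto simp: S_def)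
    note i = Q.inv_closed_field[OF n(2,3)] Q.inv_closed_field[OF n(4,5)] Q.inv_field[OF n(2,3)]
    have "(?c x \<otimes> inv ?c y) \<otimes> (?c y \<otimes> inv ?c z) = ?c x \<otimes> (inv ?c y \<otimes> ?c y) \<otimes> inv ?c z"
      using n(1,2,4) i(1,2) by (simp add: Q.m_assoc)
    also have "\<dots> = ?c x \<otimes> inv ?c z" using n i by simp
    finally show "?c x \<otimes> inv ?c z \<in> pinf" using V.P_mult[OF a] by simp
  qed
  then obtain m where m: "m \<in> S" "\<And>x. x \<in> S ==> ?c x \<otimes> inv ?c m \<in> pinf" by blast
  let ?q = "?c m"
  have q: "?q \<in> carrier Q" "?q \<noteq> \<zero>" and mB: "m \<in> B" using m(1) cc by (auto simp: S_def)
  note qi = Q.inv_closed_field[OF q] Q.inv_field[OF q]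
  define d where "d x = ?c x \<otimes> inv ?q" for x
  have dP: "d x \<in> pinf" if "x \<in> B" for x
  proof (cases "?c x = \<zero>")
    case True then show ?thesis using qi V.P_zero by (simp add: d_def)
  next
    case False then show ?thesis using m(2)[of x] that by (simp add: d_def S_def)
  qed
  have dm: "d m = \<one>" using qi by (simp add: d_def)
  have qd: "?q \<otimes> d x = ?c x" if "x \<in> B" for x
    unfolding d_def Q.m_lcomm[OF q(1) cc[OF that] qi(1)] using cc[OF that] qi by simp
  define Y where "Y = (\<Oplus>\<^bsub>PT\<^esub>x\<in>B. atP (d x) x)"
  have Yc: "Y \<in> carrier PT" unfolding Y_def using dP QT.B_mem by (intro PT.TA.finsum_closed) auto
  have inclA: "additive_map PT QL incl" using inclP_hom by (auto simp: additive_map_def ring_hom_closed ring_hom_add)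
  have rhoA: "additive_map PT L \<rho>" using \<rho>(1) by (auto simp: additive_map_def ring_hom_closed ring_hom_add)
  have mulA: "additive_map QL QL (\<lambda>Z. q1 ?q \<otimes>\<^bsub>QL\<^esub> Z)" by (rule QT.mult_additive_right[OF q1_closed[OF q(1)]])
  have atPc: "(\<lambda>x. atP (d x) x) \<in> B \<rightarrow> carrier PT" using dP QT.B_mem by auto
  have atQc: "(\<lambda>x. atQ (d x) x) \<in> B \<rightarrow> carrier QL" using V.P_carrier[OF dP] QT.B_mem by auto
  have "incl Y = (\<Oplus>\<^bsub>QL\<^esub>x\<in>B. incl (atP (d x) x))"
    unfolding Y_def by (rule additive_map_finsum[OF PT.TA_abelian_group QT.TA_abelian_group inclA B_finite atPc])
  also have "\<dots> = (\<Oplus>\<^bsub>QL\<^esub>x\<in>B. atQ (d x) x)"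
    by (rule QT.TA.finsum_cong'[OF refl atQc]) (use dP QT.B_mem inclP_pure in auto)
  finally have "q1 ?q \<otimes>\<^bsub>QL\<^esub> incl Y = (\<Oplus>\<^bsub>QL\<^esub>x\<in>B. q1 ?q \<otimes>\<^bsub>QL\<^esub> atQ (d x) x)"
    using additive_map_finsum[OF QT.TA_abelian_group QT.TA_abelian_group mulA B_finite atQc] by simp
  also have "\<dots> = (\<Oplus>\<^bsub>QL\<^esub>x\<in>B. atQ (?c x) x)"
  proof (rule QT.TA.finsum_cong'[OF refl])
    fix x assume x: "x \<in> B"
    show "q1 ?q \<otimes>\<^bsub>QL\<^esub> atQ (d x) x = atQ (?c x) x"
      using q V.P_carrier[OF dP[OF x]] QT.B_mem[OF x] qd[OF x] by (simp add: QT.at_mult)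
  qed (use cc QT.B_mem in auto)
  also have "\<dots> = Z" by (rule QT.expand[OF Z(1), symmetric])
  finally have ZqY: "Z = q1 ?q \<otimes>\<^bsub>QL\<^esub> incl Y" by (rule sym)
  have rho_ne: "\<rho> Y \<noteq> \<zero>\<^bsub>L\<^esub>"
  proof
    assume 0: "\<rho> Y = \<zero>\<^bsub>L\<^esub>"
    have "\<rho> Y = (\<Oplus>\<^bsub>L\<^esub>x\<in>B. \<rho> (atP (d x) x))"
      unfolding Y_def by (rule additive_map_finsum[OF PT.TA_abelian_group L.abelian_group_axioms rhoA B_finite atPc])
    also have "\<dots> = (\<Oplus>\<^bsub>L\<^esub>x\<in>B. \<iota>L (res (d x)) \<otimes>\<^bsub>L\<^esub> x)"
      by (rule L.finsum_cong'[OF refl]) (use dP QT.B_mem \<rho>(2) res ring_hom_closed[OF \<iota>] in auto)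
    finally have "(\<Oplus>\<^bsub>L\<^esub>x\<in>B. \<iota>L (res (d x)) \<otimes>\<^bsub>L\<^esub> x) = \<zero>\<^bsub>L\<^esub>" using 0 by (simp only:)
    then have "res (d m) = \<zero>\<^bsub>K\<^esub>" using dP res(1) by (intro B_indep[OF _ _ mB]) auto
    moreover have "res \<one> = \<one>\<^bsub>K\<^esub>" using ring_hom_one[OF res_hom] by simp
    ultimately show False using dm by simp
  qed
  show thesis by (rule that[OF q Yc rho_ne ZqY])
qed

lemma primitive_mult:
  assumes "Y \<in> carrier PT" "Y' \<in> carrier PT" "\<rho> Y \<noteq> \<zero>\<^bsub>L\<^esub>" "\<rho> Y' \<noteq> \<zero>\<^bsub>L\<^esub>"
  shows "\<rho> (Y \<otimes>\<^bsub>PT\<^esub> Y') \<noteq> \<zero>\<^bsub>L\<^esub>"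
  using assms \<rho>_closed by (simp add: ring_hom_mult[OF \<rho>(1)] L.integral_iff)

text \<open>Up to units coming from \<open>Q\<close> every nonzero element is primitive, and a
  product of primitive elements is primitive because \<open>L\<close> is a field.\<close>

lemma QL_domain: "domain QL"
proof (rule domain.intro[OF QT.TA_cring domain_axioms.intro])
  have "\<rho> \<one>\<^bsub>PT\<^esub> \<noteq> \<zero>\<^bsub>L\<^esub>" by (simp add: ring_hom_one[OF \<rho>(1)])
  then show "\<one>\<^bsub>QL\<^esub> \<noteq> \<zero>\<^bsub>QL\<^esub>"
    using incl_primitive_nonzero[of "\<one>\<^bsub>PT\<^esub>"] by (simp add: ring_hom_one[OF inclP_hom])
  fix Z Z' assume ZZ: "Z \<otimes>\<^bsub>QL\<^esub> Z' = \<zero>\<^bsub>QL\<^esub>" "Z \<in> carrier QL" "Z' \<in> carrier QL"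
  show "Z = \<zero>\<^bsub>QL\<^esub> \<or> Z' = \<zero>\<^bsub>QL\<^esub>"
  proof (rule ccontr)
    assume "\<not> (Z = \<zero>\<^bsub>QL\<^esub> \<or> Z' = \<zero>\<^bsub>QL\<^esub>)"
    then have ne: "Z \<noteq> \<zero>\<^bsub>QL\<^esub>" "Z' \<noteq> \<zero>\<^bsub>QL\<^esub>" by auto
    obtain q Y where q: "q \<in> carrier Q" "q \<noteq> \<zero>" "Y \<in> carrier PT" "\<rho> Y \<noteq> \<zero>\<^bsub>L\<^esub>" "Z = q1 q \<otimes>\<^bsub>QL\<^esub> incl Y"
      using primitive_decomposition[OF ZZ(2) ne(1)] by blast
    obtain q' Y' where q': "q' \<in> carrier Q" "q' \<noteq> \<zero>" "Y' \<in> carrier PT" "\<rho> Y' \<noteq> \<zero>\<^bsub>L\<^esub>" "Z' = q1 q' \<otimes>\<^bsub>QL\<^esub> incl Y'"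
      using primitive_decomposition[OF ZZ(3) ne(2)] by blast
    let ?u = "q1 q \<otimes>\<^bsub>QL\<^esub> q1 q'" and ?y = "incl Y \<otimes>\<^bsub>QL\<^esub> incl Y'"
    have c: "q1 q \<in> carrier QL" "q1 q' \<in> carrier QL" "incl Y \<in> carrier QL" "incl Y' \<in> carrier QL"
      using q q' inclP_closed by auto
    have "?u \<otimes>\<^bsub>QL\<^esub> ?y = \<zero>\<^bsub>QL\<^esub>" using ZZ(1) c unfolding q(5) q'(5) by (simp add: QT.TA.m_ac)
    moreover have "?u \<in> Units QL" using q1_Units q q' by (intro QT.TA.Units_m_closed)
    ultimately have "?y = \<zero>\<^bsub>QL\<^esub>" using c QT.TA.Units_l_cancel[of ?u ?y "\<zero>\<^bsub>QL\<^esub>"] by simp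
    then have "incl (Y \<otimes>\<^bsub>PT\<^esub> Y') = \<zero>\<^bsub>QL\<^esub>" using ring_hom_mult[OF inclP_hom q(3) q'(3)] by simp
    then show False using incl_primitive_nonzero[of "Y \<otimes>\<^bsub>PT\<^esub> Y'"] primitive_mult[OF q(3) q'(3) q(4) q'(4)] q(3) q'(3) by simp
  qed
qed

lemma q1_zero_iff: "q \<in> carrier Q ==> q1 q = \<zero>\<^bsub>QL\<^esub> \<longleftrightarrow> q = \<zero>"
proof -
  assume q: "q \<in> carrier Q"
  have "q1 q \<noteq> \<zero>\<^bsub>QL\<^esub>" if "q \<noteq> \<zero>"
  proof
    assume "q1 q = \<zero>\<^bsub>QL\<^esub>"
    then have "\<zero>\<^bsub>QL\<^esub> \<in> Units QL" using q1_Units[OF q that] by simp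
    then show False using domain.zero_not_Unit[OF QL_domain] by blast
  qed
  then show ?thesis using QT.at_zero_left by auto
qed

text \<open>The first \<open>card B + 1\<close> powers of \<open>Z\<close> have only
  \<open>card B\<close> coordinates each, so they satisfy a nontrivial relation over
  \<open>Q\<close>. Nonzero elements of \<open>Q\<close> become units, whence \<open>Z\<close> is a
  unit.\<close>

lemma QL_field: "field QL"
proof -
  interpret D: domain QL by (rule QL_domain)
  have "Z \<in> Units QL" if Z: "Z \<in> carrier QL" "Z \<noteq> \<zero>\<^bsub>QL\<^esub>" for Z
  proof -
    have "card B < card {..card B}" by simp
    then obtain c where c: "c \<in> {..card B} \<rightarrow> carrier Q" "\<exists>i\<in>{..card B}. c i \<noteq> \<zero>"
      "\<forall>x\<in>B. (\<Oplus>i\<in>{..card B}. c i \<otimes> QT.coord x (Z [^]\<^bsub>QL\<^esub> i)) = \<zero>"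
      using Q.linear_dependence[OF B_finite finite_atMost, of "card B" "\<lambda>i x. QT.coord x (Z [^]\<^bsub>QL\<^esub> i)"] QT.coord_closed Z by auto
    define d where "d i = (if i \<le> card B then q1 (c i) else \<zero>\<^bsub>QL\<^esub>)" for i
    have cc: "c i \<in> carrier Q" if "i \<le> card B" for i using c(1) that by auto
    have dc: "d i \<in> carrier QL" for i using cc by (simp add: d_def)
    have "(\<Oplus>\<^bsub>QL\<^esub>i\<in>{..card B}. d i \<otimes>\<^bsub>QL\<^esub> Z [^]\<^bsub>QL\<^esub> i) = \<zero>\<^bsub>QL\<^esub>"
    proof (rule QT.coords_zero)
      show "(\<Oplus>\<^bsub>QL\<^esub>i\<in>{..card B}. d i \<otimes>\<^bsub>QL\<^esub> Z [^]\<^bsub>QL\<^esub> i) \<in> carrier QL" using dc Z by (intro QT.TA.finsum_closed) auto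
      fix x assume x: "x \<in> B"
      have "QT.coord x (\<Oplus>\<^bsub>QL\<^esub>i\<in>{..card B}. d i \<otimes>\<^bsub>QL\<^esub> Z [^]\<^bsub>QL\<^esub> i) = (\<Oplus>i\<in>{..card B}. QT.coord x (d i \<otimes>\<^bsub>QL\<^esub> Z [^]\<^bsub>QL\<^esub> i))"
        by (rule additive_map_finsum[OF QT.TA_abelian_group Q.abelian_group_axioms QT.coord_lift(1)[OF x]]) (use dc Z in auto)
      also have "\<dots> = (\<Oplus>i\<in>{..card B}. c i \<otimes> QT.coord x (Z [^]\<^bsub>QL\<^esub> i))"
        by (rule Q.finsum_cong'[OF refl]) (use cc x Z QT.coord_smult QT.coord_closed in \<open>auto simp: d_def\<close>)
      finally show "QT.coord x (\<Oplus>\<^bsub>QL\<^esub>i\<in>{..card B}. d i \<otimes>\<^bsub>QL\<^esub> Z [^]\<^bsub>QL\<^esub> i) = \<zero>" using bspec[OF c(3) x] by simp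
    qed
    moreover have "d i = \<zero>\<^bsub>QL\<^esub> \<or> d i \<in> Units QL" for i
      using q1_zero_iff[OF cc, of i] q1_Units[OF cc, of i] by (auto simp: d_def)
    moreover have "\<exists>i\<le>card B. d i \<noteq> \<zero>\<^bsub>QL\<^esub>" using c(2) q1_zero_iff[OF cc] by (auto simp: d_def)
    ultimately show "Z \<in> Units QL" using dc by (intro D.algebraic_unit[OF Z])
  qed
  then have "Units QL = carrier QL - {\<zero>\<^bsub>QL\<^esub>}"
    using D.zero_not_Unit QT.TA.Units_closed by blast
  then show ?thesis by (intro field.intro field_axioms.intro QL_domain)
qed

end

section \<open>The unique point above infinity\<close>

context curve_data
begin

sublocale QF: field QL by (rule QL_field)

text \<open>The local ring of the point above infinity, as a subset of the function field. Apart
  from 0 it consists of the elements whose content lies in \<open>pinf\<close>.\<close>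

definition PL :: "('q, 'l) tens set" where "PL = incl ` carrier PT"

abbreviation "constL \<equiv> (\<lambda>b. atQ \<one> b) ` carrier L"

lemma PL_carrier: "x \<in> PL ==> x \<in> carrier QL"
  using inclP_closed by (auto simp: PL_def)

lemma PL_subring: "subring PL QL"
proof -
  interpret h: ring_hom_ring PT QL incl by (rule ring_hom_ringI2[OF PT.TA.ring_axioms QT.TA.ring_axioms inclP_hom])
  show ?thesis unfolding PL_def by (rule h.img_is_subring[OF PT.TA.carrier_is_subring])
qed

lemmas PL_mult = subringE(6)[OF PL_subring] and PL_add = subringE(7)[OF PL_subring] and PL_zero = subringE(2)[OF PL_subring]
  and PL_one = subringE(3)[OF PL_subring]

lemma at_PL: "a \<in> pinf ==> b \<in> carrier L ==> atQ a b \<in> PL"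
  unfolding PL_def using inclP_pure[of a b] PT.at_closed[of a b] by (metis (no_types, lifting) image_eqI partial_object.select_convs(1) partial_object.update_convs(1) partial_object.surjective)

lemma q1_PL: "q \<in> pinf ==> q1 q \<in> PL"
  by (rule at_PL) auto

text \<open>If \<open>q\<close> has a pole at infinity, its inverse has residue 0. The primitive
  \<open>W\<close> would then be the inverse of \<open>q\<close> times an element of
  \<open>pinf \<otimes> L\<close> and would reduce to 0.\<close>

lemma q1_mult_PL_iff:
  assumes q: "q \<in> carrier Q" "q \<noteq> \<zero>" and W: "W \<in> carrier PT" "\<rho> W \<noteq> \<zero>\<^bsub>L\<^esub>"
  shows "q1 q \<otimes>\<^bsub>QL\<^esub> incl W \<in> PL \<longleftrightarrow> q \<in> pinf"
proof
  assume "q \<in> pinf"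
  then show "q1 q \<otimes>\<^bsub>QL\<^esub> incl W \<in> PL" using W by (intro PL_mult q1_PL) (auto simp: PL_def)
next
  assume "q1 q \<otimes>\<^bsub>QL\<^esub> incl W \<in> PL"
  then obtain Y where Y: "Y \<in> carrier PT" "q1 q \<otimes>\<^bsub>QL\<^esub> incl W = incl Y" by (auto simp: PL_def)
  show "q \<in> pinf"
  proof (rule ccontr)
    assume nq: "q \<notin> pinf"
    then have i: "inv q \<in> pinf - V.U" using V.P_val[OF q] q by (auto simp: V.U_iff Q.inv_field)
    let ?q = "inv q"
    have ic: "?q \<in> carrier Q" using Q.inv_closed_field[OF q] .
    have iP: "atP ?q \<one>\<^bsub>L\<^esub> \<in> carrier PT" using i by auto
    have "incl W = (q1 ?q \<otimes>\<^bsub>QL\<^esub> q1 q) \<otimes>\<^bsub>QL\<^esub> incl W"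
      using q ic inclP_closed[OF W(1)] by (simp add: q1_mult[symmetric] Q.inv_field q1_one)
    also have "\<dots> = q1 ?q \<otimes>\<^bsub>QL\<^esub> incl Y"
      using q ic inclP_closed[OF W(1)] by (simp add: QT.TA.m_assoc Y(2))
    also have "\<dots> = incl (atP ?q \<one>\<^bsub>L\<^esub> \<otimes>\<^bsub>PT\<^esub> Y)"
      using i ring_hom_mult[OF inclP_hom iP Y(1)] inclP_pure[of ?q "\<one>\<^bsub>L\<^esub>"] by simp
    finally have "W = atP ?q \<one>\<^bsub>L\<^esub> \<otimes>\<^bsub>PT\<^esub> Y" using inj_onD[OF inclP_inj _ W(1)] iP Y(1) by simp
    then have "\<rho> W = \<rho> (atP ?q \<one>\<^bsub>L\<^esub>) \<otimes>\<^bsub>L\<^esub> \<rho> Y" using ring_hom_mult[OF \<rho>(1) iP Y(1)] by simp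
    also have "\<rho> (atP ?q \<one>\<^bsub>L\<^esub>) = \<zero>\<^bsub>L\<^esub>"
      using i \<rho>(2)[of ?q "\<one>\<^bsub>L\<^esub>"] res_nonunit[OF i] ring_hom_zero[OF \<iota> K.ring_axioms L.ring_axioms] by simp
    finally show False using W(2) \<rho>_closed[OF Y(1)] by simp
  qed
qed

lemma q1_PL_iff: "q \<in> carrier Q ==> q1 q \<in> PL \<longleftrightarrow> q \<in> pinf"
proof (cases "q = \<zero>")
  case True
  then show ?thesis using V.P_zero PL_zero q1_zero_iff[of q] by simp
next
  case False
  assume q: "q \<in> carrier Q"
  have "incl \<one>\<^bsub>PT\<^esub> = \<one>\<^bsub>QL\<^esub>" by (rule ring_hom_one[OF inclP_hom])
  moreover have "\<rho> \<one>\<^bsub>PT\<^esub> \<noteq> \<zero>\<^bsub>L\<^esub>" by (simp add: ring_hom_one[OF \<rho>(1)])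
  ultimately show ?thesis using q1_mult_PL_iff[OF q False, of "\<one>\<^bsub>PT\<^esub>"] q by simp
qed

text \<open>Write the inverse as content times a primitive element. Multiplication by
  \<open>Y\<close> shows that the content times a primitive element is 1, so the content is regular
  at infinity.\<close>

lemma primitive_unit:
  assumes Y: "Y \<in> carrier PT" "\<rho> Y \<noteq> \<zero>\<^bsub>L\<^esub>"
  shows "inv\<^bsub>QL\<^esub> incl Y \<in> PL"
proof -
  have y: "incl Y \<in> carrier QL" "incl Y \<noteq> \<zero>\<^bsub>QL\<^esub>" using inclP_closed[OF Y(1)] incl_primitive_nonzero[OF Y] by auto
  note iy = QF.inv_closed_field[OF y] QF.inv_field[OF y]
  obtain q Y' where q: "q \<in> carrier Q" "q \<noteq> \<zero>" "Y' \<in> carrier PT" "\<rho> Y' \<noteq> \<zero>\<^bsub>L\<^esub>" "inv\<^bsub>QL\<^esub> incl Y = q1 q \<otimes>\<^bsub>QL\<^esub> incl Y'"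
    using primitive_decomposition[OF iy(1,2)] by blast
  have "q1 q \<otimes>\<^bsub>QL\<^esub> incl (Y' \<otimes>\<^bsub>PT\<^esub> Y) = (q1 q \<otimes>\<^bsub>QL\<^esub> incl Y') \<otimes>\<^bsub>QL\<^esub> incl Y"
    using ring_hom_mult[OF inclP_hom q(3) Y(1)] q1_closed[OF q(1)] inclP_closed[OF q(3)] y by (simp add: QT.TA.m_assoc)
  also have "\<dots> = \<one>\<^bsub>QL\<^esub>" using q(5) iy by simp
  finally have "q1 q \<otimes>\<^bsub>QL\<^esub> incl (Y' \<otimes>\<^bsub>PT\<^esub> Y) \<in> PL" using PL_one by simp
  then have "q \<in> pinf" using q1_mult_PL_iff[OF q(1,2) _ primitive_mult[OF q(3) Y(1) q(4) Y(2)]] q Y by simp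
  then have "q1 q \<in> PL" by (rule q1_PL)
  moreover have "incl Y' \<in> PL" using q(3) by (auto simp: PL_def)
  ultimately show ?thesis unfolding q(5) by (rule PL_mult)
qed

text \<open>Up to a unit every nonzero element of \<open>PL\<close> comes from \<open>pinf\<close>.
  An ideal is therefore generated by the generator of its intersection with the principal ideal
  domain \<open>pinf\<close>.\<close>

lemma PL_ideal_generator:
  assumes "ideal I (QL\<lparr>carrier := PL\<rparr>)"
  shows "\<exists>g\<in>PL. I = PIdl\<^bsub>QL\<lparr>carrier := PL\<rparr>\<^esub> g"
proof -
  interpret I: ideal I "QL\<lparr>carrier := PL\<rparr>" by fact
  have Is: "x \<in> PL" if "x \<in> I" for x using I.Icarr[OF that] by simp
  have Im: "a \<otimes>\<^bsub>QL\<^esub> x \<in> I" if "x \<in> I" "a \<in> PL" for a x using I.I_l_closed[OF that(1)] that(2) by simp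
  have Ia: "x \<oplus>\<^bsub>QL\<^esub> y \<in> I" if "x \<in> I" "y \<in> I" for x y using additive_subgroup.a_closed[OF ideal.axioms(1)[OF assms] that] by simp
  have I0: "\<zero>\<^bsub>QL\<^esub> \<in> I" using additive_subgroup.zero_closed[OF ideal.axioms(1)[OF assms]] by simp
  define I' where "I' = {q \<in> pinf. q1 q \<in> I}"
  obtain g where g: "g \<in> I'" "\<And>x. x \<in> I' ==> \<exists>a\<in>pinf. x = a \<otimes> g"
  proof (rule V.ideal_generator[of I'])
    show "\<zero> \<in> I'" using V.P_zero I0 q1_zero_iff[OF Q.zero_closed] by (simp add: I'_def)
    show "x \<oplus> y \<in> I'" if "x \<in> I'" "y \<in> I'" for x y
      using that V.P_add Ia V.P_carrier by (simp add: I'_def QT.at_add_left)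
    show "a \<otimes> x \<in> I'" if "x \<in> I'" "a \<in> pinf" for a x
      using that V.P_mult Im q1_PL V.P_carrier by (simp add: I'_def q1_mult)
  qed (auto simp: I'_def)
  have gI: "q1 g \<in> I" "g \<in> pinf" using g(1) by (auto simp: I'_def)
  have "I = PIdl\<^bsub>QL\<lparr>carrier := PL\<rparr>\<^esub> (q1 g)"
  proof (intro equalityI subsetI)
    fix Z assume Z: "Z \<in> I"
    show "Z \<in> PIdl\<^bsub>QL\<lparr>carrier := PL\<rparr>\<^esub> (q1 g)"
    proof (cases "Z = \<zero>\<^bsub>QL\<^esub>")
      case True
      then have "Z = \<zero>\<^bsub>QL\<^esub> \<otimes>\<^bsub>QL\<^esub> q1 g" using gI V.P_carrier by simp
      then show ?thesis using PL_zero by (auto simp: cgenideal_def)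
    next
      case False
      have Zc: "Z \<in> carrier QL" "Z \<in> PL" using Is[OF Z] PL_carrier by auto
      obtain q Y where q: "q \<in> carrier Q" "q \<noteq> \<zero>" "Y \<in> carrier PT" "\<rho> Y \<noteq> \<zero>\<^bsub>L\<^esub>" "Z = q1 q \<otimes>\<^bsub>QL\<^esub> incl Y"
        using primitive_decomposition[OF Zc(1) False] by blast
      have qp: "q \<in> pinf" using q1_mult_PL_iff[OF q(1-4)] q(5) Zc(2) by simp
      have y: "incl Y \<in> carrier QL" "incl Y \<noteq> \<zero>\<^bsub>QL\<^esub>" using inclP_closed[OF q(3)] incl_primitive_nonzero[OF q(3,4)] by auto
      note iy = QF.inv_closed_field[OF y] QF.inv_field[OF y]
      have "inv\<^bsub>QL\<^esub> incl Y \<otimes>\<^bsub>QL\<^esub> Z = q1 q \<otimes>\<^bsub>QL\<^esub> (inv\<^bsub>QL\<^esub> incl Y \<otimes>\<^bsub>QL\<^esub> incl Y)"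
        unfolding q(5) using q1_closed[OF q(1)] y(1) iy(1) by (simp add: QT.TA.m_lcomm)
      also have "\<dots> = q1 q" using q1_closed[OF q(1)] iy by simp
      finally have "q1 q \<in> I" using Im[OF Z primitive_unit[OF q(3,4)]] by simp
      then obtain a where a: "a \<in> pinf" "q = a \<otimes> g" using g(2)[of q] qp by (auto simp: I'_def)
      have "Z = (incl Y \<otimes>\<^bsub>QL\<^esub> q1 a) \<otimes>\<^bsub>QL\<^esub> q1 g"
        unfolding q(5) a(2) using V.P_carrier a(1) gI(2) y(1) q1_closed by (simp add: q1_mult QT.TA.m_ac)
      moreover have "incl Y \<otimes>\<^bsub>QL\<^esub> q1 a \<in> PL" using q(3) q1_PL[OF a(1)] by (intro PL_mult) (auto simp: PL_def)
      ultimately show ?thesis by (auto simp: cgenideal_def)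
    qed
  next
    fix Z assume "Z \<in> PIdl\<^bsub>QL\<lparr>carrier := PL\<rparr>\<^esub> (q1 g)"
    then show "Z \<in> I" using Im[OF gI(1)] by (auto simp: cgenideal_def)
  qed
  then show ?thesis using q1_PL[OF gI(2)] by blast
qed

lemma PL_closed_point: "PL \<in> closed_points QL constL"
  unfolding closed_points_def
proof (intro CollectI conjI ballI)
  show "subring PL QL" by (rule PL_subring)
  show "constL \<subseteq> PL" using at_PL[OF V.P_one] by blast
  obtain q where q: "q \<in> carrier Q" "q \<notin> pinf" using V.P_proper V.P_carrier by blast
  show "PL \<noteq> carrier QL" using q1_PL_iff[OF q(1)] q q1_closed by blast
  fix Z assume "Z \<in> carrier QL - {\<zero>\<^bsub>QL\<^esub>}"
  then have Z: "Z \<in> carrier QL" "Z \<noteq> \<zero>\<^bsub>QL\<^esub>" by auto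
  obtain q Y where q: "q \<in> carrier Q" "q \<noteq> \<zero>" "Y \<in> carrier PT" "\<rho> Y \<noteq> \<zero>\<^bsub>L\<^esub>" "Z = q1 q \<otimes>\<^bsub>QL\<^esub> incl Y"
    using primitive_decomposition[OF Z] by blast
  show "Z \<in> PL \<or> inv\<^bsub>QL\<^esub> Z \<in> PL"
  proof (cases "q \<in> pinf")
    case True then show ?thesis using q1_mult_PL_iff[OF q(1-4)] q(5) by simp
  next
    case False
    then have iq: "inv q \<in> pinf" using V.P_val[OF q(1,2)] by blast
    have y: "incl Y \<in> carrier QL" "incl Y \<noteq> \<zero>\<^bsub>QL\<^esub>" using inclP_closed[OF q(3)] incl_primitive_nonzero[OF q(3,4)] by auto
    have "inv\<^bsub>QL\<^esub> (q1 q) = q1 (inv q)"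
      using q Q.inv_closed_field[OF q(1,2)] Q.inv_field[OF q(1,2)]
      by (intro QT.TA.comm_inv_char) (auto simp: q1_mult[symmetric] q1_one)
    then have "inv\<^bsub>QL\<^esub> Z = q1 (inv q) \<otimes>\<^bsub>QL\<^esub> inv\<^bsub>QL\<^esub> incl Y"
      unfolding q(5) using q y q1_zero_iff[OF q(1)] q1_closed[OF q(1)] by (simp add: QF.inv_mult)
    then show ?thesis using PL_mult[OF q1_PL[OF iq] primitive_unit[OF q(3,4)]] by simp
  qed
next
  show "principal_domain (QL\<lparr>carrier := PL\<rparr>)"
    using PL_ideal_generator
    by (intro principal_domain.intro principal_domain_axioms.intro QF.subring_is_domain[OF PL_subring]) simp_all
qed

sublocale VL: valuation_point QL constL PL
  by (intro valuation_point.intro valuation_point_axioms.intro QL_field PL_closed_point)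

text \<open>A point above infinity contains \<open>pinf\<close> and the constants, hence all of
  \<open>PL\<close>; since no local ring of a point properly contains another, it equals
  \<open>PL\<close>.\<close>

lemma pinfL_eq: "(THE P. P \<in> closed_points QL constL \<and> {x \<in> carrier Q. q1 x \<in> P} = pinf) = PL"
proof (rule the_equality)
  show "PL \<in> closed_points QL constL \<and> {x \<in> carrier Q. q1 x \<in> PL} = pinf"
    using PL_closed_point q1_PL_iff V.P_carrier by auto
  fix P assume P: "P \<in> closed_points QL constL \<and> {x \<in> carrier Q. q1 x \<in> P} = pinf"
  then interpret VP: valuation_point QL constL P
    by (intro valuation_point.intro valuation_point_axioms.intro QL_field) simp
  have "incl Y \<in> P" if "Y \<in> carrier PT" for Y
    using that
  proof (induction rule: PT.at_induct)
    case (pure a b)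
    then have a: "a \<in> pinf" and aQ: "a \<in> carrier Q" using V.P_carrier by auto
    have "atQ a b = q1 a \<otimes>\<^bsub>QL\<^esub> atQ \<one> b" using aQ pure by (simp add: QT.at_mult)
    moreover have "q1 a \<in> P" using P a by blast
    moreover have "atQ \<one> b \<in> P" using VP.k_P pure by blast
    ultimately show ?case using VP.P_mult inclP_pure[OF a pure(2)] by simp
  next
    case (add Y Z)
    then show ?case using VP.P_add ring_hom_add[OF inclP_hom] by simp
  qed
  then have "PL \<subseteq> P" by (auto simp: PL_def)
  from closed_points_maximal[OF QL_field PL_closed_point _ this] show "P = PL" using P by simp
qed

text \<open>An extension of constants is unramified. The gain is a uniformizer above infinity that
  is fixed by \<open>\<sigma>\<close>.\<close>

lemma PL_unif:
  assumes t: "V.unif t"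
  shows "VL.unif (q1 t)"
  unfolding VL.unif_def
proof (intro conjI ballI)
  have tc: "t \<in> pinf" "t \<noteq> \<zero>" "t \<in> carrier Q" "inv t \<notin> pinf" using t V.P_carrier by (auto simp: V.unif_def V.U_iff)
  have ti: "inv t \<in> carrier Q" using Q.inv_closed_field tc by blast
  have inv_q1: "inv\<^bsub>QL\<^esub> (q1 q) = q1 (inv q)" if "q \<in> carrier Q" "q \<noteq> \<zero>" for q
    using that Q.inv_closed_field[OF that] Q.inv_field[OF that]
    by (intro QT.TA.comm_inv_char) (auto simp: q1_mult[symmetric] q1_one)
  show "q1 t \<in> PL - VL.U"
    using q1_PL[OF tc(1)] q1_PL_iff[OF ti] inv_q1[OF tc(3,2)] tc by (simp add: VL.U_iff)
  show "q1 t \<noteq> \<zero>\<^bsub>QL\<^esub>" using q1_zero_iff[OF tc(3)] tc by simp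
  fix x assume x: "x \<in> PL - VL.U"
  show "\<exists>y\<in>PL. x = q1 t \<otimes>\<^bsub>QL\<^esub> y"
  proof (cases "x = \<zero>\<^bsub>QL\<^esub>")
    case True then show ?thesis using PL_zero q1_closed[OF tc(3)] by (intro bexI[of _ "\<zero>\<^bsub>QL\<^esub>"]) auto
  next
    case False
    then have xx: "x \<in> carrier QL" "x \<in> PL" "inv\<^bsub>QL\<^esub> x \<notin> PL" using x PL_carrier by (auto simp: VL.U_iff)
    obtain q Y where q: "q \<in> carrier Q" "q \<noteq> \<zero>" "Y \<in> carrier PT" "\<rho> Y \<noteq> \<zero>\<^bsub>L\<^esub>" "x = q1 q \<otimes>\<^bsub>QL\<^esub> incl Y"
      using primitive_decomposition[OF xx(1) False] by blast
    have y: "incl Y \<in> carrier QL" "incl Y \<noteq> \<zero>\<^bsub>QL\<^esub>" "incl Y \<in> PL"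
      using inclP_closed[OF q(3)] incl_primitive_nonzero[OF q(3,4)] q(3) by (auto simp: PL_def)
    have qp: "q \<in> pinf" using q1_mult_PL_iff[OF q(1-4)] q(5) xx(2) by simp
    have "inv q \<notin> pinf"
    proof
      assume iq: "inv q \<in> pinf"
      have "inv\<^bsub>QL\<^esub> x = q1 (inv q) \<otimes>\<^bsub>QL\<^esub> inv\<^bsub>QL\<^esub> incl Y"
        unfolding q(5) using q y q1_zero_iff[OF q(1)] q1_closed[OF q(1)] by (simp add: QF.inv_mult inv_q1)
      then show False using PL_mult[OF q1_PL[OF iq] primitive_unit[OF q(3,4)]] xx(3) by simp
    qed
    then have "q \<in> pinf - V.U" using qp by (simp add: V.U_iff)
    then obtain p where p: "p \<in> pinf" "q = t \<otimes> p" using t unfolding V.unif_def by blast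
    have "x = q1 t \<otimes>\<^bsub>QL\<^esub> (q1 p \<otimes>\<^bsub>QL\<^esub> incl Y)"
      unfolding q(5) p(2) using V.P_carrier[OF p(1)] tc y by (simp add: q1_mult QT.TA.m_assoc q1_closed)
    then show ?thesis using PL_mult[OF q1_PL[OF p(1)] y(3)] by blast
  qed
qed

section \<open>The Frobenius automorphism after extension of constants\<close>

abbreviation "frob b \<equiv> b [^]\<^bsub>L\<^esub> card (carrier K)"

lemma frob: "frob \<in> ring_hom L L" "k \<in> carrier K ==> frob (\<iota>L k) = \<iota>L k" "\<exists>e>0. \<forall>b\<in>carrier L. (frob ^^ e) b = b"
  using frobenius_finite[OF K.field_axioms K_finite L.field_axioms L_finite \<iota>] by auto

definition fe :: nat where "fe = (SOME e. e > 0 \<and> (\<forall>b\<in>carrier L. (frob ^^ e) b = b))"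

lemma fe: "fe > 0" "b \<in> carrier L ==> (frob ^^ fe) b = b"
proof -
  have "\<exists>e. e > 0 \<and> (\<forall>b\<in>carrier L. (frob ^^ e) b = b)" using frob(3) by blast
  from someI_ex[OF this] show "fe > 0" "b \<in> carrier L ==> (frob ^^ fe) b = b" unfolding fe_def by blast+
qed

text \<open>Formulated for every ring \<open>S\<close> between the constants and the function field,
  because it is applied to the affine ring, to the local ring at infinity and to the whole field.
  For the generation statement it is enough that the elements \<open>a \<otimes> 1\<close> are
  invariant, since \<open>a \<otimes> b\<close> is such an element times
  \<open>1 \<otimes> b\<close>.\<close>

lemma sigma_sub:
  assumes S: "subring S Q" "\<iota>Q ` carrier K \<subseteq> S"
  defines "SL \<equiv> tensor_algebra K (Q\<lparr>carrier := S\<rparr>) \<iota>Q L \<iota>L" and "atS \<equiv> alg_tensor K (Q\<lparr>carrier := S\<rparr>) \<iota>Q L \<iota>L"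
  defines "\<sigma> \<equiv> tensor_lift SL (\<lambda>a b. atS a (frob b))"
  shows "\<sigma> \<in> ring_hom SL SL"
    and "a \<in> S ==> b \<in> carrier L ==> \<sigma> (atS a b) = atS a (frob b)"
    and "Z \<in> carrier SL ==> (\<sigma> ^^ fe) Z = Z"
    and "finite ((\<lambda>b. atS \<one> b) ` carrier L)" and "(\<lambda>b. atS \<one> b) ` carrier L \<subseteq> carrier SL"
    and "\<And>H. (\<lambda>b. atS \<one> b) ` carrier L \<subseteq> H ==> H \<subseteq> carrier SL ==> \<zero>\<^bsub>SL\<^esub> \<in> H ==>
       (\<And>a b. a \<in> H ==> b \<in> H ==> a \<oplus>\<^bsub>SL\<^esub> b \<in> H) ==> (\<And>a b. a \<in> fixed_ring SL \<sigma> ==> b \<in> H ==> a \<otimes>\<^bsub>SL\<^esub> b \<in> H) ==> H = carrier SL"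
proof -
  interpret S: basis_algebra K "Q\<lparr>carrier := S\<rparr>" L \<iota>Q \<iota>L B lam by (rule sub_basis_algebra[OF S])
  have u: "(\<lambda>a. a) \<in> ring_hom (Q\<lparr>carrier := S\<rparr>) (Q\<lparr>carrier := S\<rparr>)" by (intro ring_hom_memI) auto
  note * = tensor_algebra_map[OF S.two_algebras_axioms S.two_algebras_axioms u frob(1) refl frob(2)]
  show hom: "\<sigma> \<in> ring_hom SL SL" unfolding \<sigma>_def SL_def atS_def by (rule *(1))
  show pure: "\<sigma> (atS a b) = atS a (frob b)" if "a \<in> S" "b \<in> carrier L" for a b
    unfolding \<sigma>_def SL_def atS_def by (rule *(2)) (use that in auto)
  have fc: "(frob ^^ n) b \<in> carrier L" if "b \<in> carrier L" for n b using that by (induction n) auto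
  have pure_iter: "(\<sigma> ^^ n) (atS a b) = atS a ((frob ^^ n) b)" if "a \<in> S" "b \<in> carrier L" for n a b
    using that by (induction n) (auto simp: pure fc)
  have \<sigma>_add: "additive_map SL SL \<sigma>" using hom by (auto simp: additive_map_def ring_hom_closed ring_hom_add)
  have iter_add: "additive_map SL SL (\<sigma> ^^ n)" for n
  proof (induction n)
    case 0 show ?case by (simp add: additive_map_def)
  next
    case (Suc n) show ?case using additive_map_compose[OF Suc \<sigma>_add] by (simp add: comp_def)
  qed
  have id: "additive_map SL SL (\<lambda>Z. Z)" by (simp add: additive_map_def)
  show "(\<sigma> ^^ fe) Z = Z" if Z: "Z \<in> carrier SL" for Z
    by (rule S.at_map_eq[OF iter_add[unfolded SL_def] id[unfolded SL_def] _ Z[unfolded SL_def]])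
       (use pure_iter fe(2) in \<open>simp add: atS_def\<close>)
  show "finite ((\<lambda>b. atS \<one> b) ` carrier L)" using L_finite by simp
  have oneS: "\<one> \<in> S" by (rule subringE(3)[OF S(1)])
  show "(\<lambda>b. atS \<one> b) ` carrier L \<subseteq> carrier SL" unfolding atS_def SL_def using oneS S.at_closed by auto
  fix H assume H: "(\<lambda>b. atS \<one> b) ` carrier L \<subseteq> H" "H \<subseteq> carrier SL" "\<zero>\<^bsub>SL\<^esub> \<in> H"
    "\<And>a b. a \<in> H ==> b \<in> H ==> a \<oplus>\<^bsub>SL\<^esub> b \<in> H" "\<And>a b. a \<in> fixed_ring SL \<sigma> ==> b \<in> H ==> a \<otimes>\<^bsub>SL\<^esub> b \<in> H"
  have "Z \<in> H" if "Z \<in> carrier S.TA" for Z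
    using that
  proof (induction rule: S.at_induct)
    case (pure a b)
    then have a: "a \<in> S" and b: "b \<in> carrier L" by auto
    have frob1: "frob \<one>\<^bsub>L\<^esub> = \<one>\<^bsub>L\<^esub>" by (rule ring_hom_one[OF frob(1)])
    have "atS a \<one>\<^bsub>L\<^esub> \<in> fixed_ring SL \<sigma>"
      using \<open>\<And>a b. a \<in> S ==> b \<in> carrier L ==> \<sigma> (atS a b) = atS a (frob b)\<close>[OF a, of "\<one>\<^bsub>L\<^esub>"] a frob1 S.at_closed[of a "\<one>\<^bsub>L\<^esub>"]
      by (simp add: fixed_ring_def atS_def SL_def)
    moreover have "atS \<one> b \<in> H" using H(1) b by blast
    ultimately have "atS a \<one>\<^bsub>L\<^esub> \<otimes>\<^bsub>SL\<^esub> atS \<one> b \<in> H" by (rule H(5))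
    then show ?case using S.at_mult[of a "\<one>\<^bsub>L\<^esub>" "\<one>" b] a b oneS subringE(1)[OF S(1)] by (auto simp: atS_def SL_def subset_iff)
  next
    case (add Y Z)
    then show ?case using H(4)[of Y Z] by (simp add: SL_def)
  qed
  then show "H = carrier SL" using H(2) by (auto simp: SL_def)
qed

abbreviation "\<sigma>QL \<equiv> tensor_lift QL (\<lambda>a b. atQ a (frob b))"

lemma \<sigma>QL: "\<sigma>QL \<in> ring_hom QL QL" "a \<in> carrier Q ==> b \<in> carrier L ==> \<sigma>QL (atQ a b) = atQ a (frob b)"
    "Z \<in> carrier QL ==> (\<sigma>QL ^^ fe) Z = Z"
proof -
  have *: "subring (carrier Q) Q" "\<iota>Q ` carrier K \<subseteq> carrier Q" "Q\<lparr>carrier := carrier Q\<rparr> = Q"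
    using Q.carrier_is_subring \<iota>Q_closed by auto
  show "\<sigma>QL \<in> ring_hom QL QL" "a \<in> carrier Q ==> b \<in> carrier L ==> \<sigma>QL (atQ a b) = atQ a (frob b)"
    "Z \<in> carrier QL ==> (\<sigma>QL ^^ fe) Z = Z"
    using sigma_sub(1-3)[OF *(1,2)] unfolding *(3) by blast+
qed

lemma incl_\<sigma>:
  assumes S: "subring S Q" "\<iota>Q ` carrier K \<subseteq> S"
  defines "SL \<equiv> tensor_algebra K (Q\<lparr>carrier := S\<rparr>) \<iota>Q L \<iota>L" and "atS \<equiv> alg_tensor K (Q\<lparr>carrier := S\<rparr>) \<iota>Q L \<iota>L"
  assumes Z: "Z \<in> carrier SL"
  shows "incl (tensor_lift SL (\<lambda>a b. atS a (frob b)) Z) = \<sigma>QL (incl Z)"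
proof -
  interpret S: basis_algebra K "Q\<lparr>carrier := S\<rparr>" L \<iota>Q \<iota>L B lam by (rule sub_basis_algebra[OF S])
  let ?\<sigma> = "tensor_lift SL (\<lambda>a b. atS a (frob b))"
  have Sc: "S \<subseteq> carrier Q" by (rule subringE(1)[OF S(1)])
  have ia: "additive_map SL QL incl" using incl_sub(1)[OF S] by (auto simp: SL_def additive_map_def ring_hom_closed ring_hom_add)
  have sa: "additive_map SL SL ?\<sigma>" using sigma_sub(1)[OF S] by (auto simp: SL_def atS_def additive_map_def ring_hom_closed ring_hom_add)
  have qa: "additive_map QL QL \<sigma>QL" using \<sigma>QL(1) by (auto simp: additive_map_def ring_hom_closed ring_hom_add)
  show ?thesis
  proof (rule S.at_map_eq[OF additive_map_compose[OF sa ia, unfolded SL_def] additive_map_compose[OF ia qa, unfolded SL_def] _ Z[unfolded SL_def], folded SL_def])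
    fix a b assume "a \<in> carrier (Q\<lparr>carrier := S\<rparr>)" "b \<in> carrier L"
    then have ab: "a \<in> S" "b \<in> carrier L" "a \<in> carrier Q" using Sc by auto
    have "?\<sigma> (S.atens a b) = S.atens a (frob b)" using sigma_sub(2)[OF S ab(1,2)] by (simp add: SL_def atS_def)
    then show "incl (?\<sigma> (S.atens a b)) = \<sigma>QL (incl (S.atens a b))"
      using incl_sub(2)[OF S ab(1)] ab \<sigma>QL(2) by simp
  qed
qed

lemma \<sigma>QL_PL: "x \<in> PL ==> \<sigma>QL x \<in> PL"
  using incl_\<sigma>[OF V.P_subring V.k_P] ring_hom_closed[OF sigma_sub(1)[OF V.P_subring V.k_P]] by (auto simp: PL_def)

lemma \<sigma>QL_q1: "q \<in> carrier Q ==> \<sigma>QL (q1 q) = q1 q"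
  using \<sigma>QL(2)[of q "\<one>\<^bsub>L\<^esub>"] by simp

end

section \<open>Finiteness of the poles of a function\<close>

text \<open>Values at \<open>x\<close> of polynomials of degree less than \<open>m\<close> over
  \<open>k\<close>. The Horner form makes the bound \<open>card k ^ m\<close> on their number
  immediate.\<close>

fun polys :: "('f, 'x) ring_scheme \<Rightarrow> 'f set \<Rightarrow> 'f \<Rightarrow> nat \<Rightarrow> 'f set" where
  "polys F k x 0 = {\<zero>\<^bsub>F\<^esub>}"
| "polys F k x (Suc m) = {c \<oplus>\<^bsub>F\<^esub> x \<otimes>\<^bsub>F\<^esub> p |c p. c \<in> k \<and> p \<in> polys F k x m}"

fun pspan :: "('f, 'x) ring_scheme \<Rightarrow> 'f set \<Rightarrow> 'f \<Rightarrow> nat \<Rightarrow> 'f list \<Rightarrow> 'f set" where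
  "pspan F k x m [] = {\<zero>\<^bsub>F\<^esub>}"
| "pspan F k x m (u # us) = {p \<otimes>\<^bsub>F\<^esub> u \<oplus>\<^bsub>F\<^esub> g |p g. p \<in> polys F k x m \<and> g \<in> pspan F k x m us}"

locale poly_data = field F for F :: "('f, 'x) ring_scheme" (structure) +
  fixes k :: "'f set" and x :: 'f
  assumes k_finite: "finite k" and k_subring: "subring k F"
    and k_inv: "c \<in> k ==> c \<noteq> \<zero> ==> inv c \<in> k" and x_carrier: "x \<in> carrier F"
begin

abbreviation "Px \<equiv> polys F k x"
abbreviation "Gx \<equiv> pspan F k x"

lemma k_carrier: "c \<in> k ==> c \<in> carrier F"
  using subringE(1)[OF k_subring] by blast

lemmas k_zero = subringE(2)[OF k_subring] and k_one = subringE(3)[OF k_subring] and k_uminus = subringE(5)[OF k_subring]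
  and k_mult = subringE(6)[OF k_subring] and k_add = subringE(7)[OF k_subring]

lemma Px_carrier: "p \<in> Px m ==> p \<in> carrier F"
  by (induction m arbitrary: p) (auto simp: k_carrier x_carrier)

lemma Px_zero: "\<zero> \<in> Px m"
proof (induction m)
  case (Suc m)
  have "\<zero> = \<zero> \<oplus> x \<otimes> \<zero>" using x_carrier by simp
  then show ?case using k_zero Suc by auto
qed simp

lemma Px_SucI: "c \<in> k ==> p \<in> Px m ==> z = c \<oplus> x \<otimes> p ==> z \<in> Px (Suc m)"
  by auto

lemma Px_mono_Suc: "p \<in> Px m ==> p \<in> Px (Suc m)"
proof (induction m arbitrary: p)
  case 0 then show ?case using Px_zero[of 1] by simp
next
  case (Suc m)
  then obtain c q where *: "c \<in> k" "q \<in> Px m" "p = c \<oplus> x \<otimes> q" by auto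
  show ?case by (rule Px_SucI[OF *(1) Suc.IH[OF *(2)] *(3)])
qed

lemma Px_mono: "m \<le> n ==> p \<in> Px m ==> p \<in> Px n"
  by (induction n rule: dec_induct) (use Px_mono_Suc in blast)+

lemma Px_add: "p \<in> Px m ==> q \<in> Px m ==> p \<oplus> q \<in> Px m"
proof (induction m arbitrary: p q)
  case (Suc m)
  then obtain c r c' r' where *: "c \<in> k" "r \<in> Px m" "p = c \<oplus> x \<otimes> r" "c' \<in> k" "r' \<in> Px m" "q = c' \<oplus> x \<otimes> r'" by auto
  have "p \<oplus> q = (c \<oplus> c') \<oplus> x \<otimes> (r \<oplus> r')"
    using * k_carrier Px_carrier x_carrier by (simp add: r_distr a_ac)
  then show ?case by (rule Px_SucI[OF k_add[OF *(1,4)] Suc.IH[OF *(2,5)]])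
qed simp

lemma Px_smult: "c \<in> k ==> q \<in> Px m ==> c \<otimes> q \<in> Px m"
proof (induction m arbitrary: q)
  case (Suc m)
  then obtain c' r' where *: "c' \<in> k" "r' \<in> Px m" "q = c' \<oplus> x \<otimes> r'" by auto
  have "c \<otimes> q = c \<otimes> c' \<oplus> x \<otimes> (c \<otimes> r')"
    using * Suc.prems(1) k_carrier Px_carrier x_carrier by (simp add: r_distr m_lcomm)
  then show ?case by (rule Px_SucI[OF k_mult[OF Suc.prems(1) *(1)] Suc.IH[OF Suc.prems(1) *(2)]])
qed (simp add: k_carrier)

lemma Px_uminus: "q \<in> Px m ==> \<ominus> q \<in> Px m"
  using Px_smult[OF k_uminus[OF k_one], of q m] Px_carrier by (simp add: l_minus)

lemma Px_xmult: "q \<in> Px m ==> x \<otimes> q \<in> Px (Suc m)"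
  using Px_carrier x_carrier by (intro Px_SucI[OF k_zero]) auto

lemma Px_mult: "p \<in> Px m ==> q \<in> Px n ==> p \<otimes> q \<in> Px (m + n)"
proof (induction m arbitrary: p)
  case 0 then show ?case using Px_zero Px_carrier by auto
next
  case (Suc m)
  then obtain c r where *: "c \<in> k" "r \<in> Px m" "p = c \<oplus> x \<otimes> r" by auto
  have "p \<otimes> q = c \<otimes> q \<oplus> x \<otimes> (r \<otimes> q)"
    using * Suc.prems k_carrier Px_carrier x_carrier by (simp add: l_distr m_assoc)
  moreover have "c \<otimes> q \<in> Px (Suc m + n)" by (rule Px_mono[OF _ Px_smult[OF *(1) Suc.prems(2)]]) simp
  moreover have "x \<otimes> (r \<otimes> q) \<in> Px (Suc m + n)" using Px_xmult[OF Suc.IH[OF *(2) Suc.prems(2)]] by simp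
  ultimately show ?case using Px_add[of "c \<otimes> q" "Suc m + n" "x \<otimes> (r \<otimes> q)"] by (simp only:)
qed

lemma Px_const: "c \<in> k ==> c \<in> Px 1"
  using Px_SucI[OF _ Px_zero[of 0], of c c] k_carrier x_carrier by simp

lemma Px_finite: "finite (Px m) \<and> card (Px m) \<le> card k ^ m"
proof (induction m)
  case (Suc m)
  have eq: "Px (Suc m) = (\<lambda>(c, p). c \<oplus> x \<otimes> p) ` (k \<times> Px m)" by auto
  have "card (Px (Suc m)) \<le> card (k \<times> Px m)" unfolding eq using Suc k_finite by (intro card_image_le) auto
  also have "\<dots> \<le> card k * card k ^ m" using Suc by (simp add: card_cartesian_product)
  finally show ?case using Suc k_finite unfolding eq by simp
qed simp

lemma Gx_carrier: "set us \<subseteq> carrier F ==> g \<in> Gx m us ==> g \<in> carrier F"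
  by (induction us arbitrary: g) (auto simp: Px_carrier)

lemma Gx_ConsI: "p \<in> Px m ==> g \<in> Gx m us ==> z = p \<otimes> u \<oplus> g ==> z \<in> Gx m (u # us)"
  by auto

lemma Gx_zero: "set us \<subseteq> carrier F ==> \<zero> \<in> Gx m us"
  by (induction us) (auto intro!: exI[of _ \<zero>] simp: Px_zero)

lemma Gx_mono: "m \<le> n ==> g \<in> Gx m us ==> g \<in> Gx n us"
proof (induction us arbitrary: g)
  case (Cons u us)
  then show ?case using Px_mono[OF Cons.prems(1)] by auto
qed simp

lemma Gx_add: "set us \<subseteq> carrier F ==> g \<in> Gx m us ==> h \<in> Gx m us ==> g \<oplus> h \<in> Gx m us"
proof (induction us arbitrary: g h)
  case (Cons u us)
  then obtain p r p' r' where *: "p \<in> Px m" "r \<in> Gx m us" "g = p \<otimes> u \<oplus> r" "p' \<in> Px m" "r' \<in> Gx m us" "h = p' \<otimes> u \<oplus> r'" by auto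
  have us: "set us \<subseteq> carrier F" "u \<in> carrier F" using Cons.prems by auto
  have "g \<oplus> h = (p \<oplus> p') \<otimes> u \<oplus> (r \<oplus> r')"
    using * Px_carrier Gx_carrier[OF us(1)] us by (simp add: l_distr a_ac)
  then show ?case by (rule Gx_ConsI[OF Px_add[OF *(1,4)] Cons.IH[OF us(1) *(2,5)]])
qed simp

lemma Gx_mult: "set us \<subseteq> carrier F ==> d \<in> Px n ==> g \<in> Gx m us ==> d \<otimes> g \<in> Gx (n + m) us"
proof (induction us arbitrary: g)
  case Nil then show ?case using Px_carrier by simp
next
  case (Cons u us)
  then obtain p r where *: "p \<in> Px m" "r \<in> Gx m us" "g = p \<otimes> u \<oplus> r" by auto
  have us: "set us \<subseteq> carrier F" "u \<in> carrier F" using Cons.prems by auto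
  have "d \<otimes> g = (d \<otimes> p) \<otimes> u \<oplus> d \<otimes> r"
    using * Cons.prems(2) Px_carrier Gx_carrier[OF us(1)] us by (simp add: r_distr m_assoc)
  then show ?case by (rule Gx_ConsI[OF Px_mult[OF Cons.prems(2) *(1)] Cons.IH[OF us(1) Cons.prems(2) *(2)]])
qed

lemma Gx_finite: "finite (Gx m us) \<and> card (Gx m us) \<le> card (Px m) ^ length us"
proof (induction us)
  case (Cons u us)
  have eq: "Gx m (u # us) = (\<lambda>(p, g). p \<otimes> u \<oplus> g) ` (Px m \<times> Gx m us)" by auto
  have "card (Gx m (u # us)) \<le> card (Px m \<times> Gx m us)" unfolding eq using Cons Px_finite by (intro card_image_le) auto
  also have "\<dots> \<le> card (Px m) * card (Px m) ^ length us" using Cons by (simp add: card_cartesian_product)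
  finally show ?case using Cons Px_finite unfolding eq by simp
qed simp

text \<open>Multiplication by a fixed element raises degrees by a constant, which can be read off
  from the finite spanning list.\<close>

lemma Gx_linear:
  assumes us: "set us \<subseteq> carrier F" "set vs \<subseteq> carrier F" and y: "y \<in> carrier F"
    and gen: "\<And>u. u \<in> set us ==> y \<otimes> u \<in> Gx E vs" and g: "g \<in> Gx m us"
  shows "y \<otimes> g \<in> Gx (m + E) vs"
  using us(1) gen g
proof (induction us arbitrary: g)
  case Nil then show ?case using y Gx_zero[OF us(2)] by simp
next
  case (Cons u us)
  then obtain p r where *: "p \<in> Px m" "r \<in> Gx m us" "g = p \<otimes> u \<oplus> r" by auto
  have us': "set us \<subseteq> carrier F" "u \<in> carrier F" using Cons.prems by auto
  have "y \<otimes> g = p \<otimes> (y \<otimes> u) \<oplus> y \<otimes> r"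
    using * y Px_carrier Gx_carrier[OF us'(1)] us' by (simp add: r_distr m_lcomm)
  moreover have "p \<otimes> (y \<otimes> u) \<in> Gx (m + E) vs" using Gx_mult[OF us(2) *(1)] Cons.prems(2) by simp
  moreover have "y \<otimes> r \<in> Gx (m + E) vs" using Cons.IH[OF us'(1) _ *(2)] Cons.prems(2) by simp
  ultimately show ?case using Gx_add[OF us(2)] by simp
qed

end

text \<open>Encodes that \<open>F\<close> is finite over the field generated by \<open>x\<close>: up
  to a polynomial denominator every element is a combination of \<open>us\<close> with polynomial
  coefficients. Elements can then be counted by degree.\<close>

locale growth = poly_data F k x for F :: "('f, 'x) ring_scheme" (structure) and k x +
  fixes us :: "'f list"
  assumes us: "set us \<subseteq> carrier F"
    and clear: "z \<in> carrier F ==> \<exists>D E. \<exists>d\<in>Px D. d \<noteq> \<zero> \<and> d \<otimes> z \<in> Gx E us"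
begin

lemma clear_list:
  "set zs \<subseteq> carrier F ==> \<exists>D. \<exists>d\<in>Px D. d \<noteq> \<zero> \<and> (\<forall>z\<in>set zs. d \<otimes> z \<in> Gx D us)"
proof (induction zs)
  case Nil
  show ?case by (rule exI[of _ 1], rule bexI[OF _ Px_const[OF k_one]]) simp
next
  case (Cons z zs)
  then have z: "z \<in> carrier F" and zs: "set zs \<subseteq> carrier F" by auto
  obtain D d where d: "d \<in> Px D" "d \<noteq> \<zero>" "\<And>z. z \<in> set zs ==> d \<otimes> z \<in> Gx D us" using Cons.IH[OF zs] by blast
  obtain D' E' d' where d': "d' \<in> Px D'" "d' \<noteq> \<zero>" "d' \<otimes> z \<in> Gx E' us" using clear[OF z] by blast
  let ?D = "D + D' + E'"
  have c: "d \<in> carrier F" "d' \<in> carrier F" using d d' Px_carrier by auto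
  have 1: "d \<otimes> d' \<in> Px ?D" by (rule Px_mono[OF _ Px_mult[OF d(1) d'(1)]]) simp
  have "(d \<otimes> d') \<otimes> w \<in> Gx ?D us" if w: "w \<in> set (z # zs)" for w
  proof (cases "w \<in> set zs")
    case True
    then have wc: "w \<in> carrier F" using zs by auto
    have "d' \<otimes> (d \<otimes> w) \<in> Gx (D' + D) us" by (rule Gx_mult[OF us d'(1) d(3)[OF True]])
    then have "d' \<otimes> (d \<otimes> w) \<in> Gx ?D us" by (rule Gx_mono[rotated]) simp
    then show ?thesis using c wc by (simp add: m_ac)
  next
    case False
    then have [simp]: "w = z" using w by auto
    have "d \<otimes> (d' \<otimes> z) \<in> Gx (D + E') us" by (rule Gx_mult[OF us d(1) d'(3)])
    then have "d \<otimes> (d' \<otimes> z) \<in> Gx ?D us" by (rule Gx_mono[rotated]) simp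
    then show ?thesis using c z by (simp add: m_assoc)
  qed
  moreover have "d \<otimes> d' \<noteq> \<zero>" using c d(2) d'(2) by (simp add: integral_iff)
  ultimately show ?case using 1 by blast
qed

definition comb :: "nat \<Rightarrow> (nat \<Rightarrow> 'f) \<Rightarrow> (nat \<Rightarrow> 'f) \<Rightarrow> 'f"
  where "comb N z c = (\<Oplus>i\<in>{..<N}. c i \<otimes> z i)"

text \<open>The value at \<open>y\<close> of a polynomial whose coefficients are
  \<open>k\<close>-combinations of the \<open>z i\<close>, with the lowest coefficient at the head
  of the list.\<close>

fun horner :: "nat \<Rightarrow> (nat \<Rightarrow> 'f) \<Rightarrow> 'f \<Rightarrow> (nat \<Rightarrow> 'f) list \<Rightarrow> 'f" where
  "horner N z y [] = \<zero>"
| "horner N z y (c # cs) = comb N z c \<oplus> y \<otimes> horner N z y cs"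

context
  fixes N :: nat and z :: "nat \<Rightarrow> 'f" and y :: 'f
  assumes z: "\<And>i. i < N ==> z i \<in> carrier F" and y: "y \<in> carrier F" "y \<noteq> \<zero>"
begin

abbreviation "C0 \<equiv> {..<N} \<rightarrow>\<^sub>E k"

lemma comb_closed: "c \<in> {..<N} \<rightarrow> k ==> comb N z c \<in> carrier F"
  unfolding comb_def using z k_carrier by (intro finsum_closed) (auto simp: Pi_iff)

lemma comb_diff:
  assumes "c \<in> {..<N} \<rightarrow> k" "c' \<in> {..<N} \<rightarrow> k"
  shows "comb N z (\<lambda>i. c i \<ominus> c' i) = comb N z c \<ominus> comb N z c'"
proof -
  have cc: "c i \<in> carrier F" "c' i \<in> carrier F" if "i < N" for i using assms that k_carrier by (auto simp: Pi_iff)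
  have "comb N z (\<lambda>i. c i \<ominus> c' i) = (\<Oplus>i\<in>{..<N}. c i \<otimes> z i \<oplus> (\<ominus> \<one>) \<otimes> (c' i \<otimes> z i))"
    unfolding comb_def using cc z by (intro finsum_cong') (auto simp: minus_eq l_distr l_minus)
  also have "\<dots> = comb N z c \<oplus> (\<Oplus>i\<in>{..<N}. (\<ominus> \<one>) \<otimes> (c' i \<otimes> z i))"
    unfolding comb_def using cc z by (intro finsum_addf) auto
  also have "(\<Oplus>i\<in>{..<N}. (\<ominus> \<one>) \<otimes> (c' i \<otimes> z i)) = (\<ominus> \<one>) \<otimes> comb N z c'"
    unfolding comb_def using cc z by (intro finsum_rdistr[symmetric]) auto
  finally show ?thesis using comb_closed[OF assms(2)] by (simp add: l_minus minus_eq)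
qed

lemma C0_Pi: "c \<in> C0 ==> c \<in> {..<N} \<rightarrow> k"
  by auto

lemma horner_closed: "set cs \<subseteq> C0 ==> horner N z y cs \<in> carrier F"
  by (induction cs) (auto simp: y intro!: comb_closed)

lemma comb_in:
  assumes P: "subring P F" "k \<subseteq> P" "\<And>i. i < N ==> z i \<in> P" and c: "c \<in> {..<N} \<rightarrow> k"
  shows "comb N z c \<in> P"
  unfolding comb_def
proof (rule finsum_in[OF abelian_group_axioms subringE(1,2)[OF P(1)]])
  show "a \<oplus> b \<in> P" if "a \<in> P" "b \<in> P" for a b using subringE(7)[OF P(1) that] .
  show "c i \<otimes> z i \<in> P" if "i \<in> {..<N}" for i
    using subringE(6)[OF P(1)] P(2,3) c that by (auto simp: Pi_iff subset_iff)
qed simp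

lemma horner_in:
  assumes P: "subring P F" "k \<subseteq> P" "\<And>i. i < N ==> z i \<in> P" "y \<in> P"
  shows "set cs \<subseteq> C0 ==> horner N z y cs \<in> P"
proof (induction cs)
  case Nil then show ?case using subringE(2)[OF P(1)] by simp
next
  case (Cons c cs)
  then have "comb N z c \<in> P" "horner N z y cs \<in> P" using comb_in[OF P(1-3)] by auto
  then show ?case using subringE(6,7)[OF P(1)] P(4) by simp
qed

text \<open>Equal heads are cancelled together with a factor \<open>y\<close>. At the first unequal
  heads, their difference is \<open>y\<close> times a difference of Horner values, and Horner values
  stay in every subring that contains \<open>k\<close>, \<open>y\<close> and the
  \<open>z i\<close>.\<close>

lemma horner_collision:
  assumes "set cs \<subseteq> C0" "set cs' \<subseteq> C0" "length cs = length cs'" "cs \<noteq> cs'" "horner N z y cs = horner N z y cs'"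
  shows "\<exists>c\<in>{..<N} \<rightarrow> k. (\<exists>i<N. c i \<noteq> \<zero>) \<and> (\<exists>w. comb N z c = y \<otimes> w \<and>
    (\<forall>P. subring P F \<longrightarrow> k \<subseteq> P \<longrightarrow> y \<in> P \<longrightarrow> (\<forall>i<N. z i \<in> P) \<longrightarrow> w \<in> P))"
  using assms
proof (induction cs arbitrary: cs')
  case Nil then show ?case by simp
next
  case (Cons c cs)
  then obtain c' r where cs': "cs' = c' # r" by (cases cs') auto
  have s: "set cs \<subseteq> C0" "set r \<subseteq> C0" "c \<in> C0" "c' \<in> C0" "length cs = length r" using Cons.prems cs' by auto
  have cl: "horner N z y cs \<in> carrier F" "horner N z y r \<in> carrier F" "comb N z c \<in> carrier F" "comb N z c' \<in> carrier F"
    using horner_closed s comb_closed C0_Pi by auto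
  have eq: "comb N z c \<oplus> y \<otimes> horner N z y cs = comb N z c' \<oplus> y \<otimes> horner N z y r" using Cons.prems(5) cs' by simp
  show ?case
  proof (cases "c = c'")
    case True
    then have "y \<otimes> horner N z y cs = y \<otimes> horner N z y r" using eq cl y by simp
    then have "horner N z y cs = horner N z y r" using m_lcancel[OF y(2,1)] cl by simp
    then show ?thesis using Cons.IH[OF s(1,2,5)] Cons.prems(4) cs' True by auto
  next
    case False
    let ?w = "horner N z y r \<ominus> horner N z y cs"
    let ?d = "\<lambda>i. c i \<ominus> c' i"
    have "comb N z ?d = comb N z c \<ominus> comb N z c'" using comb_diff C0_Pi s by blast
    also have "\<dots> = (comb N z c \<oplus> y \<otimes> horner N z y cs) \<ominus> (comb N z c' \<oplus> y \<otimes> horner N z y cs)"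
      using cl y by algebra
    also have "\<dots> = y \<otimes> ?w" unfolding eq using cl y by algebra
    finally have 1: "comb N z ?d = y \<otimes> ?w" .
    have 2: "?w \<in> P" if "subring P F" "k \<subseteq> P" "y \<in> P" "\<forall>i<N. z i \<in> P" for P
    proof -
      have "horner N z y r \<in> P" "horner N z y cs \<in> P" using horner_in[of P] that s by auto
      then show ?thesis unfolding minus_eq using subringE(5,7)[OF that(1)] by blast
    qed
    have "\<exists>i<N. c i \<noteq> c' i"
    proof (rule ccontr)
      assume "\<not> (\<exists>i<N. c i \<noteq> c' i)"
      then have "c = c'" using s(3,4) by (intro PiE_ext[of c "{..<N}" "\<lambda>_. k"]) auto
      then show False using False by simp
    qed
    then obtain i where i: "i < N" "c i \<noteq> c' i" by blast
    have ck: "c i \<in> k" "c' i \<in> k" if "i < N" for i using s(3,4) that by (auto simp: PiE_iff)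
    have "?d i \<noteq> \<zero>" using minus_eq_zeroD[of "c i" "c' i"] ck[OF i(1)] k_carrier i(2) by blast
    moreover have "?d \<in> {..<N} \<rightarrow> k" unfolding minus_eq using ck k_add k_uminus by auto
    ultimately show ?thesis
    proof (intro bexI[of _ ?d] conjI)
      show "\<exists>w. comb N z ?d = y \<otimes> w \<and> (\<forall>P. subring P F \<longrightarrow> k \<subseteq> P \<longrightarrow> y \<in> P \<longrightarrow> (\<forall>i<N. z i \<in> P) \<longrightarrow> w \<in> P)"
        by (rule exI[of _ ?w]) (use 1 2 in blast)
    qed (use i(1) in blast)+
  qed
qed

end

text \<open>
  Pigeonhole: over a finite constant field there are more polynomials in \<open>y\<close> of bounded degree with
  coefficients in the span of the \<open>z i\<close> than values they can take, so two of them agree. The clause on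
  subrings ensures that the quotient \<open>w\<close> has no poles where \<open>y\<close> and the \<open>z i\<close> have none.
\<close>
lemma dependence_mod:
  assumes y: "y \<in> carrier F" "y \<noteq> \<zero>"
  shows "\<exists>N. \<forall>z. (\<forall>i<N. z i \<in> carrier F) \<longrightarrow> (\<exists>c\<in>{..<N} \<rightarrow> k. (\<exists>i<N. c i \<noteq> \<zero>) \<and> (\<exists>w. comb N z c = y \<otimes> w \<and>
    (\<forall>P. subring P F \<longrightarrow> k \<subseteq> P \<longrightarrow> y \<in> P \<longrightarrow> (\<forall>i<N. z i \<in> P) \<longrightarrow> w \<in> P)))"
proof -
  define s where "s = length us"
  have "set (map (\<lambda>u. y \<otimes> u) us) \<subseteq> carrier F" using us y by auto
  from clear_list[OF this] obtain D d where d: "d \<in> Px D" "d \<noteq> \<zero>" "\<And>u. u \<in> set us ==> d \<otimes> (y \<otimes> u) \<in> Gx D us" by auto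
  have dc: "d \<in> carrier F" using d Px_carrier by auto
  have dyG: "(d \<otimes> y) \<otimes> g \<in> Gx (m + D) us" if "g \<in> Gx m us" for g m
    by (rule Gx_linear[OF us us _ _ that]) (use d dc y us in \<open>auto simp: m_assoc subset_iff\<close>)
  \<comment> \<open>\<open>D\<close> depends on \<open>y\<close> alone, so \<open>N\<close> does not
    depend on the \<open>z i\<close>. Each further Horner step raises the degree by \<open>D\<close>
    in each of \<open>s\<close> coordinates, hence multiplies the number of possible values by at
    most \<open>card k ^ (s * D)\<close>, while it offers \<open>N = s * D + 1\<close> free
    constants.\<close>
  define N where "N = s * D + 1"
  have "\<exists>c\<in>{..<N} \<rightarrow> k. (\<exists>i<N. c i \<noteq> \<zero>) \<and> (\<exists>w. comb N z c = y \<otimes> w \<and>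
    (\<forall>P. subring P F \<longrightarrow> k \<subseteq> P \<longrightarrow> y \<in> P \<longrightarrow> (\<forall>i<N. z i \<in> P) \<longrightarrow> w \<in> P))" if z: "\<And>i. i < N ==> z i \<in> carrier F" for z
  proof -
    have "set (map z [0..<N]) \<subseteq> carrier F" using z by auto
    from clear_list[OF this] obtain m0 d' where d': "d' \<in> Px m0" "d' \<noteq> \<zero>" "\<And>i. i < N ==> d' \<otimes> z i \<in> Gx m0 us" by auto
    have d'c: "d' \<in> carrier F" using d' Px_carrier by auto
    have comb_G: "d' \<otimes> comb N z c \<in> Gx m0 us" if c: "c \<in> {..<N} \<rightarrow>\<^sub>E k" for c
    proof -
      have cc: "c i \<in> k" "c i \<in> carrier F" if "i < N" for i using c that k_carrier by (auto simp: PiE_iff)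
      have "d' \<otimes> comb N z c = (\<Oplus>i\<in>{..<N}. d' \<otimes> (c i \<otimes> z i))"
        unfolding comb_def using cc z d'c by (intro finsum_rdistr) auto
      also have "\<dots> \<in> Gx m0 us"
      proof (rule finsum_in[OF abelian_group_axioms])
        show "Gx m0 us \<subseteq> carrier F" using Gx_carrier[OF us] by blast
        show "\<zero> \<in> Gx m0 us" by (rule Gx_zero[OF us])
        show "a \<oplus> b \<in> Gx m0 us" if "a \<in> Gx m0 us" "b \<in> Gx m0 us" for a b by (rule Gx_add[OF us that])
        fix i assume "i \<in> {..<N}"
        then have i: "i < N" by simp
        have sm: "c i \<otimes> g \<in> Gx m0 us" if "g \<in> Gx m0 us" for g
          using that us
        proof (induction us arbitrary: g)
          case Nil then show ?case using cc[OF i] by simp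
        next
          case (Cons u us)
          then obtain p r where *: "p \<in> Px m0" "r \<in> Gx m0 us" "g = p \<otimes> u \<oplus> r" by auto
          have us': "set us \<subseteq> carrier F" "u \<in> carrier F" using Cons.prems by auto
          have "c i \<otimes> g = (c i \<otimes> p) \<otimes> u \<oplus> c i \<otimes> r"
            using * cc[OF i] Px_carrier Gx_carrier[OF us'(1)] us' by (simp add: r_distr m_assoc)
          then show ?case by (rule Gx_ConsI[OF Px_smult[OF cc(1)[OF i] *(1)] Cons.IH[OF *(2) us'(1)]])
        qed
        have "c i \<otimes> (d' \<otimes> z i) \<in> Gx m0 us" by (rule sm[OF d'(3)[OF i]])
        then show "d' \<otimes> (c i \<otimes> z i) \<in> Gx m0 us" using cc[OF i] z[OF i] d'c by (simp add: m_lcomm)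
      qed simp
      finally show ?thesis .
    qed
    \<comment> \<open>Multiplication by \<open>y\<close> is controlled only together with its
      denominator \<open>d\<close>, so a list of given length requires that many factors
      \<open>d\<close>, besides the common denominator \<open>d'\<close> of the
      \<open>z i\<close>.\<close>
    have horner_G: "(d' \<otimes> d [^] length cs) \<otimes> horner N z y cs \<in> Gx (m0 + D * length cs) us" if "set cs \<subseteq> {..<N} \<rightarrow>\<^sub>E k" for cs
      using that
    proof (induction cs)
      case Nil then show ?case using d'c dc Gx_zero[OF us] by simp
    next
      case (Cons c cs)
      let ?h = "horner N z y cs" and ?n = "length cs"
      have "comb N z c \<in> carrier F" by (rule comb_closed[OF _ y]) (use z Cons.prems in auto)
      moreover have "?h \<in> carrier F" by (rule horner_closed[OF _ y]) (use z Cons.prems in auto)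
      moreover have "d [^] ?n \<in> carrier F" using dc by simp
      ultimately have cl: "comb N z c \<in> carrier F" "?h \<in> carrier F" "d [^] ?n \<in> carrier F" by blast+
      have "(d' \<otimes> d [^] Suc ?n) \<otimes> (comb N z c \<oplus> y \<otimes> ?h) =
         d [^] Suc ?n \<otimes> (d' \<otimes> comb N z c) \<oplus> (d \<otimes> y) \<otimes> ((d' \<otimes> d [^] ?n) \<otimes> ?h)"
        using cl dc d'c y by (simp add: r_distr m_ac)
      moreover have "d [^] Suc n \<in> Px (D * Suc n)" for n
      proof (induction n)
        case 0 then show ?case using d(1) dc by simp
      next
        case (Suc n) then show ?case using Px_mult[OF Suc d(1)] by (simp add: algebra_simps)
      qed
      then have "d [^] Suc ?n \<otimes> (d' \<otimes> comb N z c) \<in> Gx (D * Suc ?n + m0) us"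
        using Gx_mult[OF us] comb_G[of c] Cons.prems by auto
      moreover have "(d \<otimes> y) \<otimes> ((d' \<otimes> d [^] ?n) \<otimes> ?h) \<in> Gx (m0 + D * ?n + D) us"
        using dyG Cons by auto
      ultimately show ?case using Gx_add[OF us] by (simp add: algebra_simps del: nat_pow_Suc)
    qed
    \<comment> \<open>The denominators of the \<open>z i\<close> cost a fixed degree
      \<open>m0\<close>. The surplus of one constant per step outweighs this as soon as
      \<open>n > s * m0\<close>, for then \<open>N * n = s * D * n + n\<close> exceeds
      \<open>s * (m0 + D * n)\<close>.\<close>
    define n where "n = s * m0 + 1"
    define LS where "LS = {cs. set cs \<subseteq> {..<N} \<rightarrow>\<^sub>E k \<and> length cs = n}"
    have finC: "finite ({..<N} \<rightarrow>\<^sub>E k)" using k_finite by (intro finite_PiE) auto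
    have cardLS: "card LS = card k ^ (N * n)"
      unfolding LS_def using card_lists_length_eq[OF finC, of n] by (simp add: card_PiE power_mult)
    let ?f = "\<lambda>cs. (d' \<otimes> d [^] n) \<otimes> horner N z y cs"
    have "?f ` LS \<subseteq> Gx (m0 + D * n) us" using horner_G by (auto simp: LS_def)
    then have "card (?f ` LS) \<le> card (Gx (m0 + D * n) us)" using Gx_finite by (intro card_mono) auto
    also have "\<dots> \<le> card (Px (m0 + D * n)) ^ s" using Gx_finite by (simp add: s_def)
    also have "\<dots> \<le> (card k ^ (m0 + D * n)) ^ s" using Px_finite by (intro power_mono) auto
    also have "\<dots> = card k ^ (s * m0 + s * D * n)" by (simp add: power_mult[symmetric] algebra_simps)
    also have "\<dots> < card k ^ (N * n)"
    proof (rule power_strict_increasing)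
      have "{\<zero>, \<one>} \<subseteq> k" using k_zero k_one by simp
      then have "card {\<zero>, \<one>} \<le> card k" using k_finite by (intro card_mono)
      then show "1 < card k" using one_not_zero by simp
      show "s * m0 + s * D * n < N * n" by (simp add: N_def n_def algebra_simps)
    qed
    finally have "card (?f ` LS) < card LS" by (simp add: cardLS)
    then have "\<not> inj_on ?f LS" using card_image by fastforce
    then obtain cs cs' where cs: "cs \<in> LS" "cs' \<in> LS" "cs \<noteq> cs'" "?f cs = ?f cs'" by (auto simp: inj_on_def)
    have "d [^] m \<noteq> \<zero>" for m :: nat using d(2) dc by (induction m) (auto simp: integral_iff)
    then have "d' \<otimes> d [^] n \<noteq> \<zero>" using d'(2) d'c dc by (simp add: integral_iff)
    then have "horner N z y cs = horner N z y cs'"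
      using cs m_lcancel[of "d' \<otimes> d [^] n" "horner N z y cs" "horner N z y cs'"] horner_closed[OF z y] d'c dc by (auto simp: LS_def)
    then show ?thesis using cs by (intro horner_collision[OF z y, where cs = cs and cs' = cs']) (auto simp: LS_def)
  qed
  then show ?thesis by (intro exI[of _ N]) blast
qed

end

section \<open>Weak approximation at finitely many points\<close>

context valuation_point
begin

lemma notin_P_iff: "x \<in> carrier F ==> x \<notin> P \<longleftrightarrow> x \<noteq> \<zero> \<and> inv x \<in> P - U"
proof (cases "x = \<zero>")
  case True then show ?thesis using P_zero by simp
next
  case False
  assume x: "x \<in> carrier F"
  show ?thesis using P_val[OF x False] inv_field(1,4)[OF x False] False by (auto simp: U_iff)
qed

text \<open>If \<open>w\<close> has order \<open>n\<close>, then \<open>u [^] m\<close> times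
  \<open>w\<close> has order at least \<open>m + n\<close>.\<close>

lemma power_absorbs:
  assumes u: "u \<in> P - U" and w: "w \<in> carrier F"
  shows "\<exists>n0. \<forall>n\<ge>n0. u [^] (n::nat) \<otimes> w \<in> P - U"
proof (cases "w = \<zero>")
  case True
  have uc: "u \<in> carrier F" using u P_carrier by auto
  have "u [^] (n::nat) \<otimes> w \<in> P - U" for n using nonunit_zero uc by (simp add: True)
  then show ?thesis by blast
next
  case False
  obtain t where t: "unif t" using exists_unif by blast
  obtain n v where v: "v \<in> U" "w = tp t n \<otimes> v" using tp_decompose[OF t w False] by blast
  obtain y where y: "y \<in> P" "u = t \<otimes> y" using t u unfolding unif_def by blast
  have c: "t \<in> carrier F" "y \<in> carrier F" "v \<in> carrier F" "v \<in> P" using t_carrier[OF t] y v P_carrier by (auto simp: U_iff)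
  have yn: "y [^] m \<in> P" for m :: nat using y(1) by (induction m) (auto simp: P_one P_mult)
  have "u [^] m \<otimes> w \<in> P - U" if m: "m \<ge> nat (- n) + 1" for m :: nat
  proof -
    have "u [^] m \<otimes> w = (t [^] m \<otimes> tp t n) \<otimes> (y [^] m \<otimes> v)"
      unfolding y(2) v(2) using c tp_closed[OF t] by (simp add: nat_pow_distrib m_ac)
    also have "t [^] m \<otimes> tp t n = tp t (int m + n)" using tp_add[OF t] tp_nat[OF t] by simp
    finally show ?thesis using nonunit_mult[OF tp_pos[OF t, of "int m + n"] P_mult[OF yn c(4)]] m by simp
  qed
  then show ?thesis by blast
qed

end

locale points_data = field F for F :: "('f, 'x) ring_scheme" (structure) + fixes k :: "'f set"
begin

lemma vp: "P \<in> closed_points F k ==> valuation_point F k P"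
  by (intro valuation_point.intro valuation_point_axioms.intro field_axioms)

abbreviation "mx P \<equiv> P - dvr_units F P"

text \<open>Neither local ring contains the other. The quotient of two elements that witness this
  has a pole at one point and a zero at the other.\<close>

lemma separate_pair:
  assumes P: "P \<in> closed_points F k" "P' \<in> closed_points F k" "P \<noteq> P'"
  obtains w where "w \<in> carrier F" "w \<notin> P" "w \<in> mx P'"
proof -
  interpret V: valuation_point F k P by (rule vp[OF P(1)])
  interpret V': valuation_point F k P' by (rule vp[OF P(2)])
  obtain a where a: "a \<in> P'" "a \<notin> P" using closed_points_maximal[OF field_axioms P(2,1)] P(3) by blast
  obtain b where b: "b \<in> P" "b \<notin> P'" using closed_points_maximal[OF field_axioms P(1,2)] P(3) by blast
  have c: "a \<in> carrier F" "b \<in> carrier F" "b \<noteq> \<zero>" using a b V'.P_carrier V.P_carrier V'.P_zero by auto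
  have ib: "inv b \<in> mx P'" using V'.notin_P_iff[OF c(2)] b(2) by blast
  note i = inv_closed_field[OF c(2,3)] inv_field[OF c(2,3)]
  show thesis
  proof (rule that[of "a \<otimes> inv b"])
    show "a \<otimes> inv b \<in> carrier F" using c i by simp
    show "a \<otimes> inv b \<in> mx P'" using V'.nonunit_mult[OF ib a(1)] c i by (simp add: m_comm)
    show "a \<otimes> inv b \<notin> P"
    proof
      assume "a \<otimes> inv b \<in> P"
      from V.P_mult[OF this b(1)] show False using a(2) c i by (simp add: m_assoc)
    qed
  qed
qed

lemma one_plus_unit:
  assumes P: "P \<in> closed_points F k" and z: "z \<in> mx P"
  shows "\<one> \<oplus> z \<in> dvr_units F P"
proof -
  interpret V: valuation_point F k P by (rule vp[OF P])
  have zc: "z \<in> carrier F" using z V.P_carrier by auto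
  show ?thesis
  proof (rule ccontr)
    assume "\<one> \<oplus> z \<notin> dvr_units F P"
    then have "\<one> \<oplus> z \<in> mx P" using z V.P_add[OF V.P_one] by auto
    from V.nonunit_add[OF this V.nonunit_uminus[OF z]] have "\<one> \<in> mx P" using zc by (simp add: a_assoc r_neg)
    then show False using V.one_U by blast
  qed
qed

text \<open>\<open>z / (1 + z) = 1 / (1 + 1 / z)\<close> has residue 1 where \<open>z\<close> has a
  pole, and it vanishes where \<open>z\<close> vanishes. This substitution turns poles into units
  while keeping zeros.\<close>

lemma pole_quotient_unit:
  assumes P: "P \<in> closed_points F k" and z: "z \<in> carrier F" "z \<notin> P"
  shows "\<one> \<oplus> z \<noteq> \<zero>" "z \<otimes> inv (\<one> \<oplus> z) \<in> dvr_units F P"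
proof -
  interpret V: valuation_point F k P by (rule vp[OF P])
  have iz: "z \<noteq> \<zero>" "inv z \<in> mx P" using V.notin_P_iff[OF z(1)] z(2) by auto
  note i = inv_closed_field[OF z(1) iz(1)] inv_field[OF z(1) iz(1)]
  have u: "\<one> \<oplus> inv z \<in> dvr_units F P" by (rule one_plus_unit[OF P iz(2)])
  then have uc: "\<one> \<oplus> inv z \<in> carrier F" "\<one> \<oplus> inv z \<noteq> \<zero>" using i by (auto simp: V.U_iff)
  have eq: "\<one> \<oplus> z = z \<otimes> (\<one> \<oplus> inv z)" using i z by (simp add: r_distr a_comm)
  show "\<one> \<oplus> z \<noteq> \<zero>" unfolding eq using uc z iz by (simp add: integral_iff)
  have "inv (\<one> \<oplus> z) = inv z \<otimes> inv (\<one> \<oplus> inv z)" unfolding eq using uc z iz by (intro inv_mult) auto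
  then have "z \<otimes> inv (\<one> \<oplus> z) = (z \<otimes> inv z) \<otimes> inv (\<one> \<oplus> inv z)"
    using i z inv_closed_field[OF uc] by (simp add: m_assoc[symmetric])
  also have "\<dots> = inv (\<one> \<oplus> inv z)" using i inv_closed_field[OF uc] by simp
  finally show "z \<otimes> inv (\<one> \<oplus> z) \<in> dvr_units F P" using V.U_inv[OF u] by simp
qed

lemma zero_quotient:
  assumes P: "P \<in> closed_points F k" and z: "z \<in> mx P"
  shows "z \<otimes> inv (\<one> \<oplus> z) \<in> mx P"
proof -
  interpret V: valuation_point F k P by (rule vp[OF P])
  have "inv (\<one> \<oplus> z) \<in> P" using V.U_inv[OF one_plus_unit[OF P z]] by (auto simp: V.U_iff)
  then show ?thesis by (rule V.nonunit_mult[OF z])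
qed

lemma common_power:
  assumes "finite S" "S \<subseteq> closed_points F k" "\<And>P. P \<in> S ==> u \<in> mx P" "w \<in> carrier F"
  shows "\<exists>n0. \<forall>n\<ge>n0. \<forall>P\<in>S. u [^] (n::nat) \<otimes> w \<in> mx P"
  using assms
proof (induction S rule: finite_induct)
  case empty then show ?case by blast
next
  case (insert P S)
  interpret V: valuation_point F k P by (rule vp) (use insert.prems in auto)
  obtain n0 where n0: "\<forall>n\<ge>n0. \<forall>P\<in>S. u [^] (n::nat) \<otimes> w \<in> mx P" using insert by auto
  obtain n1 where n1: "\<forall>n\<ge>n1. u [^] (n::nat) \<otimes> w \<in> mx P" using V.power_absorbs[of u w] insert.prems by auto
  show ?case using n0 n1 by (intro exI[of _ "max n0 n1"]) auto
qed

text \<open>Let \<open>z\<close> have a pole at \<open>P\<close> and zeros on \<open>S\<close>, and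
  let \<open>w\<close> have a pole at \<open>P\<close> and a zero at \<open>P1\<close>. If
  \<open>z\<close> does not already vanish at \<open>P1\<close>, take \<open>u = z\<close>, or
  \<open>u = z / (1 + z)\<close> in case \<open>z\<close> has a pole at \<open>P1\<close>. A large
  power of \<open>u\<close> times \<open>w\<close> vanishes on \<open>S\<close>; it keeps the zero
  at \<open>P1\<close> because \<open>u\<close> is regular there, and the pole at \<open>P\<close>
  because the inverse of \<open>u\<close> is regular there.\<close>

lemma separate_from_finite:
  assumes "finite S" "S \<subseteq> closed_points F k" "P \<in> closed_points F k" "P \<notin> S"
  shows "\<exists>z\<in>carrier F. z \<notin> P \<and> (\<forall>P'\<in>S. z \<in> mx P')"
  using assms
proof (induction S rule: finite_induct)
  case empty
  interpret V: valuation_point F k P by (rule vp) fact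
  show ?case using V.P_proper V.P_carrier by blast
next
  case (insert P1 S)
  interpret V: valuation_point F k P by (rule vp) fact
  have P1: "P1 \<in> closed_points F k" "P \<noteq> P1" using insert.prems by auto
  interpret V1: valuation_point F k P1 by (rule vp[OF P1(1)])
  obtain z where z: "z \<in> carrier F" "z \<notin> P" "\<And>P'. P' \<in> S ==> z \<in> mx P'" using insert by auto
  have S: "finite S" "S \<subseteq> closed_points F k" using insert by auto
  obtain w where w: "w \<in> carrier F" "w \<notin> P" "w \<in> mx P1" using separate_pair[OF insert.prems(2) P1] by blast
  show ?case
  proof (cases "z \<in> mx P1")
    case True then show ?thesis using z by auto
  next
    case False
    have "\<exists>u\<in>carrier F. u \<noteq> \<zero> \<and> inv u \<in> P \<and> u \<in> P1 \<and> (\<forall>P'\<in>S. u \<in> mx P')"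
    proof (cases "z \<in> P1")
      case True
      then show ?thesis using z V.notin_P_iff[OF z(1)] by (intro bexI[of _ z]) auto
    next
      case False
      let ?u = "z \<otimes> inv (\<one> \<oplus> z)"
      have "?u \<in> dvr_units F P" "?u \<in> dvr_units F P1" using pole_quotient_unit(2) insert.prems(2) P1(1) z(1,2) False by blast+
      moreover have "?u \<in> mx P'" if "P' \<in> S" for P' using zero_quotient[OF _ z(3)[OF that]] S that by blast
      ultimately show ?thesis using V.P_carrier[of ?u] by (intro bexI[of _ ?u]) (auto simp: V.U_iff V1.U_iff)
    qed
    then obtain u where u: "u \<in> carrier F" "u \<noteq> \<zero>" "inv u \<in> P" "u \<in> P1" "\<And>P'. P' \<in> S ==> u \<in> mx P'" by blast
    obtain n0 where n0: "\<forall>n\<ge>n0. \<forall>P\<in>S. u [^] (n::nat) \<otimes> w \<in> mx P" using common_power[OF S u(5) w(1)] by blast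
    let ?z = "u [^] n0 \<otimes> w"
    have un: "u [^] n0 \<in> P1" using u(4) by (induction n0) (auto simp: V1.P_one V1.P_mult)
    have iun: "(inv u) [^] n0 \<in> P" using u(3) by (induction n0) (auto simp: V.P_one V.P_mult)
    note i = inv_closed_field[OF u(1,2)] inv_field[OF u(1,2)]
    have 1: "?z \<in> mx P1" using V1.nonunit_mult[OF w(3) un] w(1) u(1) by (simp add: m_comm)
    have 2: "?z \<notin> P"
    proof
      assume "?z \<in> P"
      then have "(inv u) [^] n0 \<otimes> ?z \<in> P" using V.P_mult[OF iun] by simp
      moreover have "(inv u) [^] n0 \<otimes> ?z = (inv u \<otimes> u) [^] n0 \<otimes> w"
        unfolding nat_pow_distrib[OF i(1) u(1)] using u(1) i w(1) by (simp only: m_assoc nat_pow_closed)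
      ultimately show False using w i by simp
    qed
    show ?thesis using 1 2 n0 u(1) w(1) by (intro bexI[of _ ?z]) auto
  qed
qed

text \<open>The substitution \<open>z / (1 + z)\<close> converts the pole of a separating function
  into a unit.\<close>

lemma approximate_one:
  assumes "finite S" "S \<subseteq> closed_points F k" "P \<in> closed_points F k" "P \<notin> S"
  shows "\<exists>z\<in>carrier F. z \<in> dvr_units F P \<and> (\<forall>P'\<in>S. z \<in> mx P')"
proof -
  obtain z where z: "z \<in> carrier F" "z \<notin> P" "\<And>P'. P' \<in> S ==> z \<in> mx P'" using separate_from_finite[OF assms] by blast
  interpret V: valuation_point F k P by (rule vp) fact
  have "z \<otimes> inv (\<one> \<oplus> z) \<in> dvr_units F P" by (rule pole_quotient_unit(2)[OF assms(3) z(1,2)])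
  moreover have "z \<otimes> inv (\<one> \<oplus> z) \<in> mx P'" if "P' \<in> S" for P' using zero_quotient[OF _ z(3)[OF that]] assms(2) that by blast
  ultimately show ?thesis using V.P_carrier by (auto simp: V.U_iff intro!: bexI[of _ "z \<otimes> inv (\<one> \<oplus> z)"])
qed

end

section \<open>Finiteness of the zeros and poles of a function\<close>

context growth
begin

interpretation pd: points_data F k ..

text \<open>
  If \<open>y\<close> vanished at \<open>N\<close> points, take by weak approximation \<open>z i\<close> that is a unit at the \<open>i\<close>-th point and
  vanishes at the others: the relation modulo \<open>y\<close> then gives \<open>c j z j = 0\<close> in the \<open>j\<close>-th residue field.
\<close>
lemma finite_zeros:
  assumes y: "y \<in> carrier F" "y \<noteq> \<zero>"
  shows "finite {P \<in> closed_points F k. y \<in> P - dvr_units F P}"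
proof (rule ccontr)
  assume inf: "infinite {P \<in> closed_points F k. y \<in> P - dvr_units F P}"
  obtain N where N: "\<And>z. (\<And>i. i < N ==> z i \<in> carrier F) ==> (\<exists>c\<in>{..<N} \<rightarrow> k. (\<exists>i<N. c i \<noteq> \<zero>) \<and> (\<exists>w. comb N z c = y \<otimes> w \<and>
    (\<forall>P. subring P F \<longrightarrow> k \<subseteq> P \<longrightarrow> y \<in> P \<longrightarrow> (\<forall>i<N. z i \<in> P) \<longrightarrow> w \<in> P)))"
    using dependence_mod[OF y] by blast
  obtain S where S: "S \<subseteq> {P \<in> closed_points F k. y \<in> P - dvr_units F P}" "card S = N" "finite S"
    using infinite_arbitrarily_large[OF inf] by blast
  obtain p where p: "bij_betw p {..<N} S" using ex_bij_betw_nat_finite[OF S(3)] S(2) by (auto simp: atLeast0LessThan)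
  have pS: "p i \<in> S" if "i < N" for i using p that by (auto simp: bij_betw_def)
  have pcp: "p i \<in> closed_points F k" "y \<in> p i - dvr_units F (p i)" if "i < N" for i using pS[OF that] S(1) by auto
  have "\<exists>z\<in>carrier F. z \<in> dvr_units F (p i) \<and> (\<forall>P'\<in>S - {p i}. z \<in> P' - dvr_units F P')" if "i < N" for i
    using pcp(1)[OF that] S by (intro pd.approximate_one) auto
  then obtain z where z: "\<And>i. i < N ==> z i \<in> carrier F" "\<And>i. i < N ==> z i \<in> dvr_units F (p i)"
    "\<And>i P'. i < N ==> P' \<in> S - {p i} ==> z i \<in> P' - dvr_units F P'" by metis
  have zz: "z i \<in> p j - dvr_units F (p j)" if "i < N" "j < N" "i \<noteq> j" for i j
  proof (rule z(3)[OF that(1)])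
    have "p j \<noteq> p i" using p that by (auto simp: bij_betw_def inj_on_def)
    then show "p j \<in> S - {p i}" using pS[OF that(2)] by blast
  qed
  obtain c w where c: "c \<in> {..<N} \<rightarrow> k" "\<exists>i<N. c i \<noteq> \<zero>" "comb N z c = y \<otimes> w"
    and w: "\<And>P. subring P F ==> k \<subseteq> P ==> y \<in> P ==> \<forall>i<N. z i \<in> P ==> w \<in> P"
    using N[of z, OF z(1)] by blast
  obtain j where j: "j < N" "c j \<noteq> \<zero>" using c(2) by blast
  interpret V: valuation_point F k "p j" by (rule pd.vp[OF pcp(1)[OF j(1)]])
  have ck: "c i \<in> k" "c i \<in> p j" "c i \<in> carrier F" if "i < N" for i using c(1) that V.k_P k_carrier by (auto simp: Pi_iff)
  have zP: "z i \<in> p j" if "i < N" for i using zz[OF that j(1)] z(2)[OF that] that by (cases "i = j") (auto simp: V.U_iff)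
  \<comment> \<open>The clause on subrings is applied to the local ring itself. It excludes a pole
    of \<open>w\<close> that would cancel the zero of \<open>y\<close>.\<close>
  have "w \<in> p j" using w[OF V.P_subring V.k_P] pcp(2)[OF j(1)] zP by blast
  then have yw: "y \<otimes> w \<in> p j - V.U" by (rule V.nonunit_mult[OF pcp(2)[OF j(1)]])
  let ?I = "{..<N} - {j}"
  have rest: "(\<Oplus>i\<in>?I. c i \<otimes> z i) \<in> p j - V.U"
  proof (rule finsum_in[OF abelian_group_axioms])
    show "p j - V.U \<subseteq> carrier F" using V.P_carrier by blast
    show "c i \<otimes> z i \<in> p j - V.U" if "i \<in> ?I" for i
      using V.nonunit_mult[OF zz[of i j] ck(2)[of i]] that j(1) ck(3)[of i] z(1)[of i] by (simp add: m_comm)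
  qed (use V.nonunit_zero V.nonunit_add in auto)
  have czj: "c j \<otimes> z j \<in> carrier F" using ck z j by auto
  have "comb N z c = c j \<otimes> z j \<oplus> (\<Oplus>i\<in>?I. c i \<otimes> z i)"
  proof -
    have "(\<Oplus>i\<in>insert j ?I. c i \<otimes> z i) = c j \<otimes> z j \<oplus> (\<Oplus>i\<in>?I. c i \<otimes> z i)"
      using ck z j by (intro finsum_insert) auto
    then show ?thesis using j(1) by (simp add: comb_def insert_absorb)
  qed
  then have "c j \<otimes> z j = y \<otimes> w \<oplus> (\<ominus> (\<Oplus>i\<in>?I. c i \<otimes> z i))"
    using c(3) czj rest V.P_carrier by (auto simp: a_assoc r_neg)
  then have cz: "c j \<otimes> z j \<in> p j - V.U" using V.nonunit_add[OF yw V.nonunit_uminus[OF rest]] by simp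
  have "c j \<in> V.U" using ck[OF j(1)] k_inv[OF _ j(2)] j(2) V.k_P by (auto simp: V.U_iff)
  then have "c j \<otimes> z j \<in> V.U" using V.U_mult z(2)[OF j(1)] by blast
  then show False using cz by blast
qed

text \<open>Poles of \<open>y\<close> are zeros of its inverse.\<close>

lemma finite_poles:
  assumes "y \<in> carrier F"
  shows "finite {P \<in> closed_points F k. y \<notin> P}"
proof (cases "y = \<zero>")
  case True
  then have "{P \<in> closed_points F k. y \<notin> P} = {}" using valuation_point.P_zero[OF pd.vp] by auto
  then show ?thesis by (simp only: finite.emptyI)
next
  case False
  have "{P \<in> closed_points F k. y \<notin> P} \<subseteq> {P \<in> closed_points F k. inv y \<in> P - dvr_units F P}"
    using valuation_point.notin_P_iff[OF pd.vp assms] by blast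
  then show ?thesis using finite_zeros[OF inv_closed_field[OF assms False] inv_field(1)[OF assms False]] by (rule finite_subset)
qed

end

section \<open>Function fields satisfy the growth condition, also after extension of
  constants\<close>

lemma (in field) subfield_inv_in: "subfield k R ==> c \<in> k ==> c \<noteq> \<zero> ==> inv c \<in> k"
  using subfield_m_inv(1)[of k c] by blast

text \<open>A basis of the function field over the subfield generated by \<open>x\<close> serves as
  the list \<open>us\<close>; denominators come from the coefficients, which are quotients of
  polynomials in \<open>x\<close>.\<close>

lemma function_field_growth:
  fixes F (structure)
  assumes "function_field_one_var F k" "finite k"
  shows "\<exists>x us. growth F k x us"
proof -
  interpret field F using assms by (simp add: function_field_one_var_def)
  have sk: "subfield k F" using assms by (simp add: function_field_one_var_def)
  obtain x where x: "x \<in> carrier F" "finite_dimension (generate_field F (insert x k)) (carrier F)"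
    using assms by (auto simp: function_field_one_var_def)
  have sk_sub: "insert x k \<subseteq> carrier F" using x(1) subfieldE(3)[OF sk] by blast
  interpret pd: poly_data F k x
    by (intro poly_data.intro poly_data_axioms.intro field_axioms)
      (use assms(2) subfieldE(1)[OF sk] subfield_inv_in[OF sk] x(1) in blast)+
  \<comment> \<open>A quotient of two polynomials with one common degree bound. The bound is
    existential, so it may grow with every field operation.\<close>
  define fr where "fr z \<longleftrightarrow> (\<exists>m. \<exists>p\<in>polys F k x m. \<exists>q\<in>polys F k x m. q \<noteq> \<zero> \<and> q \<otimes> z = p)" for z
  have fr: "fr z \<and> z \<in> carrier F" if "z \<in> generate_field F (insert x k)" for z
    using that
  proof (induction rule: generate_field.induct)
    case one
    have "fr \<one>" unfolding fr_def
      by (intro exI[of _ 1] bexI[OF _ pd.Px_const[OF pd.k_one]]) auto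
    then show ?case by simp
  next
    case (incl h)
    have hc: "h \<in> carrier F" using incl sk_sub by blast
    have one2: "\<one> \<in> polys F k x 2" by (rule pd.Px_mono[OF _ pd.Px_const[OF pd.k_one]]) simp
    have "h \<in> polys F k x 2"
    proof (cases "h = x")
      case True
      then show ?thesis using pd.Px_xmult[OF pd.Px_const[OF pd.k_one]] x(1) by (simp add: numeral_2_eq_2)
    next
      case False
      then show ?thesis using incl pd.Px_mono[OF _ pd.Px_const, of 2 h] by auto
    qed
    then have "fr h" unfolding fr_def using one2 hc by (intro exI[of _ 2] bexI[OF _ \<open>h \<in> polys F k x 2\<close>] bexI[OF _ one2]) auto
    then show ?case using hc by simp
  next
    case (a_inv h)
    then obtain m p q where *: "p \<in> polys F k x m" "q \<in> polys F k x m" "q \<noteq> \<zero>" "q \<otimes> h = p" "h \<in> carrier F" by (auto simp: fr_def)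
    have "q \<otimes> (\<ominus> h) = \<ominus> p" using * pd.Px_carrier by (auto simp: r_minus)
    then have "fr (\<ominus> h)" unfolding fr_def using * pd.Px_uminus[OF *(1)] by blast
    then show ?case using *(5) by simp
  next
    case (m_inv h)
    then obtain m p q where *: "p \<in> polys F k x m" "q \<in> polys F k x m" "q \<noteq> \<zero>" "q \<otimes> h = p" "h \<in> carrier F" by (auto simp: fr_def)
    have c: "p \<in> carrier F" "q \<in> carrier F" using * pd.Px_carrier by auto
    have p0: "p \<noteq> \<zero>" using * c m_inv.hyps(2) integral_iff by auto
    have i: "inv h \<in> carrier F" "h \<otimes> inv h = \<one>" using inv_closed_field inv_field *(5) m_inv.hyps(2) by auto
    have "p \<otimes> inv h = q \<otimes> (h \<otimes> inv h)" unfolding *(4)[symmetric] using c i *(5) by (simp add: m_assoc)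
    then have "p \<otimes> inv h = q" using i c by simp
    then have "fr (inv h)" unfolding fr_def using * p0 by blast
    then show ?case using i by simp
  next
    case (eng_add h1 h2)
    then obtain m p q m' p' q' where *: "p \<in> polys F k x m" "q \<in> polys F k x m" "q \<noteq> \<zero>" "q \<otimes> h1 = p" "h1 \<in> carrier F"
      "p' \<in> polys F k x m'" "q' \<in> polys F k x m'" "q' \<noteq> \<zero>" "q' \<otimes> h2 = p'" "h2 \<in> carrier F" by (auto simp: fr_def)
    have c: "p \<in> carrier F" "q \<in> carrier F" "p' \<in> carrier F" "q' \<in> carrier F" using * pd.Px_carrier by auto
    have "(q \<otimes> q') \<otimes> (h1 \<oplus> h2) = q' \<otimes> (q \<otimes> h1) \<oplus> q \<otimes> (q' \<otimes> h2)" using c *(5,10) by (simp add: r_distr m_ac)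
    also have "\<dots> = p \<otimes> q' \<oplus> q \<otimes> p'" using c by (simp add: *(4,9) m_comm)
    finally have 1: "(q \<otimes> q') \<otimes> (h1 \<oplus> h2) = p \<otimes> q' \<oplus> q \<otimes> p'" .
    have "fr (h1 \<oplus> h2)" unfolding fr_def
      by (rule exI[of _ "m + m'"], rule bexI[OF _ pd.Px_add[OF pd.Px_mult[OF *(1,7)] pd.Px_mult[OF *(2,6)]]], rule bexI[OF _ pd.Px_mult[OF *(2,7)]])
         (use 1 c *(3,8) in \<open>simp add: integral_iff\<close>)
    then show ?case using * by simp
  next
    case (eng_mult h1 h2)
    then obtain m p q m' p' q' where *: "p \<in> polys F k x m" "q \<in> polys F k x m" "q \<noteq> \<zero>" "q \<otimes> h1 = p" "h1 \<in> carrier F"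
      "p' \<in> polys F k x m'" "q' \<in> polys F k x m'" "q' \<noteq> \<zero>" "q' \<otimes> h2 = p'" "h2 \<in> carrier F" by (auto simp: fr_def)
    have c: "p \<in> carrier F" "q \<in> carrier F" "p' \<in> carrier F" "q' \<in> carrier F" using * pd.Px_carrier by auto
    have "(q \<otimes> q') \<otimes> (h1 \<otimes> h2) = (q \<otimes> h1) \<otimes> (q' \<otimes> h2)" using c *(5,10) by (simp add: m_ac)
    then have 1: "(q \<otimes> q') \<otimes> (h1 \<otimes> h2) = p \<otimes> p'" by (simp add: *(4,9))
    have "fr (h1 \<otimes> h2)" unfolding fr_def
      by (rule exI[of _ "m + m'"], rule bexI[OF _ pd.Px_mult[OF *(1,6)]], rule bexI[OF _ pd.Px_mult[OF *(2,7)]])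
         (use 1 c *(3,8) in \<open>simp add: integral_iff\<close>)
    then show ?case using * by simp
  qed
  have sG: "subfield (generate_field F (insert x k)) F" by (rule generate_field_is_subfield[OF sk_sub])
  obtain n where "dimension n (generate_field F (insert x k)) (carrier F)" using x(2) by (auto simp: finite_dimension_def)
  then obtain us where us: "set us \<subseteq> carrier F" "Span (generate_field F (insert x k)) us = carrier F"
    using exists_base[OF sG] by blast
  have span: "\<exists>D E. \<exists>d\<in>polys F k x D. d \<noteq> \<zero> \<and> d \<otimes> combine Ks us \<in> pspan F k x E us"
    if "set us \<subseteq> carrier F" "set Ks \<subseteq> generate_field F (insert x k)" for Ks us
    using that
  proof (induction Ks us rule: combine.induct)
    case (1 a Ks u us)
    obtain D E d where d: "d \<in> polys F k x D" "d \<noteq> \<zero>" "d \<otimes> combine Ks us \<in> pspan F k x E us" using 1 by auto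
    have a: "fr a" "a \<in> carrier F" using fr[of a] 1 by auto
    obtain m p q where q: "p \<in> polys F k x m" "q \<in> polys F k x m" "q \<noteq> \<zero>" "q \<otimes> a = p" using a(1) by (auto simp: fr_def)
    have us': "set us \<subseteq> carrier F" "u \<in> carrier F" "set Ks \<subseteq> carrier F" using 1 fr by auto
    have c: "p \<in> carrier F" "q \<in> carrier F" "d \<in> carrier F" "combine Ks us \<in> carrier F" using q d pd.Px_carrier us' combine_in_carrier by auto
    have "(d \<otimes> q) \<otimes> combine (a # Ks) (u # us) = (d \<otimes> (q \<otimes> a)) \<otimes> u \<oplus> q \<otimes> (d \<otimes> combine Ks us)"
      using c a(2) us' by (simp add: r_distr m_ac)
    then have eq: "(d \<otimes> q) \<otimes> combine (a # Ks) (u # us) = (d \<otimes> p) \<otimes> u \<oplus> q \<otimes> (d \<otimes> combine Ks us)"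
      by (simp only: q(4))
    let ?E = "D + m + E"
    have "d \<otimes> p \<in> polys F k x ?E" by (rule pd.Px_mono[OF _ pd.Px_mult[OF d(1) q(1)]]) simp
    moreover have "q \<otimes> (d \<otimes> combine Ks us) \<in> pspan F k x ?E us" by (rule pd.Gx_mono[OF _ pd.Gx_mult[OF us'(1) q(2) d(3)]]) simp
    ultimately have "(d \<otimes> q) \<otimes> combine (a # Ks) (u # us) \<in> pspan F k x ?E (u # us)" by (rule pd.Gx_ConsI[OF _ _ eq])
    then show ?case using c d(2) q(3)
      by (intro exI[of _ "D + m"] exI[of _ ?E] bexI[OF _ pd.Px_mult[OF d(1) q(2)]]) (simp add: integral_iff)
  next
    case ("2_1" us)
    then show ?case by (intro exI[of _ 1] exI[of _ 0] bexI[OF _ pd.Px_const[OF pd.k_one]]) (simp add: pd.Gx_zero)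
  next
    case ("2_2" Ks)
    then show ?case by (intro exI[of _ 1] exI[of _ 0] bexI[OF _ pd.Px_const[OF pd.k_one]]) (simp add: pd.Gx_zero)
  qed
  have "growth F k x us"
  proof (unfold_locales)
    show "set us \<subseteq> carrier F" by (rule us(1))
    fix z assume "z \<in> carrier F"
    then have "z \<in> Span (generate_field F (insert x k)) us" using us(2) by simp
    then obtain Ks where "set Ks \<subseteq> generate_field F (insert x k)" "z = combine Ks us"
      using Span_eq_combine_set[OF sG us(1)] by auto
    then show "\<exists>D E. \<exists>d\<in>polys F k x D. d \<noteq> \<zero> \<and> d \<otimes> z \<in> pspan F k x E us" using span[OF us(1)] by blast
  qed
  then show ?thesis by blast
qed

context curve_data
begin

text \<open>The same \<open>x\<close> and the same list work over the larger constants: a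
  denominator of \<open>a\<close> also clears \<open>a \<otimes> b\<close>, where
  \<open>1 \<otimes> b\<close> is a constant polynomial, and a sum is cleared by the product of two
  denominators.\<close>

lemma growth_QL:
  assumes "growth Q (\<iota>Q ` carrier K) x us"
  shows "growth QL constL (q1 x) (map q1 us)"
proof -
  interpret g: growth Q "\<iota>Q ` carrier K" x us by fact
  have const_hom: "(\<lambda>b. atQ \<one> b) \<in> ring_hom L QL" by (rule QT.right_hom)
  have csub: "subring constL QL"
  proof -
    interpret h: ring_hom_ring L QL "\<lambda>b. atQ \<one> b" by (rule ring_hom_ringI2[OF L.ring_axioms QT.TA.ring_axioms const_hom])
    show ?thesis by (rule h.img_is_subring[OF L.carrier_is_subring])
  qed
  have q1k: "q1 (\<iota>Q c) \<in> constL" if "c \<in> carrier K" for c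
    using QT.at_scalar[OF that Q.one_closed L.one_closed] that \<iota>Q_closed[OF that] ring_hom_closed[OF \<iota> that] by simp
  interpret pd: poly_data QL constL "q1 x"
  proof (intro poly_data.intro poly_data_axioms.intro QL_field)
    show "finite constL" using L_finite by simp
    show "subring constL QL" by (rule csub)
    show "q1 x \<in> carrier QL" using q1_closed[OF g.x_carrier] .
    fix c assume c: "c \<in> constL" "c \<noteq> \<zero>\<^bsub>QL\<^esub>"
    then obtain b where b: "b \<in> carrier L" "c = atQ \<one> b" by auto
    have "b \<noteq> \<zero>\<^bsub>L\<^esub>" using c(2) b ring_hom_zero[OF const_hom L.ring_axioms QT.TA.ring_axioms] by auto
    note i = L.inv_closed_field[OF b(1) this] L.inv_field[OF b(1) this]
    have "inv\<^bsub>QL\<^esub> c = atQ \<one> (inv\<^bsub>L\<^esub> b)"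
      unfolding b(2) by (rule QT.TA.comm_inv_char) (use b(1) i in \<open>auto simp: QT.at_mult QT.at_one_one\<close>)
    then show "inv\<^bsub>QL\<^esub> c \<in> constL" using i by blast
  qed
  have q1p: "q1 p \<in> pd.Px m" if "p \<in> g.Px m" for p m
    using that
  proof (induction m arbitrary: p)
    case 0 then show ?case using q1_zero_iff[OF Q.zero_closed] by simp
  next
    case (Suc m)
    then obtain c r where *: "c \<in> \<iota>Q ` carrier K" "r \<in> g.Px m" "p = c \<oplus> x \<otimes> r" by auto
    have c: "c \<in> carrier Q" "r \<in> carrier Q" using * g.k_carrier g.Px_carrier by auto
    have "q1 p = q1 c \<oplus>\<^bsub>QL\<^esub> q1 x \<otimes>\<^bsub>QL\<^esub> q1 r" unfolding *(3) using c g.x_carrier by (simp add: QT.at_add_left q1_mult)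
    then show ?case using q1k * by (intro pd.Px_SucI[OF _ Suc.IH[OF *(2)]]) auto
  qed
  have q1us: "set (map q1 us) \<subseteq> carrier QL" using g.us q1_closed by auto
  have q1g: "q1 z \<in> pd.Gx m (map q1 us)" if "set us \<subseteq> carrier Q" "z \<in> g.Gx m us" for z m us
    using that
  proof (induction us arbitrary: z)
    case Nil then show ?case using q1_zero_iff[OF Q.zero_closed] by simp
  next
    case (Cons u us)
    then obtain p r where *: "p \<in> g.Px m" "r \<in> g.Gx m us" "z = p \<otimes> u \<oplus> r" by auto
    have us': "set us \<subseteq> carrier Q" "u \<in> carrier Q" using Cons.prems by auto
    have "q1 z = q1 p \<otimes>\<^bsub>QL\<^esub> q1 u \<oplus>\<^bsub>QL\<^esub> q1 r" unfolding *(3)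
      using us' g.Px_carrier[OF *(1)] g.Gx_carrier[OF us'(1) *(2)] by (simp add: QT.at_add_left q1_mult)
    then show ?case using pd.Gx_ConsI[OF q1p[OF *(1)] Cons.IH[OF us'(1) *(2)]] by simp
  qed
  show ?thesis
  proof (unfold_locales)
    show "set (map q1 us) \<subseteq> carrier QL" by (rule q1us)
    fix Z assume "Z \<in> carrier QL"
    then show "\<exists>D E. \<exists>d\<in>pd.Px D. d \<noteq> \<zero>\<^bsub>QL\<^esub> \<and> d \<otimes>\<^bsub>QL\<^esub> Z \<in> pd.Gx E (map q1 us)"
    proof (induction rule: QT.at_induct)
      case (pure a b)
      obtain D E d where d: "d \<in> g.Px D" "d \<noteq> \<zero>" "d \<otimes> a \<in> g.Gx E us" using g.clear[OF pure(1)] by blast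
      have dc: "d \<in> carrier Q" using g.Px_carrier[OF d(1)] .
      have "q1 d \<otimes>\<^bsub>QL\<^esub> atQ a b = atQ \<one> b \<otimes>\<^bsub>QL\<^esub> q1 (d \<otimes> a)" using dc pure by (simp add: QT.at_mult)
      also have "\<dots> \<in> pd.Gx (1 + E) (map q1 us)"
        using pure(2) by (intro pd.Gx_mult[OF q1us pd.Px_const q1g[OF g.us d(3)]]) blast
      finally have "q1 d \<otimes>\<^bsub>QL\<^esub> atQ a b \<in> pd.Gx (1 + E) (map q1 us)" .
      moreover have "q1 d \<noteq> \<zero>\<^bsub>QL\<^esub>" using q1_zero_iff[OF dc] d(2) by simp
      ultimately show ?case using q1p[OF d(1)] by blast
    next
      case (add Y Z)
      obtain D E d where d: "d \<in> pd.Px D" "d \<noteq> \<zero>\<^bsub>QL\<^esub>" "d \<otimes>\<^bsub>QL\<^esub> Y \<in> pd.Gx E (map q1 us)" using add by blast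
      obtain D' E' d' where d': "d' \<in> pd.Px D'" "d' \<noteq> \<zero>\<^bsub>QL\<^esub>" "d' \<otimes>\<^bsub>QL\<^esub> Z \<in> pd.Gx E' (map q1 us)" using add by blast
      have c: "d \<in> carrier QL" "d' \<in> carrier QL" using d d' pd.Px_carrier by auto
      let ?E = "D + D' + E + E'"
      have "(d \<otimes>\<^bsub>QL\<^esub> d') \<otimes>\<^bsub>QL\<^esub> (Y \<oplus>\<^bsub>QL\<^esub> Z) = d' \<otimes>\<^bsub>QL\<^esub> (d \<otimes>\<^bsub>QL\<^esub> Y) \<oplus>\<^bsub>QL\<^esub> d \<otimes>\<^bsub>QL\<^esub> (d' \<otimes>\<^bsub>QL\<^esub> Z)"
        using c add by (simp add: QT.TA.r_distr QT.TA.m_ac)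
      also have "\<dots> \<in> pd.Gx ?E (map q1 us)"
      proof (rule pd.Gx_add[OF q1us])
        show "d' \<otimes>\<^bsub>QL\<^esub> (d \<otimes>\<^bsub>QL\<^esub> Y) \<in> pd.Gx ?E (map q1 us)" by (rule pd.Gx_mono[OF _ pd.Gx_mult[OF q1us d'(1) d(3)]]) simp
        show "d \<otimes>\<^bsub>QL\<^esub> (d' \<otimes>\<^bsub>QL\<^esub> Z) \<in> pd.Gx ?E (map q1 us)" by (rule pd.Gx_mono[OF _ pd.Gx_mult[OF q1us d(1) d'(3)]]) simp
      qed
      finally have "(d \<otimes>\<^bsub>QL\<^esub> d') \<otimes>\<^bsub>QL\<^esub> (Y \<oplus>\<^bsub>QL\<^esub> Z) \<in> pd.Gx ?E (map q1 us)" .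
      moreover have "d \<otimes>\<^bsub>QL\<^esub> d' \<noteq> \<zero>\<^bsub>QL\<^esub>" using c d(2) d'(2) by (simp add: QF.integral_iff)
      ultimately show ?case using pd.Px_mult[OF d(1) d'(1)] by blast
    qed
  qed
qed

lemma finite_poles_QL:
  assumes "function_field_one_var Q (\<iota>Q ` carrier K)" "y \<in> carrier QL"
  shows "finite {P \<in> closed_points QL constL. y \<notin> P}"
proof -
  obtain x us where "growth Q (\<iota>Q ` carrier K) x us"
    using function_field_growth[OF assms(1)] K_finite by blast
  from growth.finite_poles[OF growth_QL[OF this] assms(2)] show ?thesis .
qed

end

section \<open>Locally free modules and lattices at infinity\<close>

lemma lin_comb_closed:
  assumes "module R M" "a \<in> {..<r} \<rightarrow> carrier R" "e \<in> {..<r} \<rightarrow> carrier M"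
  shows "lin_comb M r a e \<in> carrier M"
proof -
  interpret module R M by fact
  show ?thesis unfolding lin_comb_def using assms(2,3) by (intro M.finsum_closed) (auto simp: Pi_iff)
qed

lemma lin_comb_map:
  assumes "module R M" "abelian_group N" "additive_map M N h" "a \<in> {..<r} \<rightarrow> carrier R" "e \<in> {..<r} \<rightarrow> carrier M"
  shows "h (lin_comb M r a e) = (\<Oplus>\<^bsub>N\<^esub>i\<in>{..<r}. h (a i \<odot>\<^bsub>M\<^esub> e i))"
proof -
  interpret module R M by fact
  show ?thesis unfolding lin_comb_def
    by (rule additive_map_finsum[OF M.abelian_group_axioms assms(2,3)]) (use assms(4,5) in \<open>auto simp: Pi_iff\<close>)
qed

lemma lin_comb_add:
  assumes "module R M" "a \<in> {..<r} \<rightarrow> carrier R" "a' \<in> {..<r} \<rightarrow> carrier R" "e \<in> {..<r} \<rightarrow> carrier M"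
  shows "lin_comb M r (\<lambda>i. a i \<oplus>\<^bsub>R\<^esub> a' i) e = lin_comb M r a e \<oplus>\<^bsub>M\<^esub> lin_comb M r a' e"
  unfolding lin_comb_def by (rule module.finsum_smult_add[OF assms])

lemma lin_comb_smult:
  assumes "module R M" "a \<in> {..<r} \<rightarrow> carrier R" "s \<in> carrier R" "e \<in> {..<r} \<rightarrow> carrier M"
  shows "lin_comb M r (\<lambda>i. s \<otimes>\<^bsub>R\<^esub> a i) e = s \<odot>\<^bsub>M\<^esub> lin_comb M r a e"
  unfolding lin_comb_def by (rule module.finsum_smult_smult[OF assms(1) finite_lessThan assms(2-4)])

section \<open>The rank of a locally free module over a domain\<close>

locale loc_free = module R M + dom: domain R
  for R :: "('r, 'x) ring_scheme" and M :: "('r, 'm) module" (structure) +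
  fixes r :: nat
  assumes lf: "locally_free_module R M r"
begin

lemma module_RM: "module R M" by unfold_locales

lemma pow_nonzero: "f \<in> carrier R ==> f \<noteq> \<zero>\<^bsub>R\<^esub> ==> f [^]\<^bsub>R\<^esub> (n::nat) \<noteq> \<zero>\<^bsub>R\<^esub>"
  by (induction n) (auto simp: dom.integral_iff)

text \<open>Where \<open>M\<close> becomes free, \<open>s x = 0\<close> forces all coordinates of
  \<open>x\<close> to vanish, so some power of each \<open>f\<close> annihilates \<open>x\<close>;
  these powers generate the unit ideal.\<close>

lemma torsion_free:
  assumes s: "s \<in> carrier R" "s \<noteq> \<zero>\<^bsub>R\<^esub>" and x: "x \<in> carrier M" and sx: "s \<odot> x = \<zero>"
  shows "x = \<zero>"
proof -
  obtain S where S: "finite S" "S \<subseteq> carrier R" "\<And>f. f \<in> S ==> localization_free R M r f"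
    "\<And>I. ideal I R ==> (\<And>f. f \<in> S ==> \<exists>n::nat. f [^]\<^bsub>R\<^esub> n \<in> I) ==> I = carrier R"
    using locally_free_unimodular[OF lf] by blast
  have "{a \<in> carrier R. a \<odot> x \<in> {\<zero>}} = carrier R"
  proof (rule S(4)[OF transporter_ideal])
    fix f assume f: "f \<in> S"
    have fR: "f \<in> carrier R" using f S(2) by blast
    show "\<exists>n::nat. f [^]\<^bsub>R\<^esub> n \<in> {a \<in> carrier R. a \<odot> x \<in> {\<zero>}}"
    proof (cases "f = \<zero>\<^bsub>R\<^esub>")
      case True
      then show ?thesis using x by (intro exI[of _ 1]) simp
    next
      case False
      obtain e where e: "e \<in> {..<r} \<rightarrow> carrier M"
        "\<forall>x\<in>carrier M. \<exists>(n::nat). \<exists>a \<in> {..<r} \<rightarrow> carrier R. (f [^]\<^bsub>R\<^esub> n) \<odot> x = lin_comb M r a e"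
        "\<forall>a \<in> {..<r} \<rightarrow> carrier R. lin_comb M r a e = \<zero> \<longrightarrow> (\<forall>i<r. \<exists>(n::nat). (f [^]\<^bsub>R\<^esub> n) \<otimes>\<^bsub>R\<^esub> a i = \<zero>\<^bsub>R\<^esub>)"
        using S(3)[OF f] unfolding localization_free_def by blast
      obtain n :: nat and a where a: "a \<in> {..<r} \<rightarrow> carrier R" "(f [^]\<^bsub>R\<^esub> n) \<odot> x = lin_comb M r a e" using e(2) x by blast
      have "lin_comb M r (\<lambda>i. s \<otimes>\<^bsub>R\<^esub> a i) e = s \<odot> ((f [^]\<^bsub>R\<^esub> n) \<odot> x)"
        using lin_comb_smult[OF module_RM a(1) s(1) e(1)] a(2) by simp
      also have "\<dots> = (f [^]\<^bsub>R\<^esub> n) \<odot> (s \<odot> x)" using s(1) fR x by (simp add: smult_assoc1[symmetric] R.m_comm)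
      also have "\<dots> = \<zero>" using sx fR by simp
      finally have z: "lin_comb M r (\<lambda>i. s \<otimes>\<^bsub>R\<^esub> a i) e = \<zero>" .
      have "a i = \<zero>\<^bsub>R\<^esub>" if i: "i < r" for i
      proof -
        have ai: "a i \<in> carrier R" using a(1) i by auto
        have "(\<lambda>i. s \<otimes>\<^bsub>R\<^esub> a i) \<in> {..<r} \<rightarrow> carrier R" using a(1) s(1) by (auto simp: Pi_iff)
        then obtain m :: nat where "(f [^]\<^bsub>R\<^esub> m) \<otimes>\<^bsub>R\<^esub> (s \<otimes>\<^bsub>R\<^esub> a i) = \<zero>\<^bsub>R\<^esub>" using e(3) z i by blast
        then show ?thesis using pow_nonzero[OF fR False, of m] s ai fR by (auto simp: dom.integral_iff)
      qed
      then have "lin_comb M r a e = (\<Oplus>i\<in>{..<r}. \<zero>)"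
        unfolding lin_comb_def using e(1) by (intro M.finsum_cong') (auto simp: Pi_iff)
      then show ?thesis using a(2) fR by (intro exI[of _ n]) simp
    qed
  qed (use x in auto)
  then have "\<one>\<^bsub>R\<^esub> \<odot> x \<in> {\<zero>}" by blast
  then show ?thesis using x by simp
qed

text \<open>A basis of the generic fibre with a single denominator \<open>f\<close>: the submodule
  \<open>f M\<close> lies in the free module on \<open>b\<close>. Coordinates thus stay in
  \<open>R\<close>, without a field of fractions.\<close>

definition frame :: "'r \<Rightarrow> (nat \<Rightarrow> 'm) \<Rightarrow> bool"
  where "frame f b \<longleftrightarrow> f \<in> carrier R \<and> f \<noteq> \<zero>\<^bsub>R\<^esub> \<and> b \<in> {..<r} \<rightarrow> carrier M \<and>
    (\<forall>x\<in>carrier M. \<exists>a \<in> {..<r} \<rightarrow> carrier R. f \<odot> x = lin_comb M r a b) \<and>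
    (\<forall>a \<in> {..<r} \<rightarrow> carrier R. lin_comb M r a b = \<zero> \<longrightarrow> (\<forall>i<r. a i = \<zero>\<^bsub>R\<^esub>))"

lemma exists_frame: "\<exists>f b. frame f b"
proof -
  obtain S where S: "finite S" "S \<subseteq> carrier R" "\<And>f. f \<in> S ==> localization_free R M r f"
    "\<And>I. ideal I R ==> (\<And>f. f \<in> S ==> \<exists>n::nat. f [^]\<^bsub>R\<^esub> n \<in> I) ==> I = carrier R"
    using locally_free_unimodular[OF lf] by blast
  have "\<exists>f\<in>S. f \<noteq> \<zero>\<^bsub>R\<^esub>"
  proof (rule ccontr)
    assume "\<not> (\<exists>f\<in>S. f \<noteq> \<zero>\<^bsub>R\<^esub>)"
    then have *: "f [^]\<^bsub>R\<^esub> (1::nat) \<in> {\<zero>\<^bsub>R\<^esub>}" if "f \<in> S" for f using that S(2) by auto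
    have "{\<zero>\<^bsub>R\<^esub>} = carrier R" by (rule S(4)[OF R.zeroideal]) (use * in blast)
    then show False using dom.one_not_zero R.one_closed by blast
  qed
  then obtain f where f: "f \<in> S" "f \<noteq> \<zero>\<^bsub>R\<^esub>" by blast
  have fR: "f \<in> carrier R" using f S(2) by blast
  obtain e where e: "e \<in> {..<r} \<rightarrow> carrier M"
    "\<And>x. x \<in> carrier M ==> \<exists>(n::nat). \<exists>a \<in> {..<r} \<rightarrow> carrier R. (f [^]\<^bsub>R\<^esub> n) \<odot> x = lin_comb M r a e"
    "\<forall>a \<in> {..<r} \<rightarrow> carrier R. lin_comb M r a e = \<zero> \<longrightarrow> (\<forall>i<r. \<exists>(n::nat). (f [^]\<^bsub>R\<^esub> n) \<otimes>\<^bsub>R\<^esub> a i = \<zero>\<^bsub>R\<^esub>)"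
    using S(3)[OF f(1)] unfolding localization_free_def by blast
  have ind: "a i = \<zero>\<^bsub>R\<^esub>" if a: "a \<in> {..<r} \<rightarrow> carrier R" "lin_comb M r a e = \<zero>" "i < r" for a i
  proof -
    obtain n :: nat where n: "(f [^]\<^bsub>R\<^esub> n) \<otimes>\<^bsub>R\<^esub> a i = \<zero>\<^bsub>R\<^esub>" using e(3) a by blast
    have "a i \<in> carrier R" using a by auto
    then show ?thesis using n pow_nonzero[OF fR f(2), of n] fR by (auto simp: dom.integral_iff)
  qed
  obtain U where U: "finite U" "U \<subseteq> carrier M" "\<And>H. U \<subseteq> H ==> H \<subseteq> carrier M ==> \<zero> \<in> H ==>
    (\<forall>x\<in>H. \<forall>y\<in>H. x \<oplus> y \<in> H) ==> (\<forall>a\<in>carrier R. \<forall>x\<in>H. a \<odot> x \<in> H) ==> H = carrier M"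
    using locally_free_fg[OF lf] unfolding fg_module_def by blast
  obtain n :: "'m \<Rightarrow> nat" where n: "\<And>x. x \<in> U ==> \<exists>a \<in> {..<r} \<rightarrow> carrier R. (f [^]\<^bsub>R\<^esub> n x) \<odot> x = lin_comb M r a e"
    using e(2) U(2) by (metis subsetD)
  \<comment> \<open>One denominator for all of \<open>M\<close>: the sum of the exponents belonging
    to finitely many generators dominates each of them.\<close>
  let ?F = "f [^]\<^bsub>R\<^esub> sum n U"
  have F: "?F \<in> carrier R" using fR by simp
  define H where "H = {x \<in> carrier M. \<exists>a \<in> {..<r} \<rightarrow> carrier R. ?F \<odot> x = lin_comb M r a e}"
  have smult: "s \<odot> x \<in> H" if "s \<in> carrier R" "x \<in> H" for s x
  proof -
    obtain a where a: "a \<in> {..<r} \<rightarrow> carrier R" "?F \<odot> x = lin_comb M r a e" using \<open>x \<in> H\<close> by (auto simp: H_def)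
    have x: "x \<in> carrier M" using that by (simp add: H_def)
    have "?F \<odot> (s \<odot> x) = s \<odot> (?F \<odot> x)" using F that(1) x by (simp add: smult_assoc1[symmetric] R.m_comm)
    also have "\<dots> = lin_comb M r (\<lambda>i. s \<otimes>\<^bsub>R\<^esub> a i) e" unfolding a(2) by (rule lin_comb_smult[OF module_RM a(1) that(1) e(1), symmetric])
    finally show ?thesis using a(1) that(1) x by (auto simp: H_def Pi_iff intro!: bexI[of _ "\<lambda>i. s \<otimes>\<^bsub>R\<^esub> a i"])
  qed
  have "H = carrier M"
  proof (rule U(3))
    show "U \<subseteq> H"
    proof
      fix x assume x: "x \<in> U"
      have xM: "x \<in> carrier M" using x U(2) by blast
      obtain a where a: "a \<in> {..<r} \<rightarrow> carrier R" "(f [^]\<^bsub>R\<^esub> n x) \<odot> x = lin_comb M r a e" using n[OF x] by blast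
      let ?g = "f [^]\<^bsub>R\<^esub> (sum n U - n x)"
      have "sum n U = (sum n U - n x) + n x" using member_le_sum[OF x _ U(1), of n] by simp
      then have "?F = ?g \<otimes>\<^bsub>R\<^esub> f [^]\<^bsub>R\<^esub> n x" using R.nat_pow_mult[OF fR] by metis
      then have "?F \<odot> x = ?g \<odot> lin_comb M r a e" using fR xM a(2) by (simp add: smult_assoc1)
      also have "\<dots> = lin_comb M r (\<lambda>i. ?g \<otimes>\<^bsub>R\<^esub> a i) e" using fR by (intro lin_comb_smult[OF module_RM a(1) _ e(1), symmetric]) simp
      finally show "x \<in> H" using a(1) fR xM by (auto simp: H_def Pi_iff intro!: bexI[of _ "\<lambda>i. ?g \<otimes>\<^bsub>R\<^esub> a i"])
    qed
    show "\<forall>x\<in>H. \<forall>y\<in>H. x \<oplus> y \<in> H"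
    proof (intro ballI)
      fix x y assume "x \<in> H" "y \<in> H"
      then obtain a a' where a: "a \<in> {..<r} \<rightarrow> carrier R" "?F \<odot> x = lin_comb M r a e" "x \<in> carrier M"
        "a' \<in> {..<r} \<rightarrow> carrier R" "?F \<odot> y = lin_comb M r a' e" "y \<in> carrier M" by (auto simp: H_def)
      then have "?F \<odot> (x \<oplus> y) = lin_comb M r (\<lambda>i. a i \<oplus>\<^bsub>R\<^esub> a' i) e"
        using F lin_comb_add[OF module_RM a(1,4) e(1)] by (simp add: smult_r_distr)
      then show "x \<oplus> y \<in> H" using a(1,3,4,6) by (auto simp: H_def Pi_iff intro!: bexI[of _ "\<lambda>i. a i \<oplus>\<^bsub>R\<^esub> a' i"])
    qed
    have "lin_comb M r (\<lambda>i. \<zero>\<^bsub>R\<^esub>) e = \<zero>" unfolding lin_comb_def using e(1) by (intro M.add.finprod_one_eqI) (auto simp: Pi_iff)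
    then show "\<zero> \<in> H" using F by (auto simp: H_def intro!: bexI[of _ "\<lambda>i. \<zero>\<^bsub>R\<^esub>"])
  qed (use smult in \<open>auto simp: H_def\<close>)
  then have "frame ?F e" unfolding frame_def using e(1) ind F pow_nonzero[OF fR f(2)] by (auto simp: H_def)
  then show ?thesis by blast
qed

lemma frame_unique:
  assumes fb: "frame f b" and a: "a \<in> {..<r} \<rightarrow> carrier R" "a' \<in> {..<r} \<rightarrow> carrier R" "lin_comb M r a b = lin_comb M r a' b" and i: "i < r"
  shows "a i = a' i"
proof -
  have b: "b \<in> {..<r} \<rightarrow> carrier M" using fb by (simp add: frame_def)
  let ?m = "\<lambda>i. (\<ominus>\<^bsub>R\<^esub> \<one>\<^bsub>R\<^esub>) \<otimes>\<^bsub>R\<^esub> a' i"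
  have m: "?m \<in> {..<r} \<rightarrow> carrier R" using a by (auto simp: Pi_iff)
  have "lin_comb M r (\<lambda>i. a i \<oplus>\<^bsub>R\<^esub> ?m i) b = \<zero>"
    unfolding lin_comb_add[OF module_RM a(1) m b] using lin_comb_smult[OF module_RM a(2) _ b, of "\<ominus>\<^bsub>R\<^esub> \<one>\<^bsub>R\<^esub>"]
      lin_comb_closed[OF module_RM a(2) b] a(3) by (simp add: smult_l_minus M.r_neg)
  then have "a i \<oplus>\<^bsub>R\<^esub> ?m i = \<zero>\<^bsub>R\<^esub>" using fb a m i unfolding frame_def by (auto simp: Pi_iff)
  moreover have "a i \<in> carrier R" "a' i \<in> carrier R" using a i by auto
  ultimately show ?thesis using R.minus_eq_zeroD[of "a i" "a' i"] by (simp add: R.minus_eq R.l_minus)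
qed

text \<open>The images under \<open>h\<close> of the \<open>r\<close> frame vectors and
  \<open>y\<close> are \<open>r + 1\<close> elements of a module of rank \<open>r\<close>, hence
  dependent. The coefficient of \<open>y\<close> is nonzero, since \<open>h\<close> is injective and
  the frame is independent.\<close>

lemma injective_cokernel_torsion:
  assumes h: "linear_map R M M h" "inj_on h (carrier M)" and y: "y \<in> carrier M"
  shows "\<exists>s\<in>carrier R - {\<zero>\<^bsub>R\<^esub>}. s \<odot> y \<in> h ` carrier M"
proof -
  obtain f b where fb: "frame f b" using exists_frame by blast
  have f: "f \<in> carrier R" "f \<noteq> \<zero>\<^bsub>R\<^esub>" and b: "b \<in> {..<r} \<rightarrow> carrier M"
    and indep: "\<And>a i. a \<in> {..<r} \<rightarrow> carrier R ==> lin_comb M r a b = \<zero> ==> i < r ==> a i = \<zero>\<^bsub>R\<^esub>"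
    using fb unfolding frame_def by blast+
  have ha: "additive_map M M h" and hs: "\<And>a x. a \<in> carrier R ==> x \<in> carrier M ==> h (a \<odot> x) = a \<odot> h x"
    and hc: "\<And>x. x \<in> carrier M ==> h x \<in> carrier M"
    using h(1) unfolding linear_map_def additive_map_def by blast+
  define x where "x i = (if i < r then h (b i) else y)" for i
  have xc: "x i \<in> carrier M" for i using b y hc by (auto simp: x_def Pi_iff)
  have "\<forall>i. \<exists>a. a \<in> {..<r} \<rightarrow> carrier R \<and> f \<odot> x i = lin_comb M r a b" using fb xc unfolding frame_def by blast
  then obtain A where A: "\<And>i. A i \<in> {..<r} \<rightarrow> carrier R" "\<And>i. f \<odot> x i = lin_comb M r (A i) b" by metis
  have Ac: "A i j \<in> carrier R" if "i \<in> {..r}" "j \<in> {..<r}" for i j using A(1)[of i] that by (auto simp: Pi_iff)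
  obtain c where c: "c \<in> {..r} \<rightarrow> carrier R" "\<exists>i\<in>{..r}. c i \<noteq> \<zero>\<^bsub>R\<^esub>" "\<forall>j\<in>{..<r}. (\<Oplus>\<^bsub>R\<^esub>i\<in>{..r}. c i \<otimes>\<^bsub>R\<^esub> A i j) = \<zero>\<^bsub>R\<^esub>"
    using dom.linear_dependence[of "{..<r}" "{..r}" A] Ac by auto
  have cc: "c i \<in> carrier R" if "i \<le> r" for i using c(1) that by auto
  have lcA: "lin_comb M r (\<lambda>j. \<Oplus>\<^bsub>R\<^esub>i\<in>I. c i \<otimes>\<^bsub>R\<^esub> A i j) b = (\<Oplus>i\<in>I. c i \<odot> lin_comb M r (A i) b) \<and>
      (\<lambda>j. \<Oplus>\<^bsub>R\<^esub>i\<in>I. c i \<otimes>\<^bsub>R\<^esub> A i j) \<in> {..<r} \<rightarrow> carrier R" if "finite I" "I \<subseteq> {..r}" for I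
    using that
  proof (induction I rule: finite_induct)
    case empty
    have "lin_comb M r (\<lambda>j. \<zero>\<^bsub>R\<^esub>) b = (\<Oplus>i\<in>{..<r}. \<zero>)"
      unfolding lin_comb_def using b by (intro M.finsum_cong') (auto simp: Pi_iff)
    then show ?case by simp
  next
    case (insert i I)
    have i: "i \<le> r" using insert.prems by auto
    have cA: "(\<lambda>j. c i \<otimes>\<^bsub>R\<^esub> A i j) \<in> {..<r} \<rightarrow> carrier R" using A(1) cc[OF i] by (auto simp: Pi_iff)
    have IH: "lin_comb M r (\<lambda>j. \<Oplus>\<^bsub>R\<^esub>i\<in>I. c i \<otimes>\<^bsub>R\<^esub> A i j) b = (\<Oplus>i\<in>I. c i \<odot> lin_comb M r (A i) b)"
      "(\<lambda>j. \<Oplus>\<^bsub>R\<^esub>i\<in>I. c i \<otimes>\<^bsub>R\<^esub> A i j) \<in> {..<r} \<rightarrow> carrier R" using insert by auto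
    have eq: "(\<Oplus>\<^bsub>R\<^esub>i\<in>insert i I. c i \<otimes>\<^bsub>R\<^esub> A i j) = c i \<otimes>\<^bsub>R\<^esub> A i j \<oplus>\<^bsub>R\<^esub> (\<Oplus>\<^bsub>R\<^esub>i\<in>I. c i \<otimes>\<^bsub>R\<^esub> A i j)" if "j < r" for j
      using insert cc Ac that by (intro R.finsum_insert) (auto simp: subset_iff)
    have "lin_comb M r (\<lambda>j. \<Oplus>\<^bsub>R\<^esub>i\<in>insert i I. c i \<otimes>\<^bsub>R\<^esub> A i j) b =
        lin_comb M r (\<lambda>j. c i \<otimes>\<^bsub>R\<^esub> A i j \<oplus>\<^bsub>R\<^esub> (\<Oplus>\<^bsub>R\<^esub>i\<in>I. c i \<otimes>\<^bsub>R\<^esub> A i j)) b"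
      unfolding lin_comb_def using b cA IH(2) by (intro M.finsum_cong') (auto simp: Pi_iff eq)
    also have "\<dots> = lin_comb M r (\<lambda>j. c i \<otimes>\<^bsub>R\<^esub> A i j) b \<oplus> lin_comb M r (\<lambda>j. \<Oplus>\<^bsub>R\<^esub>i\<in>I. c i \<otimes>\<^bsub>R\<^esub> A i j) b"
      by (rule lin_comb_add[OF module_RM cA IH(2) b])
    also have "\<dots> = c i \<odot> lin_comb M r (A i) b \<oplus> (\<Oplus>i\<in>I. c i \<odot> lin_comb M r (A i) b)"
      unfolding IH(1) using lin_comb_smult[OF module_RM A(1) cc[OF i] b] by simp
    also have "\<dots> = (\<Oplus>i\<in>insert i I. c i \<odot> lin_comb M r (A i) b)"
      using insert cc lin_comb_closed[OF module_RM A(1) b] by (intro M.finsum_insert[symmetric]) (auto simp: subset_iff)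
    finally show ?case using cA IH(2) eq by (auto simp: Pi_iff)
  qed
  have cr: "c \<in> {..<r} \<rightarrow> carrier R" using cc by auto
  have "h (lin_comb M r c b) = (\<Oplus>i\<in>{..<r}. h (c i \<odot> b i))"
    by (rule lin_comb_map[OF module_RM M.abelian_group_axioms ha cr b])
  also have "\<dots> = (\<Oplus>i\<in>{..<r}. c i \<odot> x i)"
    using cc b xc by (intro M.finsum_cong') (auto simp: Pi_iff hs hc x_def)
  finally have hl: "(\<Oplus>i\<in>{..<r}. c i \<odot> x i) = h (lin_comb M r c b)" by (rule sym)
  have "lin_comb M r (\<lambda>j. \<Oplus>\<^bsub>R\<^esub>i\<in>{..r}. c i \<otimes>\<^bsub>R\<^esub> A i j) b = (\<Oplus>i\<in>{..<r}. \<zero>)"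
    unfolding lin_comb_def using b c(3) by (intro M.finsum_cong') (auto simp: Pi_iff)
  then have "(\<Oplus>i\<in>{..r}. c i \<odot> lin_comb M r (A i) b) = \<zero>" using lcA[of "{..r}"] by simp
  also have "(\<Oplus>i\<in>{..r}. c i \<odot> lin_comb M r (A i) b) = (\<Oplus>i\<in>{..r}. f \<odot> (c i \<odot> x i))"
    using cc xc f(1) A(2)[symmetric] by (intro M.finsum_cong') (auto simp: smult_assoc1[symmetric] R.m_comm)
  also have "\<dots> = f \<odot> (\<Oplus>i\<in>{..r}. c i \<odot> x i)"
    using additive_map_finsum[OF M.abelian_group_axioms M.abelian_group_axioms, of "\<lambda>z. f \<odot> z" "{..r}" "\<lambda>i. c i \<odot> x i"]
      cc xc f(1) by (simp add: additive_map_def smult_r_distr Pi_iff)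
  finally have "f \<odot> (\<Oplus>i\<in>{..r}. c i \<odot> x i) = \<zero>" .
  moreover have "(\<Oplus>i\<in>{..r}. c i \<odot> x i) \<in> carrier M" using cc xc by (intro M.finsum_closed) auto
  ultimately have "(\<Oplus>i\<in>{..r}. c i \<odot> x i) = \<zero>" using torsion_free[OF f(1) f(2)] by blast
  moreover have "{..r} = insert r {..<r}" by auto
  moreover have "(\<Oplus>i\<in>insert r {..<r}. c i \<odot> x i) = c r \<odot> x r \<oplus> (\<Oplus>i\<in>{..<r}. c i \<odot> x i)"
    using cc xc by (intro M.finsum_insert) auto
  ultimately have rel: "c r \<odot> y \<oplus> h (lin_comb M r c b) = \<zero>" using hl by (simp add: x_def)
  have lc: "lin_comb M r c b \<in> carrier M" by (rule lin_comb_closed[OF module_RM cr b])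
  have crn: "c r \<noteq> \<zero>\<^bsub>R\<^esub>"
  proof
    assume 0: "c r = \<zero>\<^bsub>R\<^esub>"
    have "h \<zero> = \<zero>" by (rule additive_map_zero[OF M.abelian_group_axioms M.abelian_group_axioms ha])
    then have "h (lin_comb M r c b) = h \<zero>" using rel 0 y hc[OF lc] by simp
    then have "lin_comb M r c b = \<zero>" by (rule inj_onD[OF h(2) _ lc M.zero_closed])
    then have "c i = \<zero>\<^bsub>R\<^esub>" if "i < r" for i using indep[OF cr _ that] by blast
    then show False using c(2) 0 by (auto simp: le_less)
  qed
  have "c r \<odot> y = \<ominus> h (lin_comb M r c b)" using rel cc[of r] y hc[OF lc] by (simp add: M.minus_equality)
  also have "\<dots> = h (\<ominus> lin_comb M r c b)"
    by (rule additive_map_uminus[OF M.abelian_group_axioms M.abelian_group_axioms ha lc, symmetric])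
  finally show ?thesis using crn cc[of r] lc by (intro bexI[of _ "c r"]) auto
qed

end

section \<open>Embedding a locally free module into its generic fibre\<close>

locale generic_fibre = loc_free R M r + base_change_data R M F i + fld: field F
  for R :: "('r, 'x) ring_scheme" and M :: "('r, 'm) module" (structure) and r and F :: "('f, 'y) ring_scheme" and i +
  assumes i_inj: "inj_on i (carrier R)"
begin

abbreviation "V \<equiv> BC"
abbreviation "\<iota>M x \<equiv> bc x \<one>\<^bsub>F\<^esub>"

lemma i_closed: "a \<in> carrier R ==> i a \<in> carrier F"
  using ring_hom_closed[OF h] .

lemma i_nonzero: "a \<in> carrier R ==> a \<noteq> \<zero>\<^bsub>R\<^esub> ==> i a \<noteq> \<zero>\<^bsub>F\<^esub>"
  using inj_onD[OF i_inj, of a "\<zero>\<^bsub>R\<^esub>"] ring_hom_zero[OF h R.ring_axioms S.ring_axioms] by auto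

text \<open>The coordinates with respect to a frame are linear functions on \<open>M\<close> and
  extend to the generic fibre by \<open>y \<otimes> s \<mapsto> i (a y j) s\<close>. So they vanish
  on \<open>x\<close> if \<open>\<iota>M x\<close> is 0.\<close>

lemma \<iota>M_injective:
  assumes x: "x \<in> carrier M" "\<iota>M x = \<zero>\<^bsub>V\<^esub>"
  shows "x = \<zero>"
proof -
  obtain f b where fb: "frame f b" using exists_frame by blast
  have f: "f \<in> carrier R" "f \<noteq> \<zero>\<^bsub>R\<^esub>" and b: "b \<in> {..<r} \<rightarrow> carrier M" using fb by (auto simp: frame_def)
  have "\<exists>a. a \<in> {..<r} \<rightarrow> carrier R \<and> f \<odot> x = lin_comb M r a b" if "x \<in> carrier M" for x
    using fb that unfolding frame_def by blast
  then obtain a where a: "\<And>x. x \<in> carrier M ==> a x \<in> {..<r} \<rightarrow> carrier R"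
    "\<And>x. x \<in> carrier M ==> f \<odot> x = lin_comb M r (a x) b" by metis
  have az: "a x j = \<zero>\<^bsub>R\<^esub>" if j: "j < r" for j
  proof -
    have ac: "a y j \<in> carrier R" if "y \<in> carrier M" for y using a(1)[OF that] j by auto
    have add: "a (y \<oplus> z) j = a y j \<oplus>\<^bsub>R\<^esub> a z j" if y: "y \<in> carrier M" and z: "z \<in> carrier M" for y z
    proof (rule frame_unique[OF fb a(1) _ _ j])
      show "lin_comb M r (a (y \<oplus> z)) b = lin_comb M r (\<lambda>j. a y j \<oplus>\<^bsub>R\<^esub> a z j) b"
        using lin_comb_add[OF module_RM a(1)[OF y] a(1)[OF z] b] a(2)[of "y \<oplus> z"] a(2)[OF y] a(2)[OF z] f(1) y z by (simp add: smult_r_distr)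
    qed (use y z a(1)[OF y] a(1)[OF z] in \<open>auto simp: Pi_iff\<close>)
    have smult: "a (s \<odot> y) j = s \<otimes>\<^bsub>R\<^esub> a y j" if s: "s \<in> carrier R" and y: "y \<in> carrier M" for s y
    proof (rule frame_unique[OF fb a(1) _ _ j])
      have "f \<odot> (s \<odot> y) = s \<odot> (f \<odot> y)" using f(1) s y by (simp add: smult_assoc1[symmetric] R.m_comm)
      then show "lin_comb M r (a (s \<odot> y)) b = lin_comb M r (\<lambda>j. s \<otimes>\<^bsub>R\<^esub> a y j) b"
        using lin_comb_smult[OF module_RM a(1)[OF y] s b] a(2)[of "s \<odot> y"] a(2)[OF y] s y by simp
    qed (use s y a(1)[OF y] in \<open>auto simp: Pi_iff\<close>)
    have "balanced R M (module_along F i) F (\<lambda>y s. i (a y j) \<otimes>\<^bsub>F\<^esub> s)"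
      by (rule balancedI)
         (use ac i_closed add smult in \<open>auto simp: ring_hom_add[OF h] ring_hom_mult[OF h] S.l_distr S.r_distr S.m_ac\<close>)
    note \<Phi> = bc_lift[OF S.abelian_group_axioms this]
    have "i (a x j) \<otimes>\<^bsub>F\<^esub> \<one>\<^bsub>F\<^esub> = \<zero>\<^bsub>F\<^esub>"
      using additive_map_zero[OF BC_abelian_group S.abelian_group_axioms \<Phi>(1)]
      unfolding x(2)[symmetric] \<Phi>(2)[OF x(1) S.one_closed] .
    then show ?thesis using i_nonzero[OF ac[OF x(1)]] i_closed[OF ac[OF x(1)]] by auto
  qed
  have "a x j \<odot> b j = \<zero>" if "j \<in> {..<r}" for j
    using az[of j] funcset_mem[OF b that] that by (simp only: lessThan_iff smult_l_null)
  then have "lin_comb M r (a x) b = \<zero>" unfolding lin_comb_def by (rule M.add.finprod_one_eqI)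
  then have "f \<odot> x = \<zero>" using a(2)[OF x(1)] by simp
  then show ?thesis using torsion_free[OF f x(1)] by blast
qed

end

lemma restrict_abelian_group:
  assumes "abelian_group V" "subgroup H (add_monoid V)"
  shows "abelian_group (V\<lparr>carrier := H\<rparr>)"
proof -
  interpret V: abelian_group V by fact
  interpret H: subgroup H "add_monoid V" by fact
  have c: "x \<in> carrier V" if "x \<in> H" for x using H.subset that by auto
  have inv: "\<exists>y\<in>H. y \<oplus>\<^bsub>V\<^esub> x = \<zero>\<^bsub>V\<^esub>" if "x \<in> H" for x
    using H.m_inv_closed[OF that] c[OF that] V.l_neg by (auto simp: a_inv_def[symmetric])
  have cl: "\<zero>\<^bsub>V\<^esub> \<in> H" "\<And>x y. x \<in> H ==> y \<in> H ==> x \<oplus>\<^bsub>V\<^esub> y \<in> H" using H.one_closed H.m_closed by simp_all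
  show ?thesis by (rule abelian_groupI) ((simp_all add: cl c V.a_assoc inv)?, simp add: c V.a_comm)
qed

text \<open>Bases of sections are stated with sums in a restricted structure, coordinates in the
  generic fibre with sums in \<open>V\<close>; this identifies the two.\<close>

lemma finsum_restrict:
  assumes V: "abelian_group V" "subgroup H (add_monoid V)" and "finite I" "f \<in> I \<rightarrow> H"
  shows "finsum (V\<lparr>carrier := H\<rparr>) f I = finsum V f I"
  using assms(3,4)
proof (induction I rule: finite_induct)
  case empty
  then show ?case using V(1) restrict_abelian_group[OF V] by (simp add: abelian_monoid.finsum_empty abelian_group.axioms(1))
next
  case (insert i I)
  interpret V: abelian_group V by fact
  interpret H: abelian_group "V\<lparr>carrier := H\<rparr>" by (rule restrict_abelian_group[OF V])
  have c: "H \<subseteq> carrier V" using subgroup.subset[OF V(2)] by simp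
  have "f \<in> I \<rightarrow> carrier (V\<lparr>carrier := H\<rparr>)" "f i \<in> carrier (V\<lparr>carrier := H\<rparr>)" "f \<in> I \<rightarrow> carrier V" "f i \<in> carrier V"
    using insert.prems c by auto
  then show ?case using insert.hyps insert.IH insert.prems by (simp add: H.finsum_insert V.finsum_insert)
qed

context valuation_point
begin

lemma tp_bounded: "unif t ==> c \<in> carrier F ==> \<exists>m. \<forall>n\<ge>m. tp t n \<otimes> c \<in> P"
proof (cases "c = \<zero>")
  case True
  then show "unif t ==> ?thesis" using P_zero tp_closed by auto
next
  case False
  assume t: "unif t" and c: "c \<in> carrier F"
  obtain m u where u: "u \<in> U" "c = tp t m \<otimes> u" using tp_decompose[OF t c False] by blast
  have "tp t n \<otimes> c \<in> P" if "n \<ge> - m" for n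
    using u tp_closed[OF t] P_carrier[of u] tp_add[OF t, of n m] tp_nonneg[OF t, of "n + m"] that
    by (simp add: m_assoc[symmetric] U_iff P_mult)
  then show ?thesis by blast
qed

lemma tp_unbounded: "unif t ==> c \<in> carrier F ==> c \<noteq> \<zero> ==> \<exists>n. tp t n \<otimes> c \<notin> P"
proof -
  assume t: "unif t" and c: "c \<in> carrier F" "c \<noteq> \<zero>"
  obtain m u where u: "u \<in> U" "c = tp t m \<otimes> u" using tp_decompose[OF t c] by blast
  have uc: "u \<in> carrier F" "inv u \<in> P" "u \<noteq> \<zero>" using u(1) P_carrier by (auto simp: U_iff)
  have "tp t (- 1 - m) \<otimes> c = tp t (- 1) \<otimes> u"
    using u(2) uc tp_closed[OF t] tp_add[OF t, of "- 1 - m" m] by (simp add: m_assoc[symmetric])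
  moreover have "tp t (- 1) \<otimes> u \<notin> P"
  proof
    assume "tp t (- 1) \<otimes> u \<in> P"
    then have "tp t (- 1) \<otimes> u \<otimes> inv u \<in> P" using uc(2) by (rule P_mult)
    then have "inv t \<in> P" using uc tp_closed[OF t] tp_inv[OF t, of 1] tp_1[OF t] inv_field(3)[OF uc(1,3)] inv_closed_field[OF uc(1,3)]
      by (simp add: m_assoc)
    then show False using t by (auto simp: unif_def U_iff)
  qed
  ultimately show ?thesis by metis
qed

end

section \<open>The stalk as a lattice in the generic fibre\<close>

locale sheaf_at_point = generic_fibre R M r F i + VP: valuation_point F k P
  for R :: "('r, 'x) ring_scheme" and M :: "('r, 'm) module" and r and F :: "('f, 'y) ring_scheme" and i k P +
  fixes E :: "'f set set \<Rightarrow> ('m, 'f) tens set"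
  assumes finite_poles: "y \<in> carrier F ==> finite {P \<in> closed_points F k. y \<notin> P}"
    and E: "locally_free_sheaf F k (base_change R M i F) r E"
    and E_affine: "E (closed_points F k - {P}) = (\<lambda>x. bc_tensor R M i F x \<one>\<^bsub>F\<^esub>) ` carrier M"
begin

abbreviation "W \<equiv> stalk F k E P"

lemma open_inter: "U \<in> open_sets F k ==> U' \<in> open_sets F k ==> U \<inter> U' \<in> open_sets F k"
  by (auto simp: open_sets_def Diff_Int)

text \<open>The point at which finiteness of poles enters: open sets can be shrunk to the locus
  where finitely many given functions are regular.\<close>

lemma open_regular: "finite C ==> C \<subseteq> carrier F ==> {P \<in> closed_points F k. C \<subseteq> P} \<in> open_sets F k"
proof -
  assume C: "finite C" "C \<subseteq> carrier F"
  have "closed_points F k - {P \<in> closed_points F k. C \<subseteq> P} = (\<Union>y\<in>C. {P \<in> closed_points F k. y \<notin> P})" by blast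
  then show ?thesis using C finite_poles by (auto simp: open_sets_def)
qed

text \<open>The gluing condition for the covering of \<open>U\<close> by \<open>U\<close> and
  \<open>U'\<close> says that \<open>E U\<close> is the intersection of \<open>E U\<close> and
  \<open>E U'\<close>.\<close>

lemma E_antimono: "U \<in> open_sets F k ==> U' \<in> open_sets F k ==> U' \<subseteq> U ==> E U \<subseteq> E U'"
proof -
  assume U: "U \<in> open_sets F k" "U' \<in> open_sets F k" "U' \<subseteq> U"
  have "\<forall>\<U>. \<U> \<noteq> {} \<longrightarrow> \<U> \<subseteq> open_sets F k \<longrightarrow> E (\<Union>\<U>) = (\<Inter>U\<in>\<U>. E U)" using E by (simp add: locally_free_sheaf_def)
  from this[rule_format, of "{U, U'}"] have "E (U \<union> U') = E U \<inter> E U'" using U by simp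
  moreover have "U \<union> U' = U" using U by blast
  ultimately have "E U = E U \<inter> E U'" by simp
  then show ?thesis by (metis Int_lower2)
qed

lemma E_submodule: "U \<in> open_sets F k ==> submodule (E U) (F\<lparr>carrier := regular_functions F U\<rparr>) V"
  using E by (simp add: locally_free_sheaf_def)

lemma E_subgroup: "U \<in> open_sets F k ==> subgroup (E U) (add_monoid V)"
  using E_submodule by (simp add: submodule_def)

lemma E_smult: "U \<in> open_sets F k ==> a \<in> regular_functions F U ==> v \<in> E U ==> a \<odot>\<^bsub>V\<^esub> v \<in> E U"
  using submodule.smult_closed[OF E_submodule] by simp

lemma E_carrier: "U \<in> open_sets F k ==> v \<in> E U ==> v \<in> carrier V"
  using subgroup.subset[OF E_subgroup] by auto

lemma E_add: "U \<in> open_sets F k ==> v \<in> E U ==> w \<in> E U ==> v \<oplus>\<^bsub>V\<^esub> w \<in> E U"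
  using subgroup.m_closed[OF E_subgroup] by simp

lemma E_zero: "U \<in> open_sets F k ==> \<zero>\<^bsub>V\<^esub> \<in> E U"
  using subgroup.one_closed[OF E_subgroup] by simp

lemma W_iff: "v \<in> W \<longleftrightarrow> (\<exists>U\<in>open_sets F k. P \<in> U \<and> v \<in> E U)"
  by (auto simp: stalk_def)

lemma W_carrier: "v \<in> W ==> v \<in> carrier V"
  using E_carrier by (auto simp: W_iff)

lemma W_add: "v \<in> W ==> w \<in> W ==> v \<oplus>\<^bsub>V\<^esub> w \<in> W"
proof -
  assume "v \<in> W" "w \<in> W"
  then obtain U U' where U: "U \<in> open_sets F k" "P \<in> U" "v \<in> E U" "U' \<in> open_sets F k" "P \<in> U'" "w \<in> E U'" by (auto simp: W_iff)
  have "v \<in> E (U \<inter> U')" "w \<in> E (U \<inter> U')"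
    using E_antimono[OF U(1) open_inter[OF U(1,4)]] E_antimono[OF U(4) open_inter[OF U(1,4)]] U(3,6) by auto
  then show ?thesis using E_add[OF open_inter[OF U(1,4)]] open_inter[OF U(1,4)] U(2,5) unfolding W_iff by blast
qed

lemma W_smult: "a \<in> P ==> v \<in> W ==> a \<odot>\<^bsub>V\<^esub> v \<in> W"
proof -
  assume a: "a \<in> P" and "v \<in> W"
  then obtain U where U: "U \<in> open_sets F k" "P \<in> U" "v \<in> E U" by (auto simp: W_iff)
  let ?U = "U \<inter> {P \<in> closed_points F k. {a} \<subseteq> P}"
  have o: "?U \<in> open_sets F k" by (rule open_inter[OF U(1) open_regular]) (use a VP.P_carrier in auto)
  have "v \<in> E ?U" using E_antimono[OF U(1) o] U(3) by blast
  moreover have "a \<in> regular_functions F ?U" using a VP.P_carrier by (auto simp: regular_functions_def)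
  ultimately have "a \<odot>\<^bsub>V\<^esub> v \<in> E ?U" by (intro E_smult[OF o])
  moreover have "P \<in> ?U" using U(2) a VP.P by auto
  ultimately show ?thesis unfolding W_iff by (intro bexI[OF _ o] conjI)
qed

lemma all_open: "closed_points F k \<in> open_sets F k"
  by (simp add: open_sets_def)

lemma W_zero: "\<zero>\<^bsub>V\<^esub> \<in> W"
  using E_zero[OF all_open] all_open VP.P unfolding W_iff by blast

lemma W_uminus: "v \<in> W ==> \<ominus>\<^bsub>V\<^esub> v \<in> W"
proof -
  assume v: "v \<in> W"
  have "(\<ominus>\<^bsub>F\<^esub> \<one>\<^bsub>F\<^esub>) \<odot>\<^bsub>V\<^esub> v \<in> W" by (rule W_smult[OF VP.P_uminus[OF VP.P_one] v])
  then show ?thesis using W_carrier[OF v] by (simp add: BC.smult_l_minus)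
qed

lemma smult_W: "a \<in> VP.U ==> v \<in> carrier V ==> a \<odot>\<^bsub>V\<^esub> v \<in> W \<longleftrightarrow> v \<in> W"
proof
  assume a: "a \<in> VP.U" and v: "v \<in> carrier V"
  have ac: "a \<in> P" "inv\<^bsub>F\<^esub> a \<in> P" "a \<in> carrier F" "inv\<^bsub>F\<^esub> a \<in> carrier F" "a \<noteq> \<zero>\<^bsub>F\<^esub>" using a VP.P_carrier by (auto simp: VP.U_iff)
  show "a \<odot>\<^bsub>V\<^esub> v \<in> W" if "v \<in> W" using W_smult[OF ac(1) that] .
  assume "a \<odot>\<^bsub>V\<^esub> v \<in> W"
  then have "inv\<^bsub>F\<^esub> a \<odot>\<^bsub>V\<^esub> (a \<odot>\<^bsub>V\<^esub> v) \<in> W" by (rule W_smult[OF ac(2)])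
  then show "v \<in> W" using ac v fld.inv_field(2)[OF ac(3,5)] by (simp add: BC.smult_assoc1[symmetric])
qed

text \<open>The basis of sections near \<open>P\<close> serves both the stalk over the local ring
  and the generic fibre over \<open>F\<close>. It spans the latter because the sections away from
  \<open>P\<close>, which are the elements of \<open>M\<close>, generate it.\<close>

lemma exists_local_basis:
  obtains e where "e \<in> {..<r} \<rightarrow> W"
    "\<And>w. w \<in> W ==> \<exists>c\<in>{..<r} \<rightarrow> P. w = lin_comb V r c e"
    "\<And>v. v \<in> carrier V ==> \<exists>c\<in>{..<r} \<rightarrow> carrier F. v = lin_comb V r c e"
    "\<And>c c' i. c \<in> {..<r} \<rightarrow> carrier F ==> c' \<in> {..<r} \<rightarrow> carrier F ==> lin_comb V r c e = lin_comb V r c' e ==> i < r ==> c i = c' i"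
proof -
  have "\<forall>P \<in> closed_points F k. \<exists>U \<in> open_sets F k. P \<in> U \<and>
       (\<exists>e. \<forall>U' \<in> open_sets F k. U' \<subseteq> U \<longrightarrow> is_basis (F\<lparr>carrier := regular_functions F U'\<rparr>) (V\<lparr>carrier := E U'\<rparr>) r e)"
    using E by (simp add: locally_free_sheaf_def)
  from bspec[OF this VP.P] obtain U e where U: "U \<in> open_sets F k" "P \<in> U"
    and bb: "\<forall>U' \<in> open_sets F k. U' \<subseteq> U \<longrightarrow> is_basis (F\<lparr>carrier := regular_functions F U'\<rparr>) (V\<lparr>carrier := E U'\<rparr>) r e"
    by (elim bexE conjE exE)
  note b = bb[rule_format]
  have eE: "e j \<in> E U'" if "U' \<in> open_sets F k" "U' \<subseteq> U" "j < r" for U' j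
    using b[OF that(1,2)] that(3) by (auto simp: is_basis_def)
  have ec: "e \<in> {..<r} \<rightarrow> carrier V" using eE[OF U(1) subset_refl] E_carrier[OF U(1)] by auto
  have lc: "lin_comb (V\<lparr>carrier := E U'\<rparr>) r a e = lin_comb V r a e"
    if o: "U' \<in> open_sets F k" "U' \<subseteq> U" and a: "a \<in> {..<r} \<rightarrow> regular_functions F U'" for U' a
  proof -
    have "(\<lambda>i. a i \<odot>\<^bsub>V\<^esub> e i) \<in> {..<r} \<rightarrow> E U'" using a eE[OF o] E_smult[OF o(1)] by auto
    from finsum_restrict[OF BC_abelian_group E_subgroup[OF o(1)] _ this] show ?thesis by (simp add: lin_comb_def)
  qed
  have exp: "\<exists>a\<in>{..<r} \<rightarrow> regular_functions F U'. x = lin_comb V r a e"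
    if o: "U' \<in> open_sets F k" "U' \<subseteq> U" and x: "x \<in> E U'" for U' x
  proof -
    obtain a where a: "a \<in> {..<r} \<rightarrow>\<^sub>E regular_functions F U'" "x = lin_comb (V\<lparr>carrier := E U'\<rparr>) r a e"
      using b[OF o] x by (auto simp: is_basis_def)
    then show ?thesis using lc[OF o, of a] by (auto simp: PiE_def)
  qed
  have ind: "c j = c' j" if c: "c \<in> {..<r} \<rightarrow> carrier F" "c' \<in> {..<r} \<rightarrow> carrier F" "lin_comb V r c e = lin_comb V r c' e" "j < r" for c c' j
  proof -
    \<comment> \<open>The relation involves finitely many coefficients, so it can be read over an
      open set on which all of them are regular and \<open>e\<close> is a basis of sections.\<close>
    define U' where "U' = U \<inter> {P \<in> closed_points F k. c ` {..<r} \<union> c' ` {..<r} \<subseteq> P}"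
    have o: "U' \<in> open_sets F k" "U' \<subseteq> U"
      unfolding U'_def using c(1,2) open_inter[OF U(1) open_regular, of "c ` {..<r} \<union> c' ` {..<r}"] by blast+
    have cr: "c \<in> {..<r} \<rightarrow> regular_functions F U'" "c' \<in> {..<r} \<rightarrow> regular_functions F U'"
      using c(1,2) by (auto simp: regular_functions_def U'_def)
    let ?c = "restrict c {..<r}" and ?c' = "restrict c' {..<r}"
    have rc: "?c \<in> {..<r} \<rightarrow>\<^sub>E regular_functions F U'" "?c' \<in> {..<r} \<rightarrow>\<^sub>E regular_functions F U'" using cr by auto
    have res: "lin_comb V r (restrict d {..<r}) e = lin_comb V r d e" if "d \<in> {..<r} \<rightarrow> carrier F" for d
      unfolding lin_comb_def using that ec by (intro BC.M.finsum_cong') (auto simp: Pi_iff)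
    have lE: "lin_comb V r c e \<in> E U'"
    proof -
      interpret H: abelian_group "V\<lparr>carrier := E U'\<rparr>" by (rule restrict_abelian_group[OF BC_abelian_group E_subgroup[OF o(1)]])
      have "(\<lambda>i. c i \<odot>\<^bsub>V\<^esub> e i) \<in> {..<r} \<rightarrow> carrier (V\<lparr>carrier := E U'\<rparr>)"
        using E_smult[OF o(1) funcset_mem[OF cr(1)] eE[OF o]] by simp
      from H.finsum_closed[OF this] have "lin_comb (V\<lparr>carrier := E U'\<rparr>) r c e \<in> E U'" by (simp add: lin_comb_def)
      then show ?thesis using lc[OF o cr(1)] by simp
    qed
    have "lin_comb V r c e = lin_comb (V\<lparr>carrier := E U'\<rparr>) r ?c e" "lin_comb V r c e = lin_comb (V\<lparr>carrier := E U'\<rparr>) r ?c' e"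
      using lc[OF o, of ?c] lc[OF o, of ?c'] rc res c by (auto simp: PiE_def)
    then have "?c = ?c'" using b[OF o] lE rc unfolding is_basis_def by (auto dest!: bspec)
    then show ?thesis using c(4) by (metis restrict_apply lessThan_iff)
  qed
  \<comment> \<open>Elements of \<open>M\<close> are sections only away from \<open>P\<close>; they
    are expanded over the part of \<open>U\<close> without \<open>P\<close>, where the same
    \<open>e\<close> is a basis.\<close>
  have spanM: "\<exists>c\<in>{..<r} \<rightarrow> carrier F. \<iota>M x = lin_comb V r c e" if x: "x \<in> carrier M" for x
  proof -
    have "finite (closed_points F k - (closed_points F k - {P}))" by (rule finite_subset[of _ "{P}"]) auto
    then have oP: "closed_points F k - {P} \<in> open_sets F k" by (auto simp: open_sets_def)
    let ?U = "U \<inter> (closed_points F k - {P})"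
    have o: "?U \<in> open_sets F k" "?U \<subseteq> U" using open_inter[OF U(1) oP] by auto
    have "\<iota>M x \<in> E (closed_points F k - {P})" unfolding E_affine using x by blast
    then have "\<iota>M x \<in> E ?U" using E_antimono[OF oP o(1)] by blast
    from exp[OF o this] show ?thesis by (auto simp: regular_functions_def)
  qed
  have "\<exists>c\<in>{..<r} \<rightarrow> carrier F. v = lin_comb V r c e" if "v \<in> carrier V" for v
    using that
  proof (induction rule: bc_induct)
    case (pure x s)
    obtain c where c: "c \<in> {..<r} \<rightarrow> carrier F" "\<iota>M x = lin_comb V r c e" using spanM[OF pure(1)] by blast
    have "bc x s = s \<odot>\<^bsub>V\<^esub> \<iota>M x" using pure by (rule bc_one)
    also have "\<dots> = lin_comb V r (\<lambda>i. s \<otimes>\<^bsub>F\<^esub> c i) e" unfolding c(2) by (rule lin_comb_smult[OF BC_module c(1) pure(2) ec, symmetric])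
    finally show ?case using c(1) pure(2) by (intro bexI[of _ "\<lambda>i. s \<otimes>\<^bsub>F\<^esub> c i"]) (auto simp: Pi_iff)
  next
    case (add Y Z)
    then obtain c d where c: "c \<in> {..<r} \<rightarrow> carrier F" "Y = lin_comb V r c e" "d \<in> {..<r} \<rightarrow> carrier F" "Z = lin_comb V r d e" by blast
    then have "Y \<oplus>\<^bsub>V\<^esub> Z = lin_comb V r (\<lambda>i. c i \<oplus>\<^bsub>F\<^esub> d i) e" using lin_comb_add[OF BC_module c(1,3) ec] by simp
    then show ?case using c(1,3) by (intro bexI[of _ "\<lambda>i. c i \<oplus>\<^bsub>F\<^esub> d i"]) (auto simp: Pi_iff)
  qed
  moreover have "e \<in> {..<r} \<rightarrow> W" using eE[OF U(1) subset_refl] U W_iff by (meson Pi_I lessThan_iff)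
  moreover have "\<exists>c\<in>{..<r} \<rightarrow> P. w = lin_comb V r c e" if w: "w \<in> W" for w
  proof -
    obtain U1 where U1: "U1 \<in> open_sets F k" "P \<in> U1" "w \<in> E U1" using w by (auto simp: W_iff)
    have o: "U \<inter> U1 \<in> open_sets F k" "U \<inter> U1 \<subseteq> U" using open_inter[OF U(1) U1(1)] by auto
    have "w \<in> E (U \<inter> U1)" using E_antimono[OF U1(1) o(1)] U1(3) by blast
    from exp[OF o this] obtain a where a: "a \<in> {..<r} \<rightarrow> regular_functions F (U \<inter> U1)" "w = lin_comb V r a e" by blast
    then have "a \<in> {..<r} \<rightarrow> P" using U(2) U1(2) by (auto simp: regular_functions_def)
    then show ?thesis using a(2) by blast
  qed
  ultimately show ?thesis using that ind by blast
qed

context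
  fixes t assumes t: "VP.unif t"
begin

text \<open>Coordinates in the local basis have bounded pole orders, and one exponent serves the
  finitely many of them.\<close>

lemma W_exhaustive: "v \<in> carrier V ==> \<exists>n. VP.tp t n \<odot>\<^bsub>V\<^esub> v \<in> W"
proof -
  assume v: "v \<in> carrier V"
  obtain e c where e: "e \<in> {..<r} \<rightarrow> W" and c: "c \<in> {..<r} \<rightarrow> carrier F" "v = lin_comb V r c e"
    using exists_local_basis v by metis
  have ec: "e \<in> {..<r} \<rightarrow> carrier V" using e W_carrier by auto
  have "\<exists>m. \<forall>n\<ge>m. VP.tp t n \<otimes>\<^bsub>F\<^esub> c i \<in> P" if "i < r" for i using VP.tp_bounded[OF t] c(1) that by auto
  then obtain m where m: "\<And>i n. i < r ==> n \<ge> m i ==> VP.tp t n \<otimes>\<^bsub>F\<^esub> c i \<in> P" by metis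
  define n where "n = Max (insert 0 (m ` {..<r}))"
  have mn: "VP.tp t n \<otimes>\<^bsub>F\<^esub> c i \<in> P" if "i < r" for i using that by (intro m) (auto simp: n_def)
  have "VP.tp t n \<odot>\<^bsub>V\<^esub> v = lin_comb V r (\<lambda>i. VP.tp t n \<otimes>\<^bsub>F\<^esub> c i) e"
    unfolding c(2) by (rule lin_comb_smult[OF BC_module c(1) VP.tp_closed[OF t] ec, symmetric])
  moreover have sums: "(\<Oplus>\<^bsub>V\<^esub>i\<in>I. (VP.tp t n \<otimes>\<^bsub>F\<^esub> c i) \<odot>\<^bsub>V\<^esub> e i) \<in> W" if "finite I" "I \<subseteq> {..<r}" for I
    using that
  proof (induction I rule: finite_induct)
    case empty then show ?case using W_zero by simp
  next
    case (insert i I)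
    have w: "(VP.tp t n \<otimes>\<^bsub>F\<^esub> c j) \<odot>\<^bsub>V\<^esub> e j \<in> W" if "j \<in> insert i I" for j using W_smult[OF mn] e insert.prems that by auto
    have "(\<Oplus>\<^bsub>V\<^esub>i\<in>insert i I. (VP.tp t n \<otimes>\<^bsub>F\<^esub> c i) \<odot>\<^bsub>V\<^esub> e i) = (VP.tp t n \<otimes>\<^bsub>F\<^esub> c i) \<odot>\<^bsub>V\<^esub> e i \<oplus>\<^bsub>V\<^esub> (\<Oplus>\<^bsub>V\<^esub>i\<in>I. (VP.tp t n \<otimes>\<^bsub>F\<^esub> c i) \<odot>\<^bsub>V\<^esub> e i)"
      using w W_carrier insert.hyps by (intro BC.M.finsum_insert) auto
    then show ?case using W_add[OF w] insert by simp
  qed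
  note sums[of "{..<r}"]
  ultimately show ?thesis by (intro exI[of _ n]) (simp add: lin_comb_def)
qed

text \<open>By uniqueness of coordinates each coordinate of \<open>v\<close> remains regular after
  multiplication by every power of \<open>t\<close>, also by negative ones, so it is 0.\<close>

lemma W_separated: "v \<in> carrier V ==> (\<And>n. VP.tp t n \<odot>\<^bsub>V\<^esub> v \<in> W) ==> v = \<zero>\<^bsub>V\<^esub>"
proof -
  assume v: "v \<in> carrier V" and W: "\<And>n. VP.tp t n \<odot>\<^bsub>V\<^esub> v \<in> W"
  obtain e where e: "e \<in> {..<r} \<rightarrow> W" "\<And>w. w \<in> W ==> \<exists>c\<in>{..<r} \<rightarrow> P. w = lin_comb V r c e"
    "\<And>v. v \<in> carrier V ==> \<exists>c\<in>{..<r} \<rightarrow> carrier F. v = lin_comb V r c e"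
    "\<And>c c' i. c \<in> {..<r} \<rightarrow> carrier F ==> c' \<in> {..<r} \<rightarrow> carrier F ==> lin_comb V r c e = lin_comb V r c' e ==> i < r ==> c i = c' i"
    using exists_local_basis by blast
  have ec: "e \<in> {..<r} \<rightarrow> carrier V" using e(1) W_carrier by auto
  obtain c where c: "c \<in> {..<r} \<rightarrow> carrier F" "v = lin_comb V r c e" using e(3)[OF v] by blast
  have "c i = \<zero>\<^bsub>F\<^esub>" if i: "i < r" for i
  proof -
    have "VP.tp t n \<otimes>\<^bsub>F\<^esub> c i \<in> P" for n
    proof -
      obtain d where d: "d \<in> {..<r} \<rightarrow> P" "VP.tp t n \<odot>\<^bsub>V\<^esub> v = lin_comb V r d e" using e(2)[OF W] by blast
      have "lin_comb V r (\<lambda>i. VP.tp t n \<otimes>\<^bsub>F\<^esub> c i) e = lin_comb V r d e"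
        using lin_comb_smult[OF BC_module c(1) VP.tp_closed[OF t] ec] c(2) d(2) by simp
      then have "VP.tp t n \<otimes>\<^bsub>F\<^esub> c i = d i"
        using e(4)[OF _ _ _ i, of "\<lambda>i. VP.tp t n \<otimes>\<^bsub>F\<^esub> c i" d] c(1) d(1) VP.P_carrier VP.tp_closed[OF t] by (auto simp: Pi_iff)
      then show ?thesis using d(1) i by auto
    qed
    then show ?thesis using VP.tp_unbounded[OF t, of "c i"] c(1) i by auto
  qed
  then show ?thesis unfolding c(2) lin_comb_def using ec by (subst BC.M.finsum_cong'[where g = "\<lambda>i. \<zero>\<^bsub>V\<^esub>"]) (auto simp: Pi_iff)
qed

text \<open>The twisted stalk allows an arbitrary uniformizer. Two uniformizers differ by a factor
  from the local ring, which preserves the stalk, so the fixed \<open>t\<close> decides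
  membership.\<close>

lemma twisted_stalk_eq: "twisted_stalk F k V E P n = {v \<in> carrier V. VP.tp t (int n) \<odot>\<^bsub>V\<^esub> v \<in> W}"
proof -
  have *: "(t1 [^]\<^bsub>F\<^esub> n) \<odot>\<^bsub>V\<^esub> v \<in> W" if t1: "VP.unif t1" and t2: "VP.unif t2" and v: "v \<in> carrier V" and w: "(t2 [^]\<^bsub>F\<^esub> n) \<odot>\<^bsub>V\<^esub> v \<in> W" for t1 t2 v
  proof -
    have c: "t1 \<in> carrier F" "t2 \<in> carrier F" using VP.t_carrier[OF t1] VP.t_carrier[OF t2] by auto
    obtain y where y: "y \<in> P" "t1 = t2 \<otimes>\<^bsub>F\<^esub> y" using t1 t2 unfolding VP.unif_def by blast
    have yn: "y [^]\<^bsub>F\<^esub> n \<in> P" by (induction n) (use y(1) VP.P_one VP.P_mult in auto)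
    have "(t1 [^]\<^bsub>F\<^esub> n) \<odot>\<^bsub>V\<^esub> v = (y [^]\<^bsub>F\<^esub> n) \<odot>\<^bsub>V\<^esub> ((t2 [^]\<^bsub>F\<^esub> n) \<odot>\<^bsub>V\<^esub> v)"
      using c VP.P_carrier[OF y(1)] v y(2) by (simp add: BC.smult_assoc1[symmetric] S.nat_pow_distrib S.m_comm)
    then show ?thesis using W_smult[OF yn w] by simp
  qed
  show ?thesis unfolding twisted_stalk_def VP.tp_nat[OF t] VP.unif_iff using * t by blast
qed

text \<open>\<open>Fil j\<close> is defined by divisibility by \<open>tp t j\<close> with respect to
  the lattice \<open>W\<close>. As \<open>Sl\<close> commutes with powers of \<open>t\<close> and
  maps \<open>W\<close> bijectively onto the lattice with poles up to order \<open>m\<close>, it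
  lowers orders by exactly \<open>m\<close>; restricted to \<open>M\<close> it is
  \<open>T\<close>.\<close>

theorem exists_filtration:
  assumes fm: "frob_module R M \<theta> T0 e" and S: "additive_map V V Sl" "\<And>n v. v \<in> carrier V ==> Sl (VP.tp t n \<odot>\<^bsub>V\<^esub> v) = VP.tp t n \<odot>\<^bsub>V\<^esub> Sl v"
    and bij: "bij_betw Sl W (twisted_stalk F k V E P m)"
    and T: "\<And>x. x \<in> carrier M ==> T x \<in> carrier M" "\<And>x. x \<in> carrier M ==> Sl (\<iota>M x) = \<iota>M (T x)"
  shows "\<exists>Fil. frob_module.filtration R M Fil \<and> (\<forall>x\<in>carrier M. \<forall>j. T x \<in> Fil (j - int m) \<longleftrightarrow> x \<in> Fil j)"
proof -
  note tc = VP.tp_closed[OF t]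
  have tt: "VP.tp t a \<odot>\<^bsub>V\<^esub> (VP.tp t b \<odot>\<^bsub>V\<^esub> v) = VP.tp t (a + b) \<odot>\<^bsub>V\<^esub> v" if "v \<in> carrier V" for a b v
    using that tc by (simp add: VP.tp_add[OF t] BC.smult_assoc1)
  have \<iota>c: "\<iota>M x \<in> carrier V" if "x \<in> carrier M" for x using that by auto
  have Sc: "Sl v \<in> carrier V" if "v \<in> carrier V" for v using additive_map_closed[OF S(1) that] .
  have tp0: "VP.tp t 0 \<odot>\<^bsub>V\<^esub> v = v" if "v \<in> carrier V" for v using that by (simp add: VP.tp_0[OF t])
  have S0: "Sl \<zero>\<^bsub>V\<^esub> = \<zero>\<^bsub>V\<^esub>" by (rule additive_map_zero[OF BC_abelian_group BC_abelian_group S(1)])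
  \<comment> \<open>Injectivity is given on \<open>W\<close> only, but some power of
    \<open>t\<close> brings any vector into \<open>W\<close>.\<close>
  have S_inj: "v = \<zero>\<^bsub>V\<^esub>" if v: "v \<in> carrier V" "Sl v = \<zero>\<^bsub>V\<^esub>" for v
  proof -
    obtain n where n: "VP.tp t n \<odot>\<^bsub>V\<^esub> v \<in> W" using W_exhaustive[OF v(1)] by blast
    have "Sl (VP.tp t n \<odot>\<^bsub>V\<^esub> v) = Sl \<zero>\<^bsub>V\<^esub>" using S(2)[OF v(1)] v(2) S0 tc by simp
    then have "VP.tp t n \<odot>\<^bsub>V\<^esub> v = \<zero>\<^bsub>V\<^esub>" using bij n W_zero by (auto simp: bij_betw_def dest: inj_onD)
    then have "VP.tp t (- n) \<odot>\<^bsub>V\<^esub> (VP.tp t n \<odot>\<^bsub>V\<^esub> v) = \<zero>\<^bsub>V\<^esub>" using tc by simp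
    then show ?thesis using tt[OF v(1)] tp0[OF v(1)] by simp
  qed
  have S_W: "VP.tp t (int m) \<odot>\<^bsub>V\<^esub> Sl v \<in> W \<longleftrightarrow> v \<in> W" if v: "v \<in> carrier V" for v
  proof
    have img: "Sl ` W = {v \<in> carrier V. VP.tp t (int m) \<odot>\<^bsub>V\<^esub> v \<in> W}" using bij by (simp add: bij_betw_def twisted_stalk_eq)
    show "VP.tp t (int m) \<odot>\<^bsub>V\<^esub> Sl v \<in> W" if "v \<in> W" using img that by blast
    assume "VP.tp t (int m) \<odot>\<^bsub>V\<^esub> Sl v \<in> W"
    then have "Sl v \<in> Sl ` W" using img Sc[OF v] by blast
    then obtain w where w: "w \<in> W" "Sl v = Sl w" by blast
    have "Sl (v \<ominus>\<^bsub>V\<^esub> w) = \<zero>\<^bsub>V\<^esub>"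
      using w v W_carrier[OF w(1)] Sc additive_map_minus[OF BC_abelian_group BC_abelian_group S(1)] by (simp add: BC.M.minus_eq BC.M.r_neg)
    from S_inj[OF BC.M.minus_closed[OF v W_carrier[OF w(1)]] this] have "v = w"
      by (rule BC.M.minus_eq_zeroD[OF v W_carrier[OF w(1)]])
    then show "v \<in> W" using w by simp
  qed
  define Fil where "Fil j = {x \<in> carrier M. VP.tp t (- j) \<odot>\<^bsub>V\<^esub> \<iota>M x \<in> W}" for j
  have \<iota>add: "additive_map M V (\<lambda>x. \<iota>M x)" by (rule additive_bc_one)
  have scaled: "additive_map M V (\<lambda>x. VP.tp t j \<odot>\<^bsub>V\<^esub> \<iota>M x)" for j using additive_map_compose[OF \<iota>add smult_additive[OF tc]] .
  have "Fil (j + 1) \<subseteq> Fil j" for j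
  proof
    fix x assume x: "x \<in> Fil (j + 1)"
    then have "VP.tp t 1 \<odot>\<^bsub>V\<^esub> (VP.tp t (- (j + 1)) \<odot>\<^bsub>V\<^esub> \<iota>M x) \<in> W" using VP.tp_nonneg[OF t, of 1] by (auto simp: Fil_def intro: W_smult)
    then show "x \<in> Fil j" using x tt[OF \<iota>c] by (simp add: Fil_def)
  qed
  moreover have "\<zero>\<^bsub>M\<^esub> \<in> Fil j" for j
    using additive_map_zero[OF M.abelian_group_axioms BC_abelian_group scaled] W_zero by (simp add: Fil_def)
  moreover have "x \<oplus>\<^bsub>M\<^esub> y \<in> Fil j" if "x \<in> Fil j" "y \<in> Fil j" for x y j
    using that additive_map_add[OF scaled, of x y "- j"] W_add by (simp add: Fil_def)
  moreover have "\<ominus>\<^bsub>M\<^esub> x \<in> Fil j" if "x \<in> Fil j" for x j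
    using that additive_map_uminus[OF M.abelian_group_axioms BC_abelian_group scaled, of x "- j"] W_uminus by (simp add: Fil_def)
  moreover have "\<exists>j. x \<in> Fil j" if x: "x \<in> carrier M" for x
  proof -
    obtain n where "VP.tp t n \<odot>\<^bsub>V\<^esub> \<iota>M x \<in> W" using W_exhaustive[OF \<iota>c[OF x]] by blast
    then have "x \<in> Fil (- n)" using x by (simp add: Fil_def)
    then show ?thesis ..
  qed
  moreover have "\<exists>j. x \<notin> Fil j" if x: "x \<in> carrier M" "x \<noteq> \<zero>\<^bsub>M\<^esub>" for x
  proof (rule ccontr)
    assume "\<not> ?thesis"
    then have "x \<in> Fil (- n)" for n by blast
    then have "VP.tp t n \<odot>\<^bsub>V\<^esub> \<iota>M x \<in> W" for n by (simp add: Fil_def)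
    then show False using W_separated[OF \<iota>c[OF x(1)]] \<iota>M_injective[OF x(1)] x(2) by blast
  qed
  moreover have "\<exists>v. \<forall>x\<in>carrier M. \<forall>j. a \<odot>\<^bsub>M\<^esub> x \<in> Fil (j + v) \<longleftrightarrow> x \<in> Fil j" if a: "a \<in> carrier R - {\<zero>\<^bsub>R\<^esub>}" for a
  proof -
    have ia: "i a \<in> carrier F" "i a \<noteq> \<zero>\<^bsub>F\<^esub>" using a i_closed i_nonzero by auto
    \<comment> \<open>\<open>n\<close> is the order of the scalar at the point, and the unit
      \<open>u\<close> preserves the lattice.\<close>
    obtain n u where u: "u \<in> VP.U" "i a = VP.tp t n \<otimes>\<^bsub>F\<^esub> u" using VP.tp_decompose[OF t ia] by blast
    have uc: "u \<in> carrier F" using u(1) VP.P_carrier by (auto simp: VP.U_iff)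
    have "a \<odot>\<^bsub>M\<^esub> x \<in> Fil (j + n) \<longleftrightarrow> x \<in> Fil j" if x: "x \<in> carrier M" for x j
    proof -
      have "VP.tp t (- (j + n)) \<odot>\<^bsub>V\<^esub> \<iota>M (a \<odot>\<^bsub>M\<^esub> x) = VP.tp t (- (j + n)) \<odot>\<^bsub>V\<^esub> (VP.tp t n \<odot>\<^bsub>V\<^esub> (u \<odot>\<^bsub>V\<^esub> \<iota>M x))"
        using a x uc tc \<iota>c[OF x] by (simp add: bc_one_smult u(2) BC.smult_assoc1)
      also have "\<dots> = VP.tp t (- j) \<odot>\<^bsub>V\<^esub> (u \<odot>\<^bsub>V\<^esub> \<iota>M x)" using tt[of "u \<odot>\<^bsub>V\<^esub> \<iota>M x" "- (j + n)" n] uc \<iota>c[OF x] by simp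
      also have "\<dots> = u \<odot>\<^bsub>V\<^esub> (VP.tp t (- j) \<odot>\<^bsub>V\<^esub> \<iota>M x)" using uc tc \<iota>c[OF x] by (simp add: BC.smult_assoc1[symmetric] S.m_comm)
      finally show ?thesis using a x smult_W[OF u(1), of "VP.tp t (- j) \<odot>\<^bsub>V\<^esub> \<iota>M x"] tc \<iota>c[OF x] by (simp add: Fil_def)
    qed
    then show ?thesis by blast
  qed
  moreover have "Fil j \<subseteq> carrier M" for j by (auto simp: Fil_def)
  ultimately have "frob_module.filtration R M Fil" unfolding frob_module.filtration_def[OF fm] by (intro conjI allI ballI impI) auto
  moreover have "T x \<in> Fil (j - int m) \<longleftrightarrow> x \<in> Fil j" if x: "x \<in> carrier M" for x j
  proof -
    have "VP.tp t (- (j - int m)) \<odot>\<^bsub>V\<^esub> \<iota>M (T x) = VP.tp t (int m) \<odot>\<^bsub>V\<^esub> (VP.tp t (- j) \<odot>\<^bsub>V\<^esub> \<iota>M (T x))"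
      using tt[OF \<iota>c[OF T(1)[OF x]]] by simp
    also have "VP.tp t (- j) \<odot>\<^bsub>V\<^esub> \<iota>M (T x) = Sl (VP.tp t (- j) \<odot>\<^bsub>V\<^esub> \<iota>M x)" using S(2)[OF \<iota>c[OF x]] T(2)[OF x] by simp
    finally show ?thesis using S_W[of "VP.tp t (- j) \<odot>\<^bsub>V\<^esub> \<iota>M x"] x T(1)[OF x] tc \<iota>c[OF x] by (simp add: Fil_def)
  qed
  ultimately show ?thesis by blast
qed

end

end

section \<open>Semilinear maps on the generic fibre and the pullback of the stalk\<close>

context base_change_data
begin

lemma semilinear_extension:
  assumes \<sigma>: "\<sigma> \<in> ring_hom S S" "\<And>a. a \<in> carrier R ==> h (\<sigma>' a) = \<sigma> (h a)"
    and T: "additive_map M M T" "\<And>a x. a \<in> carrier R ==> x \<in> carrier M ==> T (a \<odot>\<^bsub>M\<^esub> x) = \<sigma>' a \<odot>\<^bsub>M\<^esub> T x"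
    and \<sigma>': "\<And>a. a \<in> carrier R ==> \<sigma>' a \<in> carrier R"
  defines "TV \<equiv> tensor_lift BC (\<lambda>x s. bc (T x) (\<sigma> s))"
  shows "additive_map BC BC TV" and "x \<in> carrier M ==> s \<in> carrier S ==> TV (bc x s) = bc (T x) (\<sigma> s)"
    and "s \<in> carrier S ==> v \<in> carrier BC ==> TV (s \<odot>\<^bsub>BC\<^esub> v) = \<sigma> s \<odot>\<^bsub>BC\<^esub> TV v"
proof -
  note c = ring_hom_closed[OF \<sigma>(1)] additive_map_closed[OF T(1)] ring_hom_closed[OF h]
  have "balanced R M (module_along S h) BC (\<lambda>x s. bc (T x) (\<sigma> s))"
    by (rule balancedI) (use c T \<sigma> \<sigma>' in \<open>auto simp: additive_map_add[OF T(1)] ring_hom_add[OF \<sigma>(1)] ring_hom_mult[OF \<sigma>(1)] bc_add_left bc_add_right bc_smult_left\<close>)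
  note * = bc_lift[OF BC_abelian_group this]
  show add: "additive_map BC BC TV" and pure: "x \<in> carrier M ==> s \<in> carrier S ==> TV (bc x s) = bc (T x) (\<sigma> s)" for x s
    unfolding TV_def using * by auto
  assume s: "s \<in> carrier S" and v: "v \<in> carrier BC"
  show "TV (s \<odot>\<^bsub>BC\<^esub> v) = \<sigma> s \<odot>\<^bsub>BC\<^esub> TV v"
  proof (rule bc_map_eq[OF _ _ _ v])
    show "additive_map BC BC (\<lambda>v. TV (s \<odot>\<^bsub>BC\<^esub> v))" by (rule additive_map_compose[OF smult_additive[OF s] add])
    show "additive_map BC BC (\<lambda>v. \<sigma> s \<odot>\<^bsub>BC\<^esub> TV v)" by (rule additive_map_compose[OF add smult_additive[OF c(1)[OF s]]])
    show "TV (s \<odot>\<^bsub>BC\<^esub> bc x s') = \<sigma> s \<odot>\<^bsub>BC\<^esub> TV (bc x s')" if "x \<in> carrier M" "s' \<in> carrier S" for x s'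
      using that s c by (simp add: smult_bc pure ring_hom_mult[OF \<sigma>(1)])
  qed
qed

end

text \<open>The inverse of \<open>f\<close> is its iterate with exponent
  \<open>n - 1\<close>.\<close>

lemma periodic_bij:
  assumes "\<And>x. x \<in> C ==> f x \<in> C" "\<And>x. x \<in> C ==> (f ^^ n) x = x" "n > (0::nat)"
  shows "bij_betw (f ^^ l) C C"
proof (rule bij_betw_funpow)
  obtain m where m: "n = Suc m" using assms(3) by (cases n) auto
  have c: "(f ^^ k) x \<in> C" if "x \<in> C" for k x using that assms(1) by (induction k) auto
  show "bij_betw f C C"
    by (rule bij_betw_byWitness[of _ "f ^^ m"]) (use assms c m in \<open>auto simp: funpow_swap1\<close>)
qed

context sheaf_at_point
begin

text \<open>As \<open>\<theta>\<close> is bijective on the local ring,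
  \<open>v \<mapsto> v \<otimes> 1\<close> identifies the stalk with its pullback. Purity, a
  condition on a linear map from the pullback, thereby becomes a condition on the semilinear
  \<open>Sl\<close>.\<close>

lemma stalk_pullback_bij:
  assumes \<theta>: "\<theta> \<in> ring_hom F F" "bij_betw \<theta> P P"
    and S: "additive_map V V Sl" "\<And>a v. a \<in> carrier F ==> v \<in> carrier V ==> Sl (a \<odot>\<^bsub>V\<^esub> v) = \<theta> a \<odot>\<^bsub>V\<^esub> Sl v"
    and bij: "bij_betw (tensor_lift V (\<lambda>v s. s \<odot>\<^bsub>V\<^esub> Sl v))
      (carrier (base_change (F\<lparr>carrier := P\<rparr>) (V\<lparr>carrier := W\<rparr>) \<theta> (F\<lparr>carrier := P\<rparr>))) Y"
  shows "bij_betw Sl W Y"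
proof -
  let ?P = "F\<lparr>carrier := P\<rparr>" and ?W = "V\<lparr>carrier := W\<rparr>"
  interpret Pc: cring ?P by (rule cring_restrict[OF VP.P_subring S.cring_axioms])
  have "subgroup W (add_monoid V)"
    using W_carrier W_zero W_add W_uminus by (intro group.subgroupI[OF BC.M.a_group]) (auto simp: a_inv_def)
  from restrict_abelian_group[OF BC_abelian_group this] interpret Wg: abelian_group ?W .
  interpret Wm: module ?P ?W
    by (rule moduleI[OF Pc.cring_axioms Wg.abelian_group_axioms])
       (auto simp: W_smult dest!: W_carrier VP.P_carrier simp: BC.smult_l_distr BC.smult_r_distr BC.smult_assoc1)
  have \<theta>P: "\<theta> a \<in> P" if "a \<in> P" for a using \<theta>(2) that by (auto simp: bij_betw_def)
  have "\<theta> \<in> ring_hom ?P ?P"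
    using \<theta>P VP.P_carrier by (intro ring_hom_memI) (auto simp: ring_hom_mult[OF \<theta>(1)] ring_hom_add[OF \<theta>(1)] ring_hom_one[OF \<theta>(1)])
  then interpret b: base_change_data ?P ?W ?P \<theta>
    by (intro base_change_data.intro base_change_data_axioms.intro) unfold_locales
  have "balanced ?P ?W (module_along ?P \<theta>) V (\<lambda>v s. s \<odot>\<^bsub>V\<^esub> Sl v)"
  proof (rule balancedI)
    note c = W_carrier VP.P_carrier additive_map_closed[OF S(1)] ring_hom_closed[OF \<theta>(1)]
    show "s \<odot>\<^bsub>V\<^esub> Sl v \<in> carrier V" if "v \<in> carrier ?W" "s \<in> carrier (module_along ?P \<theta>)" for v s using that c by auto
    show "s \<odot>\<^bsub>V\<^esub> Sl (v \<oplus>\<^bsub>?W\<^esub> v') = s \<odot>\<^bsub>V\<^esub> Sl v \<oplus>\<^bsub>V\<^esub> s \<odot>\<^bsub>V\<^esub> Sl v'"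
      if "v \<in> carrier ?W" "v' \<in> carrier ?W" "s \<in> carrier (module_along ?P \<theta>)" for v v' s
      using that c by (simp add: additive_map_add[OF S(1)] BC.smult_r_distr)
    show "(s \<oplus>\<^bsub>module_along ?P \<theta>\<^esub> s') \<odot>\<^bsub>V\<^esub> Sl v = s \<odot>\<^bsub>V\<^esub> Sl v \<oplus>\<^bsub>V\<^esub> s' \<odot>\<^bsub>V\<^esub> Sl v"
      if "v \<in> carrier ?W" "s \<in> carrier (module_along ?P \<theta>)" "s' \<in> carrier (module_along ?P \<theta>)" for v s s'
      using that c by (simp add: BC.smult_l_distr)
    show "s \<odot>\<^bsub>V\<^esub> Sl (a \<odot>\<^bsub>?W\<^esub> v) = (a \<odot>\<^bsub>module_along ?P \<theta>\<^esub> s) \<odot>\<^bsub>V\<^esub> Sl v"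
      if "a \<in> carrier ?P" "v \<in> carrier ?W" "s \<in> carrier (module_along ?P \<theta>)" for a v s
      using that c by (simp add: S(2) BC.smult_assoc1[symmetric] S.m_comm)
  qed
  note lift = b.bc_lift(2)[OF BC_abelian_group this]
  have "bij_betw (\<lambda>v. b.bc v \<one>\<^bsub>?P\<^esub>) W (carrier b.BC)" using b.bc_one_bij \<theta>(2) by simp
  from bij_betw_trans[OF this bij]
  have *: "bij_betw (\<lambda>v. tensor_lift V (\<lambda>v s. s \<odot>\<^bsub>V\<^esub> Sl v) (b.bc v \<one>\<^bsub>?P\<^esub>)) W Y" by (simp add: comp_def)
  show ?thesis
  proof (rule iffD1[OF bij_betw_cong *])
    show "tensor_lift V (\<lambda>v s. s \<odot>\<^bsub>V\<^esub> Sl v) (b.bc v \<one>\<^bsub>?P\<^esub>) = Sl v" if "v \<in> W" for v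
      using lift[of v "\<one>\<^bsub>?P\<^esub>"] that W_carrier additive_map_closed[OF S(1)] VP.P_one by simp
  qed
qed

end

section \<open>Separable isogenies\<close>

locale quotient_by = module R M for R :: "('r, 'x) ring_scheme" and M :: "('r, 'm) module" (structure) +
  fixes N assumes N: "submodule N R M"
begin

abbreviation "QM \<equiv> quotient_module M N"
abbreviation "cl y \<equiv> N +> y"

lemma N_carrier: "x \<in> N ==> x \<in> carrier M" and N_zero: "\<zero> \<in> N"
  and N_add: "x \<in> N ==> y \<in> N ==> x \<oplus> y \<in> N" and N_uminus: "x \<in> N ==> \<ominus> x \<in> N"
  and N_smult: "a \<in> carrier R ==> x \<in> N ==> a \<odot> x \<in> N"
  using submoduleE[OF N] subgroup.one_closed[OF submodule.axioms(1)[OF N]] by auto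

lemma minus_zero: "x \<in> carrier M ==> x \<ominus> \<zero> = x"
  using M.minus_equality[of "\<zero>" "\<zero>"] by (simp add: M.minus_eq)

lemma abelian_subgroup_N: "abelian_subgroup N M"
  using N by (intro abelian_subgroupI3 additive_subgroup.intro M.abelian_group_axioms) (simp add: submodule_def)

lemma cl_eq: "cl y = {n \<oplus> y |n. n \<in> N}"
  by (auto simp: a_r_coset_def')

lemma cl_mem: "y \<in> carrier M ==> y \<in> cl y"
  unfolding cl_eq using N_zero M.l_zero[of y] by (intro CollectI exI[of _ "\<zero>"]) simp

lemma cl_iff: "x \<in> carrier M ==> y \<in> carrier M ==> cl x = cl y \<longleftrightarrow> x \<ominus> y \<in> N"
proof
  interpret a: abelian_subgroup N M by (rule abelian_subgroup_N)
  assume xy: "x \<in> carrier M" "y \<in> carrier M"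
  show "x \<ominus> y \<in> N" if "cl x = cl y"
    using that cl_mem[OF xy(1)] a.a_rcos_module[OF xy(2,1)] by (simp add: M.minus_eq)
  show "cl x = cl y" if "x \<ominus> y \<in> N"
    using that a.a_rcos_module[OF xy(2,1)] M.a_repr_independence[OF _ xy(2) a.a_subgroup, of x] by (simp add: M.minus_eq)
qed

lemma cl_zero: "x \<in> carrier M ==> cl x = N \<longleftrightarrow> x \<in> N"
proof -
  have "cl \<zero> = N" unfolding cl_eq using N_carrier by (auto, metis M.r_zero)
  then show "x \<in> carrier M ==> cl x = N \<longleftrightarrow> x \<in> N" using cl_iff[of x "\<zero>"] minus_zero[of x] by simp
qed

lemma QM_carrier: "carrier QM = cl ` carrier M"
  by (auto simp: quotient_module_def A_RCOSETS_def')

lemma QM_zero: "\<zero>\<^bsub>QM\<^esub> = N"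
  by (simp add: quotient_module_def)

lemma QM_add: "x \<in> carrier M ==> y \<in> carrier M ==> cl x \<oplus>\<^bsub>QM\<^esub> cl y = cl (x \<oplus> y)"
  using abelian_subgroup.a_rcos_sum[OF abelian_subgroup_N] by (simp add: quotient_module_def)

text \<open>Operations on cosets are defined as unions over all representatives; such a union
  collapses to one coset when the result is independent of the representative.\<close>

lemma cl_UN:
  assumes g: "\<And>y'. y' \<in> cl y ==> g y' \<in> carrier M \<and> g y' \<ominus> z \<in> N" and y: "y \<in> carrier M" and z: "z \<in> carrier M"
  shows "(\<Union>y'\<in>cl y. cl (g y')) = cl z"
proof -
  have "cl (g y') = cl z" if "y' \<in> cl y" for y' using g[OF that] z cl_iff by blast
  then show ?thesis using cl_mem[OF y] by blast
qed

lemma QM_smult: "a \<in> carrier R ==> x \<in> carrier M ==> a \<odot>\<^bsub>QM\<^esub> cl x = cl (a \<odot> x)"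
proof -
  assume a: "a \<in> carrier R" and x: "x \<in> carrier M"
  have "(\<Union>y\<in>cl x. cl (a \<odot> y)) = cl (a \<odot> x)"
  proof (rule cl_UN[OF _ x])
    fix y assume "y \<in> cl x"
    then obtain n where n: "n \<in> N" "y = n \<oplus> x" by (auto simp: cl_eq)
    have "a \<odot> y \<ominus> a \<odot> x = a \<odot> n"
      using a x n N_carrier by (simp add: smult_r_distr M.minus_eq M.a_assoc M.r_neg)
    then show "a \<odot> y \<in> carrier M \<and> a \<odot> y \<ominus> a \<odot> x \<in> N" using a x n N_carrier N_smult by simp
  qed (use a x in simp)
  then show ?thesis by (simp add: quotient_module_def)
qed

lemma QM_module: "module R QM"
proof -
  have z: "\<zero>\<^bsub>QM\<^esub> = cl \<zero>" using cl_zero[of "\<zero>"] N_zero by (simp add: QM_zero)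
  have "\<exists>Z'\<in>carrier QM. Z' \<oplus>\<^bsub>QM\<^esub> Z = \<zero>\<^bsub>QM\<^esub>" if Z: "Z \<in> carrier QM" for Z
  proof -
    obtain y where y: "y \<in> carrier M" "Z = cl y" using Z by (auto simp: QM_carrier)
    then show ?thesis by (intro bexI[of _ "cl (\<ominus> y)"]) (simp_all add: QM_carrier QM_add z M.l_neg)
  qed
  then have "abelian_group QM"
    by (intro abelian_groupI) (auto simp: QM_carrier QM_add z M.a_ac)
  then show ?thesis
    by (rule moduleI[OF R.cring_axioms]) (auto simp: QM_carrier QM_smult QM_add smult_l_distr smult_r_distr smult_assoc1)
qed

lemma quotient_torsion:
  "(\<forall>Z\<in>carrier QM. \<exists>s\<in>D. s \<odot>\<^bsub>QM\<^esub> Z = \<zero>\<^bsub>QM\<^esub>) \<longleftrightarrow> (\<forall>y\<in>carrier M. \<exists>s\<in>D. s \<odot> y \<in> N)" if "D \<subseteq> carrier R"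
proof -
  have "s \<odot>\<^bsub>QM\<^esub> cl y = \<zero>\<^bsub>QM\<^esub> \<longleftrightarrow> s \<odot> y \<in> N" if "s \<in> D" "y \<in> carrier M" for s y
    using that \<open>D \<subseteq> carrier R\<close> by (auto simp: QM_smult QM_zero cl_zero subset_iff)
  then show ?thesis unfolding QM_carrier by auto
qed

text \<open>As \<open>\<theta>\<close> is bijective, \<open>Z \<mapsto> Z \<otimes> 1\<close>
  identifies the quotient with its pullback. Under this identification the induced linear map is the
  action of \<open>T\<close> on the quotient, and the two conditions are its injectivity and
  surjectivity.\<close>

lemma quotient_semilinear_bij:
  assumes \<theta>: "\<theta> \<in> ring_hom R R" "bij_betw \<theta> (carrier R) (carrier R)"
    and \<tau>: "linear_map R (base_change R M \<theta> R) M \<tau>"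
    and T: "\<And>y. y \<in> carrier M ==> T y = \<tau> (bc_tensor R M \<theta> R y \<one>\<^bsub>R\<^esub>)" and TN: "\<And>y. y \<in> N ==> T y \<in> N"
  shows "bij_betw (tensor_lift QM (\<lambda>Z s. \<Union>y\<in>Z. cl (\<tau> (bc_tensor R M \<theta> R y s)))) (carrier (base_change R QM \<theta> R)) (carrier QM) \<longleftrightarrow>
    (\<forall>y\<in>carrier M. T y \<in> N \<longrightarrow> y \<in> N) \<and> (\<forall>y\<in>carrier M. \<exists>y'\<in>carrier M. y \<ominus> T y' \<in> N)"
proof -
  interpret b: base_change_data R M R \<theta> by (intro base_change_data.intro base_change_data_axioms.intro) (unfold_locales, rule \<theta>(1))
  interpret QM: module R QM by (rule QM_module)
  interpret q: base_change_data R QM R \<theta> by (intro base_change_data.intro base_change_data_axioms.intro) (unfold_locales, rule \<theta>(1))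
  define B where "B Z s = (\<Union>y\<in>Z. cl (\<tau> (bc_tensor R M \<theta> R y s)))" for Z s
  have \<tau>a: "additive_map b.BC M \<tau>" and \<tau>s: "\<And>s Z. s \<in> carrier R ==> Z \<in> carrier b.BC ==> \<tau> (s \<odot>\<^bsub>b.BC\<^esub> Z) = s \<odot> \<tau> Z"
    using \<tau> by (auto simp: linear_map_def additive_map_def)
  have \<tau>T: "\<tau> (b.bc y s) = s \<odot> T y" if "y \<in> carrier M" "s \<in> carrier R" for y s
    using b.bc_one[OF that] \<tau>s[OF that(2) b.bc_closed[OF that(1) R.one_closed]] T[OF that(1)] by simp
  have Tc: "T y \<in> carrier M" if "y \<in> carrier M" for y
    unfolding T[OF that] using additive_map_closed[OF \<tau>a b.bc_closed[OF that R.one_closed]] .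
  have Tadd: "T (y \<oplus> y') = T y \<oplus> T y'" if "y \<in> carrier M" "y' \<in> carrier M" for y y'
    using that by (simp add: T b.bc_add_left additive_map_add[OF \<tau>a])
  have Tsm: "T (a \<odot> y) = \<theta> a \<odot> T y" if "a \<in> carrier R" "y \<in> carrier M" for a y
    using that ring_hom_closed[OF \<theta>(1) that(1)] T[of "a \<odot> y"] \<tau>T[OF that(2)] by (simp add: b.bc_smult_left)
  have B: "B (cl y) s = cl (s \<odot> T y)" if y: "y \<in> carrier M" and s: "s \<in> carrier R" for y s
    unfolding B_def
  proof (rule cl_UN[OF _ y])
    fix y' assume "y' \<in> cl y"
    then obtain n where n: "n \<in> N" "y' = n \<oplus> y" by (auto simp: cl_eq)
    have y': "y' \<in> carrier M" using n y N_carrier by simp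
    have "s \<odot> T y' \<ominus> s \<odot> T y = s \<odot> T n"
      using s y n N_carrier Tc by (simp add: Tadd smult_r_distr M.minus_eq M.a_assoc M.r_neg)
    then show "\<tau> (b.bc y' s) \<in> carrier M \<and> \<tau> (b.bc y' s) \<ominus> s \<odot> T y \<in> N"
      using \<tau>T[OF y' s] Tc[OF y'] s N_smult[OF s TN[OF n(1)]] by simp
  qed (use Tc[OF y] s in simp)
  have "balanced R QM (module_along R \<theta>) QM B"
  proof (rule balancedI)
    note c = Tc ring_hom_closed[OF \<theta>(1)]
    fix Z s assume "Z \<in> carrier QM" and "s \<in> carrier (module_along R \<theta>)"
    then obtain y where y: "y \<in> carrier M" "Z = cl y" and s: "s \<in> carrier R" by (auto simp: QM_carrier)
    show "B Z s \<in> carrier QM" using y s c by (auto simp: B QM_carrier)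
    show "B (Z \<oplus>\<^bsub>QM\<^esub> Z') s = B Z s \<oplus>\<^bsub>QM\<^esub> B Z' s" if Z': "Z' \<in> carrier QM" for Z'
    proof -
      obtain y' where "y' \<in> carrier M" "Z' = cl y'" using Z' by (auto simp: QM_carrier)
      then show ?thesis using y s c by (simp add: B QM_add Tadd smult_r_distr)
    qed
    show "B Z (s \<oplus>\<^bsub>module_along R \<theta>\<^esub> s') = B Z s \<oplus>\<^bsub>QM\<^esub> B Z s'" if "s' \<in> carrier (module_along R \<theta>)" for s'
      using that y s c by (simp add: B QM_add smult_l_distr)
    show "B (a \<odot>\<^bsub>QM\<^esub> Z) s = B Z (a \<odot>\<^bsub>module_along R \<theta>\<^esub> s)" if "a \<in> carrier R" for a
      using that y s c by (simp add: QM_smult B Tsm smult_assoc1[symmetric] R.m_comm)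
  qed
  note lift = q.bc_lift[OF QM.M.abelian_group_axioms this]
  define G where "G Z = tensor_lift QM B (q.bc Z \<one>\<^bsub>R\<^esub>)" for Z
  have clQ: "cl y \<in> carrier QM" if "y \<in> carrier M" for y using that by (simp add: QM_carrier)
  have clE: "\<exists>y\<in>carrier M. Z = cl y" if "Z \<in> carrier QM" for Z using that by (auto simp: QM_carrier)
  have G: "G (cl y) = cl (T y)" if "y \<in> carrier M" for y
    using lift(2)[OF clQ[OF that], of "\<one>\<^bsub>R\<^esub>"] B[OF that R.one_closed] Tc[OF that] by (simp add: G_def)
  have "bij_betw (tensor_lift QM B) (carrier q.BC) (carrier QM) \<longleftrightarrow> bij_betw G (carrier QM) (carrier QM)"
    using bij_betw_comp_iff[OF q.bc_one_bij[OF \<theta>(2)]] by (simp add: comp_def G_def[abs_def])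
  also have "\<dots> \<longleftrightarrow> (\<forall>y\<in>carrier M. T y \<in> N \<longrightarrow> y \<in> N) \<and> (\<forall>y\<in>carrier M. \<exists>y'\<in>carrier M. y \<ominus> T y' \<in> N)"
  proof (intro iffI conjI ballI impI)
    assume b: "bij_betw G (carrier QM) (carrier QM)"
    fix y assume y: "y \<in> carrier M"
    show "y \<in> N" if "T y \<in> N"
    proof -
      have "G (cl y) = G (cl \<zero>)"
        unfolding G[OF y] G[OF M.zero_closed] using that TN[OF N_zero] cl_zero[OF Tc[OF y]] cl_zero[OF Tc[OF M.zero_closed]] by simp
      then have "cl y = cl \<zero>" by (rule inj_onD[OF bij_betw_imp_inj_on[OF b] _ clQ[OF y] clQ[OF M.zero_closed]])
      then show ?thesis using cl_iff[OF y M.zero_closed] minus_zero[OF y] by simp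
    qed
    have "cl y \<in> G ` carrier QM" using b clQ[OF y] by (simp add: bij_betw_def)
    then obtain y' where y': "y' \<in> carrier M" "cl y = G (cl y')" using clE by blast
    then show "\<exists>y'\<in>carrier M. y \<ominus> T y' \<in> N" using cl_iff[OF y Tc[OF y'(1)]] G by auto
  next
    assume a: "(\<forall>y\<in>carrier M. T y \<in> N \<longrightarrow> y \<in> N) \<and> (\<forall>y\<in>carrier M. \<exists>y'\<in>carrier M. y \<ominus> T y' \<in> N)"
    have "inj_on G (carrier QM)"
    proof (rule inj_onI)
      fix Z Z' assume Z: "Z \<in> carrier QM" "Z' \<in> carrier QM" "G Z = G Z'"
      obtain y where y0: "y \<in> carrier M" "Z = cl y" using clE[OF Z(1)] by blast
      obtain y' where "y' \<in> carrier M" "Z' = cl y'" using clE[OF Z(2)] by blast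
      note y = y0 this
      have "T (y \<ominus> y') = T y \<ominus> T y'"
        using y Tc Tadd by (intro additive_map_minus[OF M.abelian_group_axioms M.abelian_group_axioms]) (auto simp: additive_map_def)
      moreover have "T y \<ominus> T y' \<in> N" using Z(3) y G cl_iff[OF Tc[OF y(1)] Tc[OF y(3)]] by simp
      ultimately have "y \<ominus> y' \<in> N" using a M.minus_closed[OF y(1,3)] by simp
      then show "Z = Z'" using cl_iff[OF y(1,3)] y by simp
    qed
    moreover have "G Z \<in> carrier QM" if "Z \<in> carrier QM" for Z using clE[OF that] G clQ Tc by auto
    moreover have "Z \<in> G ` carrier QM" if Z: "Z \<in> carrier QM" for Z
    proof -
      obtain y where y: "y \<in> carrier M" "Z = cl y" using clE[OF Z] by blast
      obtain y' where y': "y' \<in> carrier M" "y \<ominus> T y' \<in> N" using a y(1) by blast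
      then have "Z = G (cl y')" using y cl_iff[OF y(1) Tc] G by simp
      then show ?thesis using clQ[OF y'(1)] by blast
    qed
    ultimately show "bij_betw G (carrier QM) (carrier QM)" unfolding bij_betw_def by blast
  qed
  finally show ?thesis by (simp add: B_def[abs_def])
qed

end

section \<open>Separable isogenies in terms of semilinear endomorphisms\<close>

lemma linear_image_submodule:
  assumes "module R M" "module R M'" "linear_map R M M' f"
  shows "submodule (f ` carrier M) R M'"
proof -
  interpret M: module R M by fact
  interpret M': module R M' by fact
  have f: "additive_map M M' f" using assms(3) by (auto simp: linear_map_def additive_map_def)
  note c = additive_map_closed[OF f] and z = additive_map_zero[OF M.M.abelian_group_axioms M'.M.abelian_group_axioms f]
    and u = additive_map_uminus[OF M.M.abelian_group_axioms M'.M.abelian_group_axioms f]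
  show ?thesis
  proof (rule M'.submoduleI)
    show "f ` carrier M \<subseteq> carrier M'" using c by blast
    show "\<zero>\<^bsub>M'\<^esub> \<in> f ` carrier M" using z by (metis M.M.zero_closed image_eqI)
    show "\<ominus>\<^bsub>M'\<^esub> a \<in> f ` carrier M" if "a \<in> f ` carrier M" for a using that u by (metis (no_types, lifting) M.M.a_inv_closed image_iff)
    show "a \<oplus>\<^bsub>M'\<^esub> b \<in> f ` carrier M" if "a \<in> f ` carrier M" "b \<in> f ` carrier M" for a b
      using that additive_map_add[OF f] by (metis (no_types, lifting) M.M.a_closed image_iff)
    show "a \<odot>\<^bsub>M'\<^esub> x \<in> f ` carrier M" if "a \<in> carrier R" "x \<in> f ` carrier M" for a x
    proof -
      obtain z where z: "z \<in> carrier M" "x = f z" using \<open>x \<in> f ` carrier M\<close> by blast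
      then have "a \<odot>\<^bsub>M'\<^esub> x = f (a \<odot>\<^bsub>M\<^esub> z)" using assms(3) \<open>a \<in> carrier R\<close> by (simp add: linear_map_def)
      then show ?thesis using z M.smult_closed[OF \<open>a \<in> carrier R\<close>] by blast
    qed
  qed
qed

text \<open>A separable isogeny with all pullbacks and cokernels eliminated. The last two clauses
  express that \<open>T'\<close> is injective and surjective on the cokernel of
  \<open>f\<close>.\<close>

definition sep_map ::
    "('r, 'x) ring_scheme \<Rightarrow> ('r, 'm) module \<Rightarrow> ('m \<Rightarrow> 'm) \<Rightarrow> ('r, 'n) module \<Rightarrow> ('n \<Rightarrow> 'n) \<Rightarrow> ('m \<Rightarrow> 'n) \<Rightarrow> bool"
  where "sep_map R M T M' T' f \<longleftrightarrow> linear_map R M M' f \<and> (\<forall>x\<in>carrier M. f (T x) = T' (f x)) \<and> inj_on f (carrier M) \<and>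
    (\<forall>y\<in>carrier M'. \<exists>s\<in>carrier R - {\<zero>\<^bsub>R\<^esub>}. s \<odot>\<^bsub>M'\<^esub> y \<in> f ` carrier M) \<and>
    (\<forall>y\<in>carrier M'. T' y \<in> f ` carrier M \<longrightarrow> y \<in> f ` carrier M) \<and>
    (\<forall>y\<in>carrier M'. \<exists>y'\<in>carrier M'. y \<ominus>\<^bsub>M'\<^esub> T' y' \<in> f ` carrier M)"

lemma sep_map_id:
  assumes "module R M" "domain R" "additive_map M M T"
  shows "sep_map R M T M T (\<lambda>x. x)"
proof -
  interpret M: module R M by fact
  interpret R: domain R by fact
  have "\<exists>s\<in>carrier R - {\<zero>\<^bsub>R\<^esub>}. s \<odot>\<^bsub>M\<^esub> y \<in> carrier M" if "y \<in> carrier M" for y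
    using that by (intro bexI[of _ "\<one>\<^bsub>R\<^esub>"]) auto
  then show ?thesis using additive_map_closed[OF assms(3)] by (auto simp: sep_map_def linear_map_def)
qed

lemma sep_map_compose:
  assumes "module R M" "module R M'" "module R M''" "domain R" "additive_map M' M' T'" "additive_map M'' M'' T''"
    and f: "sep_map R M T M' T' f" and g: "sep_map R M' T' M'' T'' g" and Tc: "\<And>x. x \<in> carrier M ==> T x \<in> carrier M"
  shows "sep_map R M T M'' T'' (\<lambda>x. g (f x))"
proof -
  interpret M: module R M by fact
  interpret M': module R M' by fact
  interpret M'': module R M'' by fact
  interpret R: domain R by fact
  have fl: "linear_map R M M' f" and fT: "\<And>x. x \<in> carrier M ==> f (T x) = T' (f x)" and fi: "inj_on f (carrier M)"
    and ft: "\<And>y. y \<in> carrier M' ==> \<exists>s\<in>carrier R - {\<zero>\<^bsub>R\<^esub>}. s \<odot>\<^bsub>M'\<^esub> y \<in> f ` carrier M"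
    and f1: "\<And>y. y \<in> carrier M' ==> T' y \<in> f ` carrier M ==> y \<in> f ` carrier M"
    and f2: "\<And>y. y \<in> carrier M' ==> \<exists>y'\<in>carrier M'. y \<ominus>\<^bsub>M'\<^esub> T' y' \<in> f ` carrier M"
    using f unfolding sep_map_def by blast+
  have gl: "linear_map R M' M'' g" and gT: "\<And>x. x \<in> carrier M' ==> g (T' x) = T'' (g x)" and gi: "inj_on g (carrier M')"
    and gt: "\<And>y. y \<in> carrier M'' ==> \<exists>s\<in>carrier R - {\<zero>\<^bsub>R\<^esub>}. s \<odot>\<^bsub>M''\<^esub> y \<in> g ` carrier M'"
    and g1: "\<And>y. y \<in> carrier M'' ==> T'' y \<in> g ` carrier M' ==> y \<in> g ` carrier M'"
    and g2: "\<And>y. y \<in> carrier M'' ==> \<exists>y'\<in>carrier M''. y \<ominus>\<^bsub>M''\<^esub> T'' y' \<in> g ` carrier M'"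
    using g unfolding sep_map_def by blast+
  have fa: "additive_map M M' f" and ga: "additive_map M' M'' g" using fl gl by (auto simp: linear_map_def additive_map_def)
  have fc: "f x \<in> carrier M'" if "x \<in> carrier M" for x using additive_map_closed[OF fa that] .
  have gc: "g x \<in> carrier M''" if "x \<in> carrier M'" for x using additive_map_closed[OF ga that] .
  have T'c: "T' x \<in> carrier M'" if "x \<in> carrier M'" for x using additive_map_closed[OF assms(5) that] .
  have gs: "g (s \<odot>\<^bsub>M'\<^esub> x) = s \<odot>\<^bsub>M''\<^esub> g x" if "s \<in> carrier R" "x \<in> carrier M'" for s x using gl that by (simp add: linear_map_def)
  show ?thesis
    unfolding sep_map_def
  proof (intro conjI ballI impI)
    show "linear_map R M M'' (\<lambda>x. g (f x))" using fl gl by (auto simp: linear_map_def Pi_iff)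
    show "inj_on (\<lambda>x. g (f x)) (carrier M)"
      using fi gi fc by (auto simp: inj_on_def)
    show "g (f (T x)) = T'' (g (f x))" if "x \<in> carrier M" for x using that fT gT fc by simp
    fix y assume y: "y \<in> carrier M''"
    obtain s y1 where s: "s \<in> carrier R" "s \<noteq> \<zero>\<^bsub>R\<^esub>" "y1 \<in> carrier M'" "s \<odot>\<^bsub>M''\<^esub> y = g y1" using gt[OF y] by blast
    obtain s' x where s': "s' \<in> carrier R" "s' \<noteq> \<zero>\<^bsub>R\<^esub>" "x \<in> carrier M" "s' \<odot>\<^bsub>M'\<^esub> y1 = f x" using ft[OF s(3)] by blast
    have "(s' \<otimes>\<^bsub>R\<^esub> s) \<odot>\<^bsub>M''\<^esub> y = g (f x)" using s s' y gs[of s' y1] by (simp add: M''.smult_assoc1)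
    then show "\<exists>s\<in>carrier R - {\<zero>\<^bsub>R\<^esub>}. s \<odot>\<^bsub>M''\<^esub> y \<in> (\<lambda>x. g (f x)) ` carrier M"
      using s s' by (intro bexI[of _ "s' \<otimes>\<^bsub>R\<^esub> s"]) (auto simp: R.integral_iff)
    show "y \<in> (\<lambda>x. g (f x)) ` carrier M" if Ty: "T'' y \<in> (\<lambda>x. g (f x)) ` carrier M"
    proof -
      obtain x where x: "x \<in> carrier M" "T'' y = g (f x)" using Ty by blast
      then have "T'' y \<in> g ` carrier M'" using fc by blast
      then obtain y1 where y1: "y1 \<in> carrier M'" "y = g y1" using g1[OF y] by blast
      have "T' y1 = f x" using x y1 gT fc T'c by (intro inj_onD[OF gi]) auto
      then have "y1 \<in> f ` carrier M" using f1[OF y1(1)] x(1) by blast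
      then show ?thesis using y1(2) by blast
    qed
    \<comment> \<open>Surjectivity is obtained in two stages: \<open>y\<close> is corrected modulo
      the image of \<open>g\<close>, then the preimage \<open>y1\<close> of the remainder modulo the
      image of \<open>f\<close>. The two corrections combine to \<open>y' + g y2\<close>.\<close>
    obtain y' y1 where y': "y' \<in> carrier M''" "y1 \<in> carrier M'" "y \<ominus>\<^bsub>M''\<^esub> T'' y' = g y1" using g2[OF y] by blast
    obtain y2 x where y2: "y2 \<in> carrier M'" "x \<in> carrier M" "y1 \<ominus>\<^bsub>M'\<^esub> T' y2 = f x" using f2[OF y'(2)] by blast
    have c: "T'' y' \<in> carrier M''" "T'' (g y2) \<in> carrier M''" using additive_map_closed[OF assms(6)] y'(1) gc[OF y2(1)] by auto
    have "y \<ominus>\<^bsub>M''\<^esub> T'' (y' \<oplus>\<^bsub>M''\<^esub> g y2) = (y \<ominus>\<^bsub>M''\<^esub> T'' y') \<ominus>\<^bsub>M''\<^esub> T'' (g y2)"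
      using c y by (simp add: additive_map_add[OF assms(6) y'(1) gc[OF y2(1)]] M''.M.minus_eq M''.M.minus_add M''.M.a_assoc)
    also have "\<dots> = g y1 \<ominus>\<^bsub>M''\<^esub> g (T' y2)" using y'(3) gT[OF y2(1)] by simp
    also have "\<dots> = g (f x)"
      using additive_map_minus[OF M'.M.abelian_group_axioms M''.M.abelian_group_axioms ga y'(2) T'c[OF y2(1)]] y2(3) by simp
    finally show "\<exists>y'\<in>carrier M''. y \<ominus>\<^bsub>M''\<^esub> T'' y' \<in> (\<lambda>x. g (f x)) ` carrier M"
      using y'(1) gc[OF y2(1)] y2(2) by (intro bexI[of _ "y' \<oplus>\<^bsub>M''\<^esub> g y2"]) auto
  qed
qed

text \<open>The map is \<open>f\<inverse> \<circ> h\<close>, defined because \<open>h\<close> takes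
  values in the image of \<open>f\<close>. As \<open>f\<close> is an isomorphism onto its image,
  statements on that image modulo \<open>h\<close> carry over to the cokernel of the new
  map.\<close>

lemma sep_map_reverse:
  assumes "module R M'" "module R M" and f: "sep_map R M' T' M T f" and T'c: "\<And>x. x \<in> carrier M' ==> T' x \<in> carrier M'"
    and h: "linear_map R M M h" "h ` carrier M \<subseteq> f ` carrier M'" "inj_on h (carrier M)"
    "\<And>x. x \<in> carrier M ==> h (T x) = T (h x)"
    "\<And>y. y \<in> carrier M ==> \<exists>s\<in>carrier R - {\<zero>\<^bsub>R\<^esub>}. s \<odot>\<^bsub>M\<^esub> y \<in> h ` carrier M"
    "\<And>y. y \<in> f ` carrier M' ==> T y \<in> h ` carrier M ==> y \<in> h ` carrier M"
    "\<And>y. y \<in> f ` carrier M' ==> \<exists>y'\<in>f ` carrier M'. y \<ominus>\<^bsub>M\<^esub> T y' \<in> h ` carrier M"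
    and Tc: "\<And>x. x \<in> carrier M ==> T x \<in> carrier M"
  shows "\<exists>g. sep_map R M T M' T' g"
proof -
  interpret M': module R M' by fact
  interpret M: module R M by fact
  have fl: "linear_map R M' M f" and fT: "\<And>x. x \<in> carrier M' ==> f (T' x) = T (f x)" and fi: "inj_on f (carrier M')"
    using f unfolding sep_map_def by blast+
  have fa: "additive_map M' M f" using fl by (auto simp: linear_map_def additive_map_def)
  have fs: "f (s \<odot>\<^bsub>M'\<^esub> x) = s \<odot>\<^bsub>M\<^esub> f x" if "s \<in> carrier R" "x \<in> carrier M'" for s x using fl that by (simp add: linear_map_def)
  have hs: "h (x \<oplus>\<^bsub>M\<^esub> y) = h x \<oplus>\<^bsub>M\<^esub> h y" if "x \<in> carrier M" "y \<in> carrier M" for x y using h(1) that by (simp add: linear_map_def)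
  have hsm: "h (a \<odot>\<^bsub>M\<^esub> x) = a \<odot>\<^bsub>M\<^esub> h x" if "a \<in> carrier R" "x \<in> carrier M" for a x using h(1) that by (simp add: linear_map_def)
  define g where "g x = inv_into (carrier M') f (h x)" for x
  have g: "g x \<in> carrier M'" "f (g x) = h x" if "x \<in> carrier M" for x
  proof -
    have "h x \<in> f ` carrier M'" using h(2) that by blast
    then show "g x \<in> carrier M'" "f (g x) = h x" unfolding g_def by (rule inv_into_into, rule f_inv_into_f)
  qed
  have eq: "x = y" if "f x = f y" "x \<in> carrier M'" "y \<in> carrier M'" for x y using inj_onD[OF fi that(1)] that by blast
  have img: "y \<in> g ` carrier M \<longleftrightarrow> f y \<in> h ` carrier M" if y: "y \<in> carrier M'" for y
  proof
    assume "f y \<in> h ` carrier M"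
    then obtain x where "x \<in> carrier M" "f y = f (g x)" using g by auto
    then show "y \<in> g ` carrier M" using eq[OF _ y g(1)] by blast
  qed (use g in auto)
  have "sep_map R M T M' T' g"
    unfolding sep_map_def linear_map_def
  proof (intro conjI ballI impI)
    show "g \<in> carrier M \<rightarrow> carrier M'" using g by blast
    show "g (x \<oplus>\<^bsub>M\<^esub> y) = g x \<oplus>\<^bsub>M'\<^esub> g y" if "x \<in> carrier M" "y \<in> carrier M" for x y
      by (rule eq) (use that g hs in \<open>simp_all add: additive_map_add[OF fa]\<close>)
    show "g (a \<odot>\<^bsub>M\<^esub> x) = a \<odot>\<^bsub>M'\<^esub> g x" if "a \<in> carrier R" "x \<in> carrier M" for a x
      by (rule eq) (use that g hsm fs in simp_all)
    show "g (T x) = T' (g x)" if "x \<in> carrier M" for x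
      by (rule eq) (use that g h(4) fT Tc T'c in simp_all)
    show "inj_on g (carrier M)" using g inj_onD[OF h(3)] by (metis inj_onI)
    fix y assume y: "y \<in> carrier M'"
    have fy: "f y \<in> carrier M" by (rule additive_map_closed[OF fa y])
    obtain s where "s \<in> carrier R - {\<zero>\<^bsub>R\<^esub>}" "s \<odot>\<^bsub>M\<^esub> f y \<in> h ` carrier M" using h(5)[OF fy] by blast
    then show "\<exists>s\<in>carrier R - {\<zero>\<^bsub>R\<^esub>}. s \<odot>\<^bsub>M'\<^esub> y \<in> g ` carrier M" using y fs img by (intro bexI[of _ s]) auto
    show "y \<in> g ` carrier M" if "T' y \<in> g ` carrier M"
      using that h(6)[of "f y"] img[OF y] img[OF T'c[OF y]] fT[OF y] y by simp
    obtain y' where y': "y' \<in> carrier M'" "f y \<ominus>\<^bsub>M\<^esub> T (f y') \<in> h ` carrier M" using h(7)[of "f y"] y by blast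
    have "f (y \<ominus>\<^bsub>M'\<^esub> T' y') = f y \<ominus>\<^bsub>M\<^esub> T (f y')"
      using additive_map_minus[OF M'.M.abelian_group_axioms M.M.abelian_group_axioms fa y T'c[OF y'(1)]] fT[OF y'(1)] by simp
    then show "\<exists>y'\<in>carrier M'. y \<ominus>\<^bsub>M'\<^esub> T' y' \<in> g ` carrier M" using y' y T'c img by (intro bexI[of _ y']) auto
  qed
  then show ?thesis by (intro exI[of _ g])
qed

section \<open>Application to pure motives\<close>

locale motive_setting = curve_data K Q \<iota>Q pinf L \<iota>L B lam
  for K :: "'k ring" and Q :: "'q ring" and \<iota>Q :: "'k \<Rightarrow> 'q" and pinf and L :: "'l ring" and \<iota>L :: "'k \<Rightarrow> 'l" and B lam +
  fixes c :: "'q \<Rightarrow> 'l"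
  assumes ff: "function_field_one_var Q (\<iota>Q ` carrier K)"

sublocale motive_setting \<subseteq> md: motive_data K Q \<iota>Q pinf L \<iota>L c .

context motive_setting
begin

abbreviation "AL \<equiv> md.AL"
abbreviation "\<sigma>A \<equiv> md.\<sigma>A"
abbreviation "SA \<equiv> regular_functions Q (closed_points Q (\<iota>Q ` carrier K) - {pinf})"

lemma SA: "subring SA Q" "\<iota>Q ` carrier K \<subseteq> SA"
proof -
  have P: "subring P Q" "\<iota>Q ` carrier K \<subseteq> P" if "P \<in> closed_points Q (\<iota>Q ` carrier K)" for P using that by (auto simp: closed_points_def)
  note c = subringE(2,3,5,6,7)[OF P(1)]
  show "subring SA Q"
    by (rule Q.subringI) (auto simp: regular_functions_def intro: c)
  show "\<iota>Q ` carrier K \<subseteq> SA" using P(2) \<iota>Q_closed by (auto simp: regular_functions_def)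
qed

lemma AL_eq: "AL = tensor_algebra K (Q\<lparr>carrier := SA\<rparr>) \<iota>Q L \<iota>L"
  by (simp add: md.AL_def md.A_def)

lemma md_eqs: "md.QL = QL" "md.constL = constL" "md.AL_to_QL = incl" "md.\<sigma>Q = \<sigma>QL" "md.pinfL = PL"
  by (simp_all add: md.QL_def md.constL_def md.AL_to_QL_def md.\<sigma>Q_def md.pinfL_def pinfL_eq)

lemma \<sigma>A_eq: "\<sigma>A = tensor_lift (tensor_algebra K (Q\<lparr>carrier := SA\<rparr>) \<iota>Q L \<iota>L) (\<lambda>a b. alg_tensor K (Q\<lparr>carrier := SA\<rparr>) \<iota>Q L \<iota>L a (frob b))"
  by (simp add: md.\<sigma>A_def AL_eq md.A_def)

lemma incl_AL: "incl \<in> ring_hom AL QL" "inj_on incl (carrier AL)"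
  unfolding AL_eq using incl_sub(1,3)[OF SA] by auto

lemma \<sigma>A: "\<sigma>A \<in> ring_hom AL AL" "Z \<in> carrier AL ==> (\<sigma>A ^^ fe) Z = Z" "Z \<in> carrier AL ==> incl (\<sigma>A Z) = \<sigma>QL (incl Z)"
  unfolding \<sigma>A_eq AL_eq using sigma_sub(1,3)[OF SA] incl_\<sigma>[OF SA] by auto

lemma AL_cring: "cring AL"
proof -
  interpret S: basis_algebra K "Q\<lparr>carrier := SA\<rparr>" L \<iota>Q \<iota>L B lam by (rule sub_basis_algebra[OF SA])
  show ?thesis unfolding AL_eq by (rule S.TA_cring)
qed

text \<open>Inherited from the field \<open>QL\<close> through the injection
  \<open>incl\<close>.\<close>

lemma AL_domain: "domain AL"
proof -
  interpret AL: cring AL by (rule AL_cring)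
  have z: "incl \<zero>\<^bsub>AL\<^esub> = \<zero>\<^bsub>QL\<^esub>" by (rule ring_hom_zero[OF incl_AL(1) AL.ring_axioms QT.TA.ring_axioms])
  have iz: "a = \<zero>\<^bsub>AL\<^esub>" if "a \<in> carrier AL" "incl a = \<zero>\<^bsub>QL\<^esub>" for a
    using inj_onD[OF incl_AL(2), of a "\<zero>\<^bsub>AL\<^esub>"] that z by simp
  show ?thesis
  proof (rule domain.intro[OF AL_cring domain_axioms.intro])
    show "\<one>\<^bsub>AL\<^esub> \<noteq> \<zero>\<^bsub>AL\<^esub>" using ring_hom_one[OF incl_AL(1)] z by auto
    fix a b assume ab: "a \<otimes>\<^bsub>AL\<^esub> b = \<zero>\<^bsub>AL\<^esub>" "a \<in> carrier AL" "b \<in> carrier AL"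
    then have "incl a \<otimes>\<^bsub>QL\<^esub> incl b = \<zero>\<^bsub>QL\<^esub>" using ring_hom_mult[OF incl_AL(1) ab(2,3)] z by simp
    from QF.integral[OF this] have "incl a = \<zero>\<^bsub>QL\<^esub> \<or> incl b = \<zero>\<^bsub>QL\<^esub>" using ab ring_hom_closed[OF incl_AL(1)] by simp
    then show "a = \<zero>\<^bsub>AL\<^esub> \<or> b = \<zero>\<^bsub>AL\<^esub>" using iz ab(2,3) by metis
  qed
qed

lemma \<sigma>A_bij: "bij_betw \<sigma>A (carrier AL) (carrier AL)"
  using periodic_bij[of "carrier AL" \<sigma>A fe 1] \<sigma>A ring_hom_closed[OF \<sigma>A(1)] fe(1) by simp

lemma base_change_\<sigma>A: "module AL M ==> base_change_data AL M AL \<sigma>A"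
  using \<sigma>A(1) AL_cring by (intro base_change_data.intro base_change_data_axioms.intro)

definition Tm where "Tm M \<tau> x = \<tau> (bc_tensor AL M \<sigma>A AL x \<one>\<^bsub>AL\<^esub>)"

text \<open>The portion of the notion of a motive on which the translation between
  \<open>\<tau>\<close> and \<open>Tm\<close> rests.\<close>

definition tau_module :: "(('q, 'l) tens, 'm) module \<Rightarrow> (('m, ('q, 'l) tens) tens \<Rightarrow> 'm) \<Rightarrow> bool"
  where "tau_module M \<tau> \<longleftrightarrow> module AL M \<and> linear_map AL (md.pullback M) M \<tau>"

lemma frob_module_Tm:
  assumes "tau_module M \<tau>"
  shows "frob_module AL M \<sigma>A (Tm M \<tau>) fe"
proof -
  have M: "module AL M" and \<tau>: "linear_map AL (base_change AL M \<sigma>A AL) M \<tau>" using assms by (auto simp: tau_module_def md.pullback_def)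
  interpret b: base_change_data AL M AL \<sigma>A by (rule base_change_\<sigma>A[OF M])
  have \<tau>a: "additive_map b.BC M \<tau>" using \<tau> by (auto simp: linear_map_def additive_map_def)
  have add: "additive_map M M (Tm M \<tau>)" using additive_map_compose[OF b.additive_bc_one \<tau>a] by (simp add: Tm_def[abs_def])
  have smult: "Tm M \<tau> (a \<odot>\<^bsub>M\<^esub> x) = \<sigma>A a \<odot>\<^bsub>M\<^esub> Tm M \<tau> x" if "a \<in> carrier AL" "x \<in> carrier M" for a x
    using that \<tau> ring_hom_closed[OF \<sigma>A(1)] by (simp add: Tm_def b.bc_one_smult linear_map_def)
  show ?thesis
    by (intro frob_module.intro frob_module_axioms.intro M AL_domain \<sigma>A fe(1) add smult) auto
qed

lemma morphism_iff:
  assumes "tau_module M \<tau>" "tau_module M' \<tau>'" and f: "linear_map AL M M' f"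
  shows "(\<forall>x\<in>carrier (md.pullback M). f (\<tau> x) = \<tau>' (md.pullback_map M M' f x)) \<longleftrightarrow> (\<forall>x\<in>carrier M. f (Tm M \<tau> x) = Tm M' \<tau>' (f x))"
proof -
  have M: "module AL M" "module AL M'" using assms by (auto simp: tau_module_def)
  interpret AL: cring AL by (rule AL_cring)
  interpret b: base_change_data AL M AL \<sigma>A by (rule base_change_\<sigma>A[OF M(1)])
  interpret b': base_change_data AL M' AL \<sigma>A by (rule base_change_\<sigma>A[OF M(2)])
  have fc: "f x \<in> carrier M'" if "x \<in> carrier M" for x using f that by (auto simp: linear_map_def)
  have "balanced AL M (module_along AL \<sigma>A) b'.BC (\<lambda>x s. b'.bc (f x) s)"
    by (rule balancedI) (use f fc in \<open>auto simp: linear_map_def b'.bc_add_left b'.bc_add_right b'.bc_smult_left\<close>)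
  note * = b.bc_lift(2)[OF b'.BC_abelian_group this]
  have "md.pullback_map M M' f (b.bc x \<one>\<^bsub>AL\<^esub>) = b'.bc (f x) \<one>\<^bsub>AL\<^esub>" if "x \<in> carrier M" for x
    using *[OF that AL.one_closed] by (simp add: md.pullback_map_def md.pullback_def)
  moreover have "carrier (md.pullback M) = (\<lambda>x. b.bc x \<one>\<^bsub>AL\<^esub>) ` carrier M"
    using b.bc_one_bij[OF \<sigma>A_bij] by (simp add: bij_betw_def md.pullback_def)
  ultimately show ?thesis by (simp add: Tm_def)
qed

lemma separable_isogeny_iff:
  assumes t: "tau_module M \<tau>" "tau_module M' \<tau>'"
  shows "md.separable_isogeny (M, \<tau>) (M', \<tau>') f \<longleftrightarrow> sep_map AL M (Tm M \<tau>) M' (Tm M' \<tau>') f"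
proof -
  have M: "module AL M" "module AL M'" and \<tau>': "linear_map AL (base_change AL M' \<sigma>A AL) M' \<tau>'"
    using t by (auto simp: tau_module_def md.pullback_def)
  have *: "md.torsion_module (cokernel M M' f) \<longleftrightarrow> (\<forall>y\<in>carrier M'. \<exists>s\<in>carrier AL - {\<zero>\<^bsub>AL\<^esub>}. s \<odot>\<^bsub>M'\<^esub> y \<in> f ` carrier M)"
    "bij_betw (md.coker_\<tau> M (M', \<tau>') f) (carrier (md.pullback (cokernel M M' f))) (carrier (cokernel M M' f)) \<longleftrightarrow>
     (\<forall>y\<in>carrier M'. Tm M' \<tau>' y \<in> f ` carrier M \<longrightarrow> y \<in> f ` carrier M) \<and>
     (\<forall>y\<in>carrier M'. \<exists>y'\<in>carrier M'. y \<ominus>\<^bsub>M'\<^esub> Tm M' \<tau>' y' \<in> f ` carrier M)"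
    if f: "linear_map AL M M' f" and fT: "\<forall>x\<in>carrier M. f (Tm M \<tau> x) = Tm M' \<tau>' (f x)"
  proof -
    interpret M': module AL M' by (rule M(2))
    interpret q: quotient_by AL M' "f ` carrier M"
      by (intro quotient_by.intro quotient_by_axioms.intro M linear_image_submodule[OF M f])
    interpret F: frob_module AL M \<sigma>A "Tm M \<tau>" fe by (rule frob_module_Tm[OF t(1)])
    show "md.torsion_module (cokernel M M' f) \<longleftrightarrow> (\<forall>y\<in>carrier M'. \<exists>s\<in>carrier AL - {\<zero>\<^bsub>AL\<^esub>}. s \<odot>\<^bsub>M'\<^esub> y \<in> f ` carrier M)"
      unfolding md.torsion_module_def cokernel_def by (rule q.quotient_torsion) simp
    have "Tm M' \<tau>' y \<in> f ` carrier M" if "y \<in> f ` carrier M" for y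
      using that fT additive_map_closed[OF F.T_additive] by (metis (no_types, lifting) image_iff)
    from q.quotient_semilinear_bij[OF \<sigma>A(1) \<sigma>A_bij \<tau>' Tm_def this]
    show "bij_betw (md.coker_\<tau> M (M', \<tau>') f) (carrier (md.pullback (cokernel M M' f))) (carrier (cokernel M M' f)) \<longleftrightarrow>
     (\<forall>y\<in>carrier M'. Tm M' \<tau>' y \<in> f ` carrier M \<longrightarrow> y \<in> f ` carrier M) \<and>
     (\<forall>y\<in>carrier M'. \<exists>y'\<in>carrier M'. y \<ominus>\<^bsub>M'\<^esub> Tm M' \<tau>' y' \<in> f ` carrier M)"
      by (simp add: md.coker_\<tau>_def md.pullback_def cokernel_def)
  qed
  show ?thesis
  \<comment> \<open>The analysis of the cokernel presupposes a linear map compatible with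
    \<open>T\<close>. Both sides contain this condition, so otherwise both are false.\<close>
  proof (cases "linear_map AL M M' f \<and> (\<forall>x\<in>carrier M. f (Tm M \<tau> x) = Tm M' \<tau>' (f x))")
    case True
    then show ?thesis using * morphism_iff[OF t]
      by (simp add: md.separable_isogeny_def md.isogeny_def md.morphism_def sep_map_def conj_assoc)
  next
    case False
    then show ?thesis using morphism_iff[OF t]
      by (auto simp: md.separable_isogeny_def md.isogeny_def md.morphism_def sep_map_def)
  qed
qed

lemma \<sigma>QL_iter: "\<sigma>QL ^^ n \<in> ring_hom QL QL"
proof (induction n)
  case 0 then show ?case by (intro ring_hom_memI) auto
next
  case (Suc n) then show ?case using ring_hom_trans[OF Suc \<sigma>QL(1)] by (simp add: comp_def)
qed

text \<open>The uniformizer \<open>q1 t\<close> comes from the curve over \<open>K\<close> and is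
  fixed by \<open>\<sigma>\<close>. Negative powers follow by cancelling the corresponding positive
  ones.\<close>

lemma \<sigma>QL_tp:
  assumes t: "V.unif t"
  shows "(\<sigma>QL ^^ l) (VL.tp (q1 t) n) = VL.tp (q1 t) n"
proof -
  note u = PL_unif[OF t]
  note c = VL.tp_closed[OF u]
  have t1: "\<sigma>QL (q1 t) = q1 t" by (rule \<sigma>QL_q1[OF V.t_carrier[OF t]])
  note tc = VL.t_carrier[OF u]
  have nat: "\<sigma>QL (q1 t [^]\<^bsub>QL\<^esub> m) = q1 t [^]\<^bsub>QL\<^esub> m" for m :: nat
    by (induction m) (use tc t1 in \<open>auto simp: ring_hom_one[OF \<sigma>QL(1)] ring_hom_mult[OF \<sigma>QL(1)]\<close>)
  have pos: "\<sigma>QL (VL.tp (q1 t) n) = VL.tp (q1 t) n" if "n \<ge> 0" for n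
    using that nat VL.tp_nat[OF u] by (metis zero_le_imp_eq_int)
  have "\<sigma>QL (VL.tp (q1 t) n) = VL.tp (q1 t) n"
  proof (cases "n \<ge> 0")
    case False
    let ?a = "VL.tp (q1 t) n" and ?b = "VL.tp (q1 t) (- n)"
    have "\<sigma>QL ?a \<otimes>\<^bsub>QL\<^esub> ?b = \<sigma>QL (?a \<otimes>\<^bsub>QL\<^esub> ?b)" using c pos[of "- n"] False by (simp add: ring_hom_mult[OF \<sigma>QL(1)])
    also have "\<dots> = ?a \<otimes>\<^bsub>QL\<^esub> ?b" by (simp add: VL.tp_inverse[OF u] ring_hom_one[OF \<sigma>QL(1)])
    finally show ?thesis using QF.m_rcancel[of ?b "\<sigma>QL ?a" ?a] c VL.tp_nz[OF u] ring_hom_closed[OF \<sigma>QL(1)] by simp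
  qed (rule pos)
  then show ?thesis by (induction l) auto
qed

text \<open>The purity condition lives on the generic stalk. It descends to \<open>M\<close> since
  the semilinear extension of \<open>T\<close> restricts to \<open>T\<close> on the image of
  \<open>M\<close>, and this image is a faithful copy of \<open>M\<close>.\<close>

lemma pure_filtration:
  assumes lf: "locally_free_module AL M r" and t: "tau_module M \<tau>" and p: "md.pure_at_infty r M \<tau>"
  obtains Fil k l where "frob_module.filtration AL M Fil" "(k::nat) > 0" "l > 0"
    "\<And>x j. x \<in> carrier M ==> (Tm M \<tau> ^^ l) x \<in> Fil (j - int k) \<longleftrightarrow> x \<in> Fil j"
proof -
  obtain E k l where E: "locally_free_sheaf QL constL (base_change AL M incl QL) r E"
    "E (closed_points QL constL - {PL}) = (\<lambda>x. bc_tensor AL M incl QL x \<one>\<^bsub>QL\<^esub>) ` carrier M"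
    and kl: "k > 0" "l > 0"
    and bij: "bij_betw (md.\<tau>_power_at_infty M \<tau> l) (carrier (md.pullback_stalk_infty M E l)) (twisted_stalk QL constL (base_change AL M incl QL) E PL k)"
    using p by (auto simp: md.pure_at_infty_def md.generic_stalk_def md_eqs)
  interpret F: frob_module AL M \<sigma>A "Tm M \<tau>" fe by (rule frob_module_Tm[OF t])
  interpret s: sheaf_at_point AL M r QL incl constL PL E
    by (intro sheaf_at_point.intro generic_fibre.intro loc_free.intro base_change_data.intro base_change_data_axioms.intro
        loc_free_axioms.intro generic_fibre_axioms.intro sheaf_at_point_axioms.intro F.module_axioms AL_domain QL_field lf incl_AL
        VL.valuation_point_axioms QT.TA_cring finite_poles_QL[OF ff] E)
  let ?TV = "tensor_lift s.V (\<lambda>x s. s.bc (Tm M \<tau> x) (\<sigma>QL s))"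
  note TV = s.semilinear_extension[OF \<sigma>QL(1) \<sigma>A(3) F.T_additive F.T_smult ring_hom_closed[OF \<sigma>A(1)]]
  have TV_iter: "additive_map s.V s.V (?TV ^^ n)" "\<And>v. v \<in> carrier s.V ==> (?TV ^^ n) v \<in> carrier s.V" for n
  proof -
    show "additive_map s.V s.V (?TV ^^ n)"
    proof (induction n)
      case (Suc n) then show ?case using additive_map_compose[OF Suc TV(1)] by (simp add: comp_def)
    qed (simp add: additive_map_def)
    from additive_map_closed[OF this] show "(?TV ^^ n) v \<in> carrier s.V" if "v \<in> carrier s.V" for v using that .
  qed
  have TV_smult: "(?TV ^^ n) (a \<odot>\<^bsub>s.V\<^esub> v) = (\<sigma>QL ^^ n) a \<odot>\<^bsub>s.V\<^esub> (?TV ^^ n) v" if "a \<in> carrier QL" "v \<in> carrier s.V" for n a v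
    by (induction n) (use that TV_iter TV(3) ring_hom_closed[OF \<sigma>QL_iter] in auto)
  have T_iter: "(Tm M \<tau> ^^ n) x \<in> carrier M" "(?TV ^^ n) (s.\<iota>M x) = s.\<iota>M ((Tm M \<tau> ^^ n) x)" if "x \<in> carrier M" for n x
  proof -
    show c: "(Tm M \<tau> ^^ n) x \<in> carrier M" for n by (induction n) (use that additive_map_closed[OF F.T_additive] in auto)
    show "(?TV ^^ n) (s.\<iota>M x) = s.\<iota>M ((Tm M \<tau> ^^ n) x)"
      by (induction n) (use c TV(2) in \<open>auto simp: ring_hom_one[OF \<sigma>QL(1)]\<close>)
  qed
  \<comment> \<open>\<open>\<sigma>\<close> preserves \<open>PL\<close> and has finite order, so its
    powers are bijective on \<open>PL\<close>; this removes the pullback from the purity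
    condition.\<close>
  have "bij_betw (\<sigma>QL ^^ l) PL PL" by (rule periodic_bij[OF \<sigma>QL_PL \<sigma>QL(3)[OF PL_carrier] fe(1)])
  from s.stalk_pullback_bij[OF \<sigma>QL_iter this TV_iter(1) TV_smult]
  have b: "bij_betw (?TV ^^ l) s.W (twisted_stalk QL constL s.V E PL k)"
    using bij by (simp add: md.\<tau>_power_at_infty_def md.pullback_stalk_infty_def md.stalk_infty_def md.semilinear_\<tau>_def md.generic_stalk_def md_eqs Tm_def[symmetric])
  obtain t0 where t0: "V.unif t0" using V.exists_unif by blast
  have "(?TV ^^ l) (VL.tp (q1 t0) n \<odot>\<^bsub>s.V\<^esub> v) = VL.tp (q1 t0) n \<odot>\<^bsub>s.V\<^esub> (?TV ^^ l) v" if "v \<in> carrier s.V" for n v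
    using TV_smult[OF VL.tp_closed[OF PL_unif[OF t0]] that] \<sigma>QL_tp[OF t0] by simp
  from s.exists_filtration[OF PL_unif[OF t0] F.frob_module_axioms TV_iter(1) this b T_iter]
  show ?thesis using that kl by blast
qed

text \<open>The endomorphism \<open>h\<close> lives on the target \<open>M\<close> of
  \<open>f\<close>, so it is purity of the target that provides the filtration.\<close>

lemma separable_reverse:
  assumes t: "tau_module M \<tau>" "tau_module M' \<tau>'" and lf: "locally_free_module AL M r" and p: "md.pure_at_infty r M \<tau>"
    and f: "sep_map AL M' (Tm M' \<tau>') M (Tm M \<tau>) f"
  shows "\<exists>g. sep_map AL M (Tm M \<tau>) M' (Tm M' \<tau>') g"
proof -
  interpret F: frob_module AL M \<sigma>A "Tm M \<tau>" fe by (rule frob_module_Tm[OF t(1)])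
  interpret F': frob_module AL M' \<sigma>A "Tm M' \<tau>'" fe by (rule frob_module_Tm[OF t(2)])
  interpret l: loc_free AL M r by (intro loc_free.intro loc_free_axioms.intro F.module_axioms AL_domain lf)
  obtain Fil k l where Fil: "F.filtration Fil" "(k::nat) > 0" "l > 0"
    "\<And>x j. x \<in> carrier M ==> (Tm M \<tau> ^^ l) x \<in> Fil (j - int k) \<longleftrightarrow> x \<in> Fil j"
    by (rule pure_filtration[OF lf t(1) p]) blast
  have k: "int k > 0" using Fil(2) by simp
  have fl: "linear_map AL M' M f" and fT: "\<And>x. x \<in> carrier M' ==> f (Tm M' \<tau>' x) = Tm M \<tau> (f x)"
    and ft: "\<And>y. y \<in> carrier M ==> \<exists>s\<in>carrier AL - {\<zero>\<^bsub>AL\<^esub>}. s \<odot>\<^bsub>M\<^esub> y \<in> f ` carrier M'"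
    and f2: "\<And>y. y \<in> carrier M ==> \<exists>y'\<in>carrier M. y \<ominus>\<^bsub>M\<^esub> Tm M \<tau> y' \<in> f ` carrier M'"
    using f unfolding sep_map_def by blast+
  have Tc: "Tm M \<tau> x \<in> carrier M" if "x \<in> carrier M" for x using additive_map_closed[OF F.T_additive that] .
  have T'c: "Tm M' \<tau>' x \<in> carrier M'" if "x \<in> carrier M'" for x using additive_map_closed[OF F'.T_additive that] .
  interpret q: quotient_by AL M "f ` carrier M'"
    by (intro quotient_by.intro quotient_by_axioms.intro F.module_axioms linear_image_submodule[OF F'.module_axioms F.module_axioms fl])
  have N: "F.frobenius_stable (f ` carrier M')"
    unfolding F.frobenius_stable_def using q.N_carrier q.N_zero q.N_add q.N_smult fT[symmetric] T'c by auto
  note gen = sigma_sub(6)[OF SA, folded \<sigma>A_eq, folded AL_eq]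
  note \<Lambda> = sigma_sub(4,5)[OF SA, folded \<sigma>A_eq, folded AL_eq]
  show ?thesis
  proof (rule F.separable_endomorphism[OF Fil(1) k Fil(4) Fil(3) locally_free_fg[OF lf] \<Lambda> gen l.injective_cokernel_torsion N ft f2])
    fix h assume h: "linear_map AL M M h" "h ` carrier M \<subseteq> f ` carrier M'" "inj_on h (carrier M)"
      "\<And>x. x \<in> carrier M ==> h (Tm M \<tau> x) = Tm M \<tau> (h x)"
      "\<And>y. y \<in> carrier M ==> \<exists>s\<in>carrier AL - {\<zero>\<^bsub>AL\<^esub>}. s \<odot>\<^bsub>M\<^esub> y \<in> h ` carrier M"
      "\<And>y. y \<in> f ` carrier M' ==> Tm M \<tau> y \<in> h ` carrier M ==> y \<in> h ` carrier M"
      "\<And>y. y \<in> f ` carrier M' ==> \<exists>y'\<in>f ` carrier M'. y \<ominus>\<^bsub>M\<^esub> Tm M \<tau> y' \<in> h ` carrier M"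
    show ?thesis by (rule sep_map_reverse[OF F'.module_axioms F.module_axioms f T'c h Tc])
  qed
qed

end

theorem theorem8p9:
  fixes K :: "'k ring" and Q :: "'q ring" and \<iota>Q :: "'k \<Rightarrow> 'q" and pinf :: "'q set"
    and L :: "'l ring" and \<iota>L :: "'k \<Rightarrow> 'l" and c :: "'q \<Rightarrow> 'l"
    and motives :: "((('q, 'l) tens, 'm) module \<times> (('m, ('q, 'l) tens) tens \<Rightarrow> 'm)) set"
  assumes "field K" and "finite (carrier K)"
    and "smooth_projective_curve K Q \<iota>Q"
    and "rational_point Q (\<iota>Q ` carrier K) pinf"
    and "field L" and "finite (carrier L)" and "\<iota>L \<in> ring_hom K L"
    and "c \<in> ring_hom (motive_data.A K Q \<iota>Q pinf) L" and "\<forall>x\<in>carrier K. c (\<iota>Q x) = \<iota>L x"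
    and "motives = motive_data.pure_motives K Q \<iota>Q pinf L \<iota>L c"
  shows "equiv motives
    {(M', M). M' \<in> motives \<and> M \<in> motives \<and>
       (\<exists>f. motive_data.separable_isogeny K Q \<iota>Q pinf L \<iota>L M' M f)}"
proof -
  obtain B lam where B: "l_basis K L \<iota>L B lam" using exists_l_basis[OF assms(1,5,6,7)] by blast
  have ff: "function_field_one_var Q (\<iota>Q ` carrier K)" and h: "\<iota>Q \<in> ring_hom K Q"
    using assms(3) by (auto simp: smooth_projective_curve_def)
  interpret motive_setting K Q \<iota>Q pinf L \<iota>L B lam c
    using ff assms(4) by (intro motive_setting.intro curve_data.intro curve_data_axioms.intro motive_setting_axioms.intro
        valuation_point.intro valuation_point_axioms.intro assms B h) (auto simp: rational_point_def function_field_one_var_def)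
  have pm: "\<exists>r. locally_free_module AL M r \<and> tau_module M \<tau> \<and> md.pure_at_infty r M \<tau>" if "(M, \<tau>) \<in> motives" for M :: "(('q, 'l) tens, 'm) module" and \<tau>
    using that assms(10) by (auto simp: md.pure_motives_def md.pure_motive_def tau_module_def locally_free_module_def)
  have tm: "tau_module M \<tau>" if "(M, \<tau>) \<in> motives" for M \<tau> using pm[OF that] by blast
  have mod: "module AL M" and add: "additive_map M M (Tm M \<tau>)" if "(M, \<tau>) \<in> motives" for M \<tau>
    using tm[OF that] frob_module.T_additive[OF frob_module_Tm[OF tm[OF that]]] by (auto simp: tau_module_def)
  let ?R = "{(M', M). M' \<in> motives \<and> M \<in> motives \<and> (\<exists>f. md.separable_isogeny M' M f)}"
  show ?thesis
  proof (rule equivI)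
    show "?R \<subseteq> motives \<times> motives" by auto
    show "refl_on motives ?R"
    proof (rule refl_onI)
      fix MM assume MM: "MM \<in> motives"
      obtain M \<tau> where M: "MM = (M, \<tau>)" by (cases MM)
      have m: "(M, \<tau>) \<in> motives" using MM M by simp
      have "md.separable_isogeny (M, \<tau>) (M, \<tau>) (\<lambda>x. x)"
        unfolding separable_isogeny_iff[OF tm[OF m] tm[OF m]] by (rule sep_map_id[OF mod[OF m] AL_domain add[OF m]])
      then show "(MM, MM) \<in> ?R" using MM M by blast
    qed
    show "sym ?R"
    proof (rule symI)
      fix MM NN assume "(MM, NN) \<in> ?R"
      then obtain M \<tau> N \<tau>' f where M: "MM = (M, \<tau>)" "NN = (N, \<tau>')" "(M, \<tau>) \<in> motives" "(N, \<tau>') \<in> motives" "md.separable_isogeny (M, \<tau>) (N, \<tau>') f"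
        by (cases MM, cases NN) auto
      \<comment> \<open>Rank and purity are taken from \<open>N\<close>, the target of the isogeny
        to be reversed.\<close>
      obtain r where r: "locally_free_module AL N r" "md.pure_at_infty r N \<tau>'" using pm[OF M(4)] by blast
      have "sep_map AL M (Tm M \<tau>) N (Tm N \<tau>') f" using M(5) separable_isogeny_iff[OF tm[OF M(3)] tm[OF M(4)]] by blast
      from separable_reverse[OF tm[OF M(4)] tm[OF M(3)] r this]
      show "(NN, MM) \<in> ?R" using separable_isogeny_iff[OF tm[OF M(4)] tm[OF M(3)]] M by blast
    qed
    show "trans ?R"
    proof (rule transI)
      fix MM NN PP assume "(MM, NN) \<in> ?R" "(NN, PP) \<in> ?R"
      then obtain M \<tau> N \<tau>' P \<tau>'' f g where M: "MM = (M, \<tau>)" "NN = (N, \<tau>')" "PP = (P, \<tau>'')"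
        "(M, \<tau>) \<in> motives" "(N, \<tau>') \<in> motives" "(P, \<tau>'') \<in> motives"
        "md.separable_isogeny (M, \<tau>) (N, \<tau>') f" "md.separable_isogeny (N, \<tau>') (P, \<tau>'') g"
        by (cases MM, cases NN, cases PP) auto
      note tm = tm[OF M(4)] tm[OF M(5)] tm[OF M(6)]
      note fg = M(7)[unfolded separable_isogeny_iff[OF tm(1,2)]] M(8)[unfolded separable_isogeny_iff[OF tm(2,3)]]
      have "md.separable_isogeny (M, \<tau>) (P, \<tau>'') (\<lambda>x. g (f x))"
        unfolding separable_isogeny_iff[OF tm(1,3)]
        by (rule sep_map_compose[OF mod[OF M(4)] mod[OF M(5)] mod[OF M(6)] AL_domain add[OF M(5)] add[OF M(6)] fg
              additive_map_closed[OF add[OF M(4)]]])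
      then show "(MM, PP) \<in> ?R" using M(1-6) by blast
    qed
  qed
qed

end
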